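(* There exists a real number $\eta>0$ with the following property. Let $q$ be a rational number with $\sqrt2<5^q<\sqrt2+\eta$; fix $q$-th powers $(2+i)^q,(2-i)^q\in\overline{\mathbf Q}$, let $k\subset\overline{\mathbf Q}$ be a finite extension of $\mathbf Q(i)$ containing them, and let $\overline E_q$ be the adelic hermitian vector bundle over $k$ with underlying space $k^2$, with norm $|\cdot|_{2,v}$ at every place $v$ of $k$ not dividing $5$, and, for $\varepsilon\in\{-1,1\}$ and every place $v$ of $k$ lying above the prime ideal $(2+\varepsilon i)$ of $\mathbf Z[i]$, $$\|(x,y)\|_{\overline E_q,v}=\max\big(|x|_v,\ 5^q|x+\varepsilon y|_v\big)\qquad((x,y)\in\mathbf C_v^2).$$ Then $\Lambda(\overline E_q,\overline{\mathbf Q})=5^q$ and $\Lambda(\overline E_q\otimes\overline E_q,\overline{\mathbf Q})<\Lambda(\overline E_q,\overline{\mathbf Q})^2$.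
   Context: For a number field $k\subset\overline{\mathbf Q}$ and a place $v$, $\mathbf C_v$ is the completion of an algebraic closure of $k_v$ with absolute value $|\cdot|_v$ extending the usual one on $\mathbf Q_v$ (so $|2+\varepsilon i|_v=1/5$ at places above $(2+\varepsilon i)$). For $x\in\mathbf C_v^n$, $|x|_{2,v}=(\sum|x_j|_v^2)^{1/2}$ if $v$ is archimedean and $\max_j|x_j|_v$ otherwise. An adelic hermitian vector bundle over $k$ is a finite-dimensional $k$-vector space $E$ with norms $\|\cdot\|_v$ on $E\otimes_k\mathbf C_v$ for all places $v$, given in some basis by $\|\sum x_je_j\|_v=|a_v(x)|_{2,v}$ for an adelic matrix $(a_v)\in GL_n(k_{\mathbf A})$ (here $\overline E_q$ is given by the matrix $\begin{pmatrix}1&0\\(2+\varepsilon i)^{-q}&\varepsilon(2+\varepsilon i)^{-q}\end{pmatrix}$ at places above $(2+\varepsilon i)$ and the identity elsewhere). For a finite extension $K'$ of $k$ and a place $w$ above $v$, norms on $E\otimes K'\otimes\mathbf C_w$ are those of $E\otimes\mathbf C_v$. The height of $x\in E\otimes_k\overline{\mathbf Q}$ is $H(x)=\prod_{w\in V(K')}\|x\|_w^{[K'_w:\mathbf Q_w]/[K':\mathbf Q]}$ for any finite $K'$ with $x\in E\otimes K'$, and $\Lambda(\overline E,\overline{\mathbf Q})=\inf\{H(x):0\neq x\in E\otimes_k\overline{\mathbf Q}\}$. A basis of $E\otimes\mathbf C_v$ is orthonormal if the norm of $\sum x_je_j$ is $|x|_{2,v}$; the tensor product bundle is $E\otimes F$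 with, at each place, the norm making tensor products of orthonormal bases orthonormal. *)

theory Defs
  imports
    Complex_Main
    "HOL-Library.FuncSet"
    "HOL-Library.Numeral_Type"
    "HOL-Computational_Algebra.Computational_Algebra"
    "HOL-Algebra.QuotRing"
    "HOL-Algebra.Generated_Fields"
    "HOL-Algebra.Algebraic_Closure_Type"
begin

section \<open>Number fields inside the complex numbers\<close>

text \<open>The field of algebraic numbers is realised inside the complex numbers, and all number
  fields are subfields of the complex numbers.\<close>

abbreviation \<CC> :: "complex ring"
  where "\<CC> \<equiv> ring_of_type_algebra"

abbreviation subring_of :: "complex set \<Rightarrow> complex ring"
  where "subring_of K \<equiv> \<CC>\<lparr>carrier := K\<rparr>"

definition finite_extension_of :: "complex set \<Rightarrow> complex set \<Rightarrow> bool"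
  where "finite_extension_of k K \<longleftrightarrow>
    subfield k \<CC> \<and> subfield K \<CC> \<and> k \<subseteq> K \<and> ring.finite_dimension \<CC> k K"

definition gaussian_rationals :: "complex set"
  where "gaussian_rationals = generate_field \<CC> {\<i>}"

definition gaussian_integers :: "complex set"
  where "gaussian_integers = {of_int a + of_int b * \<i> | a b. True}"

text \<open>For \<open>q = a / b\<close> in lowest terms, the \<open>q\<close>-th powers of \<open>z\<close> are the solutions \<open>\<alpha>\<close>
  of \<open>\<alpha>\<^sup>b = z\<^sup>a\<close>.\<close>

definition is_rat_power :: "complex \<Rightarrow> rat \<Rightarrow> complex \<Rightarrow> bool"
  where "is_rat_power z q \<alpha> \<longleftrightarrow> \<alpha> ^ nat (snd (quotient_of q)) = z powi fst (quotient_of q)"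


section \<open>Absolute values, completions and places\<close>

definition absolute_value :: "('a, 'm) ring_scheme \<Rightarrow> ('a \<Rightarrow> real) \<Rightarrow> bool"
  where "absolute_value R v \<longleftrightarrow>
    (\<forall>x\<in>carrier R. 0 \<le> v x \<and> (v x = 0 \<longleftrightarrow> x = \<zero>\<^bsub>R\<^esub>)) \<and>
    (\<forall>x\<in>carrier R. \<forall>y\<in>carrier R. v (x \<otimes>\<^bsub>R\<^esub> y) = v x * v y) \<and>
    (\<forall>x\<in>carrier R. \<forall>y\<in>carrier R. v (x \<oplus>\<^bsub>R\<^esub> y) \<le> v x + v y)"

definition cauchy_seqs :: "('a, 'm) ring_scheme \<Rightarrow> ('a \<Rightarrow> real) \<Rightarrow> (nat \<Rightarrow> 'a) set"
  where "cauchy_seqs R v = {s. (\<forall>n. s n \<in> carrier R) \<and>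
    (\<forall>e>0. \<exists>N. \<forall>m\<ge>N. \<forall>n\<ge>N. v (s m \<ominus>\<^bsub>R\<^esub> s n) < e)}"

definition cauchy_ring :: "('a, 'm) ring_scheme \<Rightarrow> ('a \<Rightarrow> real) \<Rightarrow> (nat \<Rightarrow> 'a) ring"
  where "cauchy_ring R v =
    \<lparr>carrier = cauchy_seqs R v,
     monoid.mult = (\<lambda>s t n. s n \<otimes>\<^bsub>R\<^esub> t n),
     one = (\<lambda>n. \<one>\<^bsub>R\<^esub>),
     zero = (\<lambda>n. \<zero>\<^bsub>R\<^esub>),
     add = (\<lambda>s t n. s n \<oplus>\<^bsub>R\<^esub> t n)\<rparr>"

definition null_seqs :: "('a, 'm) ring_scheme \<Rightarrow> ('a \<Rightarrow> real) \<Rightarrow> (nat \<Rightarrow> 'a) set"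
  where "null_seqs R v = {s \<in> cauchy_seqs R v. (\<lambda>n. v (s n)) \<longlonglongrightarrow> 0}"

definition completion :: "('a, 'm) ring_scheme \<Rightarrow> ('a \<Rightarrow> real) \<Rightarrow> (nat \<Rightarrow> 'a) set ring"
  where "completion R v = cauchy_ring R v Quot null_seqs R v"

definition completion_class ::
    "('a, 'm) ring_scheme \<Rightarrow> ('a \<Rightarrow> real) \<Rightarrow> (nat \<Rightarrow> 'a) \<Rightarrow> (nat \<Rightarrow> 'a) set"
  where "completion_class R v s = null_seqs R v +>\<^bsub>cauchy_ring R v\<^esub> s"

definition to_completion ::
    "('a, 'm) ring_scheme \<Rightarrow> ('a \<Rightarrow> real) \<Rightarrow> 'a \<Rightarrow> (nat \<Rightarrow> 'a) set"
  where "to_completion R v x = completion_class R v (\<lambda>n. x)"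

definition completion_abs :: "('a \<Rightarrow> real) \<Rightarrow> (nat \<Rightarrow> 'a) set \<Rightarrow> real"
  where "completion_abs v A = (THE r. \<exists>s\<in>A. (\<lambda>n. v (s n)) \<longlonglongrightarrow> r)"

definition padic_abs :: "nat \<Rightarrow> rat \<Rightarrow> real"
  where "padic_abs p r = (if r = 0 then 0 else
    real p powi (int (multiplicity (int p) (snd (quotient_of r)))
                 - int (multiplicity (int p) (fst (quotient_of r)))))"

definition archimedean :: "(complex \<Rightarrow> real) \<Rightarrow> bool"
  where "archimedean v \<longleftrightarrow> (\<forall>r::rat. v (of_rat r) = \<bar>of_rat r\<bar>)"

text \<open>A place of \<open>K\<close> is represented by the unique absolute value in its class that extends the
  usual absolute value of a completion of the rationals. Being extensional, it is determined by
  its values on \<open>K\<close>, so distinct elements of \<open>places K\<close> are distinct places.\<close>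

definition places :: "complex set \<Rightarrow> (complex \<Rightarrow> real) set"
  where "places K = {v \<in> extensional K. absolute_value (subring_of K) v \<and>
    (archimedean v \<or> (\<exists>p::nat. Factorial_Ring.prime p \<and> (\<forall>r::rat. v (of_rat r) = padic_abs p r)))}"

text \<open>The place \<open>v\<close> lies above the prime ideal generated by \<open>\<pi>\<close> in the Gaussian integers.\<close>

definition above_prime :: "(complex \<Rightarrow> real) \<Rightarrow> complex \<Rightarrow> bool"
  where "above_prime v \<pi> \<longleftrightarrow>
    {z \<in> gaussian_integers. v z < 1} = {\<pi> * z | z. z \<in> gaussian_integers}"

definition global_degree :: "complex set \<Rightarrow> nat"
  where "global_degree K = ring.dim \<CC> \<rat> K"

text \<open>The degree of the completion of \<open>K\<close> at \<open>w\<close> over the completion of the rationals, the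
  latter being the set of classes of Cauchy sequences with rational terms.\<close>

definition local_degree :: "complex set \<Rightarrow> (complex \<Rightarrow> real) \<Rightarrow> nat"
  where "local_degree K w = ring.dim (completion (subring_of K) w)
    (completion_class (subring_of K) w ` {s \<in> cauchy_seqs (subring_of K) w. \<forall>n. s n \<in> \<rat>})
    (carrier (completion (subring_of K) w))"


section \<open>The fields \<open>C_v\<close>\<close>

type_synonym Kv = "(nat \<Rightarrow> complex) set"
type_synonym Kv_closure = "(Kv list \<times> nat) multiset \<Rightarrow> Kv"
type_synonym Cv = "(nat \<Rightarrow> Kv_closure) set"

definition Kv_closure_ring :: "complex set \<Rightarrow> (complex \<Rightarrow> real) \<Rightarrow> Kv_closure ring"
  where "Kv_closure_ring k v = field.alg_closure (completion (subring_of k) v)"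

text \<open>The extension of the absolute value to the algebraic closure exists and is unique; the
  library embeds a field into its algebraic closure by \<open>indexed_const\<close>.\<close>

definition Kv_closure_abs :: "complex set \<Rightarrow> (complex \<Rightarrow> real) \<Rightarrow> Kv_closure \<Rightarrow> real"
  where "Kv_closure_abs k v = (SOME a. absolute_value (Kv_closure_ring k v) a \<and>
    (\<forall>x\<in>carrier (completion (subring_of k) v).
      a (ring.indexed_const (completion (subring_of k) v) x) = completion_abs v x))"

definition Cv_ring :: "complex set \<Rightarrow> (complex \<Rightarrow> real) \<Rightarrow> Cv ring"
  where "Cv_ring k v = completion (Kv_closure_ring k v) (Kv_closure_abs k v)"

definition Cv_abs :: "complex set \<Rightarrow> (complex \<Rightarrow> real) \<Rightarrow> Cv \<Rightarrow> real"
  where "Cv_abs k v = completion_abs (Kv_closure_abs k v)"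

definition Cv_emb :: "complex set \<Rightarrow> (complex \<Rightarrow> real) \<Rightarrow> complex \<Rightarrow> Cv"
  where "Cv_emb k v x = to_completion (Kv_closure_ring k v) (Kv_closure_abs k v)
    (ring.indexed_const (completion (subring_of k) v) (to_completion (subring_of k) v x))"

text \<open>For a finite extension \<open>K\<close> of \<open>k\<close> and a place \<open>w\<close> of \<open>K\<close> above \<open>v\<close>, the field \<open>C_w\<close> is
  \<open>C_v\<close>, with \<open>K\<close> embedded by a homomorphism over \<open>k\<close> that induces \<open>w\<close>.\<close>

definition place_below :: "complex set \<Rightarrow> (complex \<Rightarrow> real) \<Rightarrow> complex \<Rightarrow> real"
  where "place_below k w = restrict w k"

definition ext_emb :: "complex set \<Rightarrow> complex set \<Rightarrow> (complex \<Rightarrow> real) \<Rightarrow> complex \<Rightarrow> Cv"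
  where "ext_emb k K w = (SOME h. h \<in> ring_hom (subring_of K) (Cv_ring k (place_below k w)) \<and>
    (\<forall>x\<in>k. h x = Cv_emb k (place_below k w) x) \<and>
    (\<forall>x\<in>K. Cv_abs k (place_below k w) (h x) = w x))"


section \<open>Bundles, heights and tensor products\<close>

text \<open>A bundle over \<open>k\<close> has underlying space \<open>k\<^sup>n\<close>, with coordinates indexed by a finite type
  \<open>'i\<close> of cardinality \<open>n\<close>; it is given by its norms on \<open>C_v\<^sup>n\<close>, one for each place \<open>v\<close> of \<open>k\<close>.\<close>

type_synonym 'i adelic_norms = "(complex \<Rightarrow> real) \<Rightarrow> ('i \<Rightarrow> Cv) \<Rightarrow> real"

definition vectors :: "complex set \<Rightarrow> (complex \<Rightarrow> real) \<Rightarrow> ('i \<Rightarrow> Cv) set"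
  where "vectors k v = {x. \<forall>i. x i \<in> carrier (Cv_ring k v)}"

definition std_norm :: "complex set \<Rightarrow> (complex \<Rightarrow> real) \<Rightarrow> ('i::finite \<Rightarrow> Cv) \<Rightarrow> real"
  where "std_norm k v x =
    (if archimedean v then sqrt (\<Sum>i\<in>UNIV. (Cv_abs k v (x i))\<^sup>2)
     else Max (range (\<lambda>i. Cv_abs k v (x i))))"

definition bundle_norm ::
    "complex set \<Rightarrow> 'i adelic_norms \<Rightarrow> complex set \<Rightarrow> (complex \<Rightarrow> real) \<Rightarrow> ('i \<Rightarrow> complex) \<Rightarrow> real"
  where "bundle_norm k N K w x = N (place_below k w) (\<lambda>i. ext_emb k K w (x i))"

text \<open>All but finitely many of the factors are \<open>1\<close> when \<open>x\<close> is nonzero and \<open>N\<close> is adelic; the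
  finite product omits places of norm \<open>1\<close>.\<close>

definition height_over ::
    "complex set \<Rightarrow> 'i adelic_norms \<Rightarrow> complex set \<Rightarrow> ('i \<Rightarrow> complex) \<Rightarrow> real"
  where "height_over k N K x =
    (\<Prod>w\<in>{w \<in> places K. bundle_norm k N K w x \<noteq> 1}.
      bundle_norm k N K w x powr (real (local_degree K w) / real (global_degree K)))"

text \<open>The value does not depend on the finite extension \<open>K\<close> over which \<open>x\<close> is defined.\<close>

definition height :: "complex set \<Rightarrow> 'i adelic_norms \<Rightarrow> ('i \<Rightarrow> complex) \<Rightarrow> real"
  where "height k N x =
    height_over k N (SOME K. finite_extension_of k K \<and> (\<forall>i. x i \<in> K)) x"

definition Lambda :: "complex set \<Rightarrow> 'i adelic_norms \<Rightarrow> real"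
  where "Lambda k N = Inf {height k N x | x. (\<forall>i. algebraic (x i)) \<and> (\<exists>i. x i \<noteq> 0)}"

definition lincomb ::
    "complex set \<Rightarrow> (complex \<Rightarrow> real) \<Rightarrow> ('i::finite \<Rightarrow> Cv) \<Rightarrow> ('i \<Rightarrow> 'i \<Rightarrow> Cv) \<Rightarrow> 'i \<Rightarrow> Cv"
  where "lincomb k v x e = (\<lambda>i. finsum (Cv_ring k v) (\<lambda>j. x j \<otimes>\<^bsub>Cv_ring k v\<^esub> e j i) UNIV)"

definition orthonormal_basis ::
    "complex set \<Rightarrow> (complex \<Rightarrow> real) \<Rightarrow> (('i::finite \<Rightarrow> Cv) \<Rightarrow> real) \<Rightarrow> ('i \<Rightarrow> 'i \<Rightarrow> Cv) \<Rightarrow> bool"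
  where "orthonormal_basis k v N e \<longleftrightarrow>
    (\<forall>j. e j \<in> vectors k v) \<and>
    (\<forall>y\<in>vectors k v. \<exists>!x. x \<in> vectors k v \<and> y = lincomb k v x e) \<and>
    (\<forall>x\<in>vectors k v. N (lincomb k v x e) = std_norm k v x)"

text \<open>The tensor product of \<open>k\<^sup>n\<close> and \<open>k\<^sup>m\<close> is \<open>k\<^sup>n\<^sup>m\<close>, with \<open>(x \<otimes> y)\<^sub>i\<^sub>j = x\<^sub>i y\<^sub>j\<close>.\<close>

definition tensor_vec ::
    "complex set \<Rightarrow> (complex \<Rightarrow> real) \<Rightarrow> ('i \<Rightarrow> Cv) \<Rightarrow> ('j \<Rightarrow> Cv) \<Rightarrow> 'i \<times> 'j \<Rightarrow> Cv"
  where "tensor_vec k v x y = (\<lambda>(i, j). x i \<otimes>\<^bsub>Cv_ring k v\<^esub> y j)"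

definition tensor_bundle ::
    "complex set \<Rightarrow> 'i::finite adelic_norms \<Rightarrow> 'j::finite adelic_norms \<Rightarrow> ('i \<times> 'j) adelic_norms"
  where "tensor_bundle k N M = (\<lambda>v. SOME P. \<forall>e f.
    orthonormal_basis k v (N v) e \<and> orthonormal_basis k v (M v) f \<longrightarrow>
    orthonormal_basis k v P (\<lambda>(i, j). tensor_vec k v (e i) (f j)))"

text \<open>The vector \<open>(x, y)\<close> has first coordinate \<open>z 1\<close> and second coordinate \<open>z 2\<close>.\<close>

definition Eq_bundle :: "complex set \<Rightarrow> rat \<Rightarrow> 2 adelic_norms"
  where "Eq_bundle k q = (\<lambda>v z.
    if above_prime v (2 + \<i>) then
      max (Cv_abs k v (z 1)) (5 powr of_rat q * Cv_abs k v (z 1 \<oplus>\<^bsub>Cv_ring k v\<^esub> z 2))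
    else if above_prime v (2 - \<i>) then
      max (Cv_abs k v (z 1)) (5 powr of_rat q * Cv_abs k v (z 1 \<ominus>\<^bsub>Cv_ring k v\<^esub> z 2))
    else std_norm k v z)"

end

theory Submission
  imports Defs "Jordan_Normal_Form.Char_Poly"
begin

text \<open>The tensor \<open>e\<^sub>1 \<otimes> e\<^sub>2 - e\<^sub>2 \<otimes> e\<^sub>1\<close> has norm \<open>\<surd>2\<close> at the archimedean places, norm \<open>5\<^sup>q\<close>, the inverse of
  a determinant, at the places above \<open>5\<close>, and norm \<open>1\<close> elsewhere; so its height is
  \<open>\<surd>2 5\<^sup>q < 5\<^sup>q 5\<^sup>q\<close>. The vector \<open>(1, 0)\<close> has height \<open>5\<^sup>q\<close> in the bundle itself. To see that no
  nonzero \<open>(x, y)\<close> has a smaller one, let \<open>P = y\<^sup>5 + 2ix\<^sup>5\<close> and \<open>Q = x\<^sup>5 + 2iy\<^sup>5\<close>. At the places above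
  \<open>5\<close> both are at most \<open>1/5\<close> of the fifth power of the norm of \<open>(x, y)\<close>, so that the form
  \<open>(xy)\<^sup>6PQ\<close> of degree \<open>22\<close> is at most \<open>1/25\<close> of the \<open>22\<close>nd power; at the archimedean places the factor
  is \<open>24/2\<^sup>1\<^sup>1\<close>, and at the other places it is \<open>1\<close>. If the form does not vanish, the product formula
  gives \<open>H\<^sup>2\<^sup>2 \<ge> 25/24 \<cdot> 2\<^sup>1\<^sup>1\<close>, which exceeds \<open>5\<^sup>2\<^sup>2\<^sup>q\<close> for \<open>5\<^sup>q\<close> close to \<open>\<surd>2\<close>. If \<open>PQ = 0\<close> and \<open>xy \<noteq> 0\<close>,
  the absolute values of \<open>x\<close> and \<open>y\<close> at the archimedean places differ by the factor \<open>2\<^sup>1\<^sup>/\<^sup>5\<close>, which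
  gives \<open>H \<ge> \<surd>2.3\<close>; if \<open>xy = 0\<close>, then \<open>H = 5\<^sup>q\<close>.

  The product formula for a number field follows from that for the rationals once it is known that every
  place of \<open>K\<close> comes from an embedding of \<open>K\<close> into a normal closure with a chosen place \<open>u\<close>, and that
  the local degree counts the embeddings inducing the place. Both are instances of weak approximation.\<close>

section \<open>Valued fields and their completions\<close>

text \<open>The exponent 5 serves two purposes. In \<open>(u - a)^5 + a^5 = u^5 - 5u(...)\<close>
  the inner binomial coefficients supply a factor 5, and \<open>u^5\<close> gains as much because
  \<open>5^q > sqrt 2\<close> makes \<open>5^(5q) > 4 sqrt 2 > 5\<close>; a fourth power would only
  guarantee 4. The coefficient \<open>2i\<close> is congruent to 1 modulo \<open>2 + i\<close> and
  to -1 modulo \<open>2 - i\<close>, so one pair of forms is small above both primes, and its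
  absolute value 2 keeps the zeros of the forms off \<open>|x| = |y|\<close>, where the archimedean
  norm is too small. The power of \<open>xy\<close> damps \<open>PQ\<close> near the coordinate
  axes, which are treated separately. What remains of these choices is \<open>24 < 25\<close>, and
  this margin is the room for \<open>\<eta>\<close>. Several objects are selected by
  \<open>SOME\<close>: the absolute value on the closure of \<open>k_v\<close>, the embeddings into
  \<open>C_v\<close>, the tensor norm. Nothing is known about them before an object with the
  defining property has been produced, and each time this is a theorem: the extension of absolute
  values, the origin of places in embeddings, the independence of the orthonormal bases.\<close>

lemma tendsto_null_bound:
  fixes f :: "'a \<Rightarrow> real"
  assumes "\<And>n. \<bar>f n\<bar> \<le> g n" and "(g \<longlongrightarrow> 0) F"
  shows "(f \<longlongrightarrow> 0) F"
  by (rule tendsto_rabs_zero_cancel, rule real_tendsto_sandwich[OF _ _ tendsto_const assms(2)])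
    (use assms(1) in auto)

locale valued_field = field R for R (structure) +
  fixes v :: "'a \<Rightarrow> real"
  assumes absolute_value: "absolute_value R v"
begin

lemma v_nonneg [simp]: "x \<in> carrier R \<Longrightarrow> 0 \<le> v x"
  and v_eq_0_iff [simp]: "x \<in> carrier R \<Longrightarrow> v x = 0 \<longleftrightarrow> x = \<zero>"
  and v_mult: "x \<in> carrier R \<Longrightarrow> y \<in> carrier R \<Longrightarrow> v (x \<otimes> y) = v x * v y"
  and v_add: "x \<in> carrier R \<Longrightarrow> y \<in> carrier R \<Longrightarrow> v (x \<oplus> y) \<le> v x + v y"
  using absolute_value unfolding absolute_value_def by auto

lemma v_zero [simp]: "v \<zero> = 0"
  by simp

lemma v_pos: "x \<in> carrier R \<Longrightarrow> x \<noteq> \<zero> \<Longrightarrow> 0 < v x"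
  using v_nonneg[of x] v_eq_0_iff[of x] by linarith

lemma v_one [simp]: "v \<one> = 1"
proof -
  have "v \<one> * v \<one> = v \<one>"
    using v_mult[of \<one> \<one>] by simp
  then show ?thesis
    using v_eq_0_iff[of \<one>] by simp
qed

lemma v_uminus [simp]: "x \<in> carrier R \<Longrightarrow> v (\<ominus> x) = v x"
proof -
  assume x: "x \<in> carrier R"
  have "v (\<ominus> \<one>) * v (\<ominus> \<one>) = 1"
    using v_mult[of "\<ominus> \<one>" "\<ominus> \<one>"] by (simp add: l_minus r_minus)
  then have "v (\<ominus> \<one>) = 1"
    using v_nonneg[of "\<ominus> \<one>"] by (metis a_inv_closed abs_of_nonneg abs_one one_closed power2_eq_1_iff power2_eq_square abs_minus_cancel)
  then show ?thesis
    using v_mult[of "\<ominus> \<one>" x] x by (simp add: l_minus)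
qed

lemma v_diff: "x \<in> carrier R \<Longrightarrow> y \<in> carrier R \<Longrightarrow> v (x \<ominus> y) \<le> v x + v y"
  using v_add[of x "\<ominus> y"] by (simp add: a_minus_def)

lemma v_diff_commute: "x \<in> carrier R \<Longrightarrow> y \<in> carrier R \<Longrightarrow> v (x \<ominus> y) = v (y \<ominus> x)"
proof -
  assume "x \<in> carrier R" "y \<in> carrier R"
  moreover from this have "x \<ominus> y = \<ominus> (y \<ominus> x)"
    by algebra
  ultimately show ?thesis
    by (metis minus_closed v_uminus)
qed

lemma abs_v_diff: "x \<in> carrier R \<Longrightarrow> y \<in> carrier R \<Longrightarrow> \<bar>v x - v y\<bar> \<le> v (x \<ominus> y)"
proof -
  assume xy: "x \<in> carrier R" "y \<in> carrier R"
  moreover from this have "x = (x \<ominus> y) \<oplus> y" "y = (y \<ominus> x) \<oplus> x"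
    by algebra+
  ultimately have "v x \<le> v (x \<ominus> y) + v y" "v y \<le> v (y \<ominus> x) + v x"
    by (metis minus_closed v_add)+
  then show ?thesis
    using v_diff_commute[OF xy] by linarith
qed

lemma v_triangle:
  "x \<in> carrier R \<Longrightarrow> y \<in> carrier R \<Longrightarrow> z \<in> carrier R \<Longrightarrow> v (x \<ominus> z) \<le> v (x \<ominus> y) + v (y \<ominus> z)"
proof -
  assume xyz: "x \<in> carrier R" "y \<in> carrier R" "z \<in> carrier R"
  then have "x \<ominus> z = (x \<ominus> y) \<oplus> (y \<ominus> z)"
    by algebra
  then show ?thesis
    using v_add[of "x \<ominus> y" "y \<ominus> z"] xyz by simp
qed

lemma v_inv: "x \<in> carrier R \<Longrightarrow> x \<noteq> \<zero> \<Longrightarrow> v (inv x) = 1 / v x"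
proof -
  assume x: "x \<in> carrier R" "x \<noteq> \<zero>"
  then have "v (inv x) * v x = 1"
    using v_mult[of "inv x" x] by (simp add: field_Units)
  then show ?thesis
    using v_pos[OF x] by (simp add: field_simps)
qed

section \<open>Cauchy sequences and the ideal of null sequences\<close>

abbreviation "cauchy \<equiv> cauchy_seqs R v"
abbreviation "null \<equiv> null_seqs R v"
abbreviation "cls \<equiv> completion_class R v"

lemma cauchyI:
  assumes "\<And>n. s n \<in> carrier R"
    and "\<And>e. e > 0 \<Longrightarrow> \<exists>N. \<forall>m\<ge>N. \<forall>n\<ge>N. v (s m \<ominus> s n) < e"
  shows "s \<in> cauchy"
  using assms unfolding cauchy_seqs_def by blast

lemma cauchy_carrier [simp]: "s \<in> cauchy \<Longrightarrow> s n \<in> carrier R"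
  unfolding cauchy_seqs_def by auto

lemma cauchyD: "s \<in> cauchy \<Longrightarrow> e > 0 \<Longrightarrow> \<exists>N. \<forall>m\<ge>N. \<forall>n\<ge>N. v (s m \<ominus> s n) < e"
  unfolding cauchy_seqs_def by auto

lemma cauchy_const [simp]: "x \<in> carrier R \<Longrightarrow> (\<lambda>n. x) \<in> cauchy"
  by (rule cauchyI) (auto simp: a_minus_def r_neg)

lemma cauchy_convergent: "s \<in> cauchy \<Longrightarrow> convergent (\<lambda>n. v (s n))"
proof -
  assume s: "s \<in> cauchy"
  have "Cauchy (\<lambda>n. v (s n))"
    unfolding Cauchy_def dist_real_def
  proof (intro allI impI)
    fix e :: real assume "e > 0"
    then obtain N where N: "\<forall>m\<ge>N. \<forall>n\<ge>N. v (s m \<ominus> s n) < e"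
      using cauchyD[OF s] by blast
    then show "\<exists>M. \<forall>m\<ge>M. \<forall>n\<ge>M. \<bar>v (s m) - v (s n)\<bar> < e"
      using abs_v_diff[OF cauchy_carrier[OF s] cauchy_carrier[OF s]] by (meson le_less_trans)
  qed
  then show ?thesis
    by (rule Cauchy_convergent)
qed

lemma cauchy_bounded: "s \<in> cauchy \<Longrightarrow> \<exists>B>0. \<forall>n. v (s n) \<le> B"
proof -
  assume s: "s \<in> cauchy"
  have "Bseq (\<lambda>n. v (s n))"
    using cauchy_convergent[OF s] by (rule convergent_imp_Bseq)
  then show ?thesis
    using s unfolding Bseq_def by auto
qed

lemma cauchy_add: "s \<in> cauchy \<Longrightarrow> t \<in> cauchy \<Longrightarrow> (\<lambda>n. s n \<oplus> t n) \<in> cauchy"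
proof (rule cauchyI)
  fix e :: real assume s: "s \<in> cauchy" and t: "t \<in> cauchy" and e: "e > 0"
  obtain N where N: "\<forall>m\<ge>N. \<forall>n\<ge>N. v (s m \<ominus> s n) < e/2"
    using cauchyD[OF s, of "e/2"] e by auto
  obtain M where M: "\<forall>m\<ge>M. \<forall>n\<ge>M. v (t m \<ominus> t n) < e/2"
    using cauchyD[OF t, of "e/2"] e by auto
  have "v ((s m \<oplus> t m) \<ominus> (s n \<oplus> t n)) < e" if "m \<ge> max M N" "n \<ge> max M N" for m n
  proof -
    have c: "s m \<in> carrier R" "s n \<in> carrier R" "t m \<in> carrier R" "t n \<in> carrier R"
      using s t by auto
    then have "(s m \<oplus> t m) \<ominus> (s n \<oplus> t n) = (s m \<ominus> s n) \<oplus> (t m \<ominus> t n)"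
      by algebra
    moreover have "v (s m \<ominus> s n) < e/2" "v (t m \<ominus> t n) < e/2"
      using N M that by auto
    ultimately show ?thesis
      using v_add[of "s m \<ominus> s n" "t m \<ominus> t n"] c by auto
  qed
  then show "\<exists>N. \<forall>m\<ge>N. \<forall>n\<ge>N. v ((s m \<oplus> t m) \<ominus> (s n \<oplus> t n)) < e"
    by blast
qed auto

lemma cauchy_uminus: "s \<in> cauchy \<Longrightarrow> (\<lambda>n. \<ominus> s n) \<in> cauchy"
proof (rule cauchyI)
  fix e :: real assume s: "s \<in> cauchy" and e: "e > 0"
  have "v (\<ominus> s m \<ominus> \<ominus> s n) = v (s m \<ominus> s n)" for m n
  proof -
    have c: "s m \<in> carrier R" "s n \<in> carrier R" using s by auto
    then have "\<ominus> s m \<ominus> \<ominus> s n = \<ominus> (s m \<ominus> s n)"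
      by algebra
    then show ?thesis using c by simp
  qed
  then show "\<exists>N. \<forall>m\<ge>N. \<forall>n\<ge>N. v (\<ominus> s m \<ominus> \<ominus> s n) < e"
    using cauchyD[OF s e] by auto
qed auto

lemma cauchy_mult: "s \<in> cauchy \<Longrightarrow> t \<in> cauchy \<Longrightarrow> (\<lambda>n. s n \<otimes> t n) \<in> cauchy"
proof (rule cauchyI)
  fix e :: real assume s: "s \<in> cauchy" and t: "t \<in> cauchy" and e: "e > 0"
  obtain B where B: "B > 0" "\<And>n. v (s n) \<le> B"
    using cauchy_bounded[OF s] by auto
  obtain C where C: "C > 0" "\<And>n. v (t n) \<le> C"
    using cauchy_bounded[OF t] by auto
  obtain N where N: "\<forall>m\<ge>N. \<forall>n\<ge>N. v (s m \<ominus> s n) < e/(2*C)"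
    using cauchyD[OF s, of "e/(2*C)"] e C by auto
  obtain M where M: "\<forall>m\<ge>M. \<forall>n\<ge>M. v (t m \<ominus> t n) < e/(2*B)"
    using cauchyD[OF t, of "e/(2*B)"] e B by auto
  have "v ((s m \<otimes> t m) \<ominus> (s n \<otimes> t n)) < e" if "m \<ge> max M N" "n \<ge> max M N" for m n
  proof -
    have c: "s m \<in> carrier R" "s n \<in> carrier R" "t m \<in> carrier R" "t n \<in> carrier R"
      using s t by auto
    then have "(s m \<otimes> t m) \<ominus> (s n \<otimes> t n) = s m \<otimes> (t m \<ominus> t n) \<oplus> (s m \<ominus> s n) \<otimes> t n"
      by algebra
    then have "v ((s m \<otimes> t m) \<ominus> (s n \<otimes> t n)) \<le> v (s m) * v (t m \<ominus> t n) + v (s m \<ominus> s n) * v (t n)"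
      using v_add[of "s m \<otimes> (t m \<ominus> t n)" "(s m \<ominus> s n) \<otimes> t n"] c by (simp add: v_mult)
    moreover have "v (s m) * v (t m \<ominus> t n) \<le> B * v (t m \<ominus> t n)"
      using B c by (intro mult_right_mono) auto
    moreover have "B * v (t m \<ominus> t n) < B * (e / (2*B))"
      using M that B by (intro mult_strict_left_mono) auto
    moreover have "v (s m \<ominus> s n) * v (t n) \<le> v (s m \<ominus> s n) * C"
      using C c by (intro mult_left_mono) auto
    moreover have "v (s m \<ominus> s n) * C < e / (2*C) * C"
      using N C that by (intro mult_strict_right_mono) auto
    moreover have "B * (e / (2*B)) + e / (2*C) * C = e"
      using B(1) C(1) by simp
    ultimately show ?thesis
      by linarith
  qed
  then show "\<exists>N. \<forall>m\<ge>N. \<forall>n\<ge>N. v ((s m \<otimes> t m) \<ominus> (s n \<otimes> t n)) < e"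
    by blast
qed auto

lemma cauchy_ring_simps:
  "carrier (cauchy_ring R v) = cauchy"
  "s \<otimes>\<^bsub>cauchy_ring R v\<^esub> t = (\<lambda>n. s n \<otimes> t n)"
  "s \<oplus>\<^bsub>cauchy_ring R v\<^esub> t = (\<lambda>n. s n \<oplus> t n)"
  "\<one>\<^bsub>cauchy_ring R v\<^esub> = (\<lambda>n. \<one>)"
  "\<zero>\<^bsub>cauchy_ring R v\<^esub> = (\<lambda>n. \<zero>)"
  unfolding cauchy_ring_def by simp_all

lemma cring_cauchy_ring: "cring (cauchy_ring R v)"
proof (rule cringI)
  show "abelian_group (cauchy_ring R v)"
  proof (rule abelian_groupI)
    fix s assume "s \<in> carrier (cauchy_ring R v)"
    then show "\<exists>t\<in>carrier (cauchy_ring R v). t \<oplus>\<^bsub>cauchy_ring R v\<^esub> s = \<zero>\<^bsub>cauchy_ring R v\<^esub>"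
      using cauchy_uminus[of s] by (intro bexI[of _ "\<lambda>n. \<ominus> s n"]) (auto simp: cauchy_ring_simps l_neg)
  qed (auto simp: cauchy_ring_simps cauchy_add fun_eq_iff a_ac)
  show "comm_monoid (cauchy_ring R v)"
    by (rule comm_monoidI) (auto simp: cauchy_ring_simps cauchy_mult fun_eq_iff m_ac)
qed (auto simp: cauchy_ring_simps fun_eq_iff l_distr)

lemma cauchy_ring_a_inv: "s \<in> cauchy \<Longrightarrow> \<ominus>\<^bsub>cauchy_ring R v\<^esub> s = (\<lambda>n. \<ominus> s n)"
proof -
  assume s: "s \<in> cauchy"
  interpret C: cring "cauchy_ring R v" by (rule cring_cauchy_ring)
  show ?thesis
    using s cauchy_uminus[OF s]
    by (intro C.minus_equality) (auto simp: cauchy_ring_simps l_neg)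
qed

lemma cauchy_ring_minus:
  "s \<in> cauchy \<Longrightarrow> t \<in> cauchy \<Longrightarrow> s \<ominus>\<^bsub>cauchy_ring R v\<^esub> t = (\<lambda>n. s n \<ominus> t n)"
  by (simp add: a_minus_def cauchy_ring_a_inv cauchy_ring_simps)

lemma cauchy_diff: "s \<in> cauchy \<Longrightarrow> t \<in> cauchy \<Longrightarrow> (\<lambda>n. s n \<ominus> t n) \<in> cauchy"
  using cauchy_add[OF _ cauchy_uminus] by (simp add: a_minus_def)

lemma null_iff: "s \<in> null \<longleftrightarrow> s \<in> cauchy \<and> (\<lambda>n. v (s n)) \<longlonglongrightarrow> 0"
  unfolding null_seqs_def by auto

lemma cauchy_if_null_diff:
  assumes s: "s \<in> cauchy" and t: "\<And>n. t n \<in> carrier R"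
    and lim: "(\<lambda>n. v (s n \<ominus> t n)) \<longlonglongrightarrow> 0"
  shows "t \<in> cauchy"
proof (rule cauchyI)
  fix e :: real assume e: "e > 0"
  obtain N where N: "\<forall>m\<ge>N. \<forall>n\<ge>N. v (s m \<ominus> s n) < e/3"
    using cauchyD[OF s, of "e/3"] e by auto
  obtain M where M: "\<forall>n\<ge>M. v (s n \<ominus> t n) < e/3"
    using LIMSEQ_D[OF lim, of "e/3"] e s t by auto
  have "v (t m \<ominus> t n) < e" if mn: "m \<ge> max M N" "n \<ge> max M N" for m n
  proof -
    have c: "s m \<in> carrier R" "s n \<in> carrier R"
      using s by auto
    have "v (t m \<ominus> t n) \<le> v (t m \<ominus> s m) + (v (s m \<ominus> s n) + v (s n \<ominus> t n))"
      using v_triangle[of "t m" "s m" "t n"] v_triangle[of "s m" "s n" "t n"] c t by (smt (verit))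
    moreover have "v (t m \<ominus> s m) < e/3" "v (s n \<ominus> t n) < e/3" "v (s m \<ominus> s n) < e/3"
      using M N mn v_diff_commute[of "t m" "s m"] c t by auto
    ultimately show ?thesis by linarith
  qed
  then show "\<exists>N. \<forall>m\<ge>N. \<forall>n\<ge>N. v (t m \<ominus> t n) < e" by blast
qed (rule t)

lemma ideal_null: "ideal null (cauchy_ring R v)"
proof -
  interpret C: cring "cauchy_ring R v" by (rule cring_cauchy_ring)
  show ?thesis
  proof (rule idealI)
    show "ring (cauchy_ring R v)" by (rule C.ring_axioms)
    have mult: "(\<lambda>n. x n \<otimes> a n) \<in> null" if a: "a \<in> null" and x: "x \<in> cauchy" for a x
    proof -
      have ac: "a \<in> cauchy" and lim: "(\<lambda>n. v (a n)) \<longlonglongrightarrow> 0"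
        using a null_iff by auto
      obtain B where B: "B > 0" "\<And>n. v (x n) \<le> B"
        using cauchy_bounded[OF x] by auto
      have "(\<lambda>n. v (x n \<otimes> a n)) \<longlonglongrightarrow> 0"
      proof (rule tendsto_null_bound)
        show "\<bar>v (x n \<otimes> a n)\<bar> \<le> B * v (a n)" for n
          using B ac x by (auto simp: v_mult abs_mult intro!: mult_right_mono)
        show "(\<lambda>n. B * v (a n)) \<longlonglongrightarrow> 0"
          using tendsto_mult_left[OF lim, of B] by simp
      qed
      then show ?thesis
        using cauchy_mult[OF x ac] null_iff by auto
    qed
    fix a x assume a: "a \<in> null" and x: "x \<in> carrier (cauchy_ring R v)"
    then show "x \<otimes>\<^bsub>cauchy_ring R v\<^esub> a \<in> null"
      using mult by (simp add: cauchy_ring_simps)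
    then show "a \<otimes>\<^bsub>cauchy_ring R v\<^esub> x \<in> null"
      using C.m_comm[of a x] a x null_iff by (simp add: cauchy_ring_simps)
  next
    show "subgroup null (add_monoid (cauchy_ring R v))"
    proof (rule group.subgroupI[OF C.a_group])
      show "null \<subseteq> carrier (add_monoid (cauchy_ring R v))"
        using null_iff by (auto simp: cauchy_ring_simps)
      have "(\<lambda>n. \<zero>) \<in> null"
        using null_iff by simp
      then show "null \<noteq> {}" by blast
    next
      fix a assume a: "a \<in> null"
      have "inv\<^bsub>add_monoid (cauchy_ring R v)\<^esub> a = \<ominus>\<^bsub>cauchy_ring R v\<^esub> a"
        by (simp add: a_inv_def)
      then show "inv\<^bsub>add_monoid (cauchy_ring R v)\<^esub> a \<in> null"
        using a null_iff cauchy_ring_a_inv[of a] cauchy_uminus[of a] by auto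
    next
      fix a b assume ab: "a \<in> null" "b \<in> null"
      have "(\<lambda>n. v (a n \<oplus> b n)) \<longlonglongrightarrow> 0"
      proof (rule tendsto_null_bound)
        show "\<bar>v (a n \<oplus> b n)\<bar> \<le> v (a n) + v (b n)" for n
          using ab null_iff by (auto simp: v_add)
        show "(\<lambda>n. v (a n) + v (b n)) \<longlonglongrightarrow> 0"
          using ab null_iff tendsto_add[of "\<lambda>n. v (a n)" 0 _ "\<lambda>n. v (b n)" 0] by simp
      qed
      then show "a \<otimes>\<^bsub>add_monoid (cauchy_ring R v)\<^esub> b \<in> null"
        using ab null_iff cauchy_add by (simp add: cauchy_ring_simps)
    qed
  qed
qed

section \<open>The quotient field and its absolute value\<close>

lemma completion_carrier: "carrier (completion R v) = cls ` cauchy"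
  unfolding completion_def FactRing_def A_RCOSETS_def' completion_class_def
  by (auto simp: cauchy_ring_simps)

lemma cls_eq_iff:
  assumes "s \<in> cauchy" "t \<in> cauchy"
  shows "cls s = cls t \<longleftrightarrow> (\<lambda>n. v (s n \<ominus> t n)) \<longlonglongrightarrow> 0"
proof -
  interpret C: cring "cauchy_ring R v" by (rule cring_cauchy_ring)
  have "cls s = cls t \<longleftrightarrow> s \<ominus>\<^bsub>cauchy_ring R v\<^esub> t \<in> null"
    unfolding completion_class_def
    using C.quotient_eq_iff_same_a_r_cos[OF ideal_null] assms by (simp add: cauchy_ring_simps)
  then show ?thesis
    using assms cauchy_ring_minus null_iff cauchy_diff by auto
qed

lemma cls_ring_hom: "cls \<in> Ring.ring_hom (cauchy_ring R v) (completion R v)"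
  unfolding completion_def completion_class_def[abs_def]
  using ideal.rcos_ring_hom[OF ideal_null] by simp

lemma cls_mult: "s \<in> cauchy \<Longrightarrow> t \<in> cauchy \<Longrightarrow>
    cls s \<otimes>\<^bsub>completion R v\<^esub> cls t = cls (\<lambda>n. s n \<otimes> t n)"
  and cls_add: "s \<in> cauchy \<Longrightarrow> t \<in> cauchy \<Longrightarrow>
    cls s \<oplus>\<^bsub>completion R v\<^esub> cls t = cls (\<lambda>n. s n \<oplus> t n)"
  and cls_one: "\<one>\<^bsub>completion R v\<^esub> = cls (\<lambda>n. \<one>)"
  using ring_hom_memE[OF cls_ring_hom] by (auto simp: cauchy_ring_simps)

lemma cls_zero: "\<zero>\<^bsub>completion R v\<^esub> = cls (\<lambda>n. \<zero>)"
proof -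
  interpret C: cring "cauchy_ring R v" by (rule cring_cauchy_ring)
  interpret D: ring "completion R v"
    unfolding completion_def by (rule ideal.quotient_is_ring[OF ideal_null])
  show ?thesis
    using ring_hom_zero[OF cls_ring_hom C.ring_axioms D.ring_axioms] by (simp add: cauchy_ring_simps)
qed

lemma cls_eq_zero_iff: "s \<in> cauchy \<Longrightarrow> cls s = \<zero>\<^bsub>completion R v\<^esub> \<longleftrightarrow> (\<lambda>n. v (s n)) \<longlonglongrightarrow> 0"
proof -
  assume s: "s \<in> cauchy"
  have "s n \<ominus> \<zero> = s n" for n
    using s cauchy_carrier[OF s, of n] by algebra
  then show ?thesis
    using cls_eq_iff[OF s, of "\<lambda>n. \<zero>"] cls_zero by simp
qed

text \<open>\<open>completion_abs\<close> is a definite description over all members of a class, so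
  the limit must be shown to be the same for each of them. Two members differ by a null sequence,
  and \<open>abs_v_diff\<close> transfers this to their absolute values.\<close>

lemma completion_abs_eqI:
  assumes s: "s \<in> cauchy" and lim: "(\<lambda>n. v (s n)) \<longlonglongrightarrow> r"
  shows "completion_abs v (cls s) = r"
proof -
  interpret C: cring "cauchy_ring R v" by (rule cring_cauchy_ring)
  interpret I: ideal null "cauchy_ring R v" by (rule ideal_null)
  have self: "s \<in> cls s"
    unfolding completion_class_def using s I.a_rcos_self by (simp add: cauchy_ring_simps)
  have "(\<lambda>n. v (t n)) \<longlonglongrightarrow> r" if "t \<in> cls s" for t
  proof -
    have "t \<in> carrier (cauchy_ring R v)"
      using that s I.a_Hcarr unfolding completion_class_def a_r_coset_def'
      by (auto simp: cauchy_ring_simps cauchy_add null_iff)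
    then have t: "t \<in> cauchy" by (simp add: cauchy_ring_simps)
    have "cls t = cls s"
      using I.a_repr_independence'[OF that[unfolded completion_class_def]] s
      by (simp add: completion_class_def cauchy_ring_simps)
    then have d: "(\<lambda>n. v (t n \<ominus> s n)) \<longlonglongrightarrow> 0"
      using cls_eq_iff[OF t s] by simp
    have "(\<lambda>n. v (t n) - v (s n)) \<longlonglongrightarrow> 0"
      by (rule tendsto_null_bound[OF _ d]) (use abs_v_diff s t in auto)
    from tendsto_add[OF this lim] show ?thesis by simp
  qed
  then show ?thesis
    unfolding completion_abs_def using self lim LIMSEQ_unique
    by (intro the_equality) blast+
qed

lemma completion_abs_lim: "s \<in> cauchy \<Longrightarrow> (\<lambda>n. v (s n)) \<longlonglongrightarrow> completion_abs v (cls s)"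
  using cauchy_convergent[of s] completion_abs_eqI[of s] unfolding convergent_def by auto

text \<open>The clause on the single terms of \<open>t\<close> keeps the inverse inside every
  subfield that contains the terms of \<open>s\<close>. Besides \<open>field_completion\<close> this
  serves \<open>subfield_khat\<close>, where the terms lie in \<open>k\<close>.\<close>

lemma cls_has_inverse:
  assumes s: "s \<in> cauchy" and nz: "cls s \<noteq> \<zero>\<^bsub>completion R v\<^esub>"
  shows "\<exists>t\<in>cauchy. (\<forall>n. t n = \<zero> \<or> s n \<noteq> \<zero> \<and> t n = inv (s n)) \<and>
    (\<lambda>n. v (s n \<otimes> t n \<ominus> \<one>)) \<longlonglongrightarrow> 0"
proof -
  let ?l = "completion_abs v (cls s)"
  have lim: "(\<lambda>n. v (s n)) \<longlonglongrightarrow> ?l"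
    by (rule completion_abs_lim[OF s])
  have "?l \<ge> 0"
    using lim by (rule LIMSEQ_le_const) (use s in auto)
  moreover have "?l \<noteq> 0"
    using lim nz cls_eq_zero_iff[OF s] by auto
  ultimately have l: "?l > 0" by simp
  obtain N where N: "\<And>n. n \<ge> N \<Longrightarrow> v (s n) > ?l / 2"
    using order_tendstoD(1)[OF lim, of "?l/2"] l unfolding eventually_sequentially by auto
  define t where "t n = (if n \<ge> N then inv (s n) else \<zero>)" for n
  have nz: "s n \<noteq> \<zero>" if "n \<ge> N" for n
    using N[OF that] l by auto
  have tc: "t n \<in> carrier R" for n
    using nz[of n] s by (simp add: t_def field_Units)
  have st: "s n \<otimes> t n = \<one>" if "n \<ge> N" for n
    using nz[OF that] that s by (simp add: t_def field_Units)
  have vt: "v (t n) \<le> 2 / ?l" for n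
    using N[of n] nz[of n] s l by (auto simp: t_def v_inv field_simps)
  have "t \<in> cauchy"
  proof (rule cauchyI)
    fix e :: real assume e: "e > 0"
    \<comment> \<open>The bound comes from \<open>1/a - 1/b = (b - a)/(ab)\<close>, in which both
      denominators have absolute value above \<open>?l / 2\<close>.\<close>
    obtain M where M: "\<forall>m\<ge>M. \<forall>n\<ge>M. v (s m \<ominus> s n) < e * (?l/2)\<^sup>2"
      using cauchyD[OF s, of "e * (?l/2)\<^sup>2"] e l by auto
    have "v (t m \<ominus> t n) < e" if mn: "m \<ge> max M N" "n \<ge> max M N" for m n
    proof -
      have c: "s m \<in> carrier R" "s n \<in> carrier R" "t m \<in> carrier R" "t n \<in> carrier R"
        using s tc by auto
      have "t m \<otimes> t n \<otimes> (s n \<ominus> s m) = t m \<otimes> (s n \<otimes> t n) \<ominus> t n \<otimes> (s m \<otimes> t m)"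
        using c by algebra
      then have "t m \<ominus> t n = t m \<otimes> t n \<otimes> (s n \<ominus> s m)"
        using st[of m] st[of n] mn c by simp
      then have "v (t m \<ominus> t n) = v (t m) * v (t n) * v (s n \<ominus> s m)"
        using c by (simp add: v_mult)
      also have "\<dots> \<le> (2 / ?l) * (2 / ?l) * v (s n \<ominus> s m)"
        using vt[of m] vt[of n] c l by (intro mult_right_mono mult_mono) auto
      also have "\<dots> < (2 / ?l) * (2 / ?l) * (e * (?l/2)\<^sup>2)"
        using M mn l by (intro mult_strict_left_mono) auto
      also have "\<dots> = e"
        using l by (simp add: power2_eq_square)
      finally show ?thesis .
    qed
    then show "\<exists>N. \<forall>m\<ge>N. \<forall>n\<ge>N. v (t m \<ominus> t n) < e" by blast
  qed (rule tc)
  moreover have "(\<lambda>n. v (s n \<otimes> t n \<ominus> \<one>)) \<longlonglongrightarrow> 0"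
  proof (rule tendsto_eventually)
    show "\<forall>\<^sub>F n in sequentially. v (s n \<otimes> t n \<ominus> \<one>) = 0"
      unfolding eventually_sequentially using st by (auto intro!: exI[of _ N] simp: a_minus_def r_neg)
  qed
  moreover have "\<forall>n. t n = \<zero> \<or> s n \<noteq> \<zero> \<and> t n = inv (s n)"
    using nz by (simp add: t_def)
  ultimately show ?thesis by blast
qed

lemma field_completion: "field (completion R v)"
proof -
  interpret C: cring "cauchy_ring R v" by (rule cring_cauchy_ring)
  interpret D: cring "completion R v"
    unfolding completion_def by (rule ideal.quotient_is_cring[OF ideal_null C.is_cring])
  show ?thesis
  proof (rule D.cring_fieldI2)
    show "\<zero>\<^bsub>completion R v\<^esub> \<noteq> \<one>\<^bsub>completion R v\<^esub>"
      using cls_eq_zero_iff[of "\<lambda>n. \<one>"] cls_one LIMSEQ_unique[of "\<lambda>n. 1::real" 1 0] by auto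
  next
    fix a assume a: "a \<in> carrier (completion R v)" "a \<noteq> \<zero>\<^bsub>completion R v\<^esub>"
    then obtain s where s: "s \<in> cauchy" "a = cls s"
      by (auto simp: completion_carrier)
    obtain t where t: "t \<in> cauchy" "(\<lambda>n. v (s n \<otimes> t n \<ominus> \<one>)) \<longlonglongrightarrow> 0"
      using cls_has_inverse s a by blast
    have "a \<otimes>\<^bsub>completion R v\<^esub> cls t = \<one>\<^bsub>completion R v\<^esub>"
      using s t cls_mult[of s t] cls_one cls_eq_iff[of "\<lambda>n. s n \<otimes> t n" "\<lambda>n. \<one>"] cauchy_mult by simp
    then show "\<exists>b\<in>carrier (completion R v). a \<otimes>\<^bsub>completion R v\<^esub> b = \<one>\<^bsub>completion R v\<^esub>"
      using t by (auto simp: completion_carrier)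
  qed
qed

lemma valued_field_completion: "valued_field (completion R v) (completion_abs v)"
proof -
  have zero: "completion_abs v (cls s) = 0 \<longleftrightarrow> cls s = \<zero>\<^bsub>completion R v\<^esub>" if "s \<in> cauchy" for s
    using completion_abs_lim[OF that] cls_eq_zero_iff[OF that] completion_abs_eqI[OF that, of 0] by auto
  have "absolute_value (completion R v) (completion_abs v)"
    unfolding absolute_value_def completion_carrier ball_simps
  proof (intro conjI ballI, goal_cases)
    case (1 s)
    show ?case
      using completion_abs_lim[OF 1] by (rule LIMSEQ_le_const) (use 1 in auto)
  next
    case (2 s)
    then show ?case by (rule zero)
  next
    case (3 s t)
    have "(\<lambda>n. v (s n \<otimes> t n)) \<longlonglongrightarrow> completion_abs v (cls s) * completion_abs v (cls t)"
      using tendsto_mult[OF completion_abs_lim[OF 3(1)] completion_abs_lim[OF 3(2)]] 3 by (simp add: v_mult)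
    then show ?case
      using 3 completion_abs_eqI[OF cauchy_mult] by (simp add: cls_mult)
  next
    case (4 s t)
    have "completion_abs v (cls (\<lambda>n. s n \<oplus> t n)) \<le> completion_abs v (cls s) + completion_abs v (cls t)"
      by (rule LIMSEQ_le[OF completion_abs_lim[OF cauchy_add[OF 4]]
            tendsto_add[OF completion_abs_lim[OF 4(1)] completion_abs_lim[OF 4(2)]]])
        (use 4 v_add in auto)
    then show ?case
      using 4 by (simp add: cls_add)
  qed
  then show ?thesis
    using field_completion by (simp add: valued_field_def valued_field_axioms_def)
qed

lemma to_completion_hom: "to_completion R v \<in> Ring.ring_hom R (completion R v)"
proof (rule ring_hom_memI)
  fix x y assume "x \<in> carrier R" "y \<in> carrier R"
  then show "to_completion R v x \<in> carrier (completion R v)"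
    and "to_completion R v (x \<otimes> y) = to_completion R v x \<otimes>\<^bsub>completion R v\<^esub> to_completion R v y"
    and "to_completion R v (x \<oplus> y) = to_completion R v x \<oplus>\<^bsub>completion R v\<^esub> to_completion R v y"
    by (auto simp: to_completion_def completion_carrier cls_mult cls_add)
qed (simp add: to_completion_def cls_one)

lemma completion_abs_to_completion: "x \<in> carrier R \<Longrightarrow> completion_abs v (to_completion R v x) = v x"
  unfolding to_completion_def by (rule completion_abs_eqI) auto

end

section \<open>Extending absolute values to algebraic extensions\<close>

text \<open>The base need not be complete, and archimedean and ultrametric values are treated alike.
  The argument is the one that finds a point in a Berkovich spectrum: by Zorn there is a minimal
  submultiplicative seminorm bounded by \<open>a\<close> on \<open>F\<close> with value 1 at 1, and
  minimality forces it to be multiplicative.\<close>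

locale algebraic_valued_extension = field R for R (structure) +
  fixes F :: "'a set" and a :: "'a \<Rightarrow> real"
  assumes subfield_F: "subfield F R"
    and absolute_value_F: "absolute_value (R\<lparr>carrier := F\<rparr>) a"
    and algebraic_over_F: "x \<in> carrier R \<Longrightarrow> (algebraic over F) x"
begin

lemma a_nonneg: "x \<in> F \<Longrightarrow> 0 \<le> a x"
  and a_eq_0: "x \<in> F \<Longrightarrow> a x = 0 \<longleftrightarrow> x = \<zero>"
  and a_mult: "x \<in> F \<Longrightarrow> y \<in> F \<Longrightarrow> a (x \<otimes> y) = a x * a y"
  and a_add: "x \<in> F \<Longrightarrow> y \<in> F \<Longrightarrow> a (x \<oplus> y) \<le> a x + a y"
  using absolute_value_F unfolding absolute_value_def by auto

lemmas F_props = subringE[OF subfieldE(1)[OF subfield_F]]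

lemma F_inv: "x \<in> F \<Longrightarrow> x \<noteq> \<zero> \<Longrightarrow> inv x \<in> F"
  using subfield_m_inv(1)[OF subfield_F] by blast

text \<open>A cost relation \<open>G\<close> records upper bounds: \<open>(x, c) \<in> G\<close> says that the value of \<open>x\<close> is at
  most \<open>c\<close>. Unlike seminorms, cost relations form a family closed under unions of chains.\<close>

definition cost_rel :: "('a \<times> real) set \<Rightarrow> bool"
  where "cost_rel G \<longleftrightarrow>
    (\<forall>x c. (x, c) \<in> G \<longrightarrow> x \<in> carrier R \<and> 0 \<le> c) \<and>
    (\<forall>x\<in>F. (x, a x) \<in> G) \<and>
    (\<forall>x c y d. (x, c) \<in> G \<longrightarrow> (y, d) \<in> G \<longrightarrow> (x \<oplus> y, c + d) \<in> G \<and> (x \<otimes> y, c * d) \<in> G) \<and>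
    (\<forall>c. (\<one>, c) \<in> G \<longrightarrow> 1 \<le> c)"

lemma a_one: "a \<one> = 1"
  using a_mult[of \<one> \<one>] a_eq_0[of \<one>] F_props by simp

lemma cost_rel_init: "cost_rel {(x, c). x \<in> F \<and> a x \<le> c}"
  unfolding cost_rel_def
proof (intro conjI allI impI ballI)
  fix x c y d assume "(x, c) \<in> {(x, c). x \<in> F \<and> a x \<le> c}" "(y, d) \<in> {(x, c). x \<in> F \<and> a x \<le> c}"
  then show "(x \<oplus> y, c + d) \<in> {(x, c). x \<in> F \<and> a x \<le> c}" "(x \<otimes> y, c * d) \<in> {(x, c). x \<in> F \<and> a x \<le> c}"
    using a_add[of x y] a_mult[of x y] mult_mono[of "a x" c "a y" d] a_nonneg[of x] a_nonneg[of y] F_props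
    by auto
next
  fix x c assume "(x, c) \<in> {(x, c). x \<in> F \<and> a x \<le> c}"
  then show "x \<in> carrier R" "0 \<le> c"
    using F_props(1) a_nonneg[of x] by auto
qed (auto simp: a_one)

text \<open>A larger relation means a smaller seminorm. Every condition in \<open>cost_rel\<close>
  concerns at most two pairs, and two pairs from the union of a chain lie in one member of it; this
  is what makes relations suitable for Zorn.\<close>

lemma maximal_cost_rel_exists: "\<exists>G. cost_rel G \<and> (\<forall>G'. cost_rel G' \<longrightarrow> G \<subseteq> G' \<longrightarrow> G' = G)"
proof -
  have "\<exists>M\<in>Collect cost_rel. \<forall>H\<in>Collect cost_rel. M \<subseteq> H \<longrightarrow> H = M"
  proof (rule subset_Zorn_nonempty)
    show "Collect cost_rel \<noteq> {}"
      using cost_rel_init by blast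
  next
    fix \<C> assume ne: "\<C> \<noteq> {}" and ch: "subset.chain (Collect cost_rel) \<C>"
    then have c: "cost_rel G" if "G \<in> \<C>" for G
      using that unfolding subset.chain_def by auto
    have two: "\<exists>G\<in>\<C>. p \<in> G \<and> q \<in> G" if "p \<in> \<Union>\<C>" "q \<in> \<Union>\<C>" for p q
    proof -
      obtain G H where "G \<in> \<C>" "p \<in> G" "H \<in> \<C>" "q \<in> H"
        using \<open>p \<in> \<Union>\<C>\<close> \<open>q \<in> \<Union>\<C>\<close> by auto
      moreover have "G \<subseteq> H \<or> H \<subseteq> G"
        using ch calculation unfolding subset.chain_def by auto
      ultimately show ?thesis by blast
    qed
    have "cost_rel (\<Union>\<C>)"
      unfolding cost_rel_def
    proof (intro conjI allI impI ballI)
      fix x c assume "(x, c) \<in> \<Union>\<C>"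
      then show "x \<in> carrier R" "0 \<le> c"
        using c unfolding cost_rel_def by blast+
    next
      fix x assume "x \<in> F"
      then show "(x, a x) \<in> \<Union>\<C>"
        using c ne unfolding cost_rel_def by blast
    next
      fix x c y d assume "(x, c) \<in> \<Union>\<C>" "(y, d) \<in> \<Union>\<C>"
      then show "(x \<oplus> y, c + d) \<in> \<Union>\<C>" "(x \<otimes> y, c * d) \<in> \<Union>\<C>"
        using two[of "(x, c)" "(y, d)"] c unfolding cost_rel_def by blast+
    next
      fix c assume "(\<one>, c) \<in> \<Union>\<C>"
      then show "1 \<le> c"
        using c unfolding cost_rel_def by blast
    qed
    then show "\<Union>\<C> \<in> Collect cost_rel" by simp
  qed
  then show ?thesis by auto
qed

section \<open>The seminorm of a maximal cost relation\<close>

definition G where "G = (SOME G. cost_rel G \<and> (\<forall>G'. cost_rel G' \<longrightarrow> G \<subseteq> G' \<longrightarrow> G' = G))"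

lemma cost_rel_G: "cost_rel G"
  and G_maximal: "cost_rel G' \<Longrightarrow> G \<subseteq> G' \<Longrightarrow> G' = G"
  using someI_ex[OF maximal_cost_rel_exists] unfolding G_def by auto

lemma G_carrier: "(x, c) \<in> G \<Longrightarrow> x \<in> carrier R"
  and G_nonneg: "(x, c) \<in> G \<Longrightarrow> 0 \<le> c"
  and G_F: "x \<in> F \<Longrightarrow> (x, a x) \<in> G"
  and G_add: "(x, c) \<in> G \<Longrightarrow> (y, d) \<in> G \<Longrightarrow> (x \<oplus> y, c + d) \<in> G"
  and G_mult: "(x, c) \<in> G \<Longrightarrow> (y, d) \<in> G \<Longrightarrow> (x \<otimes> y, c * d) \<in> G"
  and G_one: "(\<one>, c) \<in> G \<Longrightarrow> 1 \<le> c"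
  using cost_rel_G unfolding cost_rel_def by auto

definition A where "A = {x. \<exists>c. (x, c) \<in> G}"
definition N where "N x = Inf {c. (x, c) \<in> G}"

lemma A_carrier [simp]: "x \<in> A \<Longrightarrow> x \<in> carrier R"
  unfolding A_def using G_carrier by auto

lemma A_add [simp]: "x \<in> A \<Longrightarrow> y \<in> A \<Longrightarrow> x \<oplus> y \<in> A"
  and A_mult [simp]: "x \<in> A \<Longrightarrow> y \<in> A \<Longrightarrow> x \<otimes> y \<in> A"
  unfolding A_def using G_add G_mult by blast+

lemma F_A: "x \<in> F \<Longrightarrow> x \<in> A"
  unfolding A_def using G_F by auto

lemma A_one [simp]: "\<one> \<in> A" and A_zero [simp]: "\<zero> \<in> A"
  using F_A F_props by auto

lemma A_uminus [simp]: "x \<in> A \<Longrightarrow> \<ominus> x \<in> A"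
proof -
  assume x: "x \<in> A"
  have "\<ominus> \<one> \<in> A"
    using F_A F_props by simp
  moreover have "\<ominus> x = \<ominus> \<one> \<otimes> x"
    using x by (simp add: l_minus)
  ultimately show ?thesis using x by simp
qed

lemma A_power [simp]: "x \<in> A \<Longrightarrow> x [^] (n::nat) \<in> A"
  by (induction n) auto

lemma bdd: "bdd_below {c. (x, c) \<in> G}"
  using G_nonneg by (intro bdd_belowI[of _ 0]) auto

lemma N_le: "(x, c) \<in> G \<Longrightarrow> N x \<le> c"
  unfolding N_def by (rule cInf_lower[OF _ bdd]) simp

lemma N_greatest: "x \<in> A \<Longrightarrow> (\<And>c. (x, c) \<in> G \<Longrightarrow> d \<le> c) \<Longrightarrow> d \<le> N x"
  unfolding N_def A_def by (rule cInf_greatest) auto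

lemma N_nonneg: "x \<in> A \<Longrightarrow> 0 \<le> N x"
  by (rule N_greatest) (use G_nonneg in auto)

lemma N_approx: "x \<in> A \<Longrightarrow> e > 0 \<Longrightarrow> \<exists>c. (x, c) \<in> G \<and> c < N x + e"
  using N_greatest[of x "N x + e"] by (meson less_add_same_cancel1 not_less)

lemma N_add: assumes "x \<in> A" "y \<in> A" shows "N (x \<oplus> y) \<le> N x + N y"
proof (rule field_le_epsilon)
  fix e :: real assume e: "e > 0"
  obtain c where c: "(x, c) \<in> G" "c < N x + e/2"
    using N_approx[OF assms(1), of "e/2"] e by auto
  obtain d where d: "(y, d) \<in> G" "d < N y + e/2"
    using N_approx[OF assms(2), of "e/2"] e by auto
  show "N (x \<oplus> y) \<le> N x + N y + e"
    using N_le[OF G_add[OF c(1) d(1)]] c d by linarith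
qed

lemma N_mult: assumes "x \<in> A" "y \<in> A" shows "N (x \<otimes> y) \<le> N x * N y"
proof -
  have *: "N (x \<otimes> y) \<le> c * N y" if c: "(x, c) \<in> G" for c
  proof (cases "c = 0")
    case True
    obtain d where "(y, d) \<in> G"
      using assms unfolding A_def by auto
    then show ?thesis
      using N_le[OF G_mult[OF c]] True by auto
  next
    case False
    then have c0: "c > 0" using G_nonneg[OF c] by simp
    have "N (x \<otimes> y) / c \<le> N y"
      using N_le[OF G_mult[OF c]] c0 by (intro N_greatest[OF assms(2)]) (simp add: field_simps)
    then show ?thesis using c0 by (simp add: field_simps)
  qed
  show ?thesis
  proof (cases "N y = 0")
    case True
    obtain c where "(x, c) \<in> G"
      using assms unfolding A_def by auto
    then show ?thesis
      using *[of c] True by auto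
  next
    case False
    then have y0: "N y > 0" using N_nonneg[OF assms(2)] by simp
    have "N (x \<otimes> y) / N y \<le> N x"
      using * y0 by (intro N_greatest[OF assms(1)]) (simp add: field_simps)
    then show ?thesis using y0 by (simp add: field_simps)
  qed
qed

lemma N_one: "N \<one> = 1"
  using N_le[OF G_F[of \<one>]] N_greatest[of \<one> 1] G_one F_props a_one by fastforce

text \<open>On \<open>F\<close> the seminorm could only be smaller than \<open>a\<close>. It is not,
  since \<open>1 = N \<one>\<close> is at most \<open>N x\<close> times the cost
  \<open>a (inv x)\<close> of the inverse.\<close>

lemma N_F: "x \<in> F \<Longrightarrow> N x = a x"
proof -
  assume x: "x \<in> F"
  have le: "N y \<le> a y" if "y \<in> F" for y
    using N_le[OF G_F[OF that]] .
  show ?thesis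
  proof (cases "x = \<zero>")
    case True
    then show ?thesis
      using le[OF x] a_eq_0[OF x] N_nonneg[of x] by simp
  next
    case False
    then have i: "inv x \<in> F" "x \<otimes> inv x = \<one>"
      using F_inv[OF x] x F_props(1) by (auto simp: field_Units)
    have "1 \<le> N x * N (inv x)"
      using N_mult[of x "inv x"] F_A x i N_one by simp
    also have "\<dots> \<le> N x * a (inv x)"
      using le[OF i(1)] N_nonneg[OF F_A[OF x]] by (intro mult_left_mono) auto
    finally have "a x * 1 \<le> a x * (N x * a (inv x))"
      using a_nonneg[OF x] by (intro mult_left_mono) auto
    also have "\<dots> = N x"
      using a_mult[OF x i(1)] i a_one by simp
    finally show ?thesis using le[OF x] by simp
  qed
qed

text \<open>The candidate for enlarging \<open>G\<close>: it adjoins \<open>x\<close> at the price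
  \<open>r\<close>. Of the conditions in \<open>cost_rel\<close> only the one on the costs of 1 can
  fail for it.\<close>

inductive_set adj :: "'a \<Rightarrow> real \<Rightarrow> ('a \<times> real) set" for x r where
  base: "(b, c) \<in> G \<Longrightarrow> (b \<otimes> x [^] (i::nat), c * r ^ i) \<in> adj x r"
| add: "(y, c) \<in> adj x r \<Longrightarrow> (z, d) \<in> adj x r \<Longrightarrow> (y \<oplus> z, c + d) \<in> adj x r"

lemma adj_carrier: "(y, c) \<in> adj x r \<Longrightarrow> x \<in> carrier R \<Longrightarrow> r \<ge> 0 \<Longrightarrow> y \<in> carrier R \<and> c \<ge> 0"
  by (induction rule: adj.induct) (auto dest: G_carrier G_nonneg)

lemma adj_mult:
  assumes x: "x \<in> carrier R" and r: "r \<ge> 0"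
  shows "(y, c) \<in> adj x r \<Longrightarrow> (z, d) \<in> adj x r \<Longrightarrow> (y \<otimes> z, c * d) \<in> adj x r"
proof (induction rule: adj.induct)
  case (base b c i)
  have carr: "b \<in> carrier R" using G_carrier base(1) by auto
  show ?case
    using base(2)
  proof (induction rule: adj.induct)
    case (base b' c' j)
    have "b' \<in> carrier R" using G_carrier base(1) by auto
    then have "(b \<otimes> x [^] i) \<otimes> (b' \<otimes> x [^] j) = (b \<otimes> b') \<otimes> x [^] (i + j)"
      using carr x by (simp add: nat_pow_mult[symmetric] m_ac)
    moreover have "(c * r ^ i) * (c' * r ^ j) = (c * c') * r ^ (i + j)"
      by (simp add: power_add)
    ultimately show ?case
      using adj.base[OF G_mult[OF \<open>(b, c) \<in> G\<close> base(1)], of x "i + j" r] by metis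
  next
    case (add y c' z d)
    have "y \<in> carrier R" "z \<in> carrier R"
      using adj_carrier add x r by auto
    then show ?case
      using adj.add[OF add(3,4)] carr x by (simp add: r_distr distrib_left)
  qed
next
  case (add y c y' c')
  have "y \<in> carrier R" "y' \<in> carrier R" "z \<in> carrier R"
    using adj_carrier add x r by auto
  then show ?case
    using adj.add[OF add(3,4)] add(5) by (simp add: l_distr distrib_right)
qed

text \<open>Every use of maximality passes through this criterion: if adjoining \<open>x\<close> at
  the price \<open>r\<close> does not make 1 cheaper than 1, then \<open>x\<close> already has the
  cost \<open>r\<close>. It gives finiteness of costs in \<open>A_eq_carrier\<close> and the upper
  bounds in \<open>N_spectral\<close> and \<open>N_inv\<close>.\<close>

lemma adj_maximal:
  assumes x: "x \<in> carrier R" and r: "r \<ge> 0" and one: "\<And>c. (\<one>, c) \<in> adj x r \<Longrightarrow> 1 \<le> c"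
  shows "(x, r) \<in> G"
proof -
  have sub: "G \<subseteq> adj x r"
    using adj.base[of _ _ x 0 r] G_carrier by fastforce
  have "cost_rel (adj x r)"
    unfolding cost_rel_def using adj_carrier[OF _ x r] adj_mult[OF x r] adj.add[of _ _ x r] sub G_F one
    by blast
  then have "adj x r = G"
    by (rule G_maximal[OF _ sub])
  moreover have "(x, r) \<in> adj x r"
    using adj.base[OF G_F[of \<one>], of x 1 r] F_props x a_one by simp
  ultimately show ?thesis by simp
qed

section \<open>Every element has a finite cost\<close>

primrec psum :: "(nat \<Rightarrow> 'a) \<Rightarrow> 'a \<Rightarrow> nat \<Rightarrow> 'a" where
  "psum f x 0 = \<zero>"
| "psum f x (Suc n) = psum f x n \<oplus> f n \<otimes> x [^] n"

lemma psum_carrier [simp]: "x \<in> carrier R \<Longrightarrow> (\<And>i. f i \<in> carrier R) \<Longrightarrow> psum f x n \<in> carrier R"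
  by (induction n) auto

lemma psum_cong: "(\<And>i. i < n \<Longrightarrow> f i = g i) \<Longrightarrow> psum f x n = psum g x n"
  by (induction n) auto

lemma psum_add:
  assumes "x \<in> carrier R" "\<And>i. f i \<in> carrier R" "\<And>i. g i \<in> carrier R"
  shows "psum (\<lambda>i. f i \<oplus> g i) x n = psum f x n \<oplus> psum g x n"
  using assms by (induction n) (auto simp: l_distr a_ac)

lemma psum_smult:
  assumes "x \<in> carrier R" "\<And>i. f i \<in> carrier R" "c \<in> carrier R"
  shows "psum (\<lambda>i. c \<otimes> f i) x n = c \<otimes> psum f x n"
  using assms by (induction n) (auto simp: r_distr m_ac)

lemma psum_shift:
  assumes "x \<in> carrier R" "\<And>i. f i \<in> carrier R"
  shows "psum (case_nat \<zero> f) x (Suc n) = x \<otimes> psum f x n"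
  using assms by (induction n) (auto simp: r_distr m_ac)

lemma psum_unit:
  assumes "x \<in> carrier R" "c \<in> carrier R"
  shows "psum (case_nat c (\<lambda>_. \<zero>)) x (Suc n) = c"
  using assms by (induction n) auto

lemma eval_eq_psum:
  assumes "x \<in> carrier R" "set p \<subseteq> carrier R"
  shows "eval p x = psum (\<lambda>i. if i < length p then rev p ! i else \<zero>) x (length p)"
  using assms
proof (induction p)
  case (Cons b p)
  let ?f = "\<lambda>p i. if i < length p then rev p ! i else \<zero>"
  have "psum (?f (b # p)) x (length p) = psum (?f p) x (length p)"
    by (rule psum_cong) (auto simp: nth_append)
  moreover have "?f (b # p) (length p) = b"
    by (simp add: nth_append)
  moreover have "psum (?f p) x (length p) \<in> carrier R"
    using Cons.prems nth_mem[of _ "rev p"] by (intro psum_carrier) auto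
  ultimately show ?case
    using Cons by (simp add: a_comm nth_append)
qed simp

text \<open>As \<open>b\<close> is algebraic over \<open>F\<close>, its inverse is a polynomial in
  \<open>b\<close> over \<open>F\<close> and so lies in the ring \<open>A\<close>.\<close>

lemma A_subfield: "subfield A R"
proof (rule subfieldI')
  have sr: "subring A R"
    by (rule subringI) auto
  then show "subring A R" .
  fix b assume b: "b \<in> A - {\<zero>}"
  then have bc: "b \<in> carrier R" by auto
  have se: "simple_extension F b \<subseteq> A"
    using simple_extension_subring_incl[OF sr] F_A b by blast
  have "subfield (simple_extension F b) R"
    using simple_extension_is_subfield[OF subfield_F bc] algebraic_over_F[OF bc] by simp
  moreover have "b \<in> simple_extension F b"
    using simple_extension_mem[OF subfieldE(1)[OF subfield_F] bc] .
  ultimately have "inv b \<in> simple_extension F b"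
    using subfield_m_inv(1)[of "simple_extension F b" b] b by auto
  then show "inv b \<in> A" using se by auto
qed

lemma A_inv: "x \<in> A \<Longrightarrow> x \<noteq> \<zero> \<Longrightarrow> inv x \<in> A"
  using subfield_m_inv(1)[OF A_subfield] by blast

definition monic_rel where "monic_rel x d \<longleftrightarrow> (\<exists>f. (\<forall>i. f i \<in> A) \<and> x [^] d = psum f x d)"

lemma monic_relI:
  assumes x: "x \<in> carrier R" and g: "\<And>i. g i \<in> A" and z: "psum g x (Suc n) = \<zero>" and nz: "g n \<noteq> \<zero>"
  shows "monic_rel x n"
proof -
  let ?u = "\<ominus> (inv (g n))"
  have i: "inv (g n) \<in> A" "inv (g n) \<otimes> g n = \<one>"
    using A_inv[OF g nz] nz g A_carrier by (auto simp: field_Units)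
  have gc: "\<And>i. g i \<in> carrier R" using g by simp
  have "x [^] n = inv (g n) \<otimes> (g n \<otimes> x [^] n)"
    using i x gc by (simp add: m_assoc[symmetric])
  also have "g n \<otimes> x [^] n = \<ominus> psum g x n"
    using z x gc by (intro minus_equality[symmetric]) (auto simp: a_comm)
  also have "inv (g n) \<otimes> \<ominus> psum g x n = ?u \<otimes> psum g x n"
    using i x gc by (simp add: r_minus l_minus)
  also have "\<dots> = psum (\<lambda>i. ?u \<otimes> g i) x n"
    using i x gc by (intro psum_smult[symmetric]) auto
  finally show ?thesis
    unfolding monic_rel_def using i g by (intro exI[of _ "\<lambda>i. ?u \<otimes> g i"]) auto
qed

lemma monic_rel_exists: assumes x: "x \<in> carrier R" shows "\<exists>d. monic_rel x d"
proof -
  have "(algebraic over F) x" using algebraic_over_F[OF x] .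
  then obtain p where p: "p \<in> carrier (F[X])" "p \<noteq> []" "eval p x = \<zero>"
    using algebraicE[OF subfieldE(1)[OF subfield_F] x] by blast
  have pol: "polynomial F p"
    using p(1) univ_poly_carrier by blast
  then have s: "set p \<subseteq> F" "hd p \<noteq> \<zero>"
    using p(2) unfolding polynomial_def by auto
  let ?f = "\<lambda>i. if i < length p then rev p ! i else \<zero>"
  obtain n where n: "length p = Suc n" using p(2) by (cases p) auto
  have "set p \<subseteq> A" using s F_A by blast
  then have "\<And>i. ?f i \<in> A" using nth_mem[of _ "rev p"] by auto
  moreover have "psum ?f x (Suc n) = \<zero>"
    using eval_eq_psum[OF x, of p] s F_props(1) p(3) n by auto
  moreover have "?f n = hd p"
    using n p(2) by (simp add: rev_nth hd_conv_nth)
  ultimately show ?thesis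
    using monic_relI[OF x, of ?f n] s by auto
qed

text \<open>Suppose \<open>x\<close> has no cost and take a monic relation for it over
  \<open>A\<close> of least degree \<open>d\<close>. Then the powers of \<open>x\<close> below
  \<open>d\<close> are independent over \<open>A\<close>. Weighting the coefficient of
  \<open>x ^ i\<close> by \<open>r ^ i\<close>, with \<open>r\<close> large, gives a norm in which
  \<open>x ^ n\<close> costs at most \<open>r ^ n\<close>, while 1, having only one representation,
  costs at least 1. So \<open>x\<close> can be adjoined at the price \<open>r\<close>.\<close>

lemma A_eq_carrier: "A = carrier R"
proof (rule ccontr)
  assume "A \<noteq> carrier R"
  then obtain x where x: "x \<in> carrier R" "x \<notin> A"
    using A_carrier by blast
  define d where "d = (LEAST d. monic_rel x d)"
  have d: "monic_rel x d" and dmin: "\<And>n. n < d \<Longrightarrow> \<not> monic_rel x n"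
    unfolding d_def using LeastI_ex[OF monic_rel_exists[OF x(1)]] not_less_Least by auto
  obtain f0 where f0: "\<And>i. f0 i \<in> A" "x [^] d = psum f0 x d"
    using d unfolding monic_rel_def by auto
  have d0: "d > 0"
    using f0(2) by (cases d) auto
  then obtain m where m: "d = Suc m" by (cases d) auto
  have indep: "n \<le> d \<Longrightarrow> (\<And>i. g i \<in> A) \<Longrightarrow> psum g x n = \<zero> \<Longrightarrow> i < n \<Longrightarrow> g i = \<zero>" for g n i
  proof (induction n arbitrary: i)
    case (Suc n)
    have gn: "g n = \<zero>"
      using monic_relI[OF x(1) Suc.prems(2,3)] dmin[of n] Suc.prems(1) by auto
    have "psum g x n \<in> carrier R"
      using x Suc.prems(2) by (intro psum_carrier) auto
    then have "psum g x n = \<zero>"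
      using Suc.prems(3) gn x by simp
    then show ?case
      using Suc gn by (cases "i = n") auto
  qed simp
  \<comment> \<open>With \<open>r - 1\<close> equal to the sum of the \<open>N (f0 i)\<close>, the
    right side of the relation costs at most \<open>(r - 1) * r ^ (d - 1)\<close>, hence at most
    \<open>r ^ d\<close>: rewriting \<open>x ^ d\<close> by \<open>f0\<close> never raises the
    price.\<close>
  define r where "r = 1 + (\<Sum>i<d. N (f0 i))"
  have r1: "r \<ge> 1"
    unfolding r_def using f0 N_nonneg by (simp add: sum_nonneg)
  define cost where "cost f = (\<Sum>i<d. N (f i) * r ^ i)" for f
  have f0_cost: "cost f0 \<le> r ^ d"
  proof -
    have "cost f0 \<le> (\<Sum>i<d. N (f0 i) * r ^ m)"
      unfolding cost_def using r1 f0 N_nonneg m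
      by (intro sum_mono mult_left_mono power_increasing) auto
    also have "\<dots> = (r - 1) * r ^ m"
      by (simp add: r_def sum_distrib_right)
    also have "\<dots> \<le> r * r ^ m"
      using r1 by (intro mult_right_mono) auto
    finally show ?thesis by (simp add: m)
  qed
  have cost_add: "cost (\<lambda>i. f i \<oplus> g i) \<le> cost f + cost g" if "\<And>i. f i \<in> A" "\<And>i. g i \<in> A" for f g
    unfolding cost_def sum.distrib[symmetric] distrib_right[symmetric]
    using that N_add r1 by (intro sum_mono mult_right_mono) auto
  have cost_smult: "cost (\<lambda>i. c \<otimes> f i) \<le> N c * cost f" if "\<And>i. f i \<in> A" "c \<in> A" for f c
    unfolding cost_def sum_distrib_left mult.assoc[symmetric]
    using that N_mult r1 by (intro sum_mono mult_right_mono) auto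
  have power_rep: "\<exists>f. (\<forall>i. f i \<in> A) \<and> x [^] n = psum f x d \<and> cost f \<le> r ^ n" for n
  proof (induction n)
    case 0
    let ?f = "case_nat \<one> (\<lambda>_. \<zero>)"
    have "cost ?f = 1"
      unfolding cost_def m using N_one N_F[of \<zero>] a_eq_0[of \<zero>] F_props
      by (simp add: sum.lessThan_Suc_shift del: sum.lessThan_Suc)
    then show ?case
      using psum_unit[OF x(1) one_closed, of m] m
      by (intro exI[of _ ?f]) (auto split: nat.split)
  next
    case (Suc n)
    then obtain f where f: "\<And>i. f i \<in> A" "x [^] n = psum f x d" "cost f \<le> r ^ n"
      by auto
    have fc: "\<And>i. f i \<in> carrier R" "\<And>i. f0 i \<in> carrier R" using f f0 by auto
    \<comment> \<open>Multiplication by \<open>x\<close> shifts the coefficients; the last one,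
      \<open>f m\<close>, arrives at \<open>x ^ d\<close> and is distributed along
      \<open>f0\<close>.\<close>
    let ?s = "case_nat \<zero> f"
    let ?g = "\<lambda>i. ?s i \<oplus> f m \<otimes> f0 i"
    have sA: "\<And>i. ?s i \<in> A" using f by (auto split: nat.split)
    then have sc: "\<And>i. ?s i \<in> carrier R" by auto
    have "x [^] Suc n = x \<otimes> psum f x d"
      using f x by (simp add: m_comm)
    also have "\<dots> = psum ?s x (Suc d)"
      using psum_shift[OF x(1) fc(1)] by simp
    also have "\<dots> = psum ?s x d \<oplus> f m \<otimes> psum f0 x d"
      using f0(2) m by simp
    also have "\<dots> = psum ?g x d"
      using fc sc x by (simp add: psum_add psum_smult)
    finally have e: "x [^] Suc n = psum ?g x d" .
    have "cost ?s = r * (\<Sum>i<m. N (f i) * r ^ i)"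
      unfolding cost_def m using N_F[of \<zero>] a_eq_0[of \<zero>] F_props
      by (simp add: sum.lessThan_Suc_shift sum_distrib_left mult_ac del: sum.lessThan_Suc)
    then have "cost ?s + N (f m) * r ^ d = r * cost f"
      unfolding cost_def m by (simp add: distrib_left)
    moreover have "cost (\<lambda>i. f m \<otimes> f0 i) \<le> N (f m) * r ^ d"
      using cost_smult[OF f0(1) f(1)] mult_left_mono[OF f0_cost N_nonneg[OF f(1)]] by (rule order_trans)
    ultimately have "cost ?g \<le> r * cost f"
      using cost_add[of ?s "\<lambda>i. f m \<otimes> f0 i"] sA A_mult[OF f(1) f0(1)] by fastforce
    also have "\<dots> \<le> r * r ^ n"
      using f r1 by (intro mult_left_mono) auto
    finally show ?case
      using e sA f f0 by (intro exI[of _ ?g]) auto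
  qed
  have rep: "\<exists>f. (\<forall>i. f i \<in> A) \<and> y = psum f x d \<and> cost f \<le> c" if "(y, c) \<in> adj x r" for y c
    using that
  proof (induction rule: adj.induct)
    case (base b c i)
    have bA: "b \<in> A" using base unfolding A_def by auto
    obtain f where f: "\<And>i. f i \<in> A" "x [^] i = psum f x d" "cost f \<le> r ^ i"
      using power_rep[of i] by auto
    have "cost (\<lambda>j. b \<otimes> f j) \<le> N b * cost f"
      by (rule cost_smult[OF f(1) bA])
    also have "\<dots> \<le> c * r ^ i"
      using f N_le[OF base] N_nonneg[OF bA] r1 N_nonneg by (intro mult_mono) (auto simp: cost_def intro!: sum_nonneg)
    finally show ?case
      using f bA x psum_smult[where x=x and f=f and c=b and n=d] by (intro exI[of _ "\<lambda>j. b \<otimes> f j"]) auto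
  next
    case (add y c z e)
    then obtain f g where "\<And>i. f i \<in> A" "y = psum f x d" "cost f \<le> c"
      "\<And>i. g i \<in> A" "z = psum g x d" "cost g \<le> e" by blast
    then show ?case
      using cost_add[of f g] psum_add[where f=f and g=g and x=x and n=d] x
      by (intro exI[of _ "\<lambda>j. f j \<oplus> g j"]) force
  qed
  have "(x, r) \<in> G"
  proof (rule adj_maximal[OF x(1)])
    fix c assume "(\<one>, c) \<in> adj x r"
    then obtain f where f: "\<And>i. f i \<in> A" "\<one> = psum f x d" "cost f \<le> c"
      using rep by blast
    \<comment> \<open>This encodes -1. The difference of \<open>f\<close> and the representation of
      1 is a relation of length \<open>d\<close>, so all its coefficients vanish and
      \<open>f 0\<close> is 1.\<close>
    let ?u = "case_nat (\<ominus> \<one>) (\<lambda>_. \<zero>)"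
    have uA: "\<And>i. ?u i \<in> A" by (auto split: nat.split)
    then have uc: "\<And>i. ?u i \<in> carrier R" and fc: "\<And>i. f i \<in> carrier R"
      using f(1) A_carrier by blast+
    have "psum (\<lambda>i. f i \<oplus> ?u i) x d = \<one> \<oplus> \<ominus> \<one>"
      using psum_add[where x=x and f=f and g="?u" and n=d] x uc fc psum_unit[OF x(1), of "\<ominus> \<one>" m] f(2) m by simp
    then have "psum (\<lambda>i. f i \<oplus> ?u i) x d = \<zero>"
      by (simp add: r_neg)
    then have "f 0 \<oplus> ?u 0 = \<zero>"
      using indep[of d "\<lambda>i. f i \<oplus> ?u i" 0] f(1) uA d0 by auto
    then have "f 0 = \<one>"
      using fc[of 0] by (simp add: minus_equality minus_minus r_neg1 a_comm add.inv_solve_right')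
    then have "1 \<le> cost f"
      unfolding cost_def m using N_one N_nonneg f(1) r1
      by (simp add: sum.lessThan_Suc_shift sum_nonneg del: sum.lessThan_Suc)
    then show "1 \<le> c" using f by simp
  qed (use r1 in auto)
  then show False
    using x unfolding A_def by auto
qed

section \<open>Multiplicativity of the minimal seminorm\<close>

lemma N_pos: "x \<in> carrier R \<Longrightarrow> x \<noteq> \<zero> \<Longrightarrow> 0 < N x"
proof -
  assume x: "x \<in> carrier R" "x \<noteq> \<zero>"
  then have "1 \<le> N x * N (inv x)"
    using N_mult[of x "inv x"] N_one by (simp add: A_eq_carrier field_Units)
  then show ?thesis
    using N_nonneg[of x] x by (cases "N x = 0") (auto simp: A_eq_carrier)
qed

lemma N_power_le: "x \<in> carrier R \<Longrightarrow> N (x [^] (n::nat)) \<le> N x ^ n"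
proof (induction n)
  case (Suc n)
  have "N (x [^] Suc n) \<le> N (x [^] n) * N x"
    using N_mult[of "x [^] n" x] Suc by (simp add: A_eq_carrier)
  also have "\<dots> \<le> N x ^ n * N x"
    using Suc N_nonneg[of x] by (intro mult_right_mono) (auto simp: A_eq_carrier)
  finally show ?case by (simp add: mult.commute)
qed (simp add: N_one)

text \<open>If adjoining \<open>x\<close> at the price \<open>r\<close> gave 1 the cost
  \<open>c\<close>, then 1, as the \<open>n\<close>-th power of itself, would also cost
  \<open>c ^ n\<close>. The hypothesis bounds \<open>N\<close> by \<open>C\<close> times this cost,
  so \<open>1 \<le> C * c ^ n\<close> for all \<open>n\<close>, which excludes
  \<open>c < 1\<close>.\<close>

lemma N_spectral:
  assumes x: "x \<in> carrier R" and r: "r > 0" and C: "C > 0"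
    and bound: "\<And>i::nat. N (x [^] i) \<le> C * r ^ i"
  shows "N x \<le> r"
proof -
  have le: "y \<in> carrier R \<and> N y \<le> C * c" if "(y, c) \<in> adj x r" for y c
    using that
  proof (induction rule: adj.induct)
    case (base b c i)
    have b: "b \<in> carrier R" using G_carrier base by auto
    have "N (b \<otimes> x [^] i) \<le> N b * N (x [^] i)"
      using N_mult b x by (simp add: A_eq_carrier)
    also have "\<dots> \<le> c * (C * r ^ i)"
      using N_le[OF base] bound[of i] G_nonneg[OF base] N_nonneg x by (intro mult_mono) (auto simp: A_eq_carrier)
    finally show ?case using b x by (simp add: mult_ac)
  next
    case (add y c z d)
    then show ?case
      using N_add[of y z] by (auto simp: A_eq_carrier distrib_left)
  qed
  have "(x, r) \<in> G"
  proof (rule adj_maximal[OF x])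
    fix c assume c: "(\<one>, c) \<in> adj x r"
    have pow: "(\<one>, c ^ n) \<in> adj x r" for n
    proof (induction n)
      case 0
      show ?case
        using adj.base[OF G_F[of \<one>], of x 0 r] F_props a_one by simp
    next
      case (Suc n)
      then show ?case
        using adj_mult[OF x _ c Suc] r by simp
    qed
    have c0: "c \<ge> 0" using adj_carrier[OF c x] r by simp
    show "1 \<le> c"
    proof (rule ccontr)
      assume "\<not> 1 \<le> c"
      then obtain n where "c ^ n < 1 / C"
        using real_arch_pow_inv[of "1 / C" c] C c0 by auto
      moreover have "1 \<le> C * c ^ n"
        using le[OF pow[of n]] N_one by simp
      ultimately show False
        using C by (simp add: field_simps)
    qed
  qed (use r in auto)
  then show ?thesis by (rule N_le)
qed

text \<open>Powers of \<open>x\<close> pair up into powers of \<open>x \<otimes> x\<close>, so they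
  grow at most like powers of the square root of \<open>N (x \<otimes> x)\<close>. The constant
  \<open>C\<close> pays for the unpaired factor of an odd power, and \<open>N_spectral\<close>
  removes it.\<close>

lemma N_square: "x \<in> carrier R \<Longrightarrow> N (x \<otimes> x) = (N x)\<^sup>2"
proof (cases "x = \<zero>")
  case True
  then show ?thesis
    using N_F[of \<zero>] a_eq_0[of \<zero>] F_props by simp
next
  case False
  assume x: "x \<in> carrier R"
  define q where "q = N (x \<otimes> x)"
  define C where "C = max 1 (N x / sqrt q)"
  have "x \<otimes> x \<noteq> \<zero>" using x False integral by auto
  then have q: "q > 0" unfolding q_def using N_pos x by simp
  have "N x \<le> sqrt q"
  proof (rule N_spectral[OF x, of _ C])
    fix i :: nat
    obtain j where "i = 2 * j \<or> i = Suc (2 * j)" by (metis oddE evenE Suc_eq_plus1)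
    moreover have e: "N (x [^] (2 * j)) \<le> sqrt q ^ (2 * j)"
    proof -
      have "x [^] (2 * j) = (x \<otimes> x) [^] j"
        using x nat_pow_pow[of x 2 j] by (simp add: numeral_2_eq_2)
      then show ?thesis
        using N_power_le[of "x \<otimes> x" j] x q by (simp add: q_def power_mult)
    qed
    moreover have "N (x [^] Suc (2 * j)) \<le> C * sqrt q ^ Suc (2 * j)"
    proof -
      have "N (x [^] Suc (2 * j)) \<le> N (x [^] (2 * j)) * N x"
        using N_mult[of "x [^] (2 * j)" x] x by (simp add: A_eq_carrier)
      also have "\<dots> \<le> sqrt q ^ (2 * j) * N x"
        using e N_nonneg[of x] x by (intro mult_right_mono) (auto simp: A_eq_carrier)
      also have "\<dots> = (N x / sqrt q) * sqrt q ^ Suc (2 * j)"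
        using q by simp
      also have "\<dots> \<le> C * sqrt q ^ Suc (2 * j)"
        unfolding C_def using q by (intro mult_right_mono) auto
      finally show ?thesis .
    qed
    moreover have "sqrt q ^ (2 * j) \<le> C * sqrt q ^ (2 * j)"
      using mult_right_mono[of 1 C "sqrt q ^ (2 * j)"] q by (simp add: C_def)
    ultimately show "N (x [^] i) \<le> C * sqrt q ^ i" by fastforce
  qed (use q in \<open>auto simp: C_def\<close>)
  then have "(N x)\<^sup>2 \<le> (sqrt q)\<^sup>2"
    using N_nonneg[of x] x by (intro power_mono) (auto simp: A_eq_carrier)
  moreover have "q \<le> (N x)\<^sup>2"
    unfolding q_def power2_eq_square using N_mult[of x x] x by (simp add: A_eq_carrier)
  ultimately show ?thesis
    using q by (simp add: q_def)
qed

text \<open>Repeated squaring settles the exponents \<open>2 ^ k\<close>. For general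
  \<open>n\<close> the complement \<open>m\<close> with \<open>n + m = 2 ^ n\<close> is used: a loss
  at \<open>n\<close> would be inherited by \<open>2 ^ n\<close>.\<close>

lemma N_power: assumes x: "x \<in> carrier R" shows "N (x [^] (n::nat)) = N x ^ n"
proof (cases "x = \<zero>")
  case True
  then show ?thesis
    using N_F[of \<zero>] a_eq_0[of \<zero>] F_props N_one by (cases n) (auto simp: nat_pow_zero)
next
  case False
  have two: "N (x [^] (2 ^ k :: nat)) = N x ^ (2 ^ k)" for k
  proof (induction k)
    case (Suc k)
    have "x [^] (2 ^ Suc k :: nat) = x [^] (2 ^ k :: nat) \<otimes> x [^] (2 ^ k :: nat)"
      using x by (simp add: nat_pow_mult mult_2)
    then show ?case
      using N_square[of "x [^] (2 ^ k :: nat)"] Suc x by (simp add: power_mult[symmetric] mult.commute)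
  qed (use x in simp)
  have "n \<le> 2 ^ n" by simp
  then obtain m where m: "2 ^ n = n + m" using le_Suc_ex[of n "2 ^ n"] by blast
  have "N x ^ n * N x ^ m = N (x [^] n \<otimes> x [^] m)"
    using two[of n] x by (simp add: m nat_pow_mult power_add)
  also have "\<dots> \<le> N (x [^] n) * N (x [^] m)"
    using N_mult x by (simp add: A_eq_carrier)
  also have "\<dots> \<le> N (x [^] n) * N x ^ m"
    using N_power_le[OF x] N_nonneg x by (intro mult_left_mono) (auto simp: A_eq_carrier)
  finally have "N x ^ n \<le> N (x [^] n)"
    using N_pos[OF x False] by simp
  then show ?thesis
    using N_power_le[OF x, of n] by simp
qed

text \<open>Let \<rho> be \<open>N (inv x)\<close>; the claim is that \<open>x\<close> can be
  adjoined at the price 1/\<rho>. Multiplying by a high power of \<open>inv x\<close> clears the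
  powers of \<open>x\<close> from any element of \<open>adj\<close>, so that a cost \<open>c\<close>
  of 1 satisfies \<open>N (inv x [^] M) \<le> c * \<rho> ^ M\<close>. By \<open>N_power\<close> the
  left side is \<open>\<rho> ^ M\<close>, hence \<open>c\<close> is at least 1.\<close>

lemma N_inv: assumes x: "x \<in> carrier R" "x \<noteq> \<zero>" shows "N x * N (inv x) = 1"
proof -
  let ?y = "inv x"
  have y: "?y \<in> carrier R" "?y \<noteq> \<zero>" "x \<otimes> ?y = \<one>"
    using x field_Units by auto
  define \<rho> where "\<rho> = N ?y"
  have \<rho>: "\<rho> > 0" unfolding \<rho>_def using N_pos y by auto
  have le: "y \<in> carrier R \<and> (\<exists>m. \<forall>M\<ge>m. N (y \<otimes> ?y [^] (M::nat)) \<le> c * \<rho> ^ M)"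
    if "(y, c) \<in> adj x (1 / \<rho>)" for y c
    using that
  proof (induction rule: adj.induct)
    case (base b c i)
    have b: "b \<in> carrier R" using G_carrier base by auto
    have "N (b \<otimes> x [^] i \<otimes> ?y [^] M) \<le> (c * (1 / \<rho>) ^ i) * \<rho> ^ M" if Mi: "M \<ge> i" for M
    proof -
      obtain k where k: "M = i + k" using le_Suc_ex[OF Mi] by blast
      have "x [^] i \<otimes> ?y [^] i = \<one>"
        using x y nat_pow_distrib[of x ?y i] by (simp add: nat_pow_one)
      then have "b \<otimes> x [^] i \<otimes> ?y [^] M = b \<otimes> ?y [^] k"
        using b x y by (simp add: k nat_pow_mult[symmetric] m_assoc) (metis l_one m_assoc nat_pow_closed)
      also have "N \<dots> \<le> N b * \<rho> ^ k"
        using N_mult[of b "?y [^] k"] N_power[OF y(1)] b y by (simp add: A_eq_carrier \<rho>_def)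
      also have "\<dots> \<le> c * \<rho> ^ k"
        using N_le[OF base] \<rho> by (intro mult_right_mono) auto
      also have "\<dots> = (c * (1 / \<rho>) ^ i) * \<rho> ^ M"
        using \<rho> by (simp add: k power_add field_simps)
      finally show ?thesis .
    qed
    then show ?case using b x by blast
  next
    case (add u c z d)
    then obtain m n where mn: "\<And>M. M \<ge> m \<Longrightarrow> N (u \<otimes> ?y [^] M) \<le> c * \<rho> ^ M"
      "\<And>M. M \<ge> n \<Longrightarrow> N (z \<otimes> ?y [^] M) \<le> d * \<rho> ^ M" by blast
    have "N ((u \<oplus> z) \<otimes> ?y [^] M) \<le> (c + d) * \<rho> ^ M" if "M \<ge> max m n" for M
      using mn[of M] that add y N_add[of "u \<otimes> ?y [^] M" "z \<otimes> ?y [^] M"]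
      by (simp add: A_eq_carrier l_distr distrib_right)
    then show ?case using add by blast
  qed
  have "(x, 1 / \<rho>) \<in> G"
  proof (rule adj_maximal[OF x(1)])
    fix c assume "(\<one>, c) \<in> adj x (1 / \<rho>)"
    then obtain M where "N (\<one> \<otimes> ?y [^] (M::nat)) \<le> c * \<rho> ^ M"
      using le by blast
    then show "1 \<le> c"
      using N_power[OF y(1)] y \<rho> by (simp add: \<rho>_def[symmetric])
  qed (use \<rho> in auto)
  then have "N x \<le> 1 / \<rho>" by (rule N_le)
  moreover have "1 \<le> N x * \<rho>"
    unfolding \<rho>_def using N_mult[of x ?y] x y N_one by (simp add: A_eq_carrier)
  moreover have "1 / \<rho> * \<rho> = 1"
    using \<rho> by simp
  moreover have "N x * \<rho> \<le> 1 / \<rho> * \<rho>"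
    using \<open>N x \<le> 1 / \<rho>\<close> \<rho> by (intro mult_right_mono) auto
  ultimately show ?thesis
    unfolding \<rho>_def[symmetric] by linarith
qed

lemma absolute_value_N: "absolute_value R N"
  unfolding absolute_value_def
proof (intro conjI ballI)
  fix x assume x: "x \<in> carrier R"
  show "0 \<le> N x" using N_nonneg x by (simp add: A_eq_carrier)
  show "(N x = 0) = (x = \<zero>)"
    using N_pos[OF x] N_F[of \<zero>] a_eq_0[of \<zero>] F_props by force
  fix y assume y: "y \<in> carrier R"
  show "N (x \<oplus> y) \<le> N x + N y" using N_add x y by (simp add: A_eq_carrier)
  show "N (x \<otimes> y) = N x * N y"
  proof (cases "y = \<zero>")
    case True
    then show ?thesis
      using x N_F[of \<zero>] a_eq_0[of \<zero>] F_props by simp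
  next
    case False
    have i: "inv y \<in> carrier R" "y \<otimes> inv y = \<one>" using y False field_Units by auto
    have "N x = N ((x \<otimes> y) \<otimes> inv y)"
      using x y i by (simp add: m_assoc)
    also have "\<dots> \<le> N (x \<otimes> y) * N (inv y)"
      using N_mult x y i by (simp add: A_eq_carrier)
    finally have "N x * N y \<le> N (x \<otimes> y) * N (inv y) * N y"
      using N_pos[OF y False] by (intro mult_right_mono) auto
    also have "\<dots> = N (x \<otimes> y)"
      using N_inv[OF y False] by (simp add: mult.assoc mult.commute[of "N (inv y)"])
    finally show ?thesis
      using N_mult[of x y] x y by (simp add: A_eq_carrier)
  qed
qed

end

text \<open>Applied to the algebraic closure of a completion in \<open>Kv_closure_abs_exists\<close>
  and to a p-adic absolute value on a number field in \<open>padic_abs_on_field\<close>.\<close>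

theorem absolute_value_extends:
  fixes R (structure)
  assumes "field R" "subfield F R" "absolute_value (R\<lparr>carrier := F\<rparr>) a"
    and "\<And>x. x \<in> carrier R \<Longrightarrow> (ring.algebraic R over F) x"
  shows "\<exists>N. absolute_value R N \<and> (\<forall>x\<in>F. N x = a x)"
proof -
  interpret algebraic_valued_extension R F a
    using assms by (simp add: algebraic_valued_extension_def algebraic_valued_extension_axioms_def)
  show ?thesis
    using absolute_value_N N_F by blast
qed

section \<open>Subfields of the complex numbers\<close>

lemma field_CC: "field \<CC>"
  by (rule field_from_type_algebra)

lemma CC_simps [simp]:
  "carrier \<CC> = UNIV" "x \<otimes>\<^bsub>\<CC>\<^esub> y = x * y" "x \<oplus>\<^bsub>\<CC>\<^esub> y = x + y" "\<one>\<^bsub>\<CC>\<^esub> = 1" "\<zero>\<^bsub>\<CC>\<^esub> = 0"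
  by (simp_all add: ring_of_type_algebra_def)

lemma CC_a_inv [simp]: "\<ominus>\<^bsub>\<CC>\<^esub> x = - x"
proof -
  interpret field \<CC> by (rule field_CC)
  show ?thesis by (intro minus_equality) auto
qed

lemma CC_m_inv: "x \<noteq> 0 \<Longrightarrow> inv\<^bsub>\<CC>\<^esub> x = inverse x"
proof -
  assume "x \<noteq> 0"
  interpret field \<CC> by (rule field_CC)
  show ?thesis by (rule comm_inv_char) (use \<open>x \<noteq> 0\<close> in auto)
qed

lemma CC_pow [simp]: "x [^]\<^bsub>\<CC>\<^esub> (n::nat) = x ^ n"
  by (induction n) (auto simp: nat_pow_def)

lemma CC_subfieldI:
  assumes "1 \<in> k" "\<And>x y. x \<in> k \<Longrightarrow> y \<in> k \<Longrightarrow> x + y \<in> k" "\<And>x y. x \<in> k \<Longrightarrow> y \<in> k \<Longrightarrow> x * y \<in> k"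
    "\<And>x. x \<in> k \<Longrightarrow> - x \<in> k" "\<And>x. x \<in> k \<Longrightarrow> x \<noteq> 0 \<Longrightarrow> inverse x \<in> k"
  shows "subfield k \<CC>"
proof -
  interpret field \<CC> by (rule field_CC)
  show ?thesis
    using assms by (intro subfieldI' subringI) (auto simp: CC_m_inv)
qed

definition polys_over :: "complex set \<Rightarrow> complex poly set"
  where "polys_over k = {p. \<forall>i. Polynomial.coeff p i \<in> k}"

text \<open>\<open>Irr\<close> is a list with the leading coefficient first; the type
  \<open>poly\<close> gives access to complex roots, derivatives and divisibility.\<close>

definition minpoly :: "complex set \<Rightarrow> complex \<Rightarrow> complex poly"
  where "minpoly k \<theta> = Poly (rev (ring.Irr \<CC> k \<theta>))"

abbreviation alg :: "complex set \<Rightarrow> complex \<Rightarrow> bool"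
  where "alg k x \<equiv> (ring.algebraic \<CC> over k) x"

definition adjoin :: "complex set \<Rightarrow> complex \<Rightarrow> complex set"
  where "adjoin k \<theta> = {poly g \<theta> | g. g \<in> polys_over k}"

definition conjs :: "complex set \<Rightarrow> complex \<Rightarrow> complex set"
  where "conjs k \<theta> = {r. poly (minpoly k \<theta>) r = 0}"

text \<open>The embedding over \<open>k\<close> of \<open>adjoin k \<theta>\<close> that sends
  \<theta> to its conjugate \<open>r\<close>. By \<open>poly_conj_cong\<close> the choice of
  \<open>g\<close> does not affect the value.\<close>

definition emb :: "complex set \<Rightarrow> complex \<Rightarrow> complex \<Rightarrow> complex \<Rightarrow> complex"
  where "emb k \<theta> r z = poly (SOME g. g \<in> polys_over k \<and> poly g \<theta> = z) r"

lemma eval_CC: "ring.eval \<CC> p x = poly (Poly (rev p)) x"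
proof -
  interpret field \<CC> by (rule field_CC)
  show ?thesis
    by (induction p) (auto simp: Poly_append poly_monom)
qed

locale complex_subfield =
  fixes k :: "complex set"
  assumes subfield_k: "subfield k \<CC>"
begin

sublocale CC: field \<CC>
  by (rule field_CC)

lemmas k_subring = subringE[OF subfieldE(1)[OF subfield_k]]

lemma k_closed [simp, intro]:
  shows "0 \<in> k" "1 \<in> k" "x \<in> k \<Longrightarrow> y \<in> k \<Longrightarrow> x + y \<in> k" "x \<in> k \<Longrightarrow> y \<in> k \<Longrightarrow> x * y \<in> k"
    "x \<in> k \<Longrightarrow> - x \<in> k"
  using k_subring by auto

lemma k_inverse [simp, intro]: "x \<in> k \<Longrightarrow> inverse x \<in> k"
  using CC.subfield_m_inv(1)[OF subfield_k, of x] by (cases "x = 0") (auto simp: CC_m_inv)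

lemma k_diff [simp, intro]: "x \<in> k \<Longrightarrow> y \<in> k \<Longrightarrow> x - y \<in> k"
  using k_closed(3)[of x "- y"] by simp

lemma k_divide [simp, intro]: "x \<in> k \<Longrightarrow> y \<in> k \<Longrightarrow> x / y \<in> k"
  by (simp add: divide_inverse)

lemma k_power [simp, intro]: "x \<in> k \<Longrightarrow> x ^ n \<in> k"
  by (induction n) auto

lemma k_sum [intro]: "(\<And>i. i \<in> I \<Longrightarrow> f i \<in> k) \<Longrightarrow> sum f I \<in> k"
  by (induction I rule: infinite_finite_induct) auto

lemma k_of_nat [simp, intro]: "of_nat n \<in> k"
  by (induction n) auto

lemma k_of_int [simp, intro]: "of_int n \<in> k"
  by (cases n) auto

lemma k_of_rat [simp, intro]: "of_rat q \<in> k"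
  by (cases q) (auto simp: of_rat_rat)

lemma Rats_subset: "\<rat> \<subseteq> k"
  by (auto elim: Rats_cases)

section \<open>Polynomials with coefficients in a subfield\<close>

lemma over_coeff [simp]: "p \<in> polys_over k \<Longrightarrow> Polynomial.coeff p i \<in> k"
  unfolding polys_over_def by auto

lemma over_0 [simp]: "0 \<in> polys_over k"
  and over_add [simp]: "p \<in> polys_over k \<Longrightarrow> q \<in> polys_over k \<Longrightarrow> p + q \<in> polys_over k"
  and over_diff [simp]: "p \<in> polys_over k \<Longrightarrow> q \<in> polys_over k \<Longrightarrow> p - q \<in> polys_over k"
  and over_uminus [simp]: "p \<in> polys_over k \<Longrightarrow> - p \<in> polys_over k"
  and over_mult [simp]: "p \<in> polys_over k \<Longrightarrow> q \<in> polys_over k \<Longrightarrow> p * q \<in> polys_over k"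
  and over_smult [simp]: "c \<in> k \<Longrightarrow> p \<in> polys_over k \<Longrightarrow> Polynomial.smult c p \<in> polys_over k"
  and over_monom [simp]: "c \<in> k \<Longrightarrow> Polynomial.monom c n \<in> polys_over k"
  and over_pderiv [simp]: "p \<in> polys_over k \<Longrightarrow> pderiv p \<in> polys_over k"
  unfolding polys_over_def by (auto simp: coeff_mult coeff_pderiv intro!: k_sum)

lemma over_pCons [simp]: "pCons c p \<in> polys_over k \<longleftrightarrow> c \<in> k \<and> p \<in> polys_over k"
  unfolding polys_over_def by (auto simp: coeff_pCons split: nat.splits dest: spec[of _ "Suc _"])

lemma over_1 [simp]: "1 \<in> polys_over k"
  by (simp add: one_pCons)

lemma over_sum: "(\<And>i. i \<in> I \<Longrightarrow> f i \<in> polys_over k) \<Longrightarrow> sum f I \<in> polys_over k"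
  by (induction I rule: infinite_finite_induct) auto

lemma over_prod: "(\<And>i. i \<in> I \<Longrightarrow> f i \<in> polys_over k) \<Longrightarrow> prod f I \<in> polys_over k"
  by (induction I rule: infinite_finite_induct) auto

lemma over_pcompose: "p \<in> polys_over k \<Longrightarrow> q \<in> polys_over k \<Longrightarrow> pcompose p q \<in> polys_over k"
  by (induction p) (auto simp: pcompose_pCons)

lemma over_poly [simp]: "p \<in> polys_over k \<Longrightarrow> x \<in> k \<Longrightarrow> poly p x \<in> k"
  by (induction p) auto

text \<open>\<open>mod\<close> and \<open>div\<close> are taken among all complex polynomials. The
  induction follows long division to see that no step leaves \<open>k\<close>.\<close>

lemma over_mod_div:
  assumes f: "f \<in> polys_over k" "f \<noteq> 0"
  shows "p \<in> polys_over k \<Longrightarrow> p mod f \<in> polys_over k \<and> p div f \<in> polys_over k"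
proof (induction "Polynomial.degree p" arbitrary: p rule: less_induct)
  case less
  show ?case
  proof (cases "p = 0 \<or> Polynomial.degree p < Polynomial.degree f")
    case True
    then show ?thesis
      using less.prems by (auto simp: mod_poly_less div_poly_less)
  next
    case False
    let ?m = "Polynomial.monom (lead_coeff p / lead_coeff f) (Polynomial.degree p - Polynomial.degree f)"
    let ?q = "p - ?m * f"
    have m: "?m \<in> polys_over k" using less.prems f by auto
    have q: "?q \<in> polys_over k" using less.prems f m by auto
    have lt: "?q = 0 \<or> Polynomial.degree ?q < Polynomial.degree p"
    proof (cases "Polynomial.degree p = 0")
      case True
      then have "Polynomial.degree f = 0" using False by auto
      then have "?q = 0"
        using True f by (auto elim!: degree_eq_zeroE simp: monom_0)
      then show ?thesis by simp
    next
      case nz: False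
      have "Polynomial.degree (?m * f) \<le> Polynomial.degree p"
        using degree_mult_le[of ?m f] degree_monom_le[of "lead_coeff p / lead_coeff f" "Polynomial.degree p - Polynomial.degree f"] False
        by linarith
      then have "Polynomial.degree ?q \<le> Polynomial.degree p"
        by (intro degree_diff_le) auto
      moreover have "Polynomial.coeff ?q (Polynomial.degree p) = 0"
        using False f by (simp add: coeff_monom_mult)
      ultimately show ?thesis
        using eq_zero_or_degree_less by blast
    qed
    have "p mod f = (?q + ?m * f) mod f" "p div f = (?q + ?m * f) div f"
      by (simp_all only: diff_add_cancel)
    then have "p mod f = ?q mod f" "p div f = ?m + ?q div f"
      unfolding mod_mult_self1 div_mult_self1[OF f(2)] by simp_all
    then show ?thesis
    proof (cases "?q = 0")
      case True
      then show ?thesis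
        using \<open>p mod f = ?q mod f\<close> \<open>p div f = ?m + ?q div f\<close> m by simp
    next
      case False
      then show ?thesis
        using \<open>p mod f = ?q mod f\<close> \<open>p div f = ?m + ?q div f\<close> less.hyps[OF _ q] lt over_add[OF m]
        by simp
    qed
  qed
qed

lemma list_polynomial:
  assumes "g \<in> polys_over k"
  shows "rev (coeffs g) \<in> carrier (univ_poly \<CC> k)"
proof -
  have "polynomial\<^bsub>\<CC>\<^esub> k (rev (coeffs g))"
  proof (cases "g = 0")
    case False
    have "set (coeffs g) \<subseteq> k"
      using assms by (auto simp: coeffs_def)
    moreover have "hd (rev (coeffs g)) \<noteq> 0"
      using False by (simp add: hd_rev last_coeffs_eq_coeff_degree)
    ultimately show ?thesis
      unfolding polynomial_def by simp
  qed (simp add: polynomial_def)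
  then show ?thesis using univ_poly_carrier by blast
qed

lemma Poly_rev_over:
  assumes "p \<in> carrier (univ_poly \<CC> k)"
  shows "Poly (rev p) \<in> polys_over k" "p \<noteq> [] \<Longrightarrow> Poly (rev p) \<noteq> 0"
    "Polynomial.degree (Poly (rev p)) = length p - 1"
    "p \<noteq> [] \<Longrightarrow> lead_coeff (Poly (rev p)) = hd p"
proof -
  have "polynomial\<^bsub>\<CC>\<^esub> k p"
    using assms univ_poly_carrier by blast
  then have p: "p = [] \<or> (set p \<subseteq> k \<and> hd p \<noteq> 0)"
    unfolding polynomial_def by auto
  have c: "Polynomial.coeff (Poly (rev p)) i = (if i < length p then rev p ! i else 0)" for i
    by (simp add: coeff_Poly_eq nth_default_def)
  show "Poly (rev p) \<in> polys_over k"
    unfolding polys_over_def using p c nth_mem[of _ "rev p"] by auto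
  have l: "Polynomial.coeff (Poly (rev p)) (length p - 1) = hd p" if "p \<noteq> []"
    using that c[of "length p - 1"] by (simp add: rev_nth hd_conv_nth)
  then show "p \<noteq> [] \<Longrightarrow> Poly (rev p) \<noteq> 0"
    using p by (metis coeff_0)
  show d: "Polynomial.degree (Poly (rev p)) = length p - 1"
  proof (rule antisym)
    show "Polynomial.degree (Poly (rev p)) \<le> length p - 1"
      using c by (intro Polynomial.degree_le) auto
    show "length p - 1 \<le> Polynomial.degree (Poly (rev p))"
      using l p by (cases "p = []") (auto intro: le_degree)
  qed
  show "p \<noteq> [] \<Longrightarrow> lead_coeff (Poly (rev p)) = hd p"
    using l d by simp
qed

section \<open>Minimal polynomials and conjugates\<close>

lemma alg_iff: "alg k x \<longleftrightarrow> (\<exists>p\<in>polys_over k. p \<noteq> 0 \<and> poly p x = 0)"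
proof
  assume "alg k x"
  then obtain p where "p \<in> carrier (univ_poly \<CC> k)" "p \<noteq> []" "ring.eval \<CC> p x = \<zero>\<^bsub>\<CC>\<^esub>"
    using CC.algebraicE[OF subfieldE(1)[OF subfield_k], of x] by auto
  then show "\<exists>p\<in>polys_over k. p \<noteq> 0 \<and> poly p x = 0"
    using Poly_rev_over by (auto simp: eval_CC)
next
  assume "\<exists>p\<in>polys_over k. p \<noteq> 0 \<and> poly p x = 0"
  then obtain p where p: "p \<in> polys_over k" "p \<noteq> 0" "poly p x = 0" by auto
  then show "alg k x"
    by (intro CC.algebraicI[OF list_polynomial[OF p(1)]]) (auto simp: eval_CC)
qed

lemma alg_mono: "alg k x \<Longrightarrow> complex_subfield M \<Longrightarrow> k \<subseteq> M \<Longrightarrow> alg M x"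
  unfolding alg_iff complex_subfield.alg_iff polys_over_def by blast

lemma minpoly:
  assumes "alg k x"
  shows minpoly_over: "minpoly k x \<in> polys_over k"
    and minpoly_monic: "lead_coeff (minpoly k x) = 1"
    and minpoly_root: "poly (minpoly k x) x = 0"
    and minpoly_degree_Irr: "Polynomial.degree (minpoly k x) = length (CC.Irr k x) - 1"
    and minpoly_minimal: "g \<in> polys_over k \<Longrightarrow> g \<noteq> 0 \<Longrightarrow> poly g x = 0 \<Longrightarrow>
      Polynomial.degree (minpoly k x) \<le> Polynomial.degree g"
proof -
  note I = CC.IrrE[OF subfield_k _ assms, simplified]
  have ne: "CC.Irr k x \<noteq> []"
    using I(2) CC.pirreducibleE(1)[OF subfieldE(1)[OF subfield_k] I(1)] by auto
  show "minpoly k x \<in> polys_over k" "lead_coeff (minpoly k x) = 1" "poly (minpoly k x) x = 0"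
    "Polynomial.degree (minpoly k x) = length (CC.Irr k x) - 1"
    unfolding minpoly_def using Poly_rev_over[OF I(1)] I ne by (auto simp: eval_CC)
  assume g: "g \<in> polys_over k" "g \<noteq> 0" "poly g x = 0"
  have "length (CC.Irr k x) - 1 \<le> length (rev (coeffs g)) - 1"
    using CC.pdivides_imp_degree_le[OF subfieldE(1)[OF subfield_k] I(1) list_polynomial[OF g(1)] _
        CC.Irr_minimal[OF subfield_k _ assms list_polynomial[OF g(1)]]] g
    by (simp add: eval_CC)
  then show "Polynomial.degree (minpoly k x) \<le> Polynomial.degree g"
    unfolding minpoly_def Poly_rev_over(3)[OF I(1)] using g by (simp add: length_coeffs_degree)
qed

lemma minpoly_nonzero: "alg k x \<Longrightarrow> minpoly k x \<noteq> 0"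
  using minpoly_monic by fastforce

lemma minpoly_dvd:
  assumes "alg k x" "g \<in> polys_over k" "poly g x = 0"
  shows "minpoly k x dvd g"
proof -
  let ?f = "minpoly k x"
  have m: "g mod ?f \<in> polys_over k"
    using over_mod_div[OF minpoly_over minpoly_nonzero] assms by blast
  have "poly (g mod ?f) x = 0"
    using minpoly_root[OF assms(1)] assms(3)
    by (metis add.left_neutral mod_mult_div_eq mult_zero_left poly_add poly_mult add_0_right)
  then have "g mod ?f = 0"
    using minpoly_minimal[OF assms(1) m] degree_mod_less[OF minpoly_nonzero[OF assms(1)], of g] by fastforce
  then show ?thesis by auto
qed

text \<open>Write the minimal polynomial of \<open>x\<close> as \<open>?m * q\<close>. If
  \<open>x\<close> were a root of \<open>q\<close>, the degree of \<open>q\<close> would be too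
  small; so \<open>x\<close> is a root of \<open>?m\<close>, and minimality now makes
  \<open>q\<close> constant. Both polynomials are monic.\<close>

lemma minpoly_conj:
  assumes x: "alg k x" and r: "r \<in> conjs k x"
  shows "alg k r" "minpoly k r = minpoly k x"
proof -
  let ?f = "minpoly k x" and ?m = "minpoly k r"
  have fr: "poly ?f r = 0" using r by (simp add: conjs_def)
  show ar: "alg k r"
    unfolding alg_iff using minpoly_over[OF x] minpoly_nonzero[OF x] fr by blast
  obtain q where q: "?f = ?m * q"
    using minpoly_dvd[OF ar minpoly_over[OF x] fr] by (auto simp: dvd_def)
  have q_over: "q \<in> polys_over k"
    using over_mod_div[OF minpoly_over[OF ar] minpoly_nonzero[OF ar] minpoly_over[OF x]] q
      minpoly_nonzero[OF ar] by (metis nonzero_mult_div_cancel_left)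
  have nz: "q \<noteq> 0" "?m \<noteq> 0" using minpoly_nonzero[OF x] q by auto
  have deg: "Polynomial.degree ?f = Polynomial.degree ?m + Polynomial.degree q"
    unfolding q using nz by (simp add: degree_mult_eq)
  have dm: "Polynomial.degree ?m > 0"
  proof (rule ccontr)
    assume "\<not> Polynomial.degree ?m > 0"
    then obtain c where "?m = [:c:]" by (auto elim: degree_eq_zeroE)
    then show False using minpoly_root[OF ar] minpoly_nonzero[OF ar] by simp
  qed
  have "poly ?m x = 0 \<or> poly q x = 0"
    using minpoly_root[OF x] unfolding q by simp
  then have "poly ?m x = 0"
    using minpoly_minimal[OF x q_over nz(1)] deg dm by auto
  then have "Polynomial.degree q = 0"
    using minpoly_minimal[OF x minpoly_over[OF ar] nz(2)] deg by auto
  then obtain c where "q = [:c:]" by (auto elim: degree_eq_zeroE)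
  then have "?f = Polynomial.smult c ?m" using q by simp
  then show "?m = ?f"
    using minpoly_monic[OF x] minpoly_monic[OF ar] by (metis lead_coeff_smult mult.right_neutral smult_1_left)
qed

text \<open>A multiple root is a conjugate, so it has the same minimal polynomial; but it is also a
  root of the derivative, which in characteristic 0 is nonzero and of smaller degree.\<close>

lemma minpoly_rsquarefree:
  assumes x: "alg k x" shows "rsquarefree (minpoly k x)"
  unfolding rsquarefree_roots
proof (intro allI notI, elim conjE)
  fix r assume r: "poly (minpoly k x) r = 0" "poly (pderiv (minpoly k x)) r = 0"
  then have rc: "r \<in> conjs k x" by (simp add: conjs_def)
  let ?f = "minpoly k x"
  have d: "Polynomial.degree ?f > 0"
  proof (rule ccontr)
    assume "\<not> Polynomial.degree ?f > 0"
    then obtain c where "?f = [:c:]" by (auto elim: degree_eq_zeroE)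
    then show False using minpoly_root[OF x] minpoly_nonzero[OF x] by simp
  qed
  then have "pderiv ?f \<noteq> 0" by (simp add: pderiv_eq_0_iff)
  then have "Polynomial.degree ?f \<le> Polynomial.degree (pderiv ?f)"
    using minpoly_minimal[OF minpoly_conj(1)[OF x rc], of "pderiv ?f"] r minpoly_over[OF x] minpoly_conj(2)[OF x rc]
    by simp
  then show False using d by (simp add: degree_pderiv)
qed

lemma minpoly_prod:
  assumes x: "alg k x" shows "minpoly k x = (\<Prod>r\<in>conjs k x. [:-r, 1:])"
  using complex_poly_decompose_rsquarefree[OF minpoly_rsquarefree[OF x]] minpoly_monic[OF x]
  by (simp add: conjs_def)

lemma finite_conjs: "alg k x \<Longrightarrow> finite (conjs k x)"
  unfolding conjs_def using poly_roots_finite[OF minpoly_nonzero] .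

lemma card_conjs: "alg k x \<Longrightarrow> card (conjs k x) = Polynomial.degree (minpoly k x)"
  unfolding minpoly_prod by (subst degree_prod_eq_sum_degree) auto

lemma conjs_self: "alg k x \<Longrightarrow> x \<in> conjs k x"
  using minpoly_root by (simp add: conjs_def)

lemma conjs_nonempty: "alg k x \<Longrightarrow> card (conjs k x) > 0"
  using conjs_self finite_conjs card_gt_0_iff by blast

section \<open>Simple extensions and primitive elements\<close>

lemma adjoin_eq_simple_extension: "adjoin k x = CC.simple_extension k x"
proof (intro equalityI subsetI)
  fix z assume "z \<in> CC.simple_extension k x"
  then show "z \<in> adjoin k x"
  proof induction
    case zero
    show ?case unfolding adjoin_def by (auto intro!: exI[of _ 0])
  next
    case (lin k1 k2)
    then obtain g where "g \<in> polys_over k" "k1 = poly g x" by (auto simp: adjoin_def)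
    then show ?case
      using lin unfolding adjoin_def by (auto intro!: exI[of _ "pCons k2 g"])
  qed
next
  fix z assume "z \<in> adjoin k x"
  then obtain g where "g \<in> polys_over k" "z = poly g x" by (auto simp: adjoin_def)
  moreover have "g \<in> polys_over k \<Longrightarrow> poly g x \<in> CC.simple_extension k x" for g
  proof (induction g)
    case 0
    then show ?case using CC.simple_extension.zero[of k x] by simp
  next
    case (pCons a g)
    then show ?case using CC.simple_extension.lin[of "poly g x" k x a] by (simp add: mult.commute add.commute)
  qed
  ultimately show "z \<in> CC.simple_extension k x" by simp
qed

lemma adjoin_subfield: "alg k x \<Longrightarrow> complex_subfield (adjoin k x)"
  unfolding adjoin_eq_simple_extension complex_subfield_def
  using CC.simple_extension_is_subfield[OF subfield_k] by simp

lemma adjoin_dimension: "alg k x \<Longrightarrow> CC.dimension (Polynomial.degree (minpoly k x)) k (adjoin k x)"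
  unfolding adjoin_eq_simple_extension minpoly_degree_Irr
  using CC.dimension_simple_extension[OF subfield_k] by simp

lemma k_subset_adjoin: "k \<subseteq> adjoin k x"
  unfolding adjoin_def by (auto intro!: exI[of _ "[:_:]"])

lemma adjoin_self: "x \<in> adjoin k x"
  unfolding adjoin_def by (auto intro!: exI[of _ "[:0, 1:]"])

lemma adjoin_poly: "g \<in> polys_over k \<Longrightarrow> poly g x \<in> adjoin k x"
  unfolding adjoin_def by auto

lemma adjoin_least:
  assumes "complex_subfield M" "k \<subseteq> M" "x \<in> M"
  shows "adjoin k x \<subseteq> M"
proof -
  interpret M: complex_subfield M by fact
  have "poly g x \<in> M" if "g \<in> polys_over k" for g
    using that assms(2,3) by (intro M.over_poly) (unfold polys_over_def, blast+)
  then show ?thesis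
    unfolding adjoin_def by blast
qed

text \<open>Let \<open>t = a + c * b\<close>. The minimal polynomial of \<open>b\<close> over
  \<open>adjoin k t\<close> divides both that of \<open>b\<close> over \<open>k\<close> and that of
  \<open>a\<close> composed with \<open>t - c X\<close>. If \<open>b\<close> is the only common root
  of these, it is linear, because its roots are simple; then \<open>b\<close> and with it
  \<open>a\<close> lie in \<open>adjoin k t\<close>.\<close>

lemma primitive_element_two:
  assumes a: "alg k a" and b: "alg k b"
  shows "\<exists>c\<in>k. alg k (a + c * b) \<and> a \<in> adjoin k (a + c * b) \<and> b \<in> adjoin k (a + c * b)"
proof -
  \<comment> \<open>Another common root \<open>y\<close> would make \<open>x = t - c * y\<close> a
    conjugate of \<open>a\<close> and force \<open>c = (x - a) / (b - y)\<close>. A natural number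
    outside these finitely many quotients is chosen.\<close>
  let ?bad = "(\<lambda>(x, y). (x - a) / (b - y)) ` (conjs k a \<times> conjs k b)"
  have "finite ?bad" using finite_conjs a b by auto
  moreover have "infinite (range (of_nat :: nat \<Rightarrow> complex))"
    using finite_imageD[of of_nat "UNIV :: nat set"] by (auto simp: inj_on_def)
  ultimately have "\<not> range (of_nat :: nat \<Rightarrow> complex) \<subseteq> ?bad"
    using finite_subset by blast
  then obtain c :: complex where c: "c \<in> range of_nat" "c \<notin> ?bad"
    by blast
  then have ck: "c \<in> k" by auto
  let ?t = "a + c * b"
  have "subfield {x \<in> carrier \<CC>. alg k x} \<CC>"
    by (rule CC.subfield_of_algebraics[OF subfield_k])
  then interpret Al: complex_subfield "{x. alg k x}"
    by (simp add: complex_subfield_def)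
  have calg: "alg k c"
    unfolding alg_iff using ck by (intro bexI[of _ "[:-c, 1:]"]) auto
  then have t: "alg k ?t"
    using Al.k_closed(3)[of a "c * b"] Al.k_closed(4)[of c b] a b by auto
  interpret M: complex_subfield "adjoin k ?t" by (rule adjoin_subfield[OF t])
  have kM: "p \<in> polys_over (adjoin k ?t)" if "p \<in> polys_over k" for p
    using that k_subset_adjoin[of ?t] unfolding polys_over_def by blast
  have tM: "?t \<in> adjoin k ?t" and cM: "c \<in> adjoin k ?t"
    using adjoin_self k_subset_adjoin ck by auto
  have bM: "alg (adjoin k ?t) b"
    by (rule alg_mono[OF b M.complex_subfield_axioms k_subset_adjoin])
  let ?m = "minpoly (adjoin k ?t) b"
  have d1: "?m dvd minpoly k b"
    by (rule M.minpoly_dvd[OF bM kM[OF minpoly_over[OF b]] minpoly_root[OF b]])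
  have d2: "?m dvd pcompose (minpoly k a) [:?t, -c:]"
  proof (rule M.minpoly_dvd[OF bM])
    show "pcompose (minpoly k a) [:?t, -c:] \<in> polys_over (adjoin k ?t)"
      using kM[OF minpoly_over[OF a]] tM cM by (intro M.over_pcompose) auto
    show "poly (pcompose (minpoly k a) [:?t, -c:]) b = 0"
      using minpoly_root[OF a] by (simp add: poly_pcompose)
  qed
  have "r = b" if "r \<in> conjs (adjoin k ?t) b" for r
  proof (rule ccontr)
    assume "r \<noteq> b"
    have "poly (minpoly k b) r = 0" "poly (pcompose (minpoly k a) [:?t, -c:]) r = 0"
      using that d1 d2 by (auto simp: conjs_def dvd_def)
    then have "r \<in> conjs k b" "?t - c * r \<in> conjs k a"
      by (auto simp: conjs_def poly_pcompose algebra_simps)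
    then have "((?t - c * r) - a) / (b - r) \<in> ?bad" by force
    moreover have "((?t - c * r) - a) / (b - r) = c"
      using \<open>r \<noteq> b\<close> by (simp add: field_simps)
    ultimately show False using c by simp
  qed
  then have "conjs (adjoin k ?t) b = {b}"
    using M.conjs_self[OF bM] by auto
  then have "?m = [:-b, 1:]"
    using M.minpoly_prod[OF bM] by simp
  then have "- b \<in> adjoin k ?t"
    using M.minpoly_over[OF bM] by simp
  then have bb: "b \<in> adjoin k ?t"
    using M.k_closed(5)[of "-b"] by simp
  moreover have "a \<in> adjoin k ?t"
    using M.k_diff[OF tM M.k_closed(4)[OF cM bb]] by simp
  ultimately show ?thesis using ck t by blast
qed

text \<open>The clause on \<open>M\<close> says that \<theta> lies in the field generated by
  \<open>S\<close>. In \<open>primitive_element\<close> it keeps \<theta> inside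
  \<open>K\<close>.\<close>

lemma primitive_element_finite:
  assumes "finite S" "\<And>x. x \<in> S \<Longrightarrow> alg k x"
  shows "\<exists>\<theta>. alg k \<theta> \<and> S \<subseteq> adjoin k \<theta> \<and> (\<forall>M. complex_subfield M \<longrightarrow> k \<subseteq> M \<longrightarrow> S \<subseteq> M \<longrightarrow> \<theta> \<in> M)"
  using assms
proof (induction S)
  case empty
  have "alg k 0"
    unfolding alg_iff by (intro bexI[of _ "[:0, 1:]"]) auto
  then show ?case
    by (intro exI[of _ 0]) (auto intro: complex_subfield.k_closed)
next
  case (insert b S)
  then obtain \<theta> where \<theta>: "alg k \<theta>" "S \<subseteq> adjoin k \<theta>"
    "\<And>M. complex_subfield M \<Longrightarrow> k \<subseteq> M \<Longrightarrow> S \<subseteq> M \<Longrightarrow> \<theta> \<in> M" by auto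
  obtain c where c: "c \<in> k" "alg k (\<theta> + c * b)" "\<theta> \<in> adjoin k (\<theta> + c * b)" "b \<in> adjoin k (\<theta> + c * b)"
    using primitive_element_two[OF \<theta>(1), of b] insert by auto
  have "adjoin k \<theta> \<subseteq> adjoin k (\<theta> + c * b)"
    by (rule adjoin_least[OF adjoin_subfield[OF c(2)] k_subset_adjoin c(3)])
  moreover have "\<theta> + c * b \<in> M" if "complex_subfield M" "k \<subseteq> M" "insert b S \<subseteq> M" for M
  proof -
    interpret M: complex_subfield M by fact
    show ?thesis using that c \<theta>(3)[of M] by auto
  qed
  ultimately show ?case
    using c \<theta>(2) by (intro exI[of _ "\<theta> + c * b"]) auto
qed

lemma finite_extension_algebraic:
  assumes "subfield K \<CC>" "CC.finite_dimension k K" "x \<in> K"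
  shows "alg k x"
  using CC.finite_dimension_imp_algebraic[OF subfield_k subfieldE(1)[OF assms(1)] assms(2,3)] .

theorem primitive_element:
  assumes K: "subfield K \<CC>" "k \<subseteq> K" "CC.finite_dimension k K"
  shows "\<exists>\<theta>. alg k \<theta> \<and> K = adjoin k \<theta>"
proof -
  interpret K: complex_subfield K by (simp add: complex_subfield_def K)
  obtain n where "CC.dimension n k K"
    using K(3) by auto
  then obtain Us where Us: "set Us \<subseteq> carrier \<CC>" "CC.Span k Us = K"
    using CC.exists_base[OF subfield_k] by blast
  have UsK: "set Us \<subseteq> K"
    using CC.mono_Span[OF subfield_k] CC.Span_base_incl[OF subfield_k Us(1)] Us by auto
  then have "\<And>x. x \<in> set Us \<Longrightarrow> alg k x"
    using finite_extension_algebraic K by blast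
  then obtain \<theta> where \<theta>: "alg k \<theta>" "set Us \<subseteq> adjoin k \<theta>" "\<theta> \<in> K"
    using primitive_element_finite[of "set Us"] K UsK K.complex_subfield_axioms by blast
  interpret M: complex_subfield "adjoin k \<theta>" by (rule adjoin_subfield[OF \<theta>(1)])
  have "CC.combine Ks Us' \<in> adjoin k \<theta>" if "set Ks \<subseteq> k" "set Us' \<subseteq> adjoin k \<theta>" for Ks Us'
    using that k_subset_adjoin[of \<theta>] by (induction Ks Us' rule: CC.combine.induct) auto
  then have "{CC.combine Ks Us | Ks. set Ks \<subseteq> k} \<subseteq> adjoin k \<theta>"
    using \<theta>(2) by blast
  then have "K \<subseteq> adjoin k \<theta>"
    using CC.Span_eq_combine_set[OF subfield_k Us(1)] Us(2) by metis
  moreover have "adjoin k \<theta> \<subseteq> K"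
    by (rule adjoin_least[OF K.complex_subfield_axioms K(2) \<theta>(3)])
  ultimately show ?thesis using \<theta> by auto
qed

section \<open>Embeddings of a simple extension\<close>

lemma poly_conj_cong:
  assumes x: "alg k x" and r: "r \<in> conjs k x" and gh: "g \<in> polys_over k" "h \<in> polys_over k" "poly g x = poly h x"
  shows "poly g r = poly h r"
proof -
  have "minpoly k x dvd g - h"
    using gh by (intro minpoly_dvd[OF x]) auto
  then obtain q where "g - h = minpoly k x * q" by (rule dvdE)
  then have "poly (g - h) r = 0"
    using r by (simp only: poly_mult conjs_def mem_Collect_eq mult_zero_left)
  then show ?thesis by simp
qed

lemma emb_poly:
  assumes "alg k x" "r \<in> conjs k x" "g \<in> polys_over k"
  shows "emb k x r (poly g x) = poly g r"
proof -
  have "\<exists>h. h \<in> polys_over k \<and> poly h x = poly g x" using assms by auto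
  from someI_ex[OF this] show ?thesis
    unfolding emb_def using poly_conj_cong[OF assms(1,2)] assms(3) by blast
qed

lemma
  assumes "alg k x" "r \<in> conjs k x"
  shows emb_add: "y \<in> adjoin k x \<Longrightarrow> z \<in> adjoin k x \<Longrightarrow> emb k x r (y + z) = emb k x r y + emb k x r z"
    and emb_mult: "y \<in> adjoin k x \<Longrightarrow> z \<in> adjoin k x \<Longrightarrow> emb k x r (y * z) = emb k x r y * emb k x r z"
    and emb_base: "c \<in> k \<Longrightarrow> emb k x r c = c"
    and emb_self: "emb k x r x = r"
proof -
  show "emb k x r (y + z) = emb k x r y + emb k x r z" "emb k x r (y * z) = emb k x r y * emb k x r z"
    if yz: "y \<in> adjoin k x" "z \<in> adjoin k x" for y z
  proof -
    obtain g h where gh: "g \<in> polys_over k" "h \<in> polys_over k" "y = poly g x" "z = poly h x"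
      using yz by (auto simp: adjoin_def)
    then show "emb k x r (y + z) = emb k x r y + emb k x r z"
      using emb_poly[OF assms, of "g + h"] by (simp add: emb_poly[OF assms])
    show "emb k x r (y * z) = emb k x r y * emb k x r z"
      using emb_poly[OF assms, of "g * h"] gh by (simp add: emb_poly[OF assms])
  qed
  show "emb k x r c = c" if "c \<in> k"
    using emb_poly[OF assms, of "[:c:]"] that by simp
  show "emb k x r x = r"
    using emb_poly[OF assms, of "[:0, 1:]"] by simp
qed

lemma emb_eq_0_iff:
  assumes "alg k x" "r \<in> conjs k x" "z \<in> adjoin k x"
  shows "emb k x r z = 0 \<longleftrightarrow> z = 0"
proof
  interpret M: complex_subfield "adjoin k x" by (rule adjoin_subfield[OF assms(1)])
  assume z: "emb k x r z = 0"
  show "z = 0"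
  proof (rule ccontr)
    assume "z \<noteq> 0"
    then have "emb k x r 1 = emb k x r z * emb k x r (inverse z)"
      using emb_mult[OF assms(1,2,3), of "inverse z"] assms(3) by simp
    then show False
      using z emb_base[OF assms(1,2), of 1] by simp
  qed
qed (use emb_base[OF assms(1,2), of 0] in auto)

lemma emb_id: "alg k x \<Longrightarrow> z \<in> adjoin k x \<Longrightarrow> emb k x x z = z"
  using emb_poly[of x x] conjs_self by (auto simp: adjoin_def)

lemma emb_in_adjoin: "alg k x \<Longrightarrow> r \<in> conjs k x \<Longrightarrow> z \<in> adjoin k x \<Longrightarrow> emb k x r z \<in> adjoin k r"
  using emb_poly by (auto simp: adjoin_def)

end

section \<open>Characteristic polynomials\<close>

lemma poly_eq_sum:
  fixes p :: "'a :: comm_semiring_1 poly"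
  assumes "Polynomial.degree p \<le> n"
  shows "poly p x = (\<Sum>i\<le>n. Polynomial.coeff p i * x ^ i)"
  unfolding poly_altdef
  by (rule sum.mono_neutral_left) (use assms in \<open>auto simp: coeff_eq_0\<close>)

context complex_subfield
begin

lemma det_over:
  assumes A: "A \<in> carrier_mat n n" and e: "\<And>i j. i < n \<Longrightarrow> j < n \<Longrightarrow> A $$ (i, j) \<in> polys_over k"
  shows "det A \<in> polys_over k"
proof -
  have "signof p * (\<Prod>i = 0..<n. A $$ (i, p i)) \<in> polys_over k" if p: "p permutes {0..<n}" for p
  proof -
    have "(\<Prod>i = 0..<n. A $$ (i, p i)) \<in> polys_over k"
      using p e permutes_in_image[OF p] by (intro over_prod) auto
    then show ?thesis by (simp add: sign_def)
  qed
  then show ?thesis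
    using A by (auto simp: det_def intro!: over_sum)
qed

lemma char_poly_over:
  assumes A: "A \<in> carrier_mat n n" and e: "\<And>i j. i < n \<Longrightarrow> j < n \<Longrightarrow> A $$ (i, j) \<in> k"
  shows "char_poly A \<in> polys_over k"
  unfolding char_poly_def
  using A e by (intro det_over[of _ n]) (auto simp: char_poly_matrix_def)

text \<open>The product is the characteristic polynomial of multiplication by \<open>z\<close> on
  \<open>adjoin k x\<close>. In the basis of powers of \<open>x\<close> its matrix \<open>B\<close>
  has entries in \<open>k\<close>; the Vandermonde matrix \<open>W\<close> of the conjugates
  transforms it into the diagonal matrix \<open>D\<close> of the conjugates of
  \<open>z\<close>.\<close>

lemma prod_emb_over:
  assumes x: "alg k x" and z: "z \<in> adjoin k x"
  shows "(\<Prod>r\<in>conjs k x. [:- emb k x r z, 1:]) \<in> polys_over k"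
proof -
  let ?f = "minpoly k x"
  define n where "n = Polynomial.degree ?f"
  obtain g where g: "g \<in> polys_over k" "z = poly g x"
    using z by (auto simp: adjoin_def)
  obtain rs where rs: "set rs = conjs k x" "distinct rs"
    using finite_distinct_list[OF finite_conjs[OF x]] by auto
  have len: "length rs = n"
    using rs distinct_card card_conjs[OF x] by (metis n_def)
  have n0: "n > 0" using card_conjs[OF x] conjs_nonempty[OF x] n_def by simp
  let ?h = "\<lambda>j. (Polynomial.monom 1 j * g) mod ?f"
  define B where "B = mat n n (\<lambda>(i, j). Polynomial.coeff (?h j) i)"
  define D where "D = mat n n (\<lambda>(i, j). if i = j then poly g (rs ! i) else 0)"
  define W where "W = mat n n (\<lambda>(l, i). (rs ! l) ^ i)"
  have carr: "B \<in> carrier_mat n n" "D \<in> carrier_mat n n" "W \<in> carrier_mat n n"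
    by (auto simp: B_def D_def W_def)
  have h_over: "?h j \<in> polys_over k" for j
    using over_mod_div[OF minpoly_over[OF x] minpoly_nonzero[OF x]] g by simp
  have h_deg: "Polynomial.degree (?h j) < n" for j
    using degree_mod_less'[OF minpoly_nonzero[OF x], of "Polynomial.monom 1 j * g"] n0 n_def
    by (cases "?h j = 0") auto
  have h_val: "poly (?h j) r = r ^ j * poly g r" if "r \<in> conjs k x" for r j
  proof -
    let ?p = "Polynomial.monom 1 j * g"
    have "poly ?p r = poly (?p div ?f * ?f + ?p mod ?f) r"
      by (simp only: div_mult_mod_eq)
    also have "\<dots> = poly (?h j) r"
      using that by (simp only: poly_add poly_mult conjs_def mem_Collect_eq mult_zero_right add_0_left)
    finally show ?thesis by (simp add: poly_monom)
  qed
  have WB: "W * B = D * W"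
  proof (rule eq_matI)
    fix l j assume lj: "l < dim_row (D * W)" "j < dim_col (D * W)"
    then have l: "l < n" and j: "j < n" using carr by auto
    have r: "rs ! l \<in> conjs k x" using rs l len nth_mem by metis
    have "(W * B) $$ (l, j) = (\<Sum>i<n. (rs ! l) ^ i * Polynomial.coeff (?h j) i)"
      using l j by (simp add: W_def B_def scalar_prod_def lessThan_atLeast0)
    also have "\<dots> = poly (?h j) (rs ! l)"
    proof -
      have "poly (?h j) (rs ! l) = (\<Sum>i\<le>n - 1. Polynomial.coeff (?h j) i * (rs ! l) ^ i)"
        using h_deg[of j] by (intro poly_eq_sum) auto
      also have "{..n - 1} = {..<n}" using n0 by auto
      finally show ?thesis by (simp add: mult.commute)
    qed
    also have "\<dots> = poly g (rs ! l) * (rs ! l) ^ j"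
      using h_val[OF r] by simp
    also have "\<dots> = (\<Sum>i<n. (if l = i then poly g (rs ! l) else 0) * (rs ! i) ^ j)"
      using l by (simp add: if_distrib[of "\<lambda>x. x * _"] cong: if_cong)
    also have "\<dots> = (D * W) $$ (l, j)"
      using l j by (simp add: W_def D_def scalar_prod_def lessThan_atLeast0)
    finally show "(W * B) $$ (l, j) = (D * W) $$ (l, j)" .
  qed (use carr in auto)
  \<comment> \<open>A kernel vector of \<open>W\<close> would be a nonzero polynomial of degree
    below \<open>n\<close> that vanishes at all \<open>n\<close> conjugates.\<close>
  have "det W \<noteq> 0"
  proof
    assume "det W = 0"
    then obtain v where v: "v \<in> carrier_vec n" "v \<noteq> 0\<^sub>v n" "W *\<^sub>v v = 0\<^sub>v n"
      using det_0_iff_vec_prod_zero_field[OF carr(3)] by auto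
    define p where "p = Poly (map (\<lambda>i. v $ i) [0..<n])"
    have cp: "Polynomial.coeff p i = (if i < n then v $ i else 0)" for i
      unfolding p_def by (simp add: coeff_Poly_eq nth_default_def)
    have dp: "Polynomial.degree p \<le> n - 1"
      using cp by (intro Polynomial.degree_le) auto
    have "poly p r = 0" if r: "r \<in> conjs k x" for r
    proof -
      obtain l where l: "l < n" "rs ! l = r" using r rs len by (metis in_set_conv_nth)
      have "poly p r = (\<Sum>i\<le>n - 1. Polynomial.coeff p i * r ^ i)"
        using dp by (rule poly_eq_sum)
      also have "{..n - 1} = {..<n}" using n0 by auto
      also have "(\<Sum>i<n. Polynomial.coeff p i * r ^ i) = (W *\<^sub>v v) $ l"
        using l v(1) by (simp add: W_def scalar_prod_def lessThan_atLeast0 cp mult.commute)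
      finally show ?thesis using v(3) l by simp
    qed
    then have "conjs k x \<subseteq> {r. poly p r = 0}" by auto
    moreover have "p \<noteq> 0"
    proof
      assume "p = 0"
      then have "v $ i = 0" if "i < n" for i using cp[of i] that by simp
      then show False using v by auto
    qed
    ultimately have "card (conjs k x) \<le> Polynomial.degree p"
      using card_mono[OF poly_roots_finite[of p]] poly_roots_degree[of p] by (meson order_trans)
    then have "n \<le> Polynomial.degree p"
      using card_conjs[OF x] n_def by simp
    then show False using dp n0 by simp
  qed
  then have "W \<in> Units (ring_mat TYPE(complex) n ())"
    by (rule det_non_zero_imp_unit[OF carr(3)])
  then obtain Q where Q: "Q \<in> carrier_mat n n" "Q * W = 1\<^sub>m n" "W * Q = 1\<^sub>m n"
    by (auto simp: Units_def ring_mat_def)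
  have "B = Q * W * B" using Q carr by simp
  also have "\<dots> = Q * (D * W)"
    unfolding WB[symmetric] by (rule assoc_mult_mat[OF Q(1) carr(3,1)])
  also have "\<dots> = Q * D * W"
    by (rule assoc_mult_mat[OF Q(1) carr(2,3), symmetric])
  finally have "similar_mat B D"
    using Q carr by (intro similar_matI[of _ _ Q W n]) auto
  then have "char_poly B = char_poly D" by (rule char_poly_similar)
  also have "\<dots> = (\<Prod>a\<leftarrow>diag_mat D. [:- a, 1:])"
    using carr by (intro char_poly_upper_triangular[of D n]) (auto simp: D_def)
  also have "diag_mat D = map (poly g) rs"
    by (rule nth_equalityI) (auto simp: diag_mat_def D_def len)
  also have "(\<Prod>a\<leftarrow>map (poly g) rs. [:- a, 1:]) = (\<Prod>r\<in>set rs. [:- poly g r, 1:])"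
    using prod.distinct_set_conv_list[OF rs(2), of "\<lambda>r. [:- poly g r, 1:]"] by (simp add: o_def)
  also have "\<dots> = (\<Prod>r\<in>conjs k x. [:- emb k x r z, 1:])"
    using rs emb_poly[OF x _ g(1)] g(2) by (intro prod.cong) auto
  finally show ?thesis
    using char_poly_over[OF carr(1)] h_over by (auto simp: B_def)
qed

lemma prod_emb_root:
  assumes x: "alg k x" and z: "z \<in> adjoin k x"
  shows "poly (\<Prod>r\<in>conjs k x. [:- emb k x r z, 1:]) z = 0"
  using finite_conjs[OF x] conjs_self[OF x] emb_id[OF x z]
  by (auto simp: poly_prod prod_zero_iff intro!: bexI[of _ x])

lemma prod_emb_in:
  assumes x: "alg k x" and z: "z \<in> adjoin k x"
  shows "(\<Prod>r\<in>conjs k x. emb k x r z) \<in> k"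
proof -
  have "poly (\<Prod>r\<in>conjs k x. [:- emb k x r z, 1:]) 0 \<in> k"
    by (rule over_poly[OF prod_emb_over[OF x z]]) simp
  then have "(-1) ^ card (conjs k x) * (\<Prod>r\<in>conjs k x. emb k x r z) \<in> k"
    by (simp add: poly_prod prod_uminus)
  then have "(-1) ^ card (conjs k x) * (\<Prod>r\<in>conjs k x. emb k x r z) / (-1) ^ card (conjs k x) \<in> k"
    by (rule k_divide) auto
  then show ?thesis
    by simp
qed

end

section \<open>Absolute values on subfields of the complex numbers\<close>

locale complex_valued = complex_subfield K for K +
  fixes w :: "complex \<Rightarrow> real"
  assumes abs_w: "absolute_value (subring_of K) w"
begin

lemma field_K: "field (subring_of K)"
  using CC.subfield_iff(2)[OF subfield_k] .

sublocale V: valued_field "subring_of K" w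
  using field_K abs_w by (simp add: valued_field_def valued_field_axioms_def)

lemma w_nonneg [simp]: "x \<in> K \<Longrightarrow> 0 \<le> w x"
  and w_eq_0_iff [simp]: "x \<in> K \<Longrightarrow> w x = 0 \<longleftrightarrow> x = 0"
  and w_pos: "x \<in> K \<Longrightarrow> x \<noteq> 0 \<Longrightarrow> 0 < w x"
  and w_mult: "x \<in> K \<Longrightarrow> y \<in> K \<Longrightarrow> w (x * y) = w x * w y"
  and w_add: "x \<in> K \<Longrightarrow> y \<in> K \<Longrightarrow> w (x + y) \<le> w x + w y"
  and w_0 [simp]: "w 0 = 0" and w_1 [simp]: "w 1 = 1"
  using V.v_nonneg V.v_eq_0_iff V.v_pos V.v_mult V.v_add V.v_zero V.v_one by auto

lemma subring_a_inv: "x \<in> K \<Longrightarrow> \<ominus>\<^bsub>subring_of K\<^esub> x = - x"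
  by (rule V.minus_equality) auto

lemma subring_minus: "x \<in> K \<Longrightarrow> y \<in> K \<Longrightarrow> x \<ominus>\<^bsub>subring_of K\<^esub> y = x - y"
  by (simp add: a_minus_def subring_a_inv)

lemma w_minus [simp]: "x \<in> K \<Longrightarrow> w (- x) = w x"
  using V.v_uminus[of x] subring_a_inv by simp

lemma w_diff: "x \<in> K \<Longrightarrow> y \<in> K \<Longrightarrow> w (x - y) \<le> w x + w y"
  using V.v_diff[of x y] subring_minus by simp

lemma w_abs_diff: "x \<in> K \<Longrightarrow> y \<in> K \<Longrightarrow> \<bar>w x - w y\<bar> \<le> w (x - y)"
  using V.abs_v_diff[of x y] subring_minus by simp

lemma w_inverse: "x \<in> K \<Longrightarrow> w (inverse x) = inverse (w x)"
proof (cases "x = 0")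
  case False
  assume x: "x \<in> K"
  then have "w (inverse x) * w x = 1"
    using w_mult[of "inverse x" x] False by simp
  then show ?thesis by (metis inverse_unique mult.commute)
qed simp

lemma w_divide: "x \<in> K \<Longrightarrow> y \<in> K \<Longrightarrow> w (x / y) = w x / w y"
  by (simp add: divide_inverse w_mult w_inverse)

lemma w_power: "x \<in> K \<Longrightarrow> w (x ^ n) = w x ^ n"
  by (induction n) (auto simp: w_mult)

lemma w_sum: "(\<And>i. i \<in> I \<Longrightarrow> f i \<in> K) \<Longrightarrow> w (sum f I) \<le> (\<Sum>i\<in>I. w (f i))"
proof (induction I rule: infinite_finite_induct)
  case (insert i I)
  then have "w (sum f (insert i I)) \<le> w (f i) + w (sum f I)"
    by (auto intro!: w_add)
  then show ?case using insert by fastforce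
qed auto

lemma w_prod: "(\<And>i. i \<in> I \<Longrightarrow> f i \<in> K) \<Longrightarrow> prod f I \<in> K \<and> w (prod f I) = (\<Prod>i\<in>I. w (f i))"
  by (induction I rule: infinite_finite_induct) (auto simp: w_mult)

section \<open>Limits with respect to an absolute value\<close>

definition wlim :: "(nat \<Rightarrow> complex) \<Rightarrow> complex \<Rightarrow> bool"
  where "wlim s a \<longleftrightarrow> (\<forall>m. s m \<in> K) \<and> a \<in> K \<and> (\<lambda>m. w (s m - a)) \<longlonglongrightarrow> 0"

lemma wlim_const: "a \<in> K \<Longrightarrow> wlim (\<lambda>_. a) a"
  unfolding wlim_def by simp

lemma wlim_abs: "wlim s a \<Longrightarrow> (\<lambda>m. w (s m)) \<longlonglongrightarrow> w a"
proof -
  assume s: "wlim s a"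
  have "(\<lambda>m. w (s m) - w a) \<longlonglongrightarrow> 0"
    by (rule tendsto_null_bound[of _ "\<lambda>m. w (s m - a)"]) (use s w_abs_diff in \<open>auto simp: wlim_def\<close>)
  from tendsto_add[OF this tendsto_const[of "w a"]] show ?thesis by simp
qed

lemma wlim_add: assumes "wlim s a" "wlim t b" shows "wlim (\<lambda>m. s m + t m) (a + b)"
  unfolding wlim_def
proof (intro conjI allI)
  show "(\<lambda>m. w (s m + t m - (a + b))) \<longlonglongrightarrow> 0"
  proof (rule tendsto_null_bound)
    show "(\<lambda>m. w (s m - a) + w (t m - b)) \<longlonglongrightarrow> 0"
      using assms tendsto_add[of "\<lambda>m. w (s m - a)" 0 _ "\<lambda>m. w (t m - b)" 0] unfolding wlim_def by simp
    fix m
    have e: "s m + t m - (a + b) = (s m - a) + (t m - b)" by simp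
    show "\<bar>w (s m + t m - (a + b))\<bar> \<le> w (s m - a) + w (t m - b)"
      unfolding e using w_add[of "s m - a" "t m - b"] w_nonneg[of "(s m - a) + (t m - b)"] assms
      by (auto simp: wlim_def)
  qed
qed (use assms in \<open>auto simp: wlim_def\<close>)

lemma wlim_mult: assumes "wlim s a" "wlim t b" shows "wlim (\<lambda>m. s m * t m) (a * b)"
  unfolding wlim_def
proof (intro conjI allI)
  show "(\<lambda>m. w (s m * t m - (a * b))) \<longlonglongrightarrow> 0"
  proof (rule tendsto_null_bound)
    have "(\<lambda>m. w (s m - a) * w (t m - b) + w a * w (t m - b) + w (s m - a) * w b) \<longlonglongrightarrow> 0 * 0 + w a * 0 + 0 * w b"
      using assms unfolding wlim_def by (intro tendsto_intros) auto
    then show "(\<lambda>m. w (s m - a) * w (t m - b) + w a * w (t m - b) + w (s m - a) * w b) \<longlonglongrightarrow> 0" by simp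
    fix m
    have c: "s m \<in> K" "t m \<in> K" "a \<in> K" "b \<in> K" using assms by (auto simp: wlim_def)
    have "s m * t m - a * b = (s m - a) * (t m - b) + a * (t m - b) + (s m - a) * b"
      by (simp add: algebra_simps)
    then have "w (s m * t m - a * b) \<le> w ((s m - a) * (t m - b)) + w (a * (t m - b)) + w ((s m - a) * b)"
      using w_add[of "(s m - a) * (t m - b) + a * (t m - b)" "(s m - a) * b"]
        w_add[of "(s m - a) * (t m - b)" "a * (t m - b)"] c by simp
    then show "\<bar>w (s m * t m - a * b)\<bar> \<le> w (s m - a) * w (t m - b) + w a * w (t m - b) + w (s m - a) * w b"
      using c by (simp add: w_mult)
  qed
qed (use assms in \<open>auto simp: wlim_def\<close>)

lemma wlim_minus: "wlim s a \<Longrightarrow> wlim (\<lambda>m. - s m) (- a)"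
  using wlim_mult[of "\<lambda>_. -1" "-1" s a] wlim_const[of "-1"] by simp

lemma wlim_diff: "wlim s a \<Longrightarrow> wlim t b \<Longrightarrow> wlim (\<lambda>m. s m - t m) (a - b)"
  using wlim_add[OF _ wlim_minus] by simp

lemma wlim_sum: "finite I \<Longrightarrow> (\<And>i. i \<in> I \<Longrightarrow> wlim (s i) (a i)) \<Longrightarrow> wlim (\<lambda>m. \<Sum>i\<in>I. s i m) (\<Sum>i\<in>I. a i)"
  by (induction I rule: finite_induct) (auto intro: wlim_const wlim_add)

text \<open>Coefficients depend continuously on roots. Characteristic polynomials of elements
  produced by weak approximation are controlled in this way, both in
  \<open>abs_value_from_embedding\<close> and in \<open>dense_x_power_e\<close>.\<close>

lemma wlim_prod_coeff:
  assumes "finite I" "\<And>i. i \<in> I \<Longrightarrow> wlim (s i) (a i)"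
  shows "wlim (\<lambda>m. Polynomial.coeff (\<Prod>i\<in>I. [:- s i m, 1:]) j) (Polynomial.coeff (\<Prod>i\<in>I. [:- a i, 1:]) j)"
  using assms
proof (induction I arbitrary: j rule: finite_induct)
  case empty
  then show ?case by (auto simp: coeff_1 intro!: wlim_const)
next
  case (insert i I)
  have c: "Polynomial.coeff ([:- c, 1:] * p) j = (case j of 0 \<Rightarrow> 0 | Suc l \<Rightarrow> Polynomial.coeff p l) + - (c * Polynomial.coeff p j)"
    for c :: complex and p j
    by (simp add: coeff_pCons split: nat.split)
  have IH: "wlim (\<lambda>m. Polynomial.coeff (\<Prod>i\<in>I. [:- s i m, 1:]) j) (Polynomial.coeff (\<Prod>i\<in>I. [:- a i, 1:]) j)" for j
    using insert by auto
  show ?case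
    unfolding prod.insert[OF insert(1,2)] c
    using IH insert.prems[of i] by (cases j) (auto intro!: wlim_diff wlim_minus wlim_mult wlim_const)
qed

end

section \<open>Weak approximation\<close>

lemma inequivalent_abs_values:
  assumes v: "complex_valued K v" and w: "complex_valued K w"
    and rat: "\<And>q. w (of_rat q) = v (of_rat q)" and c: "0 < v (of_rat c)" "v (of_rat c) < 1"
    and le: "\<And>z. z \<in> K \<Longrightarrow> v z < 1 \<Longrightarrow> w z < 1"
    and z: "z \<in> K"
  shows "w z = v z"
proof -
  interpret v: complex_valued K v by fact
  interpret w: complex_valued K w by fact
  \<comment> \<open>Comparable absolute values are powers of each other, and agreement at
    \<open>c\<close> fixes the exponent as 1. Concretely, if \<open>v y < w y\<close>, a fraction
    \<open>m/n\<close> between the two logarithms to base \<open>C\<close> gives an element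
    \<open>y^n c^(-m)\<close> that is smaller than 1 at \<open>v\<close> and larger than 1 at
    \<open>w\<close>.\<close>
  have *: "w y \<le> v y" if y: "y \<in> K" "y \<noteq> 0" for y
  proof (rule ccontr)
    assume "\<not> w y \<le> v y"
    define C where "C = v (of_rat c)"
    have C: "ln C < 0" "C > 0" unfolding C_def using c by auto
    have pos: "v y > 0" "w y > 0" using v.w_pos w.w_pos y by auto
    have "ln (w y) / ln C < ln (v y) / ln C"
      using C pos \<open>\<not> w y \<le> v y\<close> by (simp add: divide_strict_right_mono_neg)
    then obtain r where r: "ln (w y) / ln C < of_rat r" "of_rat r < ln (v y) / ln C"
      using of_rat_dense by blast
    obtain m n where mn: "quotient_of r = (m, n)" by force
    have n: "n > 0" using quotient_of_denom_pos[OF mn] .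
    have r_eq: "of_rat r = of_int m / (of_int n :: real)"
      using quotient_of_div[OF mn] by (simp add: of_rat_divide)
    define N where "N = nat n"
    \<comment> \<open>The integer \<open>m\<close> may have either sign; as a difference of two
      naturals it gives exponents that can be used in \<open>K\<close>.\<close>
    define a b where "a = nat m" and "b = nat (- m)"
    have Nn: "real N = of_int n" "N > 0" using n by (auto simp: N_def)
    have ab: "real a - real b = of_int m" by (auto simp: a_def b_def)
    let ?z = "y ^ N * of_rat c ^ b / of_rat c ^ a"
    have zK: "?z \<in> K" using y by auto
    have vz: "v ?z = v y ^ N * C ^ b / C ^ a"
      using y by (simp add: v.w_mult v.w_divide v.w_power C_def)
    have wz: "w ?z = w y ^ N * C ^ b / C ^ a"
      using y by (simp add: w.w_mult w.w_divide w.w_power C_def rat)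
    have ln: "ln (t ^ N * C ^ b / C ^ a) = of_int n * ln t - of_int m * ln C" if "t > 0" for t
      using that C Nn ab by (simp add: ln_mult ln_div ln_realpow algebra_simps)
    have "of_int n * ln (v y) < of_int m * ln C" "of_int m * ln C < of_int n * ln (w y)"
      using r C n by (auto simp: r_eq field_simps)
    then have "ln (v ?z) < 0" "ln (w ?z) > 0"
      using ln pos vz wz by auto
    moreover have "v ?z > 0" "w ?z > 0"
      unfolding vz wz using pos C by auto
    ultimately have "v ?z < 1" "w ?z > 1" by auto
    then show False using le[OF zK] by simp
  qed
  show ?thesis
  proof (cases "z = 0")
    case False
    have "inverse (w z) \<le> inverse (v z)"
      using *[of "inverse z"] z False by (simp add: w.w_inverse v.w_inverse)
    then show ?thesis
      using *[OF z False] v.w_pos[OF z False] w.w_pos[OF z False] by (simp add: inverse_le_iff_le)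
  qed simp
qed

lemma tendsto_null_eventually_bound:
  fixes f :: "'a \<Rightarrow> real"
  assumes "\<forall>\<^sub>F n in F. \<bar>f n\<bar> \<le> g n" and "(g \<longlongrightarrow> 0) F"
  shows "(f \<longlongrightarrow> 0) F"
  by (rule tendsto_rabs_zero_cancel, rule real_tendsto_sandwich[OF _ assms(1) tendsto_const assms(2)])
    auto

lemma (in complex_valued) geometric_limits:
  assumes z: "z \<in> K"
  shows "w z > 1 \<Longrightarrow> (\<lambda>r. w (z ^ r / (1 + z ^ r) - 1)) \<longlonglongrightarrow> 0"
    and "w z < 1 \<Longrightarrow> (\<lambda>r. w (z ^ r / (1 + z ^ r))) \<longlonglongrightarrow> 0"
proof -
  show "(\<lambda>r. w (z ^ r / (1 + z ^ r) - 1)) \<longlonglongrightarrow> 0" if z1: "w z > 1"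
  proof -
    have p: "(\<lambda>r. (1 / w z) ^ r) \<longlonglongrightarrow> 0"
      using z1 by (intro LIMSEQ_realpow_zero) auto
    have "(\<lambda>r. (1 / w z) ^ r / (1 - (1 / w z) ^ r)) \<longlonglongrightarrow> 0 / (1 - 0)"
      by (intro tendsto_intros p) auto
    moreover have "(1 / w z) ^ r / (1 - (1 / w z) ^ r) = inverse (w z ^ r - 1)" for r
    proof -
      have "w z ^ r > 0" using z1 by simp
      then show ?thesis using z1 by (cases "w z ^ r = 1") (simp_all add: power_divide divide_simps)
    qed
    ultimately have "(\<lambda>r. inverse (w z ^ r - 1)) \<longlonglongrightarrow> 0" by simp
    then show ?thesis
    proof (rule tendsto_null_eventually_bound[rotated])
      show "\<forall>\<^sub>F r in sequentially. \<bar>w (z ^ r / (1 + z ^ r) - 1)\<bar> \<le> inverse (w z ^ r - 1)"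
        unfolding eventually_sequentially
      proof (intro exI[of _ 1] allI impI)
        fix r :: nat assume "r \<ge> 1"
        then have "w z ^ r > 1" using z1 by (simp add: one_less_power)
        moreover have "w z ^ r - 1 \<le> w (1 + z ^ r)"
          using w_diff[of "1 + z ^ r" 1] z by (simp add: w_power)
        moreover have "1 + z ^ r \<noteq> 0"
          using calculation by auto
        then have "z ^ r / (1 + z ^ r) - 1 = - inverse (1 + z ^ r)"
          by (simp add: field_simps)
        ultimately show "\<bar>w (z ^ r / (1 + z ^ r) - 1)\<bar> \<le> inverse (w z ^ r - 1)"
          using z by (simp add: w_inverse le_imp_inverse_le)
      qed
    qed
  qed
  show "(\<lambda>r. w (z ^ r / (1 + z ^ r))) \<longlonglongrightarrow> 0" if z1: "w z < 1"
  proof -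
    have p: "(\<lambda>r. w z ^ r) \<longlonglongrightarrow> 0"
      using z z1 by (intro LIMSEQ_realpow_zero) auto
    have "(\<lambda>r. w z ^ r / (1 - w z ^ r)) \<longlonglongrightarrow> 0 / (1 - 0)"
      by (intro tendsto_intros p) auto
    then have "(\<lambda>r. w z ^ r / (1 - w z ^ r)) \<longlonglongrightarrow> 0" by simp
    then show ?thesis
    proof (rule tendsto_null_eventually_bound[rotated])
      show "\<forall>\<^sub>F r in sequentially. \<bar>w (z ^ r / (1 + z ^ r))\<bar> \<le> w z ^ r / (1 - w z ^ r)"
        unfolding eventually_sequentially
      proof (intro exI[of _ 1] allI impI)
        fix r :: nat assume "r \<ge> 1"
        then have lt: "w z ^ r < 1" using z1 z by (simp add: power_less_one_iff)
        moreover have "1 - w z ^ r \<le> w (1 + z ^ r)"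
          using w_diff[of "1 + z ^ r" "z ^ r"] z by (simp add: w_power)
        ultimately have "w z ^ r / w (1 + z ^ r) \<le> w z ^ r / (1 - w z ^ r)"
          using z by (intro divide_left_mono) (auto simp: zero_less_mult_iff)
        then show "\<bar>w (z ^ r / (1 + z ^ r))\<bar> \<le> w z ^ r / (1 - w z ^ r)"
          using z lt by (simp add: w_divide w_power)
      qed
    qed
  qed
qed

text \<open>The induction of Artin and Whaples. Let \<open>z\<close> serve for \<open>W\<close> and
  let \<open>y\<close> separate \<open>v\<close> from the new \<open>u\<close>. If
  \<open>u z \<le> 1\<close>, then \<open>z ^ r * y\<close> works for large \<open>r\<close>.
  Otherwise powers of \<open>z\<close> would grow at \<open>u\<close>; they are replaced by
  \<open>z ^ r / (1 + z ^ r)\<close>, which tends to 1 at \<open>u\<close> and \<open>v\<close> and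
  to 0 on \<open>W\<close>.\<close>

lemma weak_approximation_aux:
  assumes v: "complex_valued K v" and c: "0 < v (of_rat c)" "v (of_rat c) < 1"
    and fin: "finite W"
    and W: "\<And>w. w \<in> W \<Longrightarrow> complex_valued K w" "\<And>w q. w \<in> W \<Longrightarrow> w (of_rat q) = v (of_rat q)"
      "\<And>w. w \<in> W \<Longrightarrow> \<exists>z\<in>K. w z \<noteq> v z"
  shows "\<exists>z\<in>K. v z > 1 \<and> (\<forall>w\<in>W. w z < 1)"
  using fin W
proof (induction W rule: finite_induct)
  case empty
  interpret v: complex_valued K v by fact
  have "v (inverse (of_rat c)) > 1"
    using c by (simp add: v.w_inverse one_less_inverse_iff)
  then show ?case by (intro bexI[of _ "inverse (of_rat c)"]) auto
next
  case (insert u W)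
  interpret v: complex_valued K v by fact
  interpret u: complex_valued K u using insert by auto
  have ne: "\<exists>z\<in>K. u z \<noteq> v z" using insert by auto
  have two: "\<exists>y\<in>K. v y > 1 \<and> u y < 1"
  proof -
    \<comment> \<open>\<open>inequivalent_abs_values\<close> is used in both directions. Each
      witness is strict at one place only; their quotient is strict at both.\<close>
    obtain \<alpha> where \<alpha>: "\<alpha> \<in> K" "v \<alpha> < 1" "u \<alpha> \<ge> 1"
      using inequivalent_abs_values[of K v u c] v u.complex_valued_axioms insert.prems(2) c ne
      by (metis insertI1 not_less)
    obtain \<beta> where \<beta>: "\<beta> \<in> K" "u \<beta> < 1" "v \<beta> \<ge> 1"
      using inequivalent_abs_values[of K u v c] v u.complex_valued_axioms insert.prems(2) c ne
      by (metis insertI1 not_less)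
    have "v \<alpha> > 0" using \<alpha> v.w_pos[of \<alpha>] by (cases "\<alpha> = 0") auto
    then have "v (\<beta> / \<alpha>) > 1" using \<alpha> \<beta> by (simp add: v.w_divide less_divide_eq)
    moreover have "u (\<beta> / \<alpha>) < 1" using \<alpha> \<beta> by (simp add: u.w_divide divide_less_eq)
    ultimately show ?thesis using \<alpha> \<beta> by blast
  qed
  then obtain y where y: "y \<in> K" "v y > 1" "u y < 1" by auto
  obtain z where z: "z \<in> K" "v z > 1" "\<And>w. w \<in> W \<Longrightarrow> w z < 1"
    using insert by auto
  show ?case
  proof (cases "u z \<le> 1")
    case True
    have "\<forall>\<^sub>F r in sequentially. \<forall>w\<in>W. w (z ^ r * y) < 1"
    proof (rule eventually_ball_finite[OF insert(1)], rule ballI)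
      fix w assume w: "w \<in> W"
      interpret w: complex_valued K w using insert.prems w by auto
      have "(\<lambda>r. w z ^ r * w y) \<longlonglongrightarrow> 0 * w y"
        using z w by (intro tendsto_mult LIMSEQ_realpow_zero tendsto_const) auto
      then have "\<forall>\<^sub>F r in sequentially. w z ^ r * w y < 1"
        by (rule order_tendstoD) simp
      then show "\<forall>\<^sub>F r in sequentially. w (z ^ r * y) < 1"
        using z y by (simp add: w.w_mult w.w_power)
    qed
    then obtain r where r: "\<forall>w\<in>W. w (z ^ r * y) < 1"
      unfolding eventually_sequentially by blast
    have "v z ^ r * v y > 1"
      using z y by (metis less_1_mult mult.left_neutral one_le_power less_eq_real_def mult_le_less_imp_less zero_le_one zero_less_one less_trans)
    then have "v (z ^ r * y) > 1" using z y by (simp add: v.w_mult v.w_power)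
    moreover have "u z ^ r * u y < 1"
      using True z y power_le_one[of "u z" r] mult_right_mono[of "u z ^ r" 1 "u y"] by simp
    then have "u (z ^ r * y) < 1" using z y by (simp add: u.w_mult u.w_power)
    ultimately show ?thesis
      using r z y by (intro bexI[of _ "z ^ r * y"]) auto
  next
    case False
    let ?t = "\<lambda>r. z ^ r / (1 + z ^ r)"
    have t: "?t r \<in> K" for r using z by auto
    have "\<forall>\<^sub>F r in sequentially. \<forall>w\<in>W. w (?t r * y) < 1"
    proof (rule eventually_ball_finite[OF insert(1)], rule ballI)
      fix w assume w: "w \<in> W"
      interpret w: complex_valued K w using insert.prems w by auto
      have "(\<lambda>r. w (?t r) * w y) \<longlonglongrightarrow> 0 * w y"
        using z w by (intro tendsto_mult w.geometric_limits(2) tendsto_const) auto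
      then have "\<forall>\<^sub>F r in sequentially. w (?t r) * w y < 1"
        by (rule order_tendstoD) simp
      then show "\<forall>\<^sub>F r in sequentially. w (?t r * y) < 1"
        by (simp only: w.w_mult[OF t y(1)])
    qed
    moreover have "\<forall>\<^sub>F r in sequentially. u (?t r * y) < 1"
    proof -
      have "u.wlim ?t 1"
        using u.geometric_limits(1)[OF z(1)] False t by (auto simp: u.wlim_def)
      then have "(\<lambda>r. u (?t r) * u y) \<longlonglongrightarrow> u 1 * u y"
        by (intro tendsto_mult u.wlim_abs tendsto_const)
      then have "\<forall>\<^sub>F r in sequentially. u (?t r) * u y < 1"
        by (rule order_tendstoD) (use y in simp)
      then show ?thesis by (simp only: u.w_mult[OF t y(1)])
    qed
    moreover have "\<forall>\<^sub>F r in sequentially. v (?t r * y) > 1"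
    proof -
      have "v.wlim ?t 1"
        using v.geometric_limits(1)[OF z(1)] z t by (auto simp: v.wlim_def)
      then have "(\<lambda>r. v (?t r) * v y) \<longlonglongrightarrow> v 1 * v y"
        by (intro tendsto_mult v.wlim_abs tendsto_const)
      then have "\<forall>\<^sub>F r in sequentially. v (?t r) * v y > 1"
        by (rule order_tendstoD) (use y in simp)
      then show ?thesis by (simp only: v.w_mult[OF t y(1)])
    qed
    ultimately have "\<forall>\<^sub>F r in sequentially. (\<forall>w\<in>W. w (?t r * y) < 1) \<and> u (?t r * y) < 1 \<and> v (?t r * y) > 1"
      by (intro eventually_conj)
    then obtain r where "(\<forall>w\<in>W. w (?t r * y) < 1) \<and> u (?t r * y) < 1 \<and> v (?t r * y) > 1"
      unfolding eventually_sequentially by blast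
    then show ?thesis
      using v.k_closed(4)[OF t y(1)] by blast
  qed
qed

theorem weak_approximation:
  assumes v: "complex_valued K v" and c: "0 < v (of_rat c)" "v (of_rat c) < 1"
    and fin: "finite W"
    and W: "\<And>w. w \<in> W \<Longrightarrow> complex_valued K w" "\<And>w q. w \<in> W \<Longrightarrow> w (of_rat q) = v (of_rat q)"
      "\<And>w. w \<in> W \<Longrightarrow> \<exists>z\<in>K. w z \<noteq> v z"
  shows "\<exists>\<epsilon>. (\<forall>m. \<epsilon> m \<in> K) \<and> (\<lambda>m. v (\<epsilon> m - 1)) \<longlonglongrightarrow> 0 \<and> (\<forall>w\<in>W. (\<lambda>m. w (\<epsilon> m)) \<longlonglongrightarrow> 0)"
proof -
  interpret v: complex_valued K v by fact
  have "\<exists>z\<in>K. v z > 1 \<and> (\<forall>w\<in>W. w z < 1)"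
    by (rule weak_approximation_aux) (use assms in auto)
  then obtain z where z: "z \<in> K" "v z > 1" "\<And>w. w \<in> W \<Longrightarrow> w z < 1"
    by blast
  show ?thesis
    using z v.geometric_limits(1)[OF z(1)] complex_valued.geometric_limits(2)[OF W(1) z(1)]
    by (intro exI[of _ "\<lambda>m. z ^ m / (1 + z ^ m)"]) auto
qed

section \<open>Places and embeddings\<close>

text \<open>\<open>L\<close> is a common home of all conjugate fields of \<open>adjoin k x\<close>,
  so a single absolute value \<open>u\<close> on it can be pulled back along every embedding. The
  rational \<open>c\<close> certifies that \<open>u\<close> is nontrivial on the rationals, as weak
  approximation requires.\<close>

locale valued_closure = complex_subfield k + U: complex_valued L u for k L u +
  fixes x :: complex and c :: rat
  assumes alg_x: "alg k x"
    and conj_L: "\<And>r. r \<in> conjs k x \<Longrightarrow> adjoin k r \<subseteq> L"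
    and c: "0 < u (of_rat c)" "u (of_rat c) < 1"
begin

abbreviation "K \<equiv> adjoin k x"
abbreviation "\<sigma> \<equiv> emb k x"

sublocale K: complex_subfield K
  by (rule adjoin_subfield[OF alg_x])

lemma k_K: "a \<in> k \<Longrightarrow> a \<in> K"
  using k_subset_adjoin by auto

lemma k_L: "a \<in> k \<Longrightarrow> a \<in> L"
  using k_subset_adjoin[of x] conj_L[OF conjs_self[OF alg_x]] by auto

lemma emb_L [simp]: "r \<in> conjs k x \<Longrightarrow> z \<in> K \<Longrightarrow> \<sigma> r z \<in> L"
  using emb_in_adjoin[OF alg_x] conj_L by blast

lemma conjs_L: "r \<in> conjs k x \<Longrightarrow> r \<in> L"
  using conj_L adjoin_self by blast

lemma emb_minus: "r \<in> conjs k x \<Longrightarrow> y \<in> K \<Longrightarrow> z \<in> K \<Longrightarrow> \<sigma> r (y - z) = \<sigma> r y - \<sigma> r z"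
  using emb_add[OF alg_x, of r "y - z" z] by auto

lemma complex_valued_emb:
  assumes r: "r \<in> conjs k x"
  shows "complex_valued K (\<lambda>z. u (\<sigma> r z))"
proof -
  have "absolute_value (subring_of K) (\<lambda>z. u (\<sigma> r z))"
    unfolding absolute_value_def
    using r emb_add[OF alg_x r] emb_mult[OF alg_x r] emb_eq_0_iff[OF alg_x r] U.w_mult U.w_add by simp
  then show ?thesis
    by (simp add: complex_valued_def complex_valued_axioms_def K.complex_subfield_axioms)
qed

lemma emb_abs_base: "r \<in> conjs k x \<Longrightarrow> a \<in> k \<Longrightarrow> u (\<sigma> r a) = u a"
  using emb_base[OF alg_x] by simp

text \<open>If \<open>w\<close> came from no embedding, an element close to \<open>1\<close> at \<open>w\<close> and close to \<open>0\<close> at all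
  \<open>u \<circ> \<sigma>\<close> would be a root of a polynomial whose coefficients are close to those of \<open>X\<^sup>n\<close>.\<close>

theorem abs_value_from_embedding:
  assumes w: "complex_valued K w" and wu: "\<And>a. a \<in> k \<Longrightarrow> w a = u a"
  shows "\<exists>r\<in>conjs k x. \<forall>z\<in>K. w z = u (\<sigma> r z)"
proof (rule ccontr)
  assume none: "\<not> ?thesis"
  interpret w: complex_valued K w by fact
  let ?W = "(\<lambda>r z. u (\<sigma> r z)) ` conjs k x"
  have "\<exists>\<epsilon>. (\<forall>m. \<epsilon> m \<in> K) \<and> (\<lambda>m. w (\<epsilon> m - 1)) \<longlonglongrightarrow> 0 \<and> (\<forall>v\<in>?W. (\<lambda>m. v (\<epsilon> m)) \<longlonglongrightarrow> 0)"
  proof (rule weak_approximation[OF w, of c])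
    show "0 < w (of_rat c)" "w (of_rat c) < 1" using c wu by auto
    show "finite ?W" using finite_conjs[OF alg_x] by simp
    fix v assume "v \<in> ?W"
    then obtain r where r: "r \<in> conjs k x" "v = (\<lambda>z. u (\<sigma> r z))" by auto
    show "complex_valued K v" using complex_valued_emb r by simp
    show "v (of_rat q) = w (of_rat q)" for q
      using r emb_abs_base wu by simp
    show "\<exists>z\<in>K. v z \<noteq> w z"
      using none r by force
  qed
  then obtain \<epsilon> where \<epsilon>: "\<And>m. \<epsilon> m \<in> K" "(\<lambda>m. w (\<epsilon> m - 1)) \<longlonglongrightarrow> 0"
    "\<And>r. r \<in> conjs k x \<Longrightarrow> (\<lambda>m. u (\<sigma> r (\<epsilon> m))) \<longlonglongrightarrow> 0"
    by auto
  define n where "n = card (conjs k x)"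
  define F where "F m = (\<Prod>r\<in>conjs k x. [:- \<sigma> r (\<epsilon> m), 1:])" for m
  have F_over: "F m \<in> polys_over k" for m
    unfolding F_def by (rule prod_emb_over[OF alg_x \<epsilon>(1)])
  have F_deg: "Polynomial.degree (F m) = n" "Polynomial.coeff (F m) n = 1" for m
  proof -
    show d: "Polynomial.degree (F m) = n"
      unfolding F_def n_def by (subst degree_prod_eq_sum_degree) auto
    have "lead_coeff (F m) = 1"
      unfolding F_def by (simp add: lead_coeff_prod)
    then show "Polynomial.coeff (F m) n = 1" using d by simp
  qed
  \<comment> \<open>The coefficients are small with respect to \<open>u\<close>, where the roots of
    \<open>F m\<close> can be seen. They lie in \<open>k\<close>, where \<open>u\<close> and
    \<open>w\<close> agree, so they are small with respect to \<open>w\<close> as well.\<close>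
  have lim0: "(\<lambda>m. w (Polynomial.coeff (F m) j)) \<longlonglongrightarrow> 0" if "j < n" for j
  proof -
    have "U.wlim (\<lambda>m. Polynomial.coeff (F m) j) (Polynomial.coeff (\<Prod>r\<in>conjs k x. [:- 0, 1:]) j)"
      unfolding F_def using \<epsilon> finite_conjs[OF alg_x]
      by (intro U.wlim_prod_coeff) (auto simp: U.wlim_def)
    moreover have "Polynomial.coeff (\<Prod>r\<in>conjs k x. [:- 0, 1:]) j = (0::complex)"
    proof -
      have "(\<Prod>r\<in>conjs k x. [:- 0, 1:]) = Polynomial.monom (1::complex) n"
        by (simp add: monom_altdef n_def)
      then show ?thesis using that by (simp del: prod_constant)
    qed
    ultimately have "(\<lambda>m. u (Polynomial.coeff (F m) j)) \<longlonglongrightarrow> 0"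
      using U.wlim_abs by fastforce
    then show ?thesis using wu F_over by simp
  qed
  have lim1: "(\<lambda>m. w (\<epsilon> m)) \<longlonglongrightarrow> 1"
    using w.wlim_abs[of \<epsilon> 1] \<epsilon> by (simp add: w.wlim_def)
  have le: "w (\<epsilon> m) ^ n \<le> (\<Sum>j<n. w (Polynomial.coeff (F m) j) * w (\<epsilon> m) ^ j)" for m
  proof -
    have "poly (F m) (\<epsilon> m) = 0"
      unfolding F_def by (rule prod_emb_root[OF alg_x \<epsilon>(1)])
    moreover have "poly (F m) (\<epsilon> m) = (\<Sum>j<n. Polynomial.coeff (F m) j * \<epsilon> m ^ j) + \<epsilon> m ^ n"
      using F_deg[of m] by (simp add: poly_altdef lessThan_Suc_atMost[symmetric])
    ultimately have "\<epsilon> m ^ n = - (\<Sum>j<n. Polynomial.coeff (F m) j * \<epsilon> m ^ j)"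
      by (simp add: eq_neg_iff_add_eq_0 add.commute)
    then have "w (\<epsilon> m ^ n) = w (\<Sum>j<n. Polynomial.coeff (F m) j * \<epsilon> m ^ j)"
      using \<epsilon>(1) F_over k_K by (subst w.w_minus[symmetric]) (auto intro!: K.k_sum)
    also have "\<dots> \<le> (\<Sum>j<n. w (Polynomial.coeff (F m) j * \<epsilon> m ^ j))"
      using \<epsilon>(1) F_over k_K by (intro w.w_sum) auto
    finally show ?thesis
      using \<epsilon>(1) F_over k_K by (simp add: w.w_mult w.w_power)
  qed
  have "(\<lambda>m. \<Sum>j<n. w (Polynomial.coeff (F m) j) * w (\<epsilon> m) ^ j) \<longlonglongrightarrow> (\<Sum>j<n. 0 * 1 ^ j)"
    by (intro tendsto_sum tendsto_mult tendsto_power lim1 lim0) auto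
  moreover have "(\<lambda>m. w (\<epsilon> m) ^ n) \<longlonglongrightarrow> 1 ^ n"
    by (intro tendsto_power lim1)
  ultimately have "(1::real) ^ n \<le> (\<Sum>j<n. 0 * 1 ^ j)"
    using le by (intro LIMSEQ_le[where X="\<lambda>m. w (\<epsilon> m) ^ n"]) auto
  then show False by simp
qed

end

section \<open>Bases of completions\<close>

text \<open>The \<open>l r j\<close> are the coefficients of the Lagrange polynomials. They are
  required to lie in every field containing \<open>R\<close>, because \<open>lin_bound\<close>
  measures them by an absolute value that lives on \<open>L\<close> only.\<close>

lemma lagrange_basis:
  fixes R :: "complex set"
  assumes fin: "finite R"
  shows "\<exists>l. (\<forall>r j. \<forall>M. complex_subfield M \<longrightarrow> R \<subseteq> M \<longrightarrow> r \<in> R \<longrightarrow> l r j \<in> M) \<and>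
    (\<forall>p j. Polynomial.degree p < card R \<longrightarrow> Polynomial.coeff p j = (\<Sum>r\<in>R. poly p r * l r j))"
proof -
  define l where "l r = (\<Prod>s\<in>R - {r}. Polynomial.smult (1 / (r - s)) [:- s, 1:])" for r
  have deg: "Polynomial.degree (l r) < card R" if "r \<in> R" for r
  proof -
    have "Polynomial.degree (l r) \<le> (\<Sum>s\<in>R - {r}. Polynomial.degree (Polynomial.smult (1 / (r - s)) [:- s, 1:]))"
      unfolding l_def
      using degree_prod_sum_le[of "R - {r}" "\<lambda>s. Polynomial.smult (1 / (r - s)) [:- s, 1:]"] fin
      unfolding o_def by blast
    also have "\<dots> \<le> (\<Sum>s\<in>R - {r}. 1)"
      by (intro sum_mono) (auto intro: order_trans[OF degree_smult_le])
    also have "\<dots> < card R"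
    proof -
      have "card R > 0" using that fin card_gt_0_iff by blast
      then show ?thesis using that fin by simp
    qed
    finally show ?thesis .
  qed
  have val: "poly (l r) s = (if r = s then 1 else 0)" if "s \<in> R" "r \<in> R" for r s
    using that fin
    by (auto simp: l_def poly_prod prod_zero_iff diff_divide_distrib[symmetric] intro!: prod.neutral)
  have "Polynomial.coeff p j = (\<Sum>r\<in>R. poly p r * Polynomial.coeff (l r) j)" if p: "Polynomial.degree p < card R" for p j
  proof -
    define q where "q = (\<Sum>r\<in>R. Polynomial.smult (poly p r) (l r))"
    have "p = q"
    proof (rule poly_eqI_degree[of R])
      show "Polynomial.degree p < card R" by fact
      have "card R > 0" using p by simp
      then show "Polynomial.degree q < card R"
        unfolding q_def using fin deg
        by (intro degree_sum_less) (auto intro: le_less_trans[OF degree_smult_le])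
      fix s assume "s \<in> R"
      then show "poly p s = poly q s"
        using fin by (simp add: q_def poly_sum val if_distrib cong: if_cong)
    qed
    then have "Polynomial.coeff p j = Polynomial.coeff q j" by simp
    then show ?thesis by (simp add: q_def coeff_sum)
  qed
  moreover have "Polynomial.coeff (l r) j \<in> M" if "complex_subfield M" "R \<subseteq> M" "r \<in> R" for r j M
  proof -
    interpret M: complex_subfield M by fact
    have "l r \<in> polys_over M"
      unfolding l_def using that by (intro M.over_prod M.over_smult) auto
    then show ?thesis by simp
  qed
  ultimately show ?thesis
    by (intro exI[of _ "\<lambda>r j. Polynomial.coeff (l r) j"]) auto
qed

locale local_basis = valued_closure k L u x c + W: complex_valued "adjoin k x" w for k L u x c w +
  assumes w_base: "\<And>a. a \<in> k \<Longrightarrow> w a = u a"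
begin

definition R\<^sub>w where "R\<^sub>w = {r \<in> conjs k x. \<forall>z\<in>K. u (\<sigma> r z) = w z}"
text \<open>The powers of \<open>x\<close> below \<open>e\<close> will be a basis of the completion
  of \<open>K\<close> at \<open>w\<close> over that of \<open>k\<close>; thus the number of
  embeddings inducing \<open>w\<close> is the local degree.\<close>

definition e where "e = card R\<^sub>w"

lemma Rw_sub: "r \<in> R\<^sub>w \<Longrightarrow> r \<in> conjs k x" and Rw_abs: "r \<in> R\<^sub>w \<Longrightarrow> z \<in> K \<Longrightarrow> u (\<sigma> r z) = w z"
  unfolding R\<^sub>w_def by auto

lemma finite_Rw: "finite R\<^sub>w"
  unfolding R\<^sub>w_def using finite_conjs[OF alg_x] by simp

lemma Rw_nonempty: "\<exists>r. r \<in> R\<^sub>w"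
  using abs_value_from_embedding[OF W.complex_valued_axioms w_base] unfolding R\<^sub>w_def by fastforce

lemma e_pos: "e > 0"
  unfolding e_def using Rw_nonempty finite_Rw card_gt_0_iff by blast

definition lin :: "(nat \<Rightarrow> complex) \<Rightarrow> complex" where "lin a = (\<Sum>j<e. a j * x ^ j)"

lemma x_K: "x \<in> K" by (rule adjoin_self)

lemma lin_K: "(\<And>j. a j \<in> k) \<Longrightarrow> lin a \<in> K"
  unfolding lin_def using k_K x_K by (intro K.k_sum K.k_closed(4) K.k_power) auto

lemma w_lin:
  assumes "\<And>j. j < e \<Longrightarrow> a j \<in> k" "r \<in> R\<^sub>w"
  shows "w (\<Sum>j<e. a j * x ^ j) = u (\<Sum>j<e. a j * r ^ j)"
proof -
  define p where "p = (\<Sum>j<e. Polynomial.monom (a j) j)"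
  have p: "p \<in> polys_over k" unfolding p_def using assms by (intro over_sum) auto
  have "\<sigma> r (poly p x) = poly p r"
    using emb_poly[OF alg_x Rw_sub[OF assms(2)] p] .
  then show ?thesis
    using Rw_abs[OF assms(2) adjoin_poly[OF p]] by (simp add: p_def poly_sum poly_monom)
qed

text \<open>The \<open>e\<close> embeddings inducing \<open>w\<close> give a polynomial in
  \<open>x\<close> conjugate values of one and the same size. Interpolation at these
  \<open>e\<close> points bounds each coefficient by that size. Hence the powers of \<open>x\<close>
  below \<open>e\<close> stay independent in the completion, with continuous coordinates.\<close>

lemma lin_bound:
  assumes j: "j < e"
  shows "\<exists>C>0. \<forall>a. (\<forall>i<e. a i \<in> k) \<longrightarrow> w (a j) \<le> C * w (\<Sum>i<e. a i * x ^ i)"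
proof -
  obtain l where l: "\<And>r j M. complex_subfield M \<Longrightarrow> R\<^sub>w \<subseteq> M \<Longrightarrow> r \<in> R\<^sub>w \<Longrightarrow> l r j \<in> M"
    "\<And>p j. Polynomial.degree p < card R\<^sub>w \<Longrightarrow> Polynomial.coeff p j = (\<Sum>r\<in>R\<^sub>w. poly p r * l r j)"
    using lagrange_basis[OF finite_Rw] by metis
  have lL: "l r j \<in> L" if "r \<in> R\<^sub>w" for r
    using l(1)[OF U.complex_subfield_axioms _ that] conjs_L Rw_sub by blast
  have rL: "r \<in> L" if "r \<in> R\<^sub>w" for r using conjs_L Rw_sub that by blast
  define C where "C = 1 + (\<Sum>r\<in>R\<^sub>w. u (l r j))"
  have sum0: "(\<Sum>r\<in>R\<^sub>w. u (l r j)) \<ge> 0" using lL by (intro sum_nonneg) auto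
  have "w (a j) \<le> C * w (\<Sum>i<e. a i * x ^ i)" if a: "\<And>i. i < e \<Longrightarrow> a i \<in> k" for a
  proof -
    define p where "p = (\<Sum>j<e. Polynomial.monom (a j) j)"
    have "Polynomial.degree p < card R\<^sub>w"
      unfolding p_def using e_pos
      by (intro degree_sum_less) (auto simp: e_def intro: le_less_trans[OF degree_monom_le])
    then have "Polynomial.coeff p j = (\<Sum>r\<in>R\<^sub>w. poly p r * l r j)" by (rule l(2))
    moreover have "Polynomial.coeff p j = a j"
      using j by (simp add: p_def coeff_sum)
    ultimately have eq: "a j = (\<Sum>r\<in>R\<^sub>w. poly p r * l r j)" by simp
    have pL: "poly p r \<in> L" if "r \<in> R\<^sub>w" for r
      unfolding p_def poly_sum poly_monom using a k_L rL[OF that] by (intro U.k_sum) auto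
    have "w (a j) = u (a j)" using a j w_base by simp
    also have "\<dots> \<le> (\<Sum>r\<in>R\<^sub>w. u (poly p r * l r j))"
      unfolding eq using pL lL by (intro U.w_sum) auto
    also have "\<dots> = (\<Sum>r\<in>R\<^sub>w. u (poly p r) * u (l r j))"
      using pL lL by (intro sum.cong) (auto simp: U.w_mult)
    also have "\<dots> = (\<Sum>r\<in>R\<^sub>w. u (l r j)) * w (\<Sum>i<e. a i * x ^ i)"
      unfolding sum_distrib_right using w_lin[of a] a
      by (intro sum.cong) (auto simp: p_def poly_sum poly_monom)
    also have "\<dots> \<le> C * w (\<Sum>i<e. a i * x ^ i)"
    proof (rule mult_right_mono)
      show "0 \<le> w (\<Sum>i<e. a i * x ^ i)"
        using a k_K x_K by (intro W.w_nonneg K.k_sum K.k_closed(4) K.k_power) auto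
    qed (simp add: C_def)
    finally show ?thesis .
  qed
  moreover have "C > 0" using sum0 by (simp add: C_def)
  ultimately show ?thesis by blast
qed

section \<open>Density of the span of the first powers of the generator\<close>

definition dense_pt where
  "dense_pt s \<longleftrightarrow> s \<in> K \<and> (\<forall>d>0. \<exists>a. (\<forall>j. a j \<in> k) \<and> w (s - lin a) < d)"

lemma dense_ptI: "s \<in> K \<Longrightarrow> (\<And>d. d > 0 \<Longrightarrow> \<exists>a. (\<forall>j. a j \<in> k) \<and> w (s - lin a) < d) \<Longrightarrow> dense_pt s"
  unfolding dense_pt_def by auto

lemma dense_ptD: "dense_pt s \<Longrightarrow> d > 0 \<Longrightarrow> \<exists>a. (\<forall>j. a j \<in> k) \<and> w (s - lin a) < d"
  unfolding dense_pt_def by auto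

lemma dense_K: "dense_pt s \<Longrightarrow> s \<in> K"
  unfolding dense_pt_def by auto

lemma dense_lin: "(\<And>j. a j \<in> k) \<Longrightarrow> dense_pt (lin a)"
  by (rule dense_ptI[OF lin_K]) (auto intro!: exI[of _ a])

lemma dense_add:
  assumes s: "dense_pt s" and t: "dense_pt t" shows "dense_pt (s + t)"
proof (rule dense_ptI)
  show "s + t \<in> K" using dense_K assms by auto
  fix d :: real assume d: "d > 0"
  obtain a where a: "\<And>j. a j \<in> k" "w (s - lin a) < d/2" using dense_ptD[OF s, of "d/2"] d by auto
  obtain b where b: "\<And>j. b j \<in> k" "w (t - lin b) < d/2" using dense_ptD[OF t, of "d/2"] d by auto
  have e: "s + t - lin (\<lambda>j. a j + b j) = (s - lin a) + (t - lin b)"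
    by (simp add: lin_def sum.distrib distrib_right)
  have "w (s + t - lin (\<lambda>j. a j + b j)) < d"
    unfolding e using W.w_add[of "s - lin a" "t - lin b"] a b dense_K[OF s] dense_K[OF t] lin_K by fastforce
  then show "\<exists>a. (\<forall>j. a j \<in> k) \<and> w (s + t - lin a) < d"
    using a b by (intro exI[of _ "\<lambda>j. a j + b j"]) auto
qed

lemma dense_smult:
  assumes s: "dense_pt s" and b: "b \<in> k" shows "dense_pt (b * s)"
proof (rule dense_ptI)
  show "b * s \<in> K" using dense_K s b k_K by auto
  fix d :: real assume d: "d > 0"
  have wb: "w b \<ge> 0" using b k_K by simp
  then obtain a where a: "\<And>j. a j \<in> k" "w (s - lin a) < d / (w b + 1)"
    using dense_ptD[OF s, of "d / (w b + 1)"] d by auto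
  have e: "b * s - lin (\<lambda>j. b * a j) = b * (s - lin a)"
    by (simp add: lin_def sum_distrib_left algebra_simps)
  have "w (b * s - lin (\<lambda>j. b * a j)) = w b * w (s - lin a)"
    unfolding e using b k_K dense_K[OF s] lin_K[OF a(1)] by (intro W.w_mult) auto
  also have "\<dots> \<le> (w b + 1) * w (s - lin a)"
    using wb dense_K[OF s] lin_K[OF a(1)] by (intro mult_right_mono) auto
  also have "\<dots> < (w b + 1) * (d / (w b + 1))"
    using a(2) wb by (intro mult_strict_left_mono) auto
  also have "\<dots> = d" using wb by simp
  finally show "\<exists>a. (\<forall>j. a j \<in> k) \<and> w (b * s - lin a) < d"
    using a b by (intro exI[of _ "\<lambda>j. b * a j"]) auto
qed

lemma dense_sum: "(\<And>i. i \<in> I \<Longrightarrow> dense_pt (f i)) \<Longrightarrow> dense_pt (sum f I)"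
proof (induction I rule: infinite_finite_induct)
  case (insert i I)
  then show ?case by (auto intro: dense_add)
qed (use dense_lin[of "\<lambda>_. 0"] in \<open>auto simp: lin_def\<close>)

lemma dense_closed:
  assumes s: "s \<in> K" and t: "\<And>d. d > 0 \<Longrightarrow> \<exists>t. dense_pt t \<and> w (s - t) < d"
  shows "dense_pt s"
proof (rule dense_ptI[OF s])
  fix d :: real assume d: "d > 0"
  obtain t where t: "dense_pt t" "w (s - t) < d/2" using t[of "d/2"] d by auto
  obtain a where a: "\<And>j. a j \<in> k" "w (t - lin a) < d/2" using dense_ptD[OF t(1), of "d/2"] d by auto
  have e: "s - lin a = (s - t) + (t - lin a)" by simp
  have "w (s - lin a) < d"
    unfolding e using W.w_add[of "s - t" "t - lin a"] a t dense_K[OF t(1)] s lin_K by fastforce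
  then show "\<exists>a. (\<forall>j. a j \<in> k) \<and> w (s - lin a) < d" using a by auto
qed

text \<open>The product of \<open>X - r\<close> over the conjugates \<open>r\<close> inducing \<open>w\<close> is a limit of polynomials over
  \<open>k\<close>, namely of truncated characteristic polynomials of \<open>\<epsilon> x\<close> with \<open>\<epsilon>\<close> close to \<open>1\<close> at \<open>w\<close> and
  close to \<open>0\<close> at the other places.\<close>

lemma dense_x_power_e: "dense_pt (x ^ e)"
proof (rule dense_closed)
  show "x ^ e \<in> K" using x_K by auto
  fix d :: real assume d: "d > 0"
  let ?R = "conjs k x"
  let ?W = "(\<lambda>r z. u (\<sigma> r z)) ` (?R - R\<^sub>w)"
  have "\<exists>\<epsilon>. (\<forall>m. \<epsilon> m \<in> K) \<and> (\<lambda>m. w (\<epsilon> m - 1)) \<longlonglongrightarrow> 0 \<and> (\<forall>v\<in>?W. (\<lambda>m. v (\<epsilon> m)) \<longlonglongrightarrow> 0)"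
  proof (rule weak_approximation[OF W.complex_valued_axioms, of c])
    show "0 < w (of_rat c)" "w (of_rat c) < 1" using c w_base by auto
    show "finite ?W" using finite_conjs[OF alg_x] by simp
    fix v assume "v \<in> ?W"
    then obtain r where r: "r \<in> ?R" "r \<notin> R\<^sub>w" "v = (\<lambda>z. u (\<sigma> r z))" by auto
    show "complex_valued K v" using complex_valued_emb r by simp
    show "v (of_rat q) = w (of_rat q)" for q
      using r emb_abs_base w_base by simp
    show "\<exists>z\<in>K. v z \<noteq> w z"
      using r unfolding R\<^sub>w_def by auto
  qed
  then obtain \<epsilon> where \<epsilon>: "\<And>m. \<epsilon> m \<in> K" "(\<lambda>m. w (\<epsilon> m - 1)) \<longlonglongrightarrow> 0"
    "\<And>r. r \<in> ?R \<Longrightarrow> r \<notin> R\<^sub>w \<Longrightarrow> (\<lambda>m. u (\<sigma> r (\<epsilon> m))) \<longlonglongrightarrow> 0"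
    by auto
  define n where "n = card ?R"
  have en: "e \<le> n"
    unfolding e_def n_def using finite_conjs[OF alg_x] Rw_sub by (intro card_mono) auto
  define F where "F m = (\<Prod>r\<in>?R. [:- \<sigma> r (\<epsilon> m * x), 1:])" for m
  have F_over: "F m \<in> polys_over k" for m
    unfolding F_def using \<epsilon>(1) x_K by (intro prod_emb_over[OF alg_x]) auto
  have F_lead: "Polynomial.coeff (F m) n = 1" for m
  proof -
    have "Polynomial.degree (F m) = n"
      unfolding F_def n_def by (subst degree_prod_eq_sum_degree) auto
    moreover have "lead_coeff (F m) = 1"
      unfolding F_def by (simp add: lead_coeff_prod)
    ultimately show ?thesis by simp
  qed
  \<comment> \<open>These are the limits of the conjugates of \<open>\<epsilon> m * x\<close>: the
    embeddings inducing \<open>w\<close> see \<epsilon> near 1, the others see it near 0.\<close>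
  define t where "t r = (if r \<in> R\<^sub>w then r else 0)" for r
  define g where "g = (\<Prod>r\<in>R\<^sub>w. [:- r, 1:])"
  have g_deg: "Polynomial.degree g = e"
    unfolding g_def e_def by (subst degree_prod_eq_sum_degree) auto
  \<comment> \<open>So \<open>F m\<close> tends to \<open>X^(n - e) g\<close>. The coefficients of
    \<open>F m\<close> below \<open>n - e\<close> tend to 0 and are discarded by the shift of the
    index.\<close>
  have G: "(\<Prod>r\<in>?R. [:- t r, 1:]) = Polynomial.monom 1 (n - e) * g"
  proof -
    have "(\<Prod>r\<in>?R. [:- t r, 1:]) = (\<Prod>r\<in>?R - R\<^sub>w. [:- t r, 1:]) * (\<Prod>r\<in>R\<^sub>w. [:- t r, 1:])"
      using finite_conjs[OF alg_x] Rw_sub by (intro prod.subset_diff) auto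
    also have "(\<Prod>r\<in>R\<^sub>w. [:- t r, 1:]) = g"
      unfolding g_def by (intro prod.cong) (auto simp: t_def)
    also have "(\<Prod>r\<in>?R - R\<^sub>w. [:- t r, 1:]) = (\<Prod>r\<in>?R - R\<^sub>w. [:0, 1:])"
      by (intro prod.cong) (auto simp: t_def)
    also have "\<dots> = Polynomial.monom 1 (n - e)"
      using finite_Rw Rw_sub by (simp add: monom_altdef card_Diff_subset n_def e_def subset_iff)
    finally show ?thesis .
  qed
  have lim: "U.wlim (\<lambda>m. Polynomial.coeff (F m) (j + (n - e))) (Polynomial.coeff g j)" for j
  proof -
    have "U.wlim (\<lambda>m. \<sigma> r (\<epsilon> m * x)) (t r)" if r: "r \<in> ?R" for r
    proof -
      have eq: "(\<lambda>m. \<sigma> r (\<epsilon> m * x)) = (\<lambda>m. \<sigma> r (\<epsilon> m) * r)"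
        using emb_mult[OF alg_x r \<epsilon>(1) x_K] emb_self[OF alg_x r] by auto
      show ?thesis
      proof (cases "r \<in> R\<^sub>w")
        case True
        have "u (\<sigma> r (\<epsilon> m) - 1) = w (\<epsilon> m - 1)" for m
          using Rw_abs[OF True, of "\<epsilon> m - 1"] emb_minus[OF r \<epsilon>(1), of 1] emb_base[OF alg_x r, of 1] \<epsilon>(1) by simp
        then have "U.wlim (\<lambda>m. \<sigma> r (\<epsilon> m)) 1"
          using \<epsilon> r by (simp add: U.wlim_def)
        then show ?thesis
          unfolding eq t_def using U.wlim_mult[OF _ U.wlim_const[OF conjs_L[OF r]]] True by fastforce
      next
        case False
        then have "U.wlim (\<lambda>m. \<sigma> r (\<epsilon> m)) 0"
          using \<epsilon> r by (simp add: U.wlim_def)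
        then show ?thesis
          unfolding eq t_def using U.wlim_mult[OF _ U.wlim_const[OF conjs_L[OF r]]] False by fastforce
      qed
    qed
    then have "U.wlim (\<lambda>m. Polynomial.coeff (F m) (j + (n - e))) (Polynomial.coeff (\<Prod>r\<in>?R. [:- t r, 1:]) (j + (n - e)))"
      unfolding F_def by (intro U.wlim_prod_coeff finite_conjs[OF alg_x])
    then show ?thesis by (simp add: G coeff_monom_mult)
  qed
  obtain r where r: "r \<in> R\<^sub>w" using Rw_nonempty by auto
  let ?b = "\<lambda>j m. Polynomial.coeff (F m) (j + (n - e))"
  have be: "?b e m = 1" for m using F_lead en by simp
  have "U.wlim (\<lambda>m. \<Sum>j\<le>e. ?b j m * r ^ j) (\<Sum>j\<le>e. Polynomial.coeff g j * r ^ j)"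
    using conjs_L[OF Rw_sub[OF r]] by (intro U.wlim_sum U.wlim_mult lim U.wlim_const) auto
  moreover have "(\<Sum>j\<le>e. Polynomial.coeff g j * r ^ j) = 0"
  proof -
    have "poly g r = 0"
      unfolding g_def poly_prod using r finite_Rw by (intro prod_zero) auto
    then show ?thesis using poly_eq_sum[of g e r] g_deg by simp
  qed
  ultimately have l0: "(\<lambda>m. u (\<Sum>j\<le>e. ?b j m * r ^ j)) \<longlonglongrightarrow> 0"
    using U.wlim_abs by fastforce
  then obtain m where m: "u (\<Sum>j\<le>e. ?b j m * r ^ j) < d"
    using order_tendstoD(2)[OF l0 d] unfolding eventually_sequentially by blast
  \<comment> \<open>The truncated polynomial has coefficients in \<open>k\<close>, so its size at
    \<open>x\<close> equals its size at the root \<open>r\<close> of \<open>g\<close>, and this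
    tends to 0.\<close>
  have wu: "w (\<Sum>j\<le>e. ?b j m * x ^ j) = u (\<Sum>j\<le>e. ?b j m * r ^ j)"
  proof -
    define p where "p = (\<Sum>j\<le>e. Polynomial.monom (?b j m) j)"
    have p: "p \<in> polys_over k" unfolding p_def using F_over by (intro over_sum) auto
    have "\<sigma> r (poly p x) = poly p r"
      using emb_poly[OF alg_x Rw_sub[OF r] p] .
    then show ?thesis
      using Rw_abs[OF r adjoin_poly[OF p]] by (simp add: p_def poly_sum poly_monom)
  qed
  \<comment> \<open>The top coefficient is exactly 1, by \<open>be\<close>, so the truncated
    polynomial does express \<open>x ^ e\<close> by lower powers up to a small error.\<close>
  have "x ^ e - lin (\<lambda>j. - ?b j m) = (\<Sum>j\<le>e. ?b j m * x ^ j)"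
    unfolding lin_def lessThan_Suc_atMost[symmetric] using be[of m] by (simp add: sum_negf)
  then show "\<exists>t. dense_pt t \<and> w (x ^ e - t) < d"
    using m wu F_over dense_lin[of "\<lambda>j. - ?b j m"] by (intro exI[of _ "lin (\<lambda>j. - ?b j m)"]) auto
qed

text \<open>Multiplication by \<open>x\<close> leaves the span of the first \<open>e\<close> powers
  only through \<open>x ^ e\<close>, which is covered by \<open>dense_x_power_e\<close>.\<close>

lemma dense_mult_x: assumes s: "dense_pt s" shows "dense_pt (x * s)"
proof (rule dense_closed)
  show "x * s \<in> K" using x_K dense_K[OF s] by auto
  fix d :: real assume d: "d > 0"
  have wx: "w x \<ge> 0" using x_K by simp
  then obtain a where a: "\<And>j. a j \<in> k" "w (s - lin a) < d / (w x + 1)"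
    using dense_ptD[OF s, of "d / (w x + 1)"] d by auto
  have "w (x * s - x * lin a) = w x * w (s - lin a)"
    unfolding right_diff_distrib[symmetric] using x_K dense_K[OF s] lin_K[OF a(1)] by (intro W.w_mult) auto
  also have "\<dots> \<le> (w x + 1) * w (s - lin a)"
    using wx dense_K[OF s] lin_K[OF a(1)] by (intro mult_right_mono) auto
  also have "\<dots> < (w x + 1) * (d / (w x + 1))"
    using a(2) wx by (intro mult_strict_left_mono) auto
  also have "\<dots> = d" using wx by simp
  finally have lt: "w (x * s - x * lin a) < d" .
  have pw: "dense_pt (x ^ Suc j)" if "j < e" for j
  proof (cases "Suc j = e")
    case True
    then show ?thesis using dense_x_power_e by simp
  next
    case False
    then have "Suc j < e" using that by simp
    then have "lin (\<lambda>i. if i = Suc j then 1 else 0) = x ^ Suc j"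
      unfolding lin_def by (simp add: if_distrib[of "\<lambda>y. y * _"] cong: if_cong)
    then show ?thesis using dense_lin[of "\<lambda>i. if i = Suc j then 1 else 0"] by simp
  qed
  have "x * lin a = (\<Sum>j<e. a j * x ^ Suc j)"
    by (simp add: lin_def sum_distrib_left mult_ac)
  also have "dense_pt \<dots>"
    using a pw by (intro dense_sum dense_smult) auto
  finally show "\<exists>t. dense_pt t \<and> w (x * s - t) < d" using lt by blast
qed

theorem dense_all: assumes "s \<in> K" shows "dense_pt s"
proof -
  have one: "dense_pt 1"
  proof -
    have "lin (\<lambda>i. if i = 0 then 1 else 0) = 1"
      unfolding lin_def using e_pos by (simp add: if_distrib[of "\<lambda>y. y * _"] cong: if_cong)
    then show ?thesis using dense_lin[of "\<lambda>i. if i = 0 then 1 else 0"] by simp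
  qed
  have "g \<in> polys_over k \<Longrightarrow> dense_pt (poly g x)" for g
  proof (induction g)
    case 0
    then show ?case using dense_lin[of "\<lambda>_. 0"] by (simp add: lin_def)
  next
    case (pCons a g)
    then show ?case using dense_add[OF dense_smult[OF one, of a] dense_mult_x[of "poly g x"]] by simp
  qed
  then show ?thesis using assms by (auto simp: adjoin_def)
qed

end

section \<open>The fields \<open>C_v\<close> and embeddings into them\<close>

text \<open>The reversal reconciles the two conventions for coefficient lists: \<open>coeffs\<close> starts with the
  constant coefficient, \<open>eval\<close> expects the leading one first.\<close>

lemma hom_extends_to_adjoin:
  fixes S (structure)
  assumes k: "complex_subfield k" and x: "alg k x" and S: "algebraically_closed S"
    and i: "i \<in> Ring.ring_hom (subring_of k) S"
  shows "\<exists>h\<in>Ring.ring_hom (subring_of (adjoin k x)) S. \<forall>a\<in>k. h a = i a"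
proof -
  interpret complex_subfield k by fact
  interpret S: algebraically_closed S by fact
  have "field (subring_of k)" using CC.subfield_iff(2)[OF subfield_k] .
  then interpret i: ring_hom_ring "subring_of k" S i
    by (intro ring_hom_ringI2) (auto intro: field.is_ring S.ring_axioms i)
  have i_closed: "i a \<in> carrier S" if "a \<in> k" for a using i.hom_closed that by simp
  have i_simps: "i (a + b) = i a \<oplus> i b" "i (a * b) = i a \<otimes> i b" if "a \<in> k" "b \<in> k" for a b
    using i.hom_add i.hom_mult that by auto
  have i01: "i 0 = \<zero>" "i 1 = \<one>" using i.hom_zero i.hom_one by auto
  have i_nz: "i a \<noteq> \<zero>" if "a \<in> k" "a \<noteq> 0" for a
  proof
    assume "i a = \<zero>"
    then have "i (a * inverse a) = \<zero>" using i_simps(2)[of a "inverse a"] that i_closed by simp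
    then show False using that i01 by simp
  qed
  define ev where "ev \<rho> cs = foldr (\<lambda>a b. i a \<oplus> \<rho> \<otimes> b) cs \<zero>" for \<rho> cs
  have ev_closed: "ev \<rho> cs \<in> carrier S" if "set cs \<subseteq> k" "\<rho> \<in> carrier S" for \<rho> cs
    using that by (induction cs) (auto simp: ev_def i_closed)
  have eval_ev: "S.eval (rev (map i cs)) \<rho> = ev \<rho> cs" if "set cs \<subseteq> k" "\<rho> \<in> carrier S" for \<rho> cs
    using that
  proof (induction cs)
    case (Cons a cs)
    moreover from this have "i ` set cs \<subseteq> carrier S" "i a \<in> carrier S"
      using i_closed by auto
    ultimately have "S.eval (rev (map i (a # cs))) \<rho> = S.eval (rev (map i cs)) \<rho> \<otimes> \<rho> \<oplus> i a"
      using S.eval_append_aux[of "rev (map i cs)" "i a" \<rho>] by simp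
    then show ?case
      using Cons ev_closed[of cs \<rho>] i_closed[of a] by (simp add: ev_def S.m_comm S.a_comm)
  qed (simp add: ev_def)
  have "\<exists>\<rho>\<in>carrier S. ev \<rho> (coeffs (minpoly k x)) = \<zero>"
  proof -
    let ?p = "rev (map i (coeffs (minpoly k x)))"
    have f: "minpoly k x \<in> polys_over k" "lead_coeff (minpoly k x) = 1" "minpoly k x \<noteq> 0"
      using minpoly_over minpoly_monic minpoly_nonzero x by auto
    have ck: "set (coeffs (minpoly k x)) \<subseteq> k"
      using f by (auto simp: coeffs_def)
    have hd: "hd ?p = \<one>"
      using f i01 by (simp add: hd_rev last_map last_coeffs_eq_coeff_degree)
    have "polynomial\<^bsub>S\<^esub> (carrier S) ?p"
      unfolding polynomial_def using ck i_closed hd S.one_not_zero by auto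
    then have p: "?p \<in> carrier (poly_ring S)"
      using univ_poly_carrier by blast
    have "length ?p = Suc (Polynomial.degree (minpoly k x))"
      using f by (simp add: length_coeffs_degree)
    moreover have "Polynomial.degree (minpoly k x) > 0"
      using card_conjs[OF x] conjs_nonempty[OF x] by simp
    ultimately have "size (S.roots ?p) > 0"
      using S.roots_over_carrier[OF p] unfolding S.splitted_def by simp
    then obtain \<rho> where "\<rho> \<in># S.roots ?p"
      by (metis multiset_nonemptyE size_empty less_irrefl)
    then have "S.is_root ?p \<rho>"
      using S.roots_mem_iff_is_root[OF p] by simp
    then show ?thesis
      using eval_ev[OF ck] unfolding S.is_root_def by auto
  qed
  then obtain \<rho> where \<rho>: "\<rho> \<in> carrier S" "ev \<rho> (coeffs (minpoly k x)) = \<zero>" by auto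
  define E where "E g = ev \<rho> (coeffs g)" for g
  have cs: "set (coeffs g) \<subseteq> k" if "g \<in> polys_over k" for g
    using that by (auto simp: coeffs_def)
  have E_closed [simp]: "E g \<in> carrier S" if "g \<in> polys_over k" for g
    unfolding E_def using ev_closed cs that \<rho> by blast
  have E_0: "E 0 = \<zero>" by (simp add: E_def ev_def)
  have E_pCons: "E (pCons a g) = i a \<oplus> \<rho> \<otimes> E g" if "a \<in> k" "g \<in> polys_over k" for a g
  proof (cases "a = 0 \<and> g = 0")
    case True
    then show ?thesis using i01 \<rho> by (simp add: E_0)
  next
    case False
    then have "coeffs (pCons a g) = a # coeffs g"
      by (auto simp: cCons_def)
    then show ?thesis by (simp add: E_def ev_def)
  qed
  have E_add: "E (g + h) = E g \<oplus> E h" if "g \<in> polys_over k" "h \<in> polys_over k" for g h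
    using that
  proof (induction g h rule: poly_induct2)
    case 0
    then show ?case by (simp add: E_0)
  next
    case (pCons a g b h)
    have c: "i a \<in> carrier S" "i b \<in> carrier S" "E g \<in> carrier S" "E h \<in> carrier S"
      using pCons.prems i_closed by auto
    have "E (pCons a g + pCons b h) = (i a \<oplus> i b) \<oplus> \<rho> \<otimes> (E g \<oplus> E h)"
      using pCons by (simp add: E_pCons i_simps)
    also have "\<dots> = (i a \<oplus> \<rho> \<otimes> E g) \<oplus> (i b \<oplus> \<rho> \<otimes> E h)"
      using c \<rho>(1) by (simp add: S.r_distr S.a_ac)
    finally show ?case using pCons.prems by (simp add: E_pCons)
  qed
  have E_smult: "E (Polynomial.smult a g) = i a \<otimes> E g" if "a \<in> k" "g \<in> polys_over k" for a g
    using that(2)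
  proof (induction g)
    case 0
    then show ?case using that i_closed by (simp add: E_0)
  next
    case (pCons b g)
    have c: "i a \<in> carrier S" "i b \<in> carrier S" "E g \<in> carrier S"
      using pCons.prems i_closed that by auto
    show ?case
      using pCons c that \<rho>(1) by (simp add: E_pCons i_simps S.r_distr S.m_ac)
  qed
  have E_mult: "E (g * h) = E g \<otimes> E h" if "g \<in> polys_over k" "h \<in> polys_over k" for g h
    using that(1)
  proof (induction g)
    case 0
    then show ?case using that by (simp add: E_0)
  next
    case (pCons a g)
    have c: "i a \<in> carrier S" "E g \<in> carrier S" "E h \<in> carrier S"
      using pCons.prems i_closed that by auto
    have "E (pCons a g * h) = E (Polynomial.smult a h + pCons 0 (g * h))"
      by (simp add: mult_pCons_left)
    also have "\<dots> = i a \<otimes> E h \<oplus> \<rho> \<otimes> (E g \<otimes> E h)"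
      using pCons that c \<rho>(1) i01 by (simp add: E_add E_smult E_pCons)
    also have "\<dots> = E (pCons a g) \<otimes> E h"
      using pCons c \<rho>(1) by (simp add: E_pCons S.l_distr S.m_assoc)
    finally show ?case .
  qed
  \<comment> \<open>This makes the extension well defined: \<rho> is a root of the image of the
    minimal polynomial, so \<open>E\<close> depends only on the value at \<open>x\<close>.\<close>
  have E_cong: "E g = E h" if gh: "g \<in> polys_over k" "h \<in> polys_over k" "poly g x = poly h x" for g h
  proof -
    have "minpoly k x dvd g - h"
      using gh by (intro minpoly_dvd[OF x]) auto
    then have "g - h = minpoly k x * ((g - h) div minpoly k x)" by simp
    moreover have q: "(g - h) div minpoly k x \<in> polys_over k"
      using over_mod_div[OF minpoly_over[OF x] minpoly_nonzero[OF x]] gh by simp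
    ultimately have "E (g - h) = E (minpoly k x) \<otimes> E ((g - h) div minpoly k x)"
      using E_mult[OF minpoly_over[OF x] q] by simp
    then have "E (g - h) = \<zero>"
      using \<rho>(2) q by (simp add: E_def[of "minpoly k x"])
    then show ?thesis
      using E_add[of "g - h" h] gh by simp
  qed
  define h where "h z = E (SOME g. g \<in> polys_over k \<and> poly g x = z)" for z
  have h_poly: "h (poly g x) = E g" if g: "g \<in> polys_over k" for g
  proof -
    have "\<exists>g'. g' \<in> polys_over k \<and> poly g' x = poly g x" using g by auto
    from someI_ex[OF this] show ?thesis
      unfolding h_def using E_cong g by blast
  qed
  have h_base: "h a = i a" if "a \<in> k" for a
    using h_poly[of "[:a:]"] that E_pCons[of a 0] i_closed[of a] \<rho>(1) by (simp add: E_0)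
  have "h \<in> Ring.ring_hom (subring_of (adjoin k x)) S"
  proof (rule ring_hom_memI)
    fix y z assume "y \<in> carrier (subring_of (adjoin k x))" "z \<in> carrier (subring_of (adjoin k x))"
    then obtain f g where fg: "f \<in> polys_over k" "g \<in> polys_over k" "y = poly f x" "z = poly g x"
      by (auto simp: adjoin_def)
    then show "h y \<in> carrier S" using h_poly by simp
    show "h (y \<otimes>\<^bsub>subring_of (adjoin k x)\<^esub> z) = h y \<otimes> h z"
      using h_poly[of "f * g"] fg by (simp add: h_poly E_mult)
    show "h (y \<oplus>\<^bsub>subring_of (adjoin k x)\<^esub> z) = h y \<oplus> h z"
      using h_poly[of "f + g"] fg by (simp add: h_poly E_add)
  next
    show "h \<one>\<^bsub>subring_of (adjoin k x)\<^esub> = \<one>"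
      using h_base[of 1] i01 by simp
  qed
  then show ?thesis using h_base by blast
qed

section \<open>The absolute values on the closure of the completion and on its completion\<close>

locale complex_completion = complex_valued
begin

abbreviation "Kw \<equiv> completion (subring_of K) w"

sublocale Kw: valued_field Kw "completion_abs w"
  by (rule V.valued_field_completion)

lemma alg_closure_Kw:
  "algebraic_closure (Kv_closure_ring K w) (Kw.indexed_const ` carrier Kw)"
  "Kw.indexed_const \<in> Ring.ring_hom Kw (Kv_closure_ring K w)"
  unfolding Kv_closure_ring_def using Kw.alg_closureE by auto

sublocale Kc: algebraic_closure "Kv_closure_ring K w" "Kw.indexed_const ` carrier Kw"
  by (rule alg_closure_Kw(1))

text \<open>This justifies the \<open>SOME\<close> in \<open>Kv_closure_abs\<close>. The absolute
  value of the completion is transported to its isomorphic copy inside the algebraic closure and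
  extended from there.\<close>

lemma Kv_closure_abs_exists:
  "\<exists>a. absolute_value (Kv_closure_ring K w) a \<and>
    (\<forall>x\<in>carrier Kw. a (Kw.indexed_const x) = completion_abs w x)"
proof -
  let ?F = "Kw.indexed_const ` carrier Kw"
  define a :: "Kv_closure \<Rightarrow> real" where "a y = completion_abs w (inv_into (carrier Kw) Kw.indexed_const y)" for y
  have a: "a (Kw.indexed_const x) = completion_abs w x" if "x \<in> carrier Kw" for x
    unfolding a_def using inv_into_f_f[OF Kw.indexed_const_inj_on that] by metis
  note hom = alg_closure_Kw(2)
  have zero: "Kw.indexed_const x = \<zero>\<^bsub>Kv_closure_ring K w\<^esub> \<longleftrightarrow> x = \<zero>\<^bsub>Kw\<^esub>" if "x \<in> carrier Kw" for x
    using ring_hom_zero[OF hom Kw.ring_axioms Kc.ring_axioms]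
      inj_on_eq_iff[OF Kw.indexed_const_inj_on that Kw.zero_closed] by metis
  have "absolute_value ((Kv_closure_ring K w)\<lparr>carrier := ?F\<rparr>) a"
    unfolding absolute_value_def
    using ring_hom_mult[OF hom, symmetric] ring_hom_add[OF hom, symmetric]
    by (simp add: a zero Kw.v_mult Kw.v_add)
  then obtain N where N: "absolute_value (Kv_closure_ring K w) N" "\<And>y. y \<in> ?F \<Longrightarrow> N y = a y"
    using absolute_value_extends[OF Kc.field_axioms Kc.subfield_axioms, of a] Kc.algebraic_extension by auto
  then show ?thesis
    using a by (intro exI[of _ N]) auto
qed

lemma Kv_closure_abs:
  "absolute_value (Kv_closure_ring K w) (Kv_closure_abs K w)"
  "x \<in> carrier Kw \<Longrightarrow> Kv_closure_abs K w (Kw.indexed_const x) = completion_abs w x"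
  unfolding Kv_closure_abs_def using someI_ex[OF Kv_closure_abs_exists] by auto

sublocale Kc: valued_field "Kv_closure_ring K w" "Kv_closure_abs K w"
  using Kc.field_axioms Kv_closure_abs(1) by (simp add: valued_field_def valued_field_axioms_def)

sublocale Cv: valued_field "Cv_ring K w" "Cv_abs K w"
  unfolding Cv_ring_def Cv_abs_def by (rule Kc.valued_field_completion)

definition \<iota> where "\<iota> x = Kw.indexed_const (to_completion (subring_of K) w x)"

lemma iota_hom: "\<iota> \<in> Ring.ring_hom (subring_of K) (Kv_closure_ring K w)"
  using ring_hom_trans[OF V.to_completion_hom alg_closure_Kw(2)] by (simp add: \<iota>_def[abs_def] comp_def)

lemma iota_abs: "x \<in> K \<Longrightarrow> Kv_closure_abs K w (\<iota> x) = w x"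
  unfolding \<iota>_def using Kv_closure_abs(2) V.completion_abs_to_completion
    ring_hom_closed[OF V.to_completion_hom] by simp

lemma Cv_emb_eq: "Cv_emb K w x = to_completion (Kv_closure_ring K w) (Kv_closure_abs K w) (\<iota> x)"
  by (simp add: Cv_emb_def \<iota>_def)

lemma Cv_emb_hom: "Cv_emb K w \<in> Ring.ring_hom (subring_of K) (Cv_ring K w)"
  using ring_hom_trans[OF iota_hom Kc.to_completion_hom]
  by (simp add: Cv_emb_eq[abs_def] Cv_ring_def comp_def)

lemma Cv_abs_emb: "x \<in> K \<Longrightarrow> Cv_abs K w (Cv_emb K w x) = w x"
  using ring_hom_closed[OF iota_hom]
  by (simp add: Cv_emb_eq Cv_abs_def Kc.completion_abs_to_completion iota_abs)

end

section \<open>Places, their restrictions and embeddings into the completed closure\<close>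

lemma padic_abs_self: "Factorial_Ring.prime p \<Longrightarrow> padic_abs p (of_nat p) = 1 / real p"
proof -
  assume p: "Factorial_Ring.prime p"
  have "quotient_of (of_nat p) = (int p, 1)"
    by (simp add: of_nat_rat quotient_of_Fract Rat.normalize_def)
  moreover have "Factorial_Ring.prime (int p)" using p by simp
  ultimately show ?thesis
    using p prime_gt_0_nat[OF p] by (simp add: padic_abs_def power_int_minus_divide multiplicity_self prime_elem_not_unit)
qed

lemma places_complex_valued:
  "complex_subfield K \<Longrightarrow> w \<in> places K \<Longrightarrow> complex_valued K w"
  unfolding places_def by (simp add: complex_valued_def complex_valued_axioms_def)

lemma places_nontrivial:
  assumes "w \<in> places K" shows "\<exists>c. 0 < w (of_rat c) \<and> w (of_rat c) < 1"
proof -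
  consider "archimedean w" | p :: nat where "Factorial_Ring.prime p" "\<And>r. w (of_rat r) = padic_abs p r"
    using assms unfolding places_def by blast
  then show ?thesis
  proof cases
    case 1
    then have e: "w (of_rat (1/2)) = \<bar>of_rat (1/2)\<bar>"
      unfolding archimedean_def by blast
    show ?thesis
      by (rule exI[of _ "1/2"], unfold e) (simp add: of_rat_divide)
  next
    case 2
    have "w (of_nat p) = 1 / real p"
      using 2(2)[of "of_nat p"] padic_abs_self[OF 2(1)] by simp
    then show ?thesis
      using prime_gt_1_nat[OF 2(1)] by (intro exI[of _ "of_nat p"]) simp
  qed
qed

lemma place_below_places:
  assumes k: "complex_subfield k" and kK: "k \<subseteq> K" and w: "w \<in> places K"
  shows "place_below k w \<in> places k"
proof -
  interpret complex_subfield k by fact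
  have r: "place_below k w x = w x" if "x \<in> k" for x
    using that by (simp add: place_below_def)
  have "absolute_value (subring_of K) w"
    using w by (simp add: places_def)
  then have "absolute_value (subring_of k) (place_below k w)"
    unfolding absolute_value_def using kK by (simp add: r subset_iff)
  then show ?thesis
    using w by (auto simp: places_def archimedean_def r place_below_def)
qed

text \<open>This justifies the \<open>SOME\<close> in \<open>ext_emb\<close>. A field
  \<open>?L\<close> containing all conjugates of a generator of \<open>K\<close> is mapped over
  \<open>k\<close> into the algebraic closure of the completion of \<open>k\<close> at
  \<open>v\<close>, and the absolute value is pulled back to \<open>?L\<close>. By
  \<open>abs_value_from_embedding\<close> the place \<open>w\<close> is induced by some embedding of
  \<open>K\<close> into \<open>?L\<close>; its composition with the map into the completed closure
  is the required homomorphism.\<close>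

theorem ext_emb_spec:
  assumes kK: "finite_extension_of k K" and w: "w \<in> places K"
  defines "v \<equiv> place_below k w"
  shows ext_emb_hom: "ext_emb k K w \<in> Ring.ring_hom (subring_of K) (Cv_ring k v)"
    and ext_emb_base: "\<forall>x\<in>k. ext_emb k K w x = Cv_emb k v x"
    and ext_emb_abs: "\<forall>x\<in>K. Cv_abs k v (ext_emb k K w x) = w x"
proof -
  have sub: "subfield k \<CC>" "subfield K \<CC>" "k \<subseteq> K" "ring.finite_dimension \<CC> k K"
    using kK by (auto simp: finite_extension_of_def)
  have vp: "v \<in> places k"
    unfolding v_def using place_below_places w sub by (simp add: complex_subfield_def)
  interpret complex_completion k v
    using places_complex_valued[OF _ vp] sub by (simp add: complex_subfield_def complex_completion_def)
  have vw: "v a = w a" if "a \<in> k" for a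
    using that by (simp add: v_def place_below_def)
  obtain x where x: "alg k x" "K = adjoin k x"
    using primitive_element[OF sub(2,3,4)] by auto
  obtain \<theta> where \<theta>: "alg k \<theta>" "conjs k x \<subseteq> adjoin k \<theta>"
    using primitive_element_finite[of "conjs k x"] finite_conjs[OF x(1)] minpoly_conj(1)[OF x(1)] by auto
  let ?L = "adjoin k \<theta>"
  interpret L: complex_subfield ?L by (rule adjoin_subfield[OF \<theta>(1)])
  obtain h0 where h0: "h0 \<in> Ring.ring_hom (subring_of ?L) (Kv_closure_ring k v)" "\<And>a. a \<in> k \<Longrightarrow> h0 a = \<iota> a"
    using hom_extends_to_adjoin[OF complex_subfield_axioms \<theta>(1) Kc.algebraically_closed_axioms iota_hom]
    by auto
  let ?u = "\<lambda>z. Kv_closure_abs k v (h0 z)"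
  have fL: "field (subring_of ?L)" using CC.subfield_iff(2)[OF L.subfield_k] .
  interpret h0: ring_hom_ring "subring_of ?L" "Kv_closure_ring k v" h0
    using h0(1) fL by (intro ring_hom_ringI2) (auto intro: field.is_ring Kc.ring_axioms)
  have h0_zero: "h0 z = \<zero>\<^bsub>Kv_closure_ring k v\<^esub> \<longleftrightarrow> z = 0" if z: "z \<in> ?L" for z
  proof
    assume h: "h0 z = \<zero>\<^bsub>Kv_closure_ring k v\<^esub>"
    show "z = 0"
    proof (rule ccontr)
      assume nz: "z \<noteq> 0"
      have "h0 (z * inverse z) = h0 z \<otimes>\<^bsub>Kv_closure_ring k v\<^esub> h0 (inverse z)"
        using h0.hom_mult[of z "inverse z"] z by simp
      then show False
        using h nz h0.hom_one h0.hom_closed[of "inverse z"] z by simp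
    qed
  qed (use h0.hom_zero in simp)
  have cl: "h0 z \<in> carrier (Kv_closure_ring k v)" if "z \<in> ?L" for z
    using h0.hom_closed that by simp
  have "absolute_value (subring_of ?L) ?u"
    unfolding absolute_value_def
    using h0_zero cl h0.hom_mult h0.hom_add Kc.v_mult Kc.v_add by simp
  then interpret U: complex_valued ?L ?u
    by (simp add: complex_valued_def complex_valued_axioms_def L.complex_subfield_axioms)
  have uv: "?u a = v a" if "a \<in> k" for a
    using h0(2) iota_abs that by simp
  obtain c where c: "0 < v (of_rat c)" "v (of_rat c) < 1"
    using places_nontrivial[OF vp] by auto
  interpret E: valued_closure k ?L ?u x c
  proof (unfold_locales)
    show "adjoin k r \<subseteq> ?L" if "r \<in> conjs k x" for r
      using adjoin_least[OF L.complex_subfield_axioms k_subset_adjoin] \<theta>(2) that by blast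
  qed (use x c uv in auto)
  have "complex_valued K w"
    using places_complex_valued w sub by (simp add: complex_subfield_def)
  then obtain r where r: "r \<in> conjs k x" "\<And>z. z \<in> K \<Longrightarrow> w z = ?u (emb k x r z)"
    using E.abs_value_from_embedding[of w] uv vw x(2) by auto
  define h where "h z = to_completion (Kv_closure_ring k v) (Kv_closure_abs k v) (h0 (emb k x r z))" for z
  note toc = Kc.to_completion_hom[folded Cv_ring_def]
  have L: "emb k x r z \<in> ?L" if "z \<in> K" for z
    using E.emb_L[OF r(1)] that x(2) by simp
  have "h \<in> Ring.ring_hom (subring_of K) (Cv_ring k v)"
  proof (rule ring_hom_memI)
    fix y z assume yz: "y \<in> carrier (subring_of K)" "z \<in> carrier (subring_of K)"
    then have L': "emb k x r y \<in> ?L" "emb k x r z \<in> ?L" using L by auto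
    show "h y \<in> carrier (Cv_ring k v)"
      using L' cl ring_hom_closed[OF toc] by (simp add: h_def)
    show "h (y \<otimes>\<^bsub>subring_of K\<^esub> z) = h y \<otimes>\<^bsub>Cv_ring k v\<^esub> h z"
      using emb_mult[OF x(1) r(1)] yz x(2) h0.hom_mult L' cl ring_hom_mult[OF toc] by (simp add: h_def)
    show "h (y \<oplus>\<^bsub>subring_of K\<^esub> z) = h y \<oplus>\<^bsub>Cv_ring k v\<^esub> h z"
      using emb_add[OF x(1) r(1)] yz x(2) h0.hom_add L' cl ring_hom_add[OF toc] by (simp add: h_def)
  next
    show "h \<one>\<^bsub>subring_of K\<^esub> = \<one>\<^bsub>Cv_ring k v\<^esub>"
      using emb_base[OF x(1) r(1), of 1] h0.hom_one ring_hom_one[OF toc] by (simp add: h_def)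
  qed
  moreover have "h a = Cv_emb k v a" if "a \<in> k" for a
    using emb_base[OF x(1) r(1) that] h0(2)[OF that] by (simp add: h_def Cv_emb_eq)
  moreover have "Cv_abs k v (h z) = w z" if "z \<in> K" for z
    using L[OF that] cl r(2)[OF that] by (simp add: h_def Cv_abs_def Kc.completion_abs_to_completion)
  ultimately have ex: "\<exists>h. h \<in> Ring.ring_hom (subring_of K) (Cv_ring k v) \<and>
    (\<forall>x\<in>k. h x = Cv_emb k v x) \<and> (\<forall>x\<in>K. Cv_abs k v (h x) = w x)" by blast
  show "ext_emb k K w \<in> Ring.ring_hom (subring_of K) (Cv_ring k v)"
    "\<forall>x\<in>k. ext_emb k K w x = Cv_emb k v x" "\<forall>x\<in>K. Cv_abs k v (ext_emb k K w x) = w x"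
    using someI_ex[OF ex] unfolding ext_emb_def v_def by auto
qed

section \<open>Local degrees\<close>

context complex_completion
begin

lemma subring_m_inv: "z \<in> K \<Longrightarrow> z \<noteq> 0 \<Longrightarrow> inv\<^bsub>subring_of K\<^esub> z = inverse z"
  by (rule V.comm_inv_char) auto

abbreviation "toc \<equiv> to_completion (subring_of K) w"

lemma combine_cls:
  assumes "\<And>a. a \<in> set as \<Longrightarrow> a \<in> V.cauchy" "\<And>y. y \<in> set ys \<Longrightarrow> y \<in> K"
  shows "(\<lambda>m. \<Sum>(a, y)\<leftarrow>zip as ys. a m * y) \<in> V.cauchy \<and>
    Kw.combine (map V.cls as) (map toc ys) = V.cls (\<lambda>m. \<Sum>(a, y)\<leftarrow>zip as ys. a m * y)"
  using assms
proof (induction as ys rule: list_induct2')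
  case (4 a as y ys)
  have IH: "(\<lambda>m. \<Sum>(a, y)\<leftarrow>zip as ys. a m * y) \<in> V.cauchy"
    "Kw.combine (map V.cls as) (map toc ys) = V.cls (\<lambda>m. \<Sum>(a, y)\<leftarrow>zip as ys. a m * y)"
    using 4 by auto
  have a: "a \<in> V.cauchy" and y: "(\<lambda>_. y) \<in> V.cauchy" using 4 by auto
  have ay: "(\<lambda>m. a m * y) \<in> V.cauchy" using V.cauchy_mult[OF a y] by simp
  show ?case
    using V.cauchy_add[OF ay IH(1)] V.cls_mult[OF a y] V.cls_add[OF ay IH(1)]
    using to_completion_def[of "subring_of K" w y] by (simp add: IH(2))
qed (use V.cauchy_const[of 0] V.cls_zero in auto)

end

locale local_completion = local_basis k L u x c w + W: complex_completion "adjoin k x" w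
  for k L u x c w
begin

abbreviation "k_seqs \<equiv> {s \<in> W.V.cauchy. \<forall>n. s n \<in> k}"

text \<open>The closure of \<open>k\<close> in the completion at \<open>w\<close>. For
  \<open>k = \<rat>\<close> it is literally the field of scalars in
  \<open>local_degree\<close>.\<close>

definition khat where "khat = W.V.cls ` k_seqs"

lemma subfield_khat: "subfield khat W.Kw"
proof (rule W.Kw.subfieldI')
  show "subring khat W.Kw"
  proof (rule W.Kw.subringI)
    show "khat \<subseteq> carrier W.Kw"
      unfolding khat_def W.V.completion_carrier by auto
    show "\<one>\<^bsub>W.Kw\<^esub> \<in> khat"
      unfolding khat_def W.V.cls_one using W.V.cauchy_const[of 1] by auto
    fix y assume "y \<in> khat"
    then obtain s where s: "s \<in> W.V.cauchy" "\<And>n. s n \<in> k" "y = W.V.cls s"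
      unfolding khat_def by auto
    let ?s = "\<lambda>n. \<ominus>\<^bsub>subring_of K\<^esub> s n"
    have s': "?s \<in> W.V.cauchy" by (rule W.V.cauchy_uminus[OF s(1)])
    have "W.V.cls ?s \<oplus>\<^bsub>W.Kw\<^esub> W.V.cls s = \<zero>\<^bsub>W.Kw\<^esub>"
      using W.V.cls_add[OF s' s(1)] W.V.l_neg[OF W.V.cauchy_carrier[OF s(1)]] W.V.cls_zero by simp
    then have "\<ominus>\<^bsub>W.Kw\<^esub> y = W.V.cls ?s"
      using s s' by (intro W.Kw.minus_equality) (auto simp: W.V.completion_carrier)
    moreover have "?s n \<in> k" for n
      using W.subring_a_inv[OF k_K[OF s(2)]] s(2) by simp
    ultimately show "\<ominus>\<^bsub>W.Kw\<^esub> y \<in> khat"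
      using s' unfolding khat_def by auto
    fix z assume "z \<in> khat"
    then obtain t where t: "t \<in> W.V.cauchy" "\<And>n. t n \<in> k" "z = W.V.cls t"
      unfolding khat_def by auto
    show "y \<otimes>\<^bsub>W.Kw\<^esub> z \<in> khat"
      using s t W.V.cls_mult[OF s(1) t(1)] W.V.cauchy_mult[OF s(1) t(1)] unfolding khat_def by auto
    show "y \<oplus>\<^bsub>W.Kw\<^esub> z \<in> khat"
      using s t W.V.cls_add[OF s(1) t(1)] W.V.cauchy_add[OF s(1) t(1)] unfolding khat_def by auto
  qed
  fix y assume y: "y \<in> khat - {\<zero>\<^bsub>W.Kw\<^esub>}"
  then obtain s where s: "s \<in> W.V.cauchy" "\<And>n. s n \<in> k" "y = W.V.cls s"
    unfolding khat_def by auto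
  then obtain t where t: "t \<in> W.V.cauchy"
    "\<And>n. t n = \<zero>\<^bsub>subring_of K\<^esub> \<or> s n \<noteq> \<zero>\<^bsub>subring_of K\<^esub> \<and> t n = inv\<^bsub>subring_of K\<^esub> (s n)"
    "(\<lambda>n. w (s n \<otimes>\<^bsub>subring_of K\<^esub> t n \<ominus>\<^bsub>subring_of K\<^esub> \<one>\<^bsub>subring_of K\<^esub>)) \<longlonglongrightarrow> 0"
    using W.V.cls_has_inverse[of s] y by blast
  have "t n \<in> k" for n
    using t(2)[of n] s(2)[of n] W.subring_m_inv[OF k_K[OF s(2)[of n]]] by auto
  then have "W.V.cls t \<in> khat" using t(1) unfolding khat_def by auto
  moreover have "y \<otimes>\<^bsub>W.Kw\<^esub> W.V.cls t = \<one>\<^bsub>W.Kw\<^esub>"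
    using t(3) W.V.cls_mult[OF s(1) t(1)] W.V.cls_one s(3)
      W.V.cls_eq_iff[OF W.V.cauchy_mult[OF s(1) t(1)] W.V.cauchy_const[of 1]] by simp
  ultimately show "inv\<^bsub>W.Kw\<^esub> y \<in> khat"
    using W.Kw.comm_inv_char[of y "W.V.cls t"] s t(1) by (auto simp: W.V.completion_carrier)
qed

section \<open>The power basis of the completion\<close>

definition power_basis where "power_basis = map W.toc (map (\<lambda>j. x ^ j) [0..<e])"

text \<open>\<open>combine\<close> stops at the end of the shorter list. Padding with zeros turns
  the sum into one over all powers below \<open>e\<close>, as needed for
  \<open>lin_bound\<close>.\<close>

lemma zip_sum:
  "(\<Sum>(a, y)\<leftarrow>zip as (map (\<lambda>j. x ^ j) [0..<e]). a m * y) =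
    (\<Sum>j<e. (if j < length as then (as ! j) m else 0) * x ^ j)"
proof -
  have "(\<Sum>(a, y)\<leftarrow>zip as (map (\<lambda>j. x ^ j) [0..<e]). a m * y) =
    (\<Sum>j<min (length as) e. (as ! j) m * x ^ j)"
    by (simp add: sum_list_sum_nth lessThan_atLeast0)
  also have "\<dots> = (\<Sum>j<e. (if j < length as then (as ! j) m else 0) * x ^ j)"
    by (rule sum.mono_neutral_cong_left) auto
  finally show ?thesis .
qed

lemma power_basis_carrier: "set power_basis \<subseteq> carrier W.Kw"
proof -
  have "W.toc (x ^ j) \<in> carrier W.Kw" for j
    using ring_hom_closed[OF W.V.to_completion_hom, of "x ^ j"] x_K by simp
  then show ?thesis unfolding power_basis_def by auto
qed

text \<open>A combination that vanishes in the completion is a null sequence of combinations in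
  \<open>K\<close>; by \<open>lin_bound\<close> its coordinates are null sequences too.\<close>

lemma power_basis_independent: "W.Kw.independent khat power_basis"
proof (rule W.Kw.trivial_combine_imp_independent[OF subfield_khat power_basis_carrier])
  fix Ks assume Ks: "set Ks \<subseteq> khat" "W.Kw.combine Ks power_basis = \<zero>\<^bsub>W.Kw\<^esub>"
  have "\<exists>as. Ks = map W.V.cls as \<and> set as \<subseteq> k_seqs"
    using Ks(1) unfolding khat_def
  proof (induction Ks)
    case (Cons y Ks)
    then obtain as s where "Ks = map W.V.cls as" "set as \<subseteq> k_seqs" "y = W.V.cls s" "s \<in> k_seqs"
      by auto
    then show ?case by (intro exI[of _ "s # as"]) simp
  qed simp
  then obtain as where as: "Ks = map W.V.cls as" "\<And>a. a \<in> set as \<Longrightarrow> a \<in> W.V.cauchy"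
    "\<And>a n. a \<in> set as \<Longrightarrow> a n \<in> k" by auto
  let ?a = "\<lambda>j m. if j < length as then (as ! j) m else 0"
  let ?s = "\<lambda>m. \<Sum>j<e. ?a j m * x ^ j"
  have c: "?s \<in> W.V.cauchy" "W.V.cls ?s = \<zero>\<^bsub>W.Kw\<^esub>"
    using W.combine_cls[of as "map (\<lambda>j. x ^ j) [0..<e]"] as x_K Ks(2)
    unfolding power_basis_def zip_sum by auto
  have lim: "(\<lambda>m. w (?s m)) \<longlonglongrightarrow> 0"
    using W.V.cls_eq_zero_iff[OF c(1)] c(2) by simp
  show "set (take (length power_basis) Ks) \<subseteq> {\<zero>\<^bsub>W.Kw\<^esub>}"
  proof
    fix y assume "y \<in> set (take (length power_basis) Ks)"
    then obtain j where j: "j < e" "j < length as" "y = W.V.cls (as ! j)"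
      by (auto simp: in_set_conv_nth as(1) power_basis_def)
    obtain C where C: "C > 0" "\<And>a. (\<And>i. i < e \<Longrightarrow> a i \<in> k) \<Longrightarrow> w (a j) \<le> C * w (\<Sum>i<e. a i * x ^ i)"
      using lin_bound[OF j(1)] by auto
    have asj: "as ! j \<in> W.V.cauchy" "\<And>m. (as ! j) m \<in> k" using as j by auto
    have "(\<lambda>m. w ((as ! j) m)) \<longlonglongrightarrow> 0"
    proof (rule tendsto_null_bound)
      show "(\<lambda>m. C * w (?s m)) \<longlonglongrightarrow> 0" using tendsto_mult_left[OF lim, of C] by simp
      fix m
      have "w (?a j m) \<le> C * w (?s m)"
        using C(2)[of "\<lambda>j. ?a j m"] as by auto
      then show "\<bar>w ((as ! j) m)\<bar> \<le> C * w (?s m)"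
        using j asj(2)[of m] k_K by simp
    qed
    then show "y \<in> {\<zero>\<^bsub>W.Kw\<^esub>}"
      using W.V.cls_eq_zero_iff[OF asj(1)] j by simp
  qed
qed

text \<open>The \<open>m\<close>-th term of a Cauchy sequence is replaced by a combination of powers
  at distance below \<open>1 / (m + 1)\<close>. The new sequence has the same class, and by
  \<open>lin_bound\<close> its coordinates are Cauchy sequences in \<open>k\<close>.\<close>

lemma power_basis_spans: "W.Kw.Span khat power_basis = carrier W.Kw"
proof -
  have "\<exists>Ks. y = W.Kw.combine Ks power_basis \<and> set Ks \<subseteq> khat" if "y \<in> carrier W.Kw" for y
  proof -
    obtain s where s: "s \<in> W.V.cauchy" "y = W.V.cls s"
      using \<open>y \<in> carrier W.Kw\<close> by (auto simp: W.V.completion_carrier)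
    have sK: "s m \<in> K" for m using W.V.cauchy_carrier[OF s(1), of m] by simp
    have "\<exists>a. (\<forall>j. a j \<in> k) \<and> w (s m - lin a) < 1 / real (Suc m)" for m
      using dense_ptD[OF dense_all[OF sK]] by simp
    then obtain a where a: "\<And>m j. a m j \<in> k" "\<And>m. w (s m - lin (a m)) < 1 / real (Suc m)"
      by metis
    have lK: "lin (a m) \<in> K" for m using lin_K a by blast
    have l0: "(\<lambda>m. w (s m - lin (a m))) \<longlonglongrightarrow> 0"
    proof (rule tendsto_null_bound[OF _ LIMSEQ_inverse_real_of_nat])
      show "\<bar>w (s m - lin (a m))\<bar> \<le> inverse (real (Suc m))" for m
        using a(2)[of m] W.w_nonneg[of "s m - lin (a m)"] sK lK by (simp add: inverse_eq_divide)
    qed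
    then have l0': "(\<lambda>m. w (s m \<ominus>\<^bsub>subring_of K\<^esub> lin (a m))) \<longlonglongrightarrow> 0"
      by (simp add: W.subring_minus sK lK)
    have lc: "(\<lambda>m. lin (a m)) \<in> W.V.cauchy"
      by (rule W.V.cauchy_if_null_diff[OF s(1) _ l0']) (use lK in simp)
    have ac: "(\<lambda>m. a m j) \<in> W.V.cauchy" if "j < e" for j
    proof (rule W.V.cauchyI)
      show "a m j \<in> carrier (subring_of K)" for m using a k_K by simp
      fix d :: real assume d: "d > 0"
      obtain C where C: "C > 0" "\<And>a. (\<And>i. i < e \<Longrightarrow> a i \<in> k) \<Longrightarrow> w (a j) \<le> C * w (\<Sum>i<e. a i * x ^ i)"
        using lin_bound[OF \<open>j < e\<close>] by auto
      obtain N where N: "\<forall>m\<ge>N. \<forall>n\<ge>N. w (lin (a m) \<ominus>\<^bsub>subring_of K\<^esub> lin (a n)) < d / C"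
        using W.V.cauchyD[OF lc, of "d / C"] d C by auto
      have "w (a m j \<ominus>\<^bsub>subring_of K\<^esub> a n j) < d" if "m \<ge> N" "n \<ge> N" for m n
      proof -
        have "w (a m j \<ominus>\<^bsub>subring_of K\<^esub> a n j) = w (a m j - a n j)"
          using a k_K by (simp add: W.subring_minus)
        also have "\<dots> \<le> C * w (\<Sum>i<e. (a m i - a n i) * x ^ i)"
          using C(2)[of "\<lambda>i. a m i - a n i"] a by auto
        also have "(\<Sum>i<e. (a m i - a n i) * x ^ i) = lin (a m) - lin (a n)"
          by (simp add: lin_def sum_subtractf left_diff_distrib)
        also have "C * w (lin (a m) - lin (a n)) < C * (d / C)"
          using N that C lK by (intro mult_strict_left_mono) (auto simp: W.subring_minus)
        finally show ?thesis using C by simp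
      qed
      then show "\<exists>N. \<forall>m\<ge>N. \<forall>n\<ge>N. w (a m j \<ominus>\<^bsub>subring_of K\<^esub> a n j) < d" by blast
    qed
    let ?as = "map (\<lambda>j m. a m j) [0..<e]"
    have "(\<lambda>m. \<Sum>j<e. (if j < length ?as then (?as ! j) m else 0) * x ^ j) = (\<lambda>m. lin (a m))"
      unfolding lin_def by (intro ext sum.cong) auto
    moreover have "b \<in> W.V.cauchy" if "b \<in> set ?as" for b
      using that ac by auto
    moreover have "y \<in> K" if "y \<in> set (map (\<lambda>j. x ^ j) [0..<e])" for y
      using that x_K by auto
    ultimately have "W.Kw.combine (map W.V.cls ?as) power_basis = W.V.cls (\<lambda>m. lin (a m))"
      using W.combine_cls[of ?as "map (\<lambda>j. x ^ j) [0..<e]"]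
      unfolding power_basis_def zip_sum by metis
    also have "\<dots> = y"
      unfolding s(2) using W.V.cls_eq_iff[OF s(1) lc] l0' by simp
    finally have "y = W.Kw.combine (map W.V.cls ?as) power_basis" ..
    moreover have "set (map W.V.cls ?as) \<subseteq> khat"
      using ac a unfolding khat_def by auto
    ultimately show ?thesis by blast
  qed
  moreover have "W.Kw.combine Ks power_basis \<in> carrier W.Kw" if "set Ks \<subseteq> khat" for Ks
    using W.Kw.combine_in_carrier[OF _ power_basis_carrier, of Ks] that subfieldE(3)[OF subfield_khat] by auto
  ultimately have "carrier W.Kw = {W.Kw.combine Ks power_basis | Ks. set Ks \<subseteq> khat}"
    by blast
  then show ?thesis
    using W.Kw.Span_eq_combine_set[OF subfield_khat power_basis_carrier] by metis
qed

theorem dim_completion: "W.Kw.dim khat (carrier W.Kw) = e"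
proof -
  have "W.Kw.dimension (length power_basis) khat (W.Kw.Span khat power_basis)"
    by (rule W.Kw.dimension_independent[OF power_basis_independent])
  then have "W.Kw.dimension e khat (carrier W.Kw)"
    unfolding power_basis_spans by (simp add: power_basis_def)
  then show ?thesis
    using W.Kw.dimI[OF subfield_khat] by (simp add: over_def)
qed

end

section \<open>The \<open>p\<close>-adic absolute values\<close>

text \<open>\<open>padic_abs\<close> reads the reduced fraction, but sums and products arise with
  unreduced ones.\<close>

lemma padic_abs_fraction:
  assumes p: "Factorial_Ring.prime p" and mn: "m \<noteq> 0" "n \<noteq> 0"
  shows "padic_abs p (of_int m / of_int n) =
    real p powi (int (multiplicity (int p) n) - int (multiplicity (int p) m))"
proof -
  obtain a b where ab: "quotient_of (of_int m / of_int n) = (a, b)" by force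
  have b: "b > 0" using quotient_of_denom_pos[OF ab] .
  have "(of_int m / of_int n :: rat) = of_int a / of_int b"
    using quotient_of_div[OF ab] .
  then have "(of_int (m * b) :: rat) = of_int (a * n)"
    using mn b by (simp add: field_simps)
  then have eq: "m * b = a * n" using of_int_eq_iff by blast
  then have a: "a \<noteq> 0" using mn b by auto
  have pp: "prime_elem (int p)" using p by simp
  have "multiplicity (int p) m + multiplicity (int p) b = multiplicity (int p) a + multiplicity (int p) n"
    using arg_cong[OF eq, of "multiplicity (int p)"] mn a b pp
    by (simp add: prime_elem_multiplicity_mult_distrib)
  then have e: "int (multiplicity (int p) b) - int (multiplicity (int p) a) =
      int (multiplicity (int p) n) - int (multiplicity (int p) m)"
    by linarith
  have "of_int m / of_int n \<noteq> (0::rat)" using mn by simp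
  then show ?thesis
    unfolding padic_abs_def ab using e by simp
qed

lemma padic_abs_0 [simp]: "padic_abs p 0 = 0"
  by (simp add: padic_abs_def)

lemma rat_fraction: "q \<noteq> 0 \<Longrightarrow> \<exists>m n. m \<noteq> 0 \<and> n > 0 \<and> coprime m n \<and> q = of_int m / (of_int n :: rat)"
proof -
  assume q: "q \<noteq> 0"
  obtain a b where ab: "quotient_of q = (a, b)" by force
  show ?thesis
    using quotient_of_denom_pos[OF ab] quotient_of_div[OF ab] quotient_of_coprime[OF ab] q
    by (intro exI[of _ a] exI[of _ b]) auto
qed

lemma padic_abs_pos: "Factorial_Ring.prime p \<Longrightarrow> q \<noteq> 0 \<Longrightarrow> padic_abs p q > 0"
  by (simp add: padic_abs_def prime_gt_0_nat)

lemma padic_abs_mult: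
  assumes p: "Factorial_Ring.prime p" shows "padic_abs p (q * r) = padic_abs p q * padic_abs p r"
proof (cases "q = 0 \<or> r = 0")
  case False
  then obtain a b c d where *: "a \<noteq> 0" "b > 0" "q = of_int a / of_int b"
    "c \<noteq> 0" "d > 0" "r = of_int c / of_int d" using rat_fraction by meson
  then have "q * r = of_int (a * c) / of_int (b * d)" by simp
  moreover have "prime_elem (int p)" "real p \<noteq> 0" using p prime_gt_0_nat[OF p] by simp_all
  ultimately show ?thesis
    using * padic_abs_fraction[OF p, of "a * c" "b * d"] padic_abs_fraction[OF p, of a b] padic_abs_fraction[OF p, of c d]
    by (simp add: prime_elem_multiplicity_mult_distrib flip: power_int_add) (simp add: algebra_simps)
qed auto

lemma padic_abs_ultrametric:
  assumes p: "Factorial_Ring.prime p"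
  shows "padic_abs p (q + r) \<le> max (padic_abs p q) (padic_abs p r)"
proof (cases "q = 0 \<or> r = 0 \<or> q + r = 0")
  case True
  then show ?thesis
    using padic_abs_pos[OF p] by (cases "q = 0"; cases "r = 0") (auto simp: less_imp_le le_max_iff_disj)
next
  case False
  then obtain a b c d where *: "a \<noteq> 0" "b > 0" "q = of_int a / of_int b"
    "c \<noteq> 0" "d > 0" "r = of_int c / of_int d" using rat_fraction by meson
  let ?v = "multiplicity (int p)"
  have bd: "b * d \<noteq> 0" using * by simp
  have q: "q = of_int (a * d) / of_int (b * d)" and r: "r = of_int (c * b) / of_int (b * d)"
    using * by auto
  have s: "q + r = of_int (a * d + c * b) / of_int (b * d)"
    unfolding q r by (simp add: add_divide_distrib)
  have nz: "a * d + c * b \<noteq> 0"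
  proof
    assume "a * d + c * b = 0"
    then have "q + r = 0" unfolding s by (simp only: of_int_0 div_0)
    then show False using False by simp
  qed
  have nu: "\<not> is_unit (int p)" using p prime_elem_not_unit[of "int p"] by simp
  have "int p ^ min (?v (a * d)) (?v (c * b)) dvd a * d + c * b"
    by (intro dvd_add multiplicity_dvd') auto
  then have "min (?v (a * d)) (?v (c * b)) \<le> ?v (a * d + c * b)"
    using nz nu by (intro multiplicity_geI) auto
  then consider "?v (a * d) \<le> ?v (a * d + c * b)" | "?v (c * b) \<le> ?v (a * d + c * b)"
    by linarith
  moreover have "padic_abs p q = real p powi (int (?v (b * d)) - int (?v (a * d)))"
    unfolding q by (rule padic_abs_fraction[OF p _ bd]) (use * in simp)
  moreover have "padic_abs p r = real p powi (int (?v (b * d)) - int (?v (c * b)))"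
    unfolding r by (rule padic_abs_fraction[OF p _ bd]) (use * in simp)
  moreover have "padic_abs p (q + r) \<le> real p powi (int (?v (b * d)) - int m)"
    if "m \<le> ?v (a * d + c * b)" for m
  proof -
    have "padic_abs p (q + r) = real p powi (int (?v (b * d)) - int (?v (a * d + c * b)))"
      unfolding s by (rule padic_abs_fraction[OF p nz bd])
    also have "\<dots> \<le> real p powi (int (?v (b * d)) - int m)"
      using that prime_gt_0_nat[OF p] by (intro power_int_increasing) auto
    finally show ?thesis .
  qed
  ultimately show ?thesis
    by (metis max.coboundedI1 max.coboundedI2)
qed

lemma padic_abs_int_le_1: "Factorial_Ring.prime p \<Longrightarrow> padic_abs p (of_int n) \<le> 1"
proof (cases "n = 0")
  case False
  assume p: "Factorial_Ring.prime p"
  have "padic_abs p (of_int n) = real p powi (- int (multiplicity (int p) n))"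
    using padic_abs_fraction[OF p False, of 1] by simp
  also have "\<dots> \<le> real p powi 0"
    using prime_gt_0_nat[OF p] by (intro power_int_increasing) auto
  finally show ?thesis by simp
qed simp

lemma padic_abs_prime:
  assumes "Factorial_Ring.prime p" "Factorial_Ring.prime l"
  shows "padic_abs p (of_nat l) = (if l = p then 1 / real p else 1)"
proof (cases "l = p")
  case False
  have "\<not> int p dvd int l"
    using assms False primes_dvd_imp_eq by (auto simp: int_dvd_int_iff)
  then have "multiplicity (int p) (int l) = 0"
    by (rule not_dvd_imp_multiplicity_0)
  then show ?thesis
    using padic_abs_fraction[OF assms(1), of "int l" 1] False prime_gt_0_nat[OF assms(2)] by simp
qed (use padic_abs_self assms in simp)

lemma prod_prime_powers:
  assumes T: "finite T" "\<And>p. p \<in> T \<Longrightarrow> Factorial_Ring.prime p"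
    and a: "a \<noteq> 0" "\<And>p. Factorial_Ring.prime p \<Longrightarrow> int p dvd a \<Longrightarrow> p \<in> T"
  shows "(\<Prod>p\<in>T. real p ^ multiplicity (int p) a) = real_of_int \<bar>a\<bar>"
proof -
  have sub: "prime_factors a \<subseteq> int ` T"
  proof
    fix P assume P: "P \<in> prime_factors a"
    then have pr: "Factorial_Ring.prime P" "P dvd a" by (auto simp: in_prime_factors_iff)
    then have "P = int (nat P)" using prime_ge_0_int[OF pr(1)] by simp
    then show "P \<in> int ` T" using a(2)[of "nat P"] pr prime_nat_iff_prime[of "nat P"]
      by (metis image_eqI prime_int_nat_transfer)
  qed
  have "(\<Prod>P\<in>int ` T. P ^ multiplicity P a) = (\<Prod>P\<in>prime_factors a. P ^ multiplicity P a)"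
  proof (rule prod.mono_neutral_right)
    show "\<forall>P\<in>int ` T - prime_factors a. P ^ multiplicity P a = 1"
      using T a by (auto simp: in_prime_factors_iff not_dvd_imp_multiplicity_0)
  qed (use T sub in auto)
  also have "\<dots> = \<bar>a\<bar>"
    using prod_prime_factors[OF a(1)] by simp
  finally have "(\<Prod>p\<in>T. int p ^ multiplicity (int p) a) = \<bar>a\<bar>"
    by (subst (asm) prod.reindex) auto
  then have "real_of_int (\<Prod>p\<in>T. int p ^ multiplicity (int p) a) = real_of_int \<bar>a\<bar>"
    by simp
  then show ?thesis by simp
qed

text \<open>\<open>T\<close> may be any finite set of primes that contains those with a nontrivial
  value. This freedom is needed because one \<open>T\<close> must later serve several functions on
  places at once.\<close>

lemma rational_product_formula:
  assumes T: "finite T" "\<And>p. p \<in> T \<Longrightarrow> Factorial_Ring.prime p"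
    and q: "q \<noteq> 0" "\<And>p. Factorial_Ring.prime p \<Longrightarrow> p \<notin> T \<Longrightarrow> padic_abs p q = 1"
  shows "\<bar>of_rat q\<bar> * (\<Prod>p\<in>T. padic_abs p q) = (1::real)"
proof -
  obtain a b where ab: "a \<noteq> 0" "b > 0" "coprime a b" "q = of_int a / of_int b"
    using rat_fraction[OF q(1)] by auto
  have v: "padic_abs p q = real p powi (int (multiplicity (int p) b) - int (multiplicity (int p) a))"
    if "Factorial_Ring.prime p" for p
    using padic_abs_fraction[OF that ab(1), of b] ab by simp
  have T': "p \<in> T" if p: "Factorial_Ring.prime p" and d: "int p dvd a \<or> int p dvd b" for p
  proof (rule ccontr)
    assume "p \<notin> T"
    have nu: "\<not> is_unit (int p)" using p prime_elem_not_unit[of "int p"] by simp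
    have "\<not> (int p dvd a \<and> int p dvd b)"
      using ab(3) nu coprime_common_divisor by blast
    moreover have "multiplicity (int p) a = 0 \<longleftrightarrow> \<not> int p dvd a" "multiplicity (int p) b = 0 \<longleftrightarrow> \<not> int p dvd b"
      using nu ab(1,2) by (simp_all add: multiplicity_eq_zero_iff)
    ultimately have "multiplicity (int p) a \<noteq> multiplicity (int p) b"
      using d by metis
    then have "int (multiplicity (int p) b) - int (multiplicity (int p) a) < 0 \<or>
        0 < int (multiplicity (int p) b) - int (multiplicity (int p) a)"
      by linarith
    moreover have "real p > 1" using prime_gt_1_nat[OF p] by simp
    ultimately have "padic_abs p q \<noteq> 1"
      using v[OF p] power_int_strict_increasing[of _ 0 "real p"] power_int_strict_increasing[of 0 _ "real p"]
      by fastforce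
    then show False using q(2)[OF p \<open>p \<notin> T\<close>] by simp
  qed
  have "(\<Prod>p\<in>T. padic_abs p q) = (\<Prod>p\<in>T. real p ^ multiplicity (int p) b / real p ^ multiplicity (int p) a)"
  proof (rule prod.cong[OF refl])
    fix p assume "p \<in> T"
    then have "Factorial_Ring.prime p" "real p \<noteq> 0" using T(2) prime_gt_0_nat by auto
    then show "padic_abs p q = real p ^ multiplicity (int p) b / real p ^ multiplicity (int p) a"
      by (simp add: v power_int_diff)
  qed
  also have "\<dots> = real_of_int \<bar>b\<bar> / real_of_int \<bar>a\<bar>"
    using prod_prime_powers[OF T, of a] prod_prime_powers[OF T, of b] T' ab by (simp add: prod_dividef)
  finally show ?thesis
    using ab by (simp add: of_rat_divide abs_divide)
qed

lemma padic_abs_finite: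
  assumes "q \<noteq> 0" shows "finite {p. Factorial_Ring.prime p \<and> padic_abs p q \<noteq> 1}"
proof -
  obtain a b where ab: "a \<noteq> 0" "b > 0" "coprime a b" "q = of_int a / of_int b"
    using rat_fraction[OF assms] by auto
  have "p \<le> nat \<bar>a\<bar> + nat b" if p: "Factorial_Ring.prime p" "padic_abs p q \<noteq> 1" for p
  proof (rule ccontr)
    assume "\<not> ?thesis"
    then have "\<not> int p dvd a" "\<not> int p dvd b"
      using ab zdvd_imp_le[of "int p" b] zdvd_imp_le[of "int p" "\<bar>a\<bar>"] by auto
    then have "padic_abs p q = 1"
      using padic_abs_fraction[OF p(1) ab(1), of b] ab by (simp add: not_dvd_imp_multiplicity_0)
    then show False using p by simp
  qed
  then have "{p. Factorial_Ring.prime p \<and> padic_abs p q \<noteq> 1} \<subseteq> {..nat \<bar>a\<bar> + nat b}" by auto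
  then show ?thesis by (rule finite_subset) simp
qed

section \<open>The product formula\<close>

lemma (in local_completion) local_degree_eq: "k = \<rat> \<Longrightarrow> local_degree K w = e"
  using dim_completion unfolding local_degree_def khat_def by simp

section \<open>The ultrametric inequality\<close>

lemma le_one_if_powers_linear:
  fixes t :: real
  assumes "t \<ge> 0" "\<And>N. t ^ N \<le> real N + 1"
  shows "t \<le> 1"
proof (rule ccontr)
  assume "\<not> t \<le> 1"
  define d where "d = t - 1"
  have d: "d > 0" using \<open>\<not> t \<le> 1\<close> by (simp add: d_def)
  obtain N where N: "real N > 2 / d\<^sup>2" using reals_Archimedean2 by blast
  have N0: "real N > 0" using N d by (meson divide_pos_pos less_trans zero_less_numeral zero_less_power)
  have "1 + real N * d \<le> t ^ N"
    using Bernoulli_inequality[of d N] d by (simp add: d_def)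
  \<comment> \<open>Bernoulli's bound grows only linearly in \<open>N\<close>; its square, taken at
    the exponent \<open>2 * N\<close>, is quadratic and exceeds \<open>2 * N + 1\<close> once
    \<open>N > 2 / d^2\<close>.\<close>
  then have "(1 + real N * d)\<^sup>2 \<le> (t ^ N)\<^sup>2"
    using d by (intro power_mono) auto
  also have "\<dots> = t ^ (2 * N)" by (simp add: power_mult[symmetric] mult.commute)
  also have "\<dots> \<le> 2 * real N + 1" using assms(2)[of "2 * N"] by simp
  finally have "(1 + real N * d)\<^sup>2 \<le> 2 * real N + 1" .
  moreover have "(1 + real N * d)\<^sup>2 = 1 + 2 * (real N * d) + real N * (real N * d\<^sup>2)"
    by (simp add: power2_eq_square algebra_simps)
  moreover have "real N * d > 0" using d N0 by simp
  ultimately have "real N * (real N * d\<^sup>2) \<le> real N * 2"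
    by linarith
  then have "real N * d\<^sup>2 \<le> 2" using N0 by simp
  then show False using N d by (simp add: field_simps)
qed

context complex_valued
begin

text \<open>A place is only assumed to satisfy the triangle inequality. Integers have value at most
  1, so every term of the binomial expansion of \<open>(x + y) ^ N\<close> is at most the
  \<open>N\<close>-th power of the maximum, and the number \<open>N + 1\<close> of terms disappears
  on comparing powers.\<close>

lemma ultrametric:
  assumes p: "Factorial_Ring.prime p" and w: "\<And>q. w (of_rat q) = padic_abs p q" and xy: "x \<in> K" "y \<in> K"
  shows "w (x + y) \<le> max (w x) (w y)"
proof (cases "max (w x) (w y) = 0")
  case True
  then have "w x \<le> 0" "w y \<le> 0" by (metis max.cobounded1, metis True max.cobounded2)
  then have "w x = 0" "w y = 0" using xy w_nonneg by (meson antisym)+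
  then show ?thesis using xy by simp
next
  case False
  define M where "M = max (w x) (w y)"
  have "M \<ge> 0" using xy by (simp add: M_def le_max_iff_disj)
  then have M: "M > 0" using False by (simp add: M_def)
  have le: "w x \<le> M" "w y \<le> M" by (simp_all add: M_def)
  have nat: "w (of_nat n) \<le> 1" for n
    using w[of "of_nat n"] padic_abs_int_le_1[OF p, of "int n"] by simp
  have "(w (x + y) / M) ^ N \<le> real N + 1" for N
  proof -
    have "w ((x + y) ^ N) \<le> (\<Sum>i\<le>N. w (of_nat (N choose i) * x ^ i * y ^ (N - i)))"
      unfolding binomial_ring using xy by (intro w_sum) auto
    also have "\<dots> \<le> (\<Sum>i\<le>N. M ^ N)"
    proof (rule sum_mono)
      fix i assume i: "i \<in> {..N}"
      have "w (of_nat (N choose i) * x ^ i * y ^ (N - i)) = w (of_nat (N choose i)) * (w x ^ i * w y ^ (N - i))"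
        using xy by (simp add: w_mult w_power mult.assoc)
      also have "\<dots> \<le> 1 * (M ^ i * M ^ (N - i))"
        using xy nat le M by (intro mult_mono power_mono) auto
      also have "\<dots> = M ^ N" using i by (simp flip: power_add)
      finally show "w (of_nat (N choose i) * x ^ i * y ^ (N - i)) \<le> M ^ N" .
    qed
    finally have "w (x + y) ^ N \<le> (real N + 1) * M ^ N" using xy by (simp add: w_power add.commute)
    then show ?thesis using M by (simp add: power_divide divide_le_eq)
  qed
  then have "w (x + y) / M \<le> 1"
    using M xy by (intro le_one_if_powers_linear) auto
  then show ?thesis using M by (simp add: M_def[symmetric])
qed

lemma ultrametric_diff:
  assumes "Factorial_Ring.prime p" "\<And>q. w (of_rat q) = padic_abs p q" "x \<in> K" "y \<in> K"
  shows "w (x - y) \<le> max (w x) (w y)"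
  using ultrametric[OF assms(1,2), of x "- y"] assms by simp

lemma ultrametric_sum:
  assumes p: "Factorial_Ring.prime p" "\<And>q. w (of_rat q) = padic_abs p q" and B: "B \<ge> 0"
  shows "(\<And>i. i \<in> I \<Longrightarrow> f i \<in> K \<and> w (f i) \<le> B) \<Longrightarrow> w (sum f I) \<le> B"
proof (induction I rule: infinite_finite_induct)
  case (insert i I)
  have "w (sum f (insert i I)) \<le> max (w (f i)) (w (sum f I))"
    using insert by (auto intro!: ultrametric[OF p])
  then show ?case using insert by fastforce
qed (use B in auto)

lemma root_bound:
  assumes p: "Factorial_Ring.prime p" "\<And>q. w (of_rat q) = padic_abs p q"
    and F: "F \<in> polys_over K" "lead_coeff F = 1" "\<And>j. w (Polynomial.coeff F j) \<le> 1"
    and s: "s \<in> K" "poly F s = 0"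
  shows "w s \<le> 1"
proof (rule ccontr)
  assume "\<not> w s \<le> 1"
  then have t: "w s > 1" by simp
  define n where "n = Polynomial.degree F"
  have "n \<noteq> 0"
  proof
    assume "n = 0"
    then obtain c where "F = [:c:]" by (auto simp: n_def elim: degree_eq_zeroE)
    then show False using F(2) s(2) by simp
  qed
  then obtain m where m: "n = Suc m" by (cases n) auto
  have "poly F s = (\<Sum>j<n. Polynomial.coeff F j * s ^ j) + s ^ n"
    using F(2) by (simp add: poly_altdef n_def lessThan_Suc_atMost[symmetric])
  then have "s ^ n = - (\<Sum>j<n. Polynomial.coeff F j * s ^ j)"
    using s(2) by (simp add: eq_neg_iff_add_eq_0 add.commute)
  then have "w (s ^ n) = w (\<Sum>j<n. Polynomial.coeff F j * s ^ j)"
    using s F by (simp add: k_sum)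
  also have "\<dots> \<le> w s ^ m"
  proof (rule ultrametric_sum[OF p])
    fix j assume "j \<in> {..<n}"
    then have "w s ^ j \<le> w s ^ m" using t m by (intro power_increasing) auto
    then show "Polynomial.coeff F j * s ^ j \<in> K \<and> w (Polynomial.coeff F j * s ^ j) \<le> w s ^ m"
      using F s mult_mono[OF F(3)[of j], of "w s ^ j" "w s ^ m"] t by (simp add: w_mult w_power)
  qed (use t in simp)
  finally have "w s ^ Suc m \<le> w s ^ m" using s m by (simp add: w_power w_mult)
  moreover have "w s ^ m < w s ^ Suc m" using t by (intro power_strict_increasing) auto
  ultimately show False by simp
qed

end

lemma cmod_of_rat: "cmod (of_rat q) = \<bar>of_rat q\<bar>"
  by (cases q) (simp add: of_rat_rat norm_divide abs_divide)

lemma complex_subfield_Rats: "complex_subfield \<rat>"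
  unfolding complex_subfield_def by (rule CC_subfieldI) auto

lemma padic_abs_on_field:
  assumes L: "complex_subfield L" "\<And>z. z \<in> L \<Longrightarrow> alg \<rat> z" and p: "Factorial_Ring.prime p"
  shows "\<exists>u. absolute_value (subring_of L) u \<and> (\<forall>q. u (of_rat q) = padic_abs p q)"
proof -
  interpret Q: complex_subfield \<rat> by (rule complex_subfield_Rats)
  interpret L: complex_subfield L by fact
  have fL: "field (subring_of L)" using Q.CC.subfield_iff(2)[OF L.subfield_k] .
  then interpret FL: field "subring_of L" .
  define a where "a z = padic_abs p (inv_into UNIV of_rat z)" for z :: complex
  have a: "a (of_rat q) = padic_abs p q" for q
    unfolding a_def by (subst inv_f_f) (auto simp: inj_def)
  have Q: "subfield \<rat> (subring_of L)"
    using Q.CC.subfield_iff(2)[OF Q.subfield_k] L.Rats_subset by (intro FL.subfield_iff(1)) auto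
  have "absolute_value ((subring_of L)\<lparr>carrier := \<rat>\<rparr>) a"
    unfolding absolute_value_def
  proof (intro conjI ballI)
    fix y z assume "y \<in> carrier ((subring_of L)\<lparr>carrier := \<rat>\<rparr>)" "z \<in> carrier ((subring_of L)\<lparr>carrier := \<rat>\<rparr>)"
    then obtain q r where q: "y = of_rat q" and r: "z = of_rat r" by (auto elim!: Rats_cases)
    have nn: "padic_abs p q \<ge> 0" for q using padic_abs_pos[OF p, of q] by (cases "q = 0") auto
    show "0 \<le> a y" using nn by (simp add: q a)
    show "a y = 0 \<longleftrightarrow> y = \<zero>\<^bsub>(subring_of L)\<lparr>carrier := \<rat>\<rparr>\<^esub>"
      using padic_abs_pos[OF p, of q] a[of 0] by (cases "q = 0") (auto simp: q a)
    show "a (y \<otimes>\<^bsub>(subring_of L)\<lparr>carrier := \<rat>\<rparr>\<^esub> z) = a y * a z"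
      using a[of "q * r"] by (simp add: q r a padic_abs_mult[OF p] of_rat_mult)
    show "a (y \<oplus>\<^bsub>(subring_of L)\<lparr>carrier := \<rat>\<rparr>\<^esub> z) \<le> a y + a z"
      using a[of "q + r"] padic_abs_ultrametric[OF p, of q r] nn[of q] nn[of r] by (simp add: q r a of_rat_add)
  qed
  moreover have "(ring.algebraic (subring_of L) over \<rat>) z" if "z \<in> carrier (subring_of L)" for z
    using L(2) that Q.CC.algebraic_consistent[OF subfieldE(1)[OF L.subfield_k]] by simp
  ultimately obtain u where u: "absolute_value (subring_of L) u" "\<And>z. z \<in> \<rat> \<Longrightarrow> u z = a z"
    using absolute_value_extends[OF fL Q, of a] by blast
  then show ?thesis using a by (intro exI[of _ u]) auto
qed

section \<open>The places of a number field\<close>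

locale number_field = Q: complex_subfield \<rat> +
  fixes x :: complex
  assumes alg_x: "alg \<rat> x"
begin

definition \<theta> where "\<theta> = (SOME \<theta>. alg \<rat> \<theta> \<and> conjs \<rat> x \<subseteq> adjoin \<rat> \<theta>)"
abbreviation "L \<equiv> adjoin \<rat> \<theta>"
abbreviation "K \<equiv> adjoin \<rat> x"
abbreviation "R \<equiv> conjs \<rat> x"
abbreviation "\<sigma> \<equiv> emb \<rat> x"
abbreviation "n \<equiv> card R"

lemma theta: "alg \<rat> \<theta>" "R \<subseteq> L"
proof -
  have "\<exists>\<theta>. alg \<rat> \<theta> \<and> conjs \<rat> x \<subseteq> adjoin \<rat> \<theta>"
    using Q.primitive_element_finite[OF Q.finite_conjs[OF alg_x]] Q.minpoly_conj(1)[OF alg_x] by blast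
  from someI_ex[OF this] show "alg \<rat> \<theta>" "R \<subseteq> L" unfolding \<theta>_def by auto
qed

sublocale L: complex_subfield L by (rule Q.adjoin_subfield[OF theta(1)])
sublocale K: complex_subfield K by (rule Q.adjoin_subfield[OF alg_x])

lemma L_alg: "z \<in> L \<Longrightarrow> alg \<rat> z"
  using Q.finite_extension_algebraic[OF L.subfield_k Q.CC.finite_dimensionI[OF Q.adjoin_dimension[OF theta(1)]]] .

text \<open>The index \<open>0\<close> stands for the archimedean place of the rationals.\<close>

definition idx :: "nat \<Rightarrow> bool" where "idx i \<longleftrightarrow> i = 0 \<or> Factorial_Ring.prime i"
definition vQ :: "nat \<Rightarrow> rat \<Rightarrow> real" where "vQ i q = (if i = 0 then \<bar>of_rat q\<bar> else padic_abs i q)"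
text \<open>Over each place of the rationals one absolute value on \<open>L\<close> is fixed. All
  places of \<open>K\<close> above it arise from this one by varying the embedding of
  \<open>K\<close> into \<open>L\<close>.\<close>

definition U where "U i = (if i = 0 then cmod else
  (SOME u. absolute_value (subring_of L) u \<and> (\<forall>q. u (of_rat q) = padic_abs i q)))"

lemma U: assumes "idx i" shows U_valued: "complex_valued L (U i)" and U_rat: "U i (of_rat q) = vQ i q"
proof -
  have "absolute_value (subring_of L) (U i) \<and> (\<forall>q. U i (of_rat q) = vQ i q)"
  proof (cases "i = 0")
    case True
    then show ?thesis
      by (auto simp: U_def vQ_def absolute_value_def norm_mult norm_triangle_ineq cmod_of_rat)
  next
    case False
    then have "Factorial_Ring.prime i" using assms by (simp add: idx_def)
    from someI_ex[OF padic_abs_on_field[OF L.complex_subfield_axioms L_alg this]] False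
    show ?thesis by (simp add: U_def vQ_def)
  qed
  then show "complex_valued L (U i)" "U i (of_rat q) = vQ i q"
    by (simp_all add: complex_valued_def complex_valued_axioms_def L.complex_subfield_axioms)
qed

lemma vQ_nontrivial: "idx i \<Longrightarrow> \<exists>c. 0 < vQ i c \<and> vQ i c < 1"
proof (cases "i = 0")
  case True
  then show ?thesis by (intro exI[of _ "1/2"]) (simp add: vQ_def of_rat_divide)
next
  case False
  assume "idx i"
  then have "Factorial_Ring.prime i" using False by (simp add: idx_def)
  then show ?thesis
    using padic_abs_self[of i] prime_gt_1_nat[of i] False by (intro exI[of _ "of_nat i"]) (simp add: vQ_def)
qed

lemma adjoin_conj_L: "r \<in> R \<Longrightarrow> adjoin \<rat> r \<subseteq> L"
  using Q.adjoin_least[OF L.complex_subfield_axioms Q.k_subset_adjoin] theta(2) by blast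

lemma closure: assumes "idx i" shows "\<exists>c. valued_closure \<rat> L (U i) x c"
proof -
  obtain c where c: "0 < vQ i c" "vQ i c < 1" using vQ_nontrivial[OF assms] by auto
  have "valued_closure \<rat> L (U i) x c"
    unfolding valued_closure_def valued_closure_axioms_def
    using Q.complex_subfield_axioms U[OF assms] alg_x adjoin_conj_L c by auto
  then show ?thesis ..
qed

definition pl where "pl i r = restrict (\<lambda>z. U i (\<sigma> r z)) K"

lemma pl_eq: "z \<in> K \<Longrightarrow> pl i r z = U i (\<sigma> r z)"
  by (simp add: pl_def)

lemma pl_rat: "idx i \<Longrightarrow> r \<in> R \<Longrightarrow> pl i r (of_rat q) = vQ i q"
  using Q.emb_base[OF alg_x, of r "of_rat q"] U_rat by (simp add: pl_eq)

lemma pl_valued: assumes "idx i" "r \<in> R" shows "complex_valued K (pl i r)"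
proof -
  obtain c where "valued_closure \<rat> L (U i) x c" using closure[OF assms(1)] ..
  then have "complex_valued K (\<lambda>z. U i (\<sigma> r z))"
    by (rule valued_closure.complex_valued_emb[OF _ assms(2)])
  then show ?thesis
    unfolding complex_valued_def complex_valued_axioms_def absolute_value_def by (simp add: pl_eq)
qed

lemma pl_place: assumes "idx i" "r \<in> R" shows "pl i r \<in> places K"
  using complex_valued.abs_w[OF pl_valued[OF assms]] pl_rat[OF assms] assms(1)
  unfolding places_def idx_def archimedean_def by (auto simp: pl_def vQ_def)

text \<open>This is \<open>abs_value_from_embedding\<close> over the rationals. Since places are
  extensional, agreement on \<open>K\<close> is equality.\<close>

lemma places_cases:
  assumes w: "w \<in> places K" shows "\<exists>i r. idx i \<and> r \<in> R \<and> w = pl i r"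
proof -
  have "\<exists>i. idx i \<and> (\<forall>q. w (of_rat q) = vQ i q)"
    using w unfolding places_def archimedean_def idx_def vQ_def
    by (auto dest: prime_gt_0_nat)
  then obtain i where i: "idx i" "\<And>q. w (of_rat q) = vQ i q" by auto
  obtain c where "valued_closure \<rat> L (U i) x c" using closure[OF i(1)] ..
  then have "\<exists>r\<in>R. \<forall>z\<in>K. w z = U i (\<sigma> r z)"
    by (rule valued_closure.abs_value_from_embedding)
      (use places_complex_valued[OF K.complex_subfield_axioms w] i U_rat in \<open>auto elim!: Rats_cases\<close>)
  then obtain r where r: "r \<in> R" "\<And>z. z \<in> K \<Longrightarrow> w z = U i (\<sigma> r z)" by auto
  have "w = pl i r"
    using w r unfolding places_def pl_def by (auto simp: fun_eq_iff extensional_def restrict_def)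
  then show ?thesis using i r by blast
qed

text \<open>For a prime \<open>i\<close>, the number \<open>i\<close> has value below 1 at the index
  \<open>i\<close> and value at least 1 at every other index.\<close>

lemma vQ_inj:
  assumes "idx i" "idx j" "\<And>q. vQ i q = vQ j q" shows "i = j"
proof (rule ccontr)
  assume ne: "i \<noteq> j"
  have *: False if i: "Factorial_Ring.prime i" and j: "idx j" "i \<noteq> j" and e: "\<And>q. vQ i q = vQ j q" for i j
  proof -
    have i0: "i \<noteq> 0" "real i > 1" using prime_gt_1_nat[OF i] by auto
    have 1: "vQ i (of_nat i) = 1 / real i" using padic_abs_self[OF i] i0 by (simp add: vQ_def)
    have "vQ j (of_nat i) \<ge> 1"
      using j padic_abs_prime[OF _ i, of j] i0 by (cases "j = 0") (auto simp: idx_def vQ_def)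
    moreover have "1 / real i < 1" using i0 by simp
    ultimately show False using 1 e[of "of_nat i"] by linarith
  qed
  show False
    using *[of i j] *[of j i] assms ne unfolding idx_def by metis
qed

lemma pl_inj: "idx i \<Longrightarrow> idx j \<Longrightarrow> r \<in> R \<Longrightarrow> s \<in> R \<Longrightarrow> pl i r = pl j s \<Longrightarrow> i = j"
  using pl_rat by (intro vQ_inj) metis+

text \<open>The embeddings counted by \<open>e\<close> in \<open>dim_completion\<close> are exactly
  the fibre of \<open>pl i\<close> over the place.\<close>

lemma local_degree_pl:
  assumes i: "idx i" and r: "r \<in> R"
  shows "local_degree K (pl i r) = card {s \<in> R. pl i s = pl i r}"
proof -
  obtain c where c: "valued_closure \<rat> L (U i) x c" using closure[OF i] ..
  have "local_completion \<rat> L (U i) x c (pl i r)"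
    unfolding local_completion_def complex_completion_def local_basis_def local_basis_axioms_def
    using c pl_valued[OF i r] pl_rat[OF i r] U_rat[OF i] by (auto elim!: Rats_cases)
  then interpret C: local_completion \<rat> L "U i" x c "pl i r" .
  have "C.R\<^sub>w = {s \<in> R. pl i s = pl i r}"
    unfolding C.R\<^sub>w_def by (auto simp: pl_def fun_eq_iff restrict_def)
  then show ?thesis
    using C.local_degree_eq unfolding C.e_def by simp
qed

lemma global_degree_eq: "global_degree K = n"
  unfolding global_degree_def Q.card_conjs[OF alg_x]
  using Q.CC.dimI[OF Q.subfield_k Q.adjoin_dimension[OF alg_x]] by (simp add: over_def)

section \<open>Norms, finiteness and the product formula\<close>

lemma finite_R: "finite R" and n_pos: "n > 0"
  using Q.finite_conjs[OF alg_x] Q.conjs_nonempty[OF alg_x] by auto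

lemma sigma_L: "r \<in> R \<Longrightarrow> z \<in> K \<Longrightarrow> \<sigma> r z \<in> L"
  using Q.emb_in_adjoin[OF alg_x] adjoin_conj_L by blast

text \<open>The rational number is the norm of \<open>z\<close>, the product of its
  conjugates.\<close>

lemma U_norm:
  assumes z: "z \<in> K" "z \<noteq> 0"
  shows "\<exists>q. q \<noteq> 0 \<and> (\<forall>i. idx i \<longrightarrow> (\<Prod>r\<in>R. U i (\<sigma> r z)) = vQ i q)"
proof -
  obtain q where q: "(\<Prod>r\<in>R. \<sigma> r z) = of_rat q"
    using Q.prod_emb_in[OF alg_x z(1)] by (auto elim!: Rats_cases)
  have "(\<Prod>r\<in>R. \<sigma> r z) \<noteq> 0"
    using finite_R Q.emb_eq_0_iff[OF alg_x _ z(1)] z(2) by (simp add: prod_zero_iff)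
  moreover have "(\<Prod>r\<in>R. U i (\<sigma> r z)) = vQ i q" if i: "idx i" for i
    using complex_valued.w_prod[OF U_valued[OF i], of R "\<lambda>r. \<sigma> r z"] sigma_L z(1) q U_rat[OF i] by simp
  ultimately show ?thesis using q by (intro exI[of _ q]) auto
qed

text \<open>The conjugates of \<open>y\<close> are the roots of a monic rational polynomial. Outside
  the finitely many primes at which one of its nonzero coefficients is not a unit, its coefficients
  are integral, and then \<open>root_bound\<close> applies to its roots.\<close>

lemma finite_large:
  assumes y: "y \<in> K" shows "finite {p. Factorial_Ring.prime p \<and> (\<exists>r\<in>R. U p (\<sigma> r y) > 1)}"
proof -
  define F where "F = (\<Prod>r\<in>R. [:- \<sigma> r y, 1:])"
  have F: "F \<in> polys_over \<rat>" unfolding F_def by (rule Q.prod_emb_over[OF alg_x y])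
  then have "\<forall>j. \<exists>q. Polynomial.coeff F j = of_rat q"
    unfolding polys_over_def by (auto elim!: Rats_cases)
  then obtain q where q: "\<And>j. Polynomial.coeff F j = of_rat (q j)" by metis
  define B where "B = (\<Union>j\<in>{j. j \<le> Polynomial.degree F \<and> q j \<noteq> 0}. {p. Factorial_Ring.prime p \<and> padic_abs p (q j) \<noteq> 1})"
  have "finite B" unfolding B_def by (intro finite_UN_I padic_abs_finite) auto
  have le1: "U p (\<sigma> r y) \<le> 1" if p: "Factorial_Ring.prime p" "p \<notin> B" and r: "r \<in> R" for p r
  proof -
    have i: "idx p" using p by (simp add: idx_def)
    have p0: "p \<noteq> 0" using p(1) by (metis not_prime_0)
    interpret Up: complex_valued L "U p" by (rule U_valued[OF i])
    show ?thesis
    proof (rule Up.root_bound[OF p(1)])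
      show "U p (of_rat q) = padic_abs p q" for q using U_rat[OF i] p0 by (simp add: vQ_def)
      show "F \<in> polys_over L" using F L.Rats_subset unfolding polys_over_def by blast
      show "lead_coeff F = 1" unfolding F_def by (simp add: lead_coeff_prod)
      show "poly F (\<sigma> r y) = 0" unfolding F_def using r finite_R by (auto simp: poly_prod prod_zero_iff)
      show "\<sigma> r y \<in> L" by (rule sigma_L[OF r y])
      fix j
      have "padic_abs p (q j) \<le> 1"
      proof (cases "q j = 0")
        case False
        then have "Polynomial.coeff F j \<noteq> 0" using q by simp
        then have "j \<le> Polynomial.degree F" by (rule le_degree)
        then show ?thesis using p False unfolding B_def by auto
      qed simp
      then show "U p (Polynomial.coeff F j) \<le> 1"
        using U_rat[OF i, of "q j"] p0 by (simp add: q vQ_def)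
    qed
  qed
  have "{p. Factorial_Ring.prime p \<and> (\<exists>r\<in>R. U p (\<sigma> r y) > 1)} \<subseteq> B"
  proof
    fix p assume "p \<in> {p. Factorial_Ring.prime p \<and> (\<exists>r\<in>R. U p (\<sigma> r y) > 1)}"
    then obtain r where r: "Factorial_Ring.prime p" "r \<in> R" "U p (\<sigma> r y) > 1" by auto
    show "p \<in> B"
    proof (rule ccontr)
      assume "p \<notin> B"
      then show False using le1[OF r(1) _ r(2)] r(3) by simp
    qed
  qed
  then show ?thesis using \<open>finite B\<close> by (rule finite_subset)
qed

lemma finite_support:
  assumes z: "z \<in> K" "z \<noteq> 0" shows "finite {p. Factorial_Ring.prime p \<and> (\<exists>r\<in>R. U p (\<sigma> r z) \<noteq> 1)}"
proof (rule finite_subset)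
  show "finite ({p. Factorial_Ring.prime p \<and> (\<exists>r\<in>R. U p (\<sigma> r z) > 1)} \<union>
    {p. Factorial_Ring.prime p \<and> (\<exists>r\<in>R. U p (\<sigma> r (inverse z)) > 1)})"
    using finite_large[of z] finite_large[of "inverse z"] z by auto
  show "{p. Factorial_Ring.prime p \<and> (\<exists>r\<in>R. U p (\<sigma> r z) \<noteq> 1)} \<subseteq> {p. Factorial_Ring.prime p \<and> (\<exists>r\<in>R. U p (\<sigma> r z) > 1)} \<union>
    {p. Factorial_Ring.prime p \<and> (\<exists>r\<in>R. U p (\<sigma> r (inverse z)) > 1)}"
  proof
    fix p assume "p \<in> {p. Factorial_Ring.prime p \<and> (\<exists>r\<in>R. U p (\<sigma> r z) \<noteq> 1)}"
    then obtain r where p: "Factorial_Ring.prime p" and r: "r \<in> R" "U p (\<sigma> r z) \<noteq> 1" by auto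
    have i: "idx p" using p by (simp add: idx_def)
    interpret w: complex_valued K "pl p r" by (rule pl_valued[OF i r(1)])
    have "pl p r z > 0" using w.w_pos z by simp
    moreover have "pl p r (inverse z) = inverse (pl p r z)" using w.w_inverse z by simp
    ultimately have "pl p r z > 1 \<or> pl p r (inverse z) > 1"
      using r(2) z by (auto simp: pl_eq one_less_inverse_iff)
    then show "p \<in> {p. Factorial_Ring.prime p \<and> (\<exists>r\<in>R. U p (\<sigma> r z) > 1)} \<union>
      {p. Factorial_Ring.prime p \<and> (\<exists>r\<in>R. U p (\<sigma> r (inverse z)) > 1)}"
      using p r z by (auto simp: pl_eq)
  qed
qed

theorem product_formula:
  assumes z: "z \<in> K" "z \<noteq> 0" and T: "finite T" "\<And>p. p \<in> T \<Longrightarrow> Factorial_Ring.prime p"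
    and supp: "\<And>p r. Factorial_Ring.prime p \<Longrightarrow> p \<notin> T \<Longrightarrow> r \<in> R \<Longrightarrow> U p (\<sigma> r z) = 1"
  shows "(\<Prod>i\<in>insert 0 T. \<Prod>r\<in>R. U i (\<sigma> r z)) = 1"
proof -
  obtain q where q: "q \<noteq> 0" "\<And>i. idx i \<Longrightarrow> (\<Prod>r\<in>R. U i (\<sigma> r z)) = vQ i q"
    using U_norm[OF z] by auto
  have 0: "0 \<notin> T" using T(2) not_prime_0 by blast
  have p: "vQ p q = padic_abs p q" if "Factorial_Ring.prime p" for p
    using that not_prime_0 by (auto simp: vQ_def)
  have "padic_abs p q = 1" if "Factorial_Ring.prime p" "p \<notin> T" for p
    using q(2)[of p] p[OF that(1)] supp[OF that] that by (simp add: idx_def)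
  then have "\<bar>of_rat q\<bar> * (\<Prod>p\<in>T. padic_abs p q) = (1::real)"
    by (intro rational_product_formula T q(1))
  moreover have "(\<Prod>i\<in>insert 0 T. \<Prod>r\<in>R. U i (\<sigma> r z)) = vQ 0 q * (\<Prod>p\<in>T. vQ p q)"
    using T 0 q(2) by (simp add: idx_def)
  moreover have "(\<Prod>p\<in>T. vQ p q) = (\<Prod>p\<in>T. padic_abs p q)"
    using T p by (intro prod.cong) auto
  ultimately show ?thesis by (simp add: vQ_def)
qed

end

section \<open>Products over all places\<close>

text \<open>This is \<open>height_over\<close> with the bundle norm replaced by an arbitrary local
  factor, so that heights can be compared with products of a different origin.\<close>

definition place_prod :: "complex set \<Rightarrow> ((complex \<Rightarrow> real) \<Rightarrow> real) \<Rightarrow> real"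
  where "place_prod K G = (\<Prod>w\<in>{w \<in> places K. G w \<noteq> 1}.
    G w powr (real (local_degree K w) / real (global_degree K)))"

context number_field
begin

text \<open>A place has as many preimages under \<open>(i, r) \<mapsto> pl i r\<close> as its local
  degree. So the product weighted by local degrees is an \<open>n\<close>-th root of an unweighted
  product over pairs.\<close>

lemma place_prod_eq:
  assumes pos: "\<And>w. w \<in> places K \<Longrightarrow> G w > 0" and T: "finite T" "\<And>p. p \<in> T \<Longrightarrow> Factorial_Ring.prime p"
    and supp: "\<And>p r. Factorial_Ring.prime p \<Longrightarrow> p \<notin> T \<Longrightarrow> r \<in> R \<Longrightarrow> G (pl p r) = 1"
  shows "place_prod K G = (\<Prod>i\<in>insert 0 T. \<Prod>r\<in>R. G (pl i r)) powr (1 / real n)"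
proof -
  let ?A = "insert 0 T \<times> R" and ?\<pi> = "\<lambda>(i, r). pl i r"
  have idx: "idx i" if "i \<in> insert 0 T" for i using that T by (auto simp: idx_def)
  have fA: "finite ?A" using T finite_R by simp
  have gpos: "G (?\<pi> a) > 0" if "a \<in> ?A" for a
    using that pos pl_place idx by auto
  have deg: "local_degree K w = card {a \<in> ?A. ?\<pi> a = w}" if wA: "w \<in> ?\<pi> ` ?A" for w
  proof -
    obtain i r where ir: "i \<in> insert 0 T" "r \<in> R" "w = pl i r" using wA by auto
    have "a = i" if "a \<in> insert 0 T" "b \<in> R" "pl a b = pl i r" for a b
      using pl_inj[OF idx[OF that(1)] idx[OF ir(1)] that(2) ir(2) that(3)] .
    then have "{a \<in> ?A. ?\<pi> a = w} = Pair i ` {s \<in> R. pl i s = pl i r}"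
      using ir(1,3) by (force simp: image_iff)
    then show ?thesis
      using local_degree_pl[OF idx[OF ir(1)] ir(2)] ir by (simp add: card_image inj_on_def)
  qed
  have "place_prod K G = (\<Prod>w\<in>?\<pi> ` ?A. G w powr (real (local_degree K w) / real n))"
    unfolding place_prod_def global_degree_eq
  proof (rule prod.mono_neutral_left)
    show "finite (?\<pi> ` ?A)" using fA by simp
    show "{w \<in> places K. G w \<noteq> 1} \<subseteq> ?\<pi> ` ?A"
    proof
      fix w assume w: "w \<in> {w \<in> places K. G w \<noteq> 1}"
      then obtain i r where ir: "idx i" "r \<in> R" "w = pl i r" using places_cases by blast
      then have "i \<in> insert 0 T" using w supp unfolding idx_def by auto
      then show "w \<in> ?\<pi> ` ?A" using ir by auto
    qed
    show "\<forall>w\<in>?\<pi> ` ?A - {w \<in> places K. G w \<noteq> 1}. G w powr (real (local_degree K w) / real n) = 1"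
      using pl_place idx by auto
  qed
  also have "\<dots> = (\<Prod>w\<in>?\<pi> ` ?A. \<Prod>a\<in>{a \<in> ?A. ?\<pi> a = w}. G (?\<pi> a) powr (1 / real n))"
  proof (rule prod.cong[OF refl])
    fix w assume w: "w \<in> ?\<pi> ` ?A"
    then have "G w > 0" using gpos by auto
    then have "G w powr (real (local_degree K w) / real n) = (G w powr (1 / real n)) ^ local_degree K w"
      by (simp add: powr_realpow[symmetric] powr_powr)
    also have "\<dots> = (\<Prod>a\<in>{a \<in> ?A. ?\<pi> a = w}. G w powr (1 / real n))"
      using deg[OF w] by simp
    also have "\<dots> = (\<Prod>a\<in>{a \<in> ?A. ?\<pi> a = w}. G (?\<pi> a) powr (1 / real n))"
      by (intro prod.cong) auto
    finally show "G w powr (real (local_degree K w) / real n) = (\<Prod>a\<in>{a \<in> ?A. ?\<pi> a = w}. G (?\<pi> a) powr (1 / real n))" .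
  qed
  also have "\<dots> = (\<Prod>a\<in>?A. G (?\<pi> a) powr (1 / real n))"
    by (rule prod.group) (use fA in auto)
  also have "\<dots> = (\<Prod>a\<in>?A. G (?\<pi> a)) powr (1 / real n)"
    by (rule prod_powr_distrib[symmetric])
  also have "(\<Prod>a\<in>?A. G (?\<pi> a)) = (\<Prod>i\<in>insert 0 T. \<Prod>r\<in>R. G (pl i r))"
    by (simp add: prod.cartesian_product split_def)
  finally show ?thesis .
qed

text \<open>The function \<open>c\<close> is the yardstick for local estimates. Its weighted product
  over all places is \<open>C0 * C5\<close>: there are \<open>n\<close> pairs over the archimedean
  index and \<open>n\<close> over the index 5, and the factors \<open>w z\<close> cancel by the
  product formula. Writing both products over the same pairs reduces a comparison of heights to
  local comparisons.\<close>

lemma place_prod_setup: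
  assumes pos: "\<And>w. w \<in> places K \<Longrightarrow> G w > 0" and fin: "finite {w \<in> places K. G w \<noteq> 1}"
    and z: "z \<in> K" "z \<noteq> 0" and C: "C0 > 0" "C5 > 0"
  defines "c \<equiv> \<lambda>w. (if archimedean w then C0 else if w 5 = 1/5 then C5 else 1) * w z"
  shows "\<exists>T. finite T \<and> (\<forall>p\<in>T. Factorial_Ring.prime p) \<and>
    (place_prod K G) ^ m = (\<Prod>i\<in>insert 0 T. \<Prod>r\<in>R. G (pl i r) ^ m) powr (1 / real n) \<and>
    C0 * C5 = (\<Prod>i\<in>insert 0 T. \<Prod>r\<in>R. c (pl i r)) powr (1 / real n) \<and>
    (\<forall>i\<in>insert 0 T. \<forall>r\<in>R. pl i r \<in> places K \<and> c (pl i r) > 0)"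
proof -
  define P where "P = {p. Factorial_Ring.prime p \<and> (\<exists>r\<in>R. G (pl p r) \<noteq> 1)}"
  have finP: "finite P"
  proof -
    \<comment> \<open>One place with nontrivial value is picked for each prime in \<open>P\<close>.
      Different primes give different places, so \<open>P\<close> inherits finiteness.\<close>
    define f where "f p = pl p (SOME r. r \<in> R \<and> G (pl p r) \<noteq> 1)" for p
    have f: "(SOME r. r \<in> R \<and> G (pl p r) \<noteq> 1) \<in> R \<and> G (f p) \<noteq> 1" if "p \<in> P" for p
      using someI_ex[of "\<lambda>r. r \<in> R \<and> G (pl p r) \<noteq> 1"] that unfolding f_def P_def by blast
    have "inj_on f P"
      using f pl_inj unfolding inj_on_def f_def P_def idx_def by blast
    moreover have "f ` P \<subseteq> {w \<in> places K. G w \<noteq> 1}"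
      using f pl_place unfolding f_def P_def idx_def by blast
    ultimately show ?thesis using fin finite_imageD finite_subset by blast
  qed
  define T where "T = P \<union> {p. Factorial_Ring.prime p \<and> (\<exists>r\<in>R. U p (\<sigma> r z) \<noteq> 1)} \<union> {5}"
  have p5: "Factorial_Ring.prime (5::nat)" by simp
  have T: "finite T" "\<And>p. p \<in> T \<Longrightarrow> Factorial_Ring.prime p"
    using finP finite_support[OF z] p5 by (auto simp: T_def P_def)
  have idx: "idx i" if "i \<in> insert 0 T" for i using that T by (auto simp: idx_def)
  have 0: "0 \<notin> T" using T(2) not_prime_0 by blast
  have "place_prod K G = (\<Prod>i\<in>insert 0 T. \<Prod>r\<in>R. G (pl i r)) powr (1 / real n)"
    by (rule place_prod_eq[OF pos T]) (auto simp: T_def P_def)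
  moreover have pp: "(\<Prod>i\<in>insert 0 T. \<Prod>r\<in>R. G (pl i r)) > 0"
    using pos pl_place idx by (intro prod_pos) auto
  moreover have "(t powr (1 / real n)) ^ m = (t ^ m) powr (1 / real n)" if "t > 0" for t :: real
    using that by (simp add: powr_realpow[symmetric] powr_powr mult.commute)
  ultimately have 1: "(place_prod K G) ^ m = (\<Prod>i\<in>insert 0 T. \<Prod>r\<in>R. G (pl i r) ^ m) powr (1 / real n)"
    by (simp only: prod_power_distrib)
  define d where "d i = (if i = 0 then C0 else if i = 5 then C5 else 1)" for i :: nat
  have c: "c (pl i r) = d i * U i (\<sigma> r z)" if i: "i \<in> insert 0 T" and r: "r \<in> R" for i r
  proof -
    have a: "archimedean (pl i r) \<longleftrightarrow> i = 0"
    proof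
      assume "archimedean (pl i r)"
      then have "vQ i q = vQ 0 q" for q
        using pl_rat[OF idx[OF i] r, of q] by (simp add: archimedean_def vQ_def)
      then show "i = 0" by (intro vQ_inj[OF idx[OF i]]) (simp_all add: idx_def)
    next
      assume "i = 0"
      then show "archimedean (pl i r)"
        using pl_rat[OF idx[OF i] r] by (simp add: archimedean_def vQ_def)
    qed
    have b: "pl i r 5 = 1/5 \<longleftrightarrow> i = 5" if "i \<noteq> 0"
    proof -
      have "Factorial_Ring.prime i" using idx[OF i] that by (simp add: idx_def)
      then have "vQ i 5 = (if i = 5 then 1/5 else 1)"
        using padic_abs_prime[OF _ p5, of i] that by (auto simp: vQ_def)
      then show ?thesis using pl_rat[OF idx[OF i] r, of 5] by auto
    qed
    show ?thesis
      unfolding c_def d_def a using b pl_eq[OF z(1)] by auto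
  qed
  have cpos: "c (pl i r) > 0" if i: "i \<in> insert 0 T" and r: "r \<in> R" for i r
  proof -
    interpret w: complex_valued K "pl i r" by (rule pl_valued[OF idx[OF i] r])
    show ?thesis unfolding c_def using C w.w_pos[OF z] by simp
  qed
  have "(\<Prod>i\<in>insert 0 T. \<Prod>r\<in>R. c (pl i r)) = (\<Prod>i\<in>insert 0 T. \<Prod>r\<in>R. d i * U i (\<sigma> r z))"
    by (intro prod.cong refl) (rule c)
  also have "\<dots> = (\<Prod>i\<in>insert 0 T. d i ^ n) * (\<Prod>i\<in>insert 0 T. \<Prod>r\<in>R. U i (\<sigma> r z))"
    by (simp only: prod.distrib prod_constant)
  also have "(\<Prod>i\<in>insert 0 T. \<Prod>r\<in>R. U i (\<sigma> r z)) = 1"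
    by (rule product_formula[OF z T]) (auto simp: T_def)
  also have "(\<Prod>i\<in>insert 0 T. d i ^ n) = (\<Prod>i\<in>{0, 5}. d i ^ n)"
  proof (rule prod.mono_neutral_right)
    show "finite (insert 0 T)" using T(1) by simp
    show "{0, 5} \<subseteq> insert 0 T" by (simp add: T_def)
    show "\<forall>i\<in>insert 0 T - {0, 5}. d i ^ n = 1" by (simp add: d_def)
  qed
  also have "\<dots> = (C0 * C5) ^ n"
    by (simp add: d_def power_mult_distrib)
  finally have "(\<Prod>i\<in>insert 0 T. \<Prod>r\<in>R. c (pl i r)) powr (1 / real n) = C0 * C5"
    using C n_pos by (simp add: powr_realpow[symmetric] powr_powr)
  then show ?thesis
    using T 1 pl_place[OF idx] cpos by (intro exI[of _ T] conjI ballI) metis+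
qed

end

lemma place_prod_nonneg: "place_prod K G \<ge> 0"
  unfolding place_prod_def by (intro prod_nonneg) auto

lemma number_field_cases:
  assumes "subfield K \<CC>" "ring.finite_dimension \<CC> \<rat> K"
  obtains x where "number_field x" "K = adjoin \<rat> x"
proof -
  interpret complex_subfield \<rat> by (rule complex_subfield_Rats)
  interpret K: complex_subfield K using assms by (simp add: complex_subfield_def)
  obtain x where "alg \<rat> x" "K = adjoin \<rat> x"
    using primitive_element[OF assms(1) K.Rats_subset assms(2)] by auto
  then show ?thesis
    using that by (simp add: number_field_def number_field_axioms_def complex_subfield_axioms)
qed

text \<open>Here \<open>w 5 = 1/5\<close> characterises the places above \<open>5\<close>.\<close>

theorem place_prod_bounds:
  assumes K: "subfield K \<CC>" "ring.finite_dimension \<CC> \<rat> K"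
    and pos: "\<And>w. w \<in> places K \<Longrightarrow> G w > 0" and fin: "finite {w \<in> places K. G w \<noteq> 1}"
    and z: "z \<in> K" "z \<noteq> 0" and C: "C0 > 0" "C5 > 0"
  defines "c \<equiv> \<lambda>w. (if archimedean w then C0 else if w 5 = 1/5 then C5 else 1) * w z"
  shows "(\<And>w. w \<in> places K \<Longrightarrow> c w \<le> G w ^ m) \<Longrightarrow> C0 * C5 \<le> place_prod K G ^ m"
    and "(\<And>w. w \<in> places K \<Longrightarrow> G w ^ m \<le> c w) \<Longrightarrow> place_prod K G ^ m \<le> C0 * C5"
proof -
  obtain x where "number_field x" and Kx: "K = adjoin \<rat> x"
    using number_field_cases[OF K] .
  then interpret number_field x by simp
  obtain T where T: "finite T"
    "(place_prod K G) ^ m = (\<Prod>i\<in>insert 0 T. \<Prod>r\<in>R. G (pl i r) ^ m) powr (1 / real n)"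
    "C0 * C5 = (\<Prod>i\<in>insert 0 T. \<Prod>r\<in>R. c (pl i r)) powr (1 / real n)"
    "\<And>i r. i \<in> insert 0 T \<Longrightarrow> r \<in> R \<Longrightarrow> pl i r \<in> places K \<and> c (pl i r) > 0"
    using place_prod_setup[of G z C0 C5 m] pos fin z C unfolding Kx c_def by blast
  show "C0 * C5 \<le> place_prod K G ^ m" if "\<And>w. w \<in> places K \<Longrightarrow> c w \<le> G w ^ m"
    unfolding T(2,3) using T(4) that
    by (intro powr_mono2 prod_mono conjI prod_nonneg) (auto intro: less_imp_le)
  show "place_prod K G ^ m \<le> C0 * C5" if "\<And>w. w \<in> places K \<Longrightarrow> G w ^ m \<le> c w"
    unfolding T(2,3) using T(4) that pos
    by (intro powr_mono2 prod_mono conjI prod_nonneg) (auto intro!: less_imp_le zero_less_power)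
qed

lemma finite_place_support:
  assumes K: "subfield K \<CC>" "ring.finite_dimension \<CC> \<rat> K" and z: "z \<in> K" "z \<noteq> 0"
  shows "finite {w \<in> places K. w z \<noteq> 1}" and "finite {w \<in> places K. archimedean w}"
    and "finite {w \<in> places K. w 5 \<noteq> 1}"
proof -
  obtain x where "number_field x" and Kx: "K = adjoin \<rat> x"
    using number_field_cases[OF K] .
  then interpret number_field x by simp
  have *: "finite {w \<in> places K. w y \<noteq> 1}" if y: "y \<in> K" "y \<noteq> 0" for y
  proof (rule finite_subset)
    let ?T = "{p. Factorial_Ring.prime p \<and> (\<exists>r\<in>R. U p (\<sigma> r y) \<noteq> 1)}"
    show "finite ((\<lambda>(i, r). pl i r) ` (insert 0 ?T \<times> R))"
      using finite_support[of y] y finite_R unfolding Kx by auto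
    show "{w \<in> places K. w y \<noteq> 1} \<subseteq> (\<lambda>(i, r). pl i r) ` (insert 0 ?T \<times> R)"
    proof
      fix w assume w: "w \<in> {w \<in> places K. w y \<noteq> 1}"
      then obtain i r where ir: "idx i" "r \<in> R" "w = pl i r" using places_cases[of w] unfolding Kx by blast
      then have "i \<in> insert 0 ?T"
        using w y pl_eq[of y i r] unfolding idx_def Kx by auto
      then show "w \<in> (\<lambda>(i, r). pl i r) ` (insert 0 ?T \<times> R)" using ir by auto
    qed
  qed
  show "finite {w \<in> places K. w z \<noteq> 1}" by (rule *[OF z])
  have "5 \<in> K" "(5::complex) \<noteq> 0" using K.k_of_nat[of 5] unfolding Kx by auto
  then show f5: "finite {w \<in> places K. w 5 \<noteq> 1}" by (rule *)
  have "w 5 = 5" if "archimedean w" for w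
    using that[unfolded archimedean_def, rule_format, of 5] by simp
  then have "w 5 \<noteq> 1" if "archimedean w" for w using that by (metis one_eq_numeral_iff num.distinct(3))
  then have "{w \<in> places K. archimedean w} \<subseteq> {w \<in> places K. w 5 \<noteq> 1}" by blast
  then show "finite {w \<in> places K. archimedean w}" using f5 by (rule finite_subset)
qed

section \<open>Tensor products of bundles of rank two\<close>

lemma exhaust_2:
  fixes x :: 2 shows "x = 1 \<or> x = 2"
proof (induct x)
  case (of_int z)
  then have "0 \<le> z" and "z < 2" by simp_all
  then have "z = 0 | z = 1" by arith
  then show ?case by auto
qed

lemma UNIV_2: "UNIV = {1, 2 :: 2}"
  using exhaust_2 by auto

lemma UNIV_2_2: "UNIV = {(1, 1), (1, 2), (2, 1), (2, 2) :: 2 \<times> 2}"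
  using exhaust_2 by (auto simp: prod_eq_iff)

context complex_completion
begin

abbreviation "C \<equiv> Cv_ring K w"
abbreviation "vecs \<equiv> vectors K w"
abbreviation "std \<equiv> std_norm K w"
abbreviation "comb \<equiv> lincomb K w"

lemma vecsD: "x \<in> vecs \<Longrightarrow> x i \<in> carrier C"
  by (simp add: vectors_def)

lemma vecsI: "(\<And>i. x i \<in> carrier C) \<Longrightarrow> x \<in> vecs"
  by (simp add: vectors_def)

lemma comb_2:
  assumes "x \<in> vecs" "\<And>j. e j \<in> vecs"
  shows "comb x e i = x (1::2) \<otimes>\<^bsub>C\<^esub> e 1 i \<oplus>\<^bsub>C\<^esub> x 2 \<otimes>\<^bsub>C\<^esub> e 2 i"
  unfolding lincomb_def UNIV_2 using assms by (subst Cv.finsum_insert) (auto simp: vecsD)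

lemma comb_vecs: "x \<in> vecs \<Longrightarrow> (\<And>j. e j \<in> vecs) \<Longrightarrow> comb x e \<in> (vecs :: (2 \<Rightarrow> Cv) set)"
  by (intro vecsI) (simp add: comb_2 vecsD)

section \<open>Coordinates of tensors\<close>

definition tens :: "(2 \<Rightarrow> 2 \<Rightarrow> Cv) \<Rightarrow> (2 \<Rightarrow> 2 \<Rightarrow> Cv) \<Rightarrow> 2 \<times> 2 \<Rightarrow> 2 \<times> 2 \<Rightarrow> Cv"
  where "tens e f = (\<lambda>(i, j). tensor_vec K w (e i) (f j))"

lemma tens_apply: "tens e f (a, b) (i, j) = e a i \<otimes>\<^bsub>C\<^esub> f b j"
  by (simp add: tens_def tensor_vec_def)

lemma tens_vecs: "(\<And>j. e j \<in> vecs) \<Longrightarrow> (\<And>j. f j \<in> vecs) \<Longrightarrow> tens e f p \<in> vecs"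
  by (cases p) (auto intro!: vecsI simp: tens_apply vecsD)

text \<open>A tensor can be evaluated along rows or along columns first. Both orders are needed for
  changing the two bases one after the other.\<close>

lemma comb_tens:
  fixes z :: "2 \<times> 2 \<Rightarrow> Cv"
  assumes z: "z \<in> vecs" and e: "\<And>j. e j \<in> vecs" and f: "\<And>j. f j \<in> vecs"
  shows "comb z (tens e f) (i, j) = comb (\<lambda>a. comb (\<lambda>b. z (a, b)) f j) e i" (is "?l = ?r1")
    and "comb z (tens e f) (i, j) = comb (\<lambda>b. comb (\<lambda>a. z (a, b)) e i) f j" (is "?l = ?r2")
proof -
  have c [simp]: "z p \<in> carrier C" "e a b \<in> carrier C" "f a b \<in> carrier C" for p a b
    using vecsD[OF z] vecsD[OF e] vecsD[OF f] by auto
  have v: "(\<lambda>b. z (a, b)) \<in> vecs" "(\<lambda>a. z (a, b)) \<in> vecs" for a b by (auto intro: vecsI)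
  have "?l = z (1, 1) \<otimes>\<^bsub>C\<^esub> (e 1 i \<otimes>\<^bsub>C\<^esub> f 1 j) \<oplus>\<^bsub>C\<^esub> (z (1, 2) \<otimes>\<^bsub>C\<^esub> (e 1 i \<otimes>\<^bsub>C\<^esub> f 2 j) \<oplus>\<^bsub>C\<^esub>
      (z (2, 1) \<otimes>\<^bsub>C\<^esub> (e 2 i \<otimes>\<^bsub>C\<^esub> f 1 j) \<oplus>\<^bsub>C\<^esub> z (2, 2) \<otimes>\<^bsub>C\<^esub> (e 2 i \<otimes>\<^bsub>C\<^esub> f 2 j)))"
    unfolding lincomb_def UNIV_2_2
    by (simp add: Cv.finsum_insert Pi_iff tens_apply)
  note l = this
  have w: "(\<lambda>a. comb (\<lambda>b. z (a, b)) f j) \<in> vecs" "(\<lambda>b. comb (\<lambda>a. z (a, b)) e i) \<in> vecs"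
    using comb_vecs[where e=f, OF v(1) f] comb_vecs[where e=e, OF v(2) e] by (auto intro!: vecsI dest: vecsD)
  show "?l = ?r1"
    unfolding l comb_2[OF w(1) e] unfolding comb_2[OF v(1) f]
    by (simp add: Cv.l_distr Cv.r_distr Cv.m_ac Cv.a_ac)
  show "?l = ?r2"
    unfolding l comb_2[OF w(2) f] unfolding comb_2[OF v(2) e]
    by (simp add: Cv.l_distr Cv.r_distr Cv.m_ac Cv.a_ac)
qed

lemma row_vecs: "z \<in> vecs \<Longrightarrow> (\<lambda>b. z (a, b)) \<in> vecs"
  by (simp add: vectors_def)

lemma row_comb_vecs:
  fixes z :: "2 \<times> 2 \<Rightarrow> Cv"
  assumes z: "z \<in> vecs" and f: "\<And>j. f j \<in> vecs"
  shows "(\<lambda>a. comb (\<lambda>b. z (a, b)) f (j::2)) \<in> vecs"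
  by (rule vecsI, rule vecsD, rule comb_vecs[OF row_vecs[OF z]], rule f)

lemma comb_tens_vecs:
  fixes z :: "2 \<times> 2 \<Rightarrow> Cv"
  assumes z: "z \<in> vecs" and e: "\<And>j. e j \<in> vecs" and f: "\<And>j. f j \<in> vecs"
  shows "comb z (tens e f) \<in> vecs"
proof (rule vecsI)
  fix p :: "2 \<times> 2"
  obtain i j where p: "p = (i, j)" by force
  show "comb z (tens e f) p \<in> carrier C"
    unfolding p comb_tens(1)[OF z e f]
    by (rule vecsD, rule comb_vecs[OF row_comb_vecs[OF z f]], rule e)
qed

text \<open>Both the euclidean and the maximum norm of a matrix are functions of the norms of its
  rows.\<close>

lemma std_rows:
  fixes z z' :: "'i::finite \<times> 'j::finite \<Rightarrow> Cv"
  assumes "\<And>a. std (\<lambda>b. z (a, b)) = std (\<lambda>b. z' (a, b))"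
  shows "std z = std z'"
proof (cases "archimedean w")
  case True
  have split: "(\<Sum>p\<in>UNIV. (Cv_abs K w (u p))\<^sup>2) = (\<Sum>a\<in>UNIV. \<Sum>b\<in>UNIV. (Cv_abs K w (u (a, b)))\<^sup>2)"
    for u :: "'i \<times> 'j \<Rightarrow> Cv"
    by (simp add: sum.cartesian_product flip: UNIV_Times_UNIV)
  show ?thesis
    using assms True unfolding std_norm_def by (simp add: split)
next
  case False
  have *: "std y \<le> std y'" if "\<And>a. std (\<lambda>b. y (a, b)) = std (\<lambda>b. y' (a, b))" for y y' :: "'i \<times> 'j \<Rightarrow> Cv"
  proof -
    have "Cv_abs K w (y (a, b)) \<le> std y'" for a b
    proof -
      have "Cv_abs K w (y (a, b)) \<le> std (\<lambda>b. y (a, b))"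
        using False by (simp add: std_norm_def)
      also have "\<dots> = std (\<lambda>b. y' (a, b))" by (rule that)
      also have "\<dots> \<le> std y'"
        using False by (auto simp: std_norm_def)
      finally show ?thesis .
    qed
    then show ?thesis using False by (auto simp: std_norm_def)
  qed
  show ?thesis using *[of z z'] *[of z' z] assms by fastforce
qed

lemma std_swap: "std (\<lambda>(a, b). z (b, a)) = std (z :: 'i::finite \<times> 'j::finite \<Rightarrow> Cv)"
proof -
  have b: "bij (\<lambda>(a, b). (b, a) :: 'i \<times> 'j)" by (auto simp: bij_def inj_def surj_def)
  have "(\<Sum>p\<in>UNIV. (Cv_abs K w ((\<lambda>(a, b). z (b, a)) p))\<^sup>2) = (\<Sum>p\<in>UNIV. (Cv_abs K w (z p))\<^sup>2)"
    using sum.reindex_bij_betw[OF b, of "\<lambda>p. (Cv_abs K w (z p))\<^sup>2"] by (simp add: split_def)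
  moreover have "range (\<lambda>p. Cv_abs K w ((\<lambda>(a, b). z (b, a)) p)) = range (\<lambda>p. Cv_abs K w (z p))"
  proof -
    have "(\<lambda>p. Cv_abs K w ((\<lambda>(a, b). z (b, a)) p)) = (\<lambda>p. Cv_abs K w (z p)) \<circ> (\<lambda>(a, b). (b, a))"
      by auto
    then show ?thesis by (simp only: image_comp[symmetric] bij_is_surj[OF b])
  qed
  ultimately show ?thesis unfolding std_norm_def by simp
qed

lemma std_cols:
  fixes z z' :: "'i::finite \<times> 'j::finite \<Rightarrow> Cv"
  assumes "\<And>b. std (\<lambda>a. z (a, b)) = std (\<lambda>a. z' (a, b))"
  shows "std z = std z'"
  using std_rows[of "\<lambda>(b, a). z (a, b)" "\<lambda>(b, a). z' (a, b)"] assms std_swap[of z] std_swap[of z']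
  by simp

section \<open>Independence of the orthonormal bases\<close>

lemma onb_vecs: "orthonormal_basis K w N e \<Longrightarrow> e j \<in> vecs"
  and onb_norm: "orthonormal_basis K w N e \<Longrightarrow> x \<in> vecs \<Longrightarrow> N (comb x e) = std x"
  and onb_coords: "orthonormal_basis K w N e \<Longrightarrow> y \<in> vecs \<Longrightarrow> \<exists>x. x \<in> vecs \<and> y = comb x e"
  and onb_unique: "orthonormal_basis K w N e \<Longrightarrow> comb x e \<in> vecs \<Longrightarrow> x \<in> vecs \<Longrightarrow> x' \<in> vecs \<Longrightarrow>
    comb x e = comb x' e \<Longrightarrow> x = x'"
  unfolding orthonormal_basis_def by blast+

lemma tens_basis:
  assumes e: "orthonormal_basis K w N e" and f: "orthonormal_basis K w M f"
  shows "y \<in> vecs \<Longrightarrow> \<exists>!z. z \<in> vecs \<and> y = comb z (tens e f)"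
proof -
  assume y: "y \<in> vecs"
  note ev = onb_vecs[OF e] and fv = onb_vecs[OF f]
  have "\<forall>j. \<exists>c. c \<in> vecs \<and> (\<lambda>i. y (i, j)) = comb c e"
    using y by (intro allI onb_coords[OF e] vecsI) (auto dest: vecsD)
  then obtain c where c: "\<And>j. c j \<in> vecs" "\<And>j. (\<lambda>i. y (i, j)) = comb (c j) e" by metis
  have "\<forall>a. \<exists>d. d \<in> vecs \<and> (\<lambda>j. c j a) = comb d f"
    using c by (intro allI onb_coords[OF f] vecsI) (auto dest: vecsD)
  then obtain d where d: "\<And>a. d a \<in> vecs" "\<And>a. (\<lambda>j. c j a) = comb (d a) f" by metis
  let ?z = "\<lambda>(a, b). d a b"
  have z: "?z \<in> vecs" using d(1) by (auto intro!: vecsI dest: vecsD)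
  have "y (i, j) = comb ?z (tens e f) (i, j)" for i j
    using comb_tens(1)[OF z ev fv, where i=i and j=j] fun_cong[OF c(2)] fun_cong[OF d(2)]
    by (simp flip: d(2))
  then have yz: "y = comb ?z (tens e f)" by auto
  show ?thesis
  proof (rule ex1I[of _ ?z])
    show "?z \<in> vecs \<and> y = comb ?z (tens e f)" using z yz by simp
    fix z' assume z': "z' \<in> vecs \<and> y = comb z' (tens e f)"
    then have zv': "z' \<in> vecs" and eq: "comb z' (tens e f) = comb ?z (tens e f)"
      using yz by auto
    have "comb (\<lambda>a. comb (\<lambda>b. z' (a, b)) f j) e = comb (\<lambda>a. comb (\<lambda>b. ?z (a, b)) f j) e" for j
    proof
      fix i
      show "comb (\<lambda>a. comb (\<lambda>b. z' (a, b)) f j) e i = comb (\<lambda>a. comb (\<lambda>b. ?z (a, b)) f j) e i"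
        using fun_cong[OF eq, of "(i, j)"] by (simp only: comb_tens(1)[OF zv' ev fv] comb_tens(1)[OF z ev fv])
    qed
    then have "(\<lambda>a. comb (\<lambda>b. z' (a, b)) f j) = (\<lambda>a. comb (\<lambda>b. ?z (a, b)) f j)" for j
      by (rule onb_unique[OF e comb_vecs[OF row_comb_vecs[OF zv' fv] ev] row_comb_vecs[OF zv' fv] row_comb_vecs[OF z fv]])
    then have "comb (\<lambda>b. z' (a, b)) f = comb (\<lambda>b. ?z (a, b)) f" for a
      by (intro ext) (rule fun_cong)
    then have "(\<lambda>b. z' (a, b)) = (\<lambda>b. ?z (a, b))" for a
      by (rule onb_unique[OF f comb_vecs[OF row_vecs[OF zv'] fv] row_vecs[OF zv'] row_vecs[OF z]])
    then show "z' = ?z" by (auto simp: fun_eq_iff)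
  qed
qed

text \<open>Passing from one pair of orthonormal bases to another changes the coordinates of a tensor
  first row by row and then column by column, each time by an isometry.\<close>

lemma tens_change_basis:
  assumes e: "orthonormal_basis K w N e" "orthonormal_basis K w N e'"
    and f: "orthonormal_basis K w M f" "orthonormal_basis K w M f'"
    and z: "z \<in> vecs"
  shows "\<exists>z'\<in>vecs. comb z (tens e f) = comb z' (tens e' f') \<and> std z = std z'"
proof -
  note ev = onb_vecs[OF e(1)] onb_vecs[OF e(2)] and fv = onb_vecs[OF f(1)] onb_vecs[OF f(2)]
  have rz: "(\<lambda>b. z (a, b)) \<in> vecs" for a using z by (auto intro!: vecsI dest: vecsD)
  have "\<forall>a. \<exists>d. d \<in> vecs \<and> comb (\<lambda>b. z (a, b)) f = comb d f'"
    using comb_vecs[where e=f, OF rz fv(1)] by (intro allI onb_coords[OF f(2)]) auto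
  then obtain d where d: "\<And>a. d a \<in> vecs" "\<And>a. comb (\<lambda>b. z (a, b)) f = comb (d a) f'" by metis
  define z1 where "z1 = (\<lambda>(a, b). d a b)"
  have z1: "z1 \<in> vecs" unfolding z1_def using d(1) by (auto intro!: vecsI dest: vecsD)
  have "std (\<lambda>b. z (a, b)) = std (\<lambda>b. z1 (a, b))" for a
    using onb_norm[OF f(1) rz, of a] onb_norm[OF f(2) d(1), of a] d(2)[of a] by (simp add: z1_def)
  then have s1: "std z = std z1" by (rule std_rows)
  have c1: "comb z (tens e f) (i, j) = comb z1 (tens e f') (i, j)" for i j
    using comb_tens(1)[OF z ev(1) fv(1), where i=i and j=j] comb_tens(1)[OF z1 ev(1) fv(2), where i=i and j=j] d(2)
    by (simp add: z1_def)
  have cz: "(\<lambda>a. z1 (a, b)) \<in> vecs" for b using z1 by (auto intro!: vecsI dest: vecsD)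
  have "\<forall>b. \<exists>g. g \<in> vecs \<and> comb (\<lambda>a. z1 (a, b)) e = comb g e'"
    using comb_vecs[where e=e, OF cz ev(1)] by (intro allI onb_coords[OF e(2)]) auto
  then obtain g where g: "\<And>b. g b \<in> vecs" "\<And>b. comb (\<lambda>a. z1 (a, b)) e = comb (g b) e'" by metis
  define z2 where "z2 = (\<lambda>(a, b). g b a)"
  have z2: "z2 \<in> vecs" unfolding z2_def using g(1) by (auto intro!: vecsI dest: vecsD)
  have "std (\<lambda>a. z1 (a, b)) = std (\<lambda>a. z2 (a, b))" for b
    using onb_norm[OF e(1) cz, of b] onb_norm[OF e(2) g(1), of b] g(2)[of b] by (simp add: z2_def)
  then have s2: "std z1 = std z2" by (rule std_cols)
  have c2: "comb z1 (tens e f') (i, j) = comb z2 (tens e' f') (i, j)" for i j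
    using comb_tens(2)[OF z1 ev(1) fv(2), where i=i and j=j] comb_tens(2)[OF z2 ev(2) fv(2), where i=i and j=j] g(2)
    by (simp add: z2_def)
  have "comb z (tens e f) = comb z2 (tens e' f')" using c1 c2 by auto
  then show ?thesis using z2 s1 s2 by auto
qed

text \<open>This justifies the \<open>SOME\<close> in \<open>tensor_bundle\<close>, which asks for
  one norm that suits all pairs of orthonormal bases. The norm \<open>P\<close> of the coordinates
  in a single pair does so by \<open>tens_change_basis\<close>.\<close>

lemma tensor_bundle_onb:
  fixes N M :: "2 adelic_norms"
  assumes e: "orthonormal_basis K w (N w) e" and f: "orthonormal_basis K w (M w) f"
  shows "orthonormal_basis K w (tensor_bundle K N M w) (tens e f)"
proof -
  define P where "P y = std (THE z. z \<in> vecs \<and> y = comb z (tens e f))" for y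
  have "orthonormal_basis K w P (tens e' f')"
    if e': "orthonormal_basis K w (N w) e'" and f': "orthonormal_basis K w (M w) f'" for e' f'
    unfolding orthonormal_basis_def
  proof (intro conjI ballI allI)
    show "tens e' f' p \<in> vecs" for p
      using onb_vecs[OF e'] onb_vecs[OF f'] by (rule tens_vecs)
    show "\<exists>!z. z \<in> vecs \<and> y = comb z (tens e' f')" if "y \<in> vecs" for y
      by (rule tens_basis[OF e' f' that])
    fix z :: "2 \<times> 2 \<Rightarrow> Cv" assume z: "z \<in> vecs"
    obtain z' where z': "z' \<in> vecs" "comb z (tens e' f') = comb z' (tens e f)" "std z = std z'"
      using tens_change_basis[OF e' e f' f z] by auto
    have "comb z (tens e' f') \<in> vecs"
      by (rule comb_tens_vecs[OF z onb_vecs[OF e'] onb_vecs[OF f']])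
    then have "(THE u. u \<in> vecs \<and> comb z (tens e' f') = comb u (tens e f)) = z'"
      using tens_basis[OF e f] z' by (intro the1_equality) auto
    then show "P (comb z (tens e' f')) = std z"
      unfolding P_def using z' by simp
  qed
  then have "\<exists>P. \<forall>e f. orthonormal_basis K w (N w) e \<and> orthonormal_basis K w (M w) f \<longrightarrow>
    orthonormal_basis K w P (\<lambda>(i, j). tensor_vec K w (e i) (f j))"
    by (intro exI[of _ P]) (auto simp: tens_def)
  from someI_ex[OF this] show ?thesis
    unfolding tensor_bundle_def tens_def using e f by blast
qed

text \<open>The basis \<open>(1, s), (0, a)\<close>, orthonormal for the bundle at every place with
  suitable entries: \<open>s = -1\<close> and \<open>a = \<alpha>\<close> above
  \<open>2 + i\<close>, \<open>s = 1\<close> and \<open>a = \<beta>\<close> above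
  \<open>2 - i\<close>, and \<open>s = 0\<close>, \<open>a = 1\<close> elsewhere.\<close>

definition tri_basis :: "Cv \<Rightarrow> Cv \<Rightarrow> 2 \<Rightarrow> 2 \<Rightarrow> Cv" where
  "tri_basis s a = (\<lambda>j i. if j = 1 then (if i = 1 then \<one>\<^bsub>C\<^esub> else s) else (if i = 1 then \<zero>\<^bsub>C\<^esub> else a))"

lemma tri_basis_vecs: "s \<in> carrier C \<Longrightarrow> a \<in> carrier C \<Longrightarrow> tri_basis s a j \<in> vecs"
  by (auto simp: tri_basis_def intro: vecsI)

lemma comb_tri_basis:
  assumes "s \<in> carrier C" "a \<in> carrier C" "x \<in> vecs"
  shows "comb x (tri_basis s a) = (\<lambda>i. if i = 1 then x 1 else x 1 \<otimes>\<^bsub>C\<^esub> s \<oplus>\<^bsub>C\<^esub> x 2 \<otimes>\<^bsub>C\<^esub> a)"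
  using assms vecsD[OF assms(3)]
  by (intro ext, subst comb_2[OF assms(3) tri_basis_vecs[OF assms(1,2)]]) (simp add: tri_basis_def)

lemma tri_basis_onb:
  fixes N :: "(2 \<Rightarrow> Cv) \<Rightarrow> real"
  assumes s: "s \<in> carrier C" and a: "a \<in> carrier C" "a \<noteq> \<zero>\<^bsub>C\<^esub>"
    and N: "\<And>x :: 2 \<Rightarrow> Cv. x \<in> vecs \<Longrightarrow> N (\<lambda>i. if i = 1 then x 1 else x 1 \<otimes>\<^bsub>C\<^esub> s \<oplus>\<^bsub>C\<^esub> x 2 \<otimes>\<^bsub>C\<^esub> a) = std x"
  shows "orthonormal_basis K w N (tri_basis s a)"
  unfolding orthonormal_basis_def
proof (intro conjI allI ballI)
  show "tri_basis s a j \<in> vecs" for j by (rule tri_basis_vecs[OF s a(1)])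
  show "N (comb x (tri_basis s a)) = std x" if "x \<in> vecs" for x
    using N[OF that] comb_tri_basis[OF s a(1) that] by simp
  fix y :: "2 \<Rightarrow> Cv" assume y: "y \<in> vecs"
  have yc: "y 1 \<in> carrier C" "y 2 \<in> carrier C" using vecsD[OF y] by auto
  have ia: "inv\<^bsub>C\<^esub> a \<in> carrier C" "inv\<^bsub>C\<^esub> a \<otimes>\<^bsub>C\<^esub> a = \<one>\<^bsub>C\<^esub>" "a \<otimes>\<^bsub>C\<^esub> inv\<^bsub>C\<^esub> a = \<one>\<^bsub>C\<^esub>"
    using a Cv.field_Units by auto
  let ?x = "\<lambda>i::2. if i = 1 then y 1 else (y 2 \<ominus>\<^bsub>C\<^esub> y 1 \<otimes>\<^bsub>C\<^esub> s) \<otimes>\<^bsub>C\<^esub> inv\<^bsub>C\<^esub> a"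
  have x: "?x \<in> vecs" using yc s ia by (auto intro: vecsI)
  show "\<exists>!x. x \<in> vecs \<and> y = comb x (tri_basis s a)"
  proof (rule ex1I[of _ ?x])
    have "y 1 \<otimes>\<^bsub>C\<^esub> s \<oplus>\<^bsub>C\<^esub> (y 2 \<ominus>\<^bsub>C\<^esub> y 1 \<otimes>\<^bsub>C\<^esub> s) \<otimes>\<^bsub>C\<^esub> inv\<^bsub>C\<^esub> a \<otimes>\<^bsub>C\<^esub> a = y 2"
    proof -
      have "(y 2 \<ominus>\<^bsub>C\<^esub> y 1 \<otimes>\<^bsub>C\<^esub> s) \<otimes>\<^bsub>C\<^esub> inv\<^bsub>C\<^esub> a \<otimes>\<^bsub>C\<^esub> a = y 2 \<ominus>\<^bsub>C\<^esub> y 1 \<otimes>\<^bsub>C\<^esub> s"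
        using yc s ia a by (simp add: Cv.m_assoc)
      moreover have "y 1 \<otimes>\<^bsub>C\<^esub> s \<oplus>\<^bsub>C\<^esub> (y 2 \<ominus>\<^bsub>C\<^esub> y 1 \<otimes>\<^bsub>C\<^esub> s) = y 2"
        using yc s by (simp add: a_minus_def Cv.a_lcomm[of _ "y 2"] Cv.r_neg)
      ultimately show ?thesis by simp
    qed
    then have "y i = comb ?x (tri_basis s a) i" for i
      using exhaust_2[of i] unfolding comb_tri_basis[OF s a(1) x] by auto
    then show "?x \<in> vecs \<and> y = comb ?x (tri_basis s a)" using x by auto
    fix x' assume "x' \<in> vecs \<and> y = comb x' (tri_basis s a)"
    then have x': "x' \<in> vecs" and yx: "y = (\<lambda>i. if i = 1 then x' 1 else x' 1 \<otimes>\<^bsub>C\<^esub> s \<oplus>\<^bsub>C\<^esub> x' 2 \<otimes>\<^bsub>C\<^esub> a)"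
      using comb_tri_basis[OF s a(1)] by auto
    have c: "x' 1 \<in> carrier C" "x' 2 \<in> carrier C" using vecsD[OF x'] by auto
    have y1: "y 1 = x' 1" and y2: "y 2 = x' 1 \<otimes>\<^bsub>C\<^esub> s \<oplus>\<^bsub>C\<^esub> x' 2 \<otimes>\<^bsub>C\<^esub> a"
      using yx by simp_all
    have "y 2 \<ominus>\<^bsub>C\<^esub> y 1 \<otimes>\<^bsub>C\<^esub> s = x' 2 \<otimes>\<^bsub>C\<^esub> a"
    proof -
      have "(p \<oplus>\<^bsub>C\<^esub> r) \<ominus>\<^bsub>C\<^esub> p = r" if "p \<in> carrier C" "r \<in> carrier C" for p r
        using that by (simp add: a_minus_def Cv.a_comm[of p r] Cv.a_assoc Cv.r_neg)
      then show ?thesis unfolding y1 y2 using c s a by simp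
    qed
    then have "(y 2 \<ominus>\<^bsub>C\<^esub> y 1 \<otimes>\<^bsub>C\<^esub> s) \<otimes>\<^bsub>C\<^esub> inv\<^bsub>C\<^esub> a = x' 2"
      using c a ia by (simp add: Cv.m_assoc)
    then have "x' i = ?x i" for i using exhaust_2[of i] y1 by auto
    then show "x' = ?x" by auto
  qed
qed

lemma std_2: "std (x :: 2 \<Rightarrow> Cv) = (if archimedean w then sqrt ((Cv_abs K w (x 1))\<^sup>2 + (Cv_abs K w (x 2))\<^sup>2)
    else max (Cv_abs K w (x 1)) (Cv_abs K w (x 2)))"
  unfolding std_norm_def UNIV_2 by simp

text \<open>The wedge \<open>e\<^sub>1 \<otimes> e\<^sub>2 - e\<^sub>2 \<otimes> e\<^sub>1\<close> of the standard basis is the wedge of \<open>tri_basis s a\<close>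
  divided by the determinant \<open>a\<close>.\<close>

lemma tensor_norm_wedge:
  fixes N :: "2 adelic_norms"
  assumes s: "s \<in> carrier C" and a: "a \<in> carrier C" "a \<noteq> \<zero>\<^bsub>C\<^esub>"
    and N: "orthonormal_basis K w (N w) (tri_basis s a)"
  shows "tensor_bundle K N N w (\<lambda>p. if p = (1, 2) then \<one>\<^bsub>C\<^esub> else if p = (2, 1) then \<ominus>\<^bsub>C\<^esub> \<one>\<^bsub>C\<^esub> else \<zero>\<^bsub>C\<^esub>) =
    (if archimedean w then sqrt 2 else 1) / Cv_abs K w a"
proof -
  let ?y = "\<lambda>p::2\<times>2. if p = (1, 2) then \<one>\<^bsub>C\<^esub> else if p = (2, 1) then \<ominus>\<^bsub>C\<^esub> \<one>\<^bsub>C\<^esub> else \<zero>\<^bsub>C\<^esub>"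
  let ?b = "inv\<^bsub>C\<^esub> a"
  let ?z = "\<lambda>p::2\<times>2. if p = (1, 2) then ?b else if p = (2, 1) then \<ominus>\<^bsub>C\<^esub> ?b else \<zero>\<^bsub>C\<^esub>"
  have b: "?b \<in> carrier C" "?b \<otimes>\<^bsub>C\<^esub> a = \<one>\<^bsub>C\<^esub>" "a \<otimes>\<^bsub>C\<^esub> ?b = \<one>\<^bsub>C\<^esub>"
    using a Cv.field_Units by auto
  have z: "?z \<in> vecs" using b by (auto intro: vecsI)
  note tv = tri_basis_vecs[OF s a(1)]
  have "comb ?z (tens (tri_basis s a) (tri_basis s a)) (i, j) = ?y (i, j)" for i j
  proof -
    have "comb ?z (tens (tri_basis s a) (tri_basis s a)) (i, j) =
      comb (\<lambda>c. comb (\<lambda>d. ?z (c, d)) (tri_basis s a) j) (tri_basis s a) i"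
      by (rule comb_tens(1)[OF z tv tv])
    also have "\<dots> = ?y (i, j)"
    proof -
      have "\<ominus>\<^bsub>C\<^esub> ?b \<otimes>\<^bsub>C\<^esub> s \<otimes>\<^bsub>C\<^esub> a = \<ominus>\<^bsub>C\<^esub> (?b \<otimes>\<^bsub>C\<^esub> a \<otimes>\<^bsub>C\<^esub> s)"
        using b(1) s a(1) by (simp add: Cv.l_minus Cv.r_minus Cv.m_ac)
      then have bs: "\<ominus>\<^bsub>C\<^esub> ?b \<otimes>\<^bsub>C\<^esub> s \<otimes>\<^bsub>C\<^esub> a = \<ominus>\<^bsub>C\<^esub> s"
        using b(2) s by simp
      have ba: "\<ominus>\<^bsub>C\<^esub> ?b \<otimes>\<^bsub>C\<^esub> a = \<ominus>\<^bsub>C\<^esub> \<one>\<^bsub>C\<^esub>"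
        using b a(1) by (simp add: Cv.l_minus)
      consider "i = 1" "j = 1" | "i = 1" "j = 2" | "i = 2" "j = 1" | "i = 2" "j = 2"
        using exhaust_2[of i] exhaust_2[of j] by blast
      then show ?thesis
        unfolding comb_tri_basis[OF s a(1) row_comb_vecs[OF z tv]]
        unfolding comb_tri_basis[OF s a(1) row_vecs[OF z]]
        by cases (use s a(1) b bs ba in \<open>simp_all add: Cv.r_neg\<close>)
    qed
    finally show ?thesis .
  qed
  note val = this
  have yz: "?y = comb ?z (tens (tri_basis s a) (tri_basis s a))"
  proof
    fix p :: "2 \<times> 2"
    show "?y p = comb ?z (tens (tri_basis s a) (tri_basis s a)) p"
      using val[of "fst p" "snd p"] unfolding prod.collapse by (rule sym)
  qed
  have "tensor_bundle K N N w ?y = std ?z"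
    unfolding yz by (rule onb_norm[OF tensor_bundle_onb[where N=N and M=N, OF N N] z])
  also have "\<dots> = (if archimedean w then sqrt 2 else 1) / Cv_abs K w a"
  proof -
    have ab: "Cv_abs K w ?b = 1 / Cv_abs K w a" "Cv_abs K w a > 0"
      using Cv.v_inv[OF a] Cv.v_pos[OF a] by auto
    show ?thesis
    proof (cases "archimedean w")
      case True
      have "std ?z = sqrt (2 * (1 / Cv_abs K w a)\<^sup>2)"
        using True ab b unfolding std_norm_def UNIV_2_2 by simp
      then show ?thesis using True ab by (simp add: real_sqrt_mult)
    next
      case False
      then show ?thesis
        using ab b unfolding std_norm_def UNIV_2_2 by (simp add: max_def)
    qed
  qed
  finally show ?thesis .
qed

end

section \<open>Gaussian numbers and the places above \<open>5\<close>\<close>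

lemma gaussian_rationals_props:
  shows "subfield gaussian_rationals \<CC>" "\<i> \<in> gaussian_rationals"
    "ring.finite_dimension \<CC> \<rat> gaussian_rationals"
proof -
  interpret Q: complex_subfield \<rat> by (rule complex_subfield_Rats)
  have sub: "subfield (generate_field \<CC> {\<i>}) \<CC>"
    by (rule Q.CC.generate_field_is_subfield) simp
  then show "subfield gaussian_rationals \<CC>" by (simp add: gaussian_rationals_def)
  have i: "\<i> \<in> generate_field \<CC> {\<i>}" by (rule generate_field.incl) simp
  then show "\<i> \<in> gaussian_rationals" by (simp add: gaussian_rationals_def)
  have ai: "alg \<rat> \<i>"
    unfolding Q.alg_iff by (intro bexI[of _ "[:1, 0, 1:]"]) auto
  interpret A: complex_subfield "adjoin \<rat> \<i>" by (rule Q.adjoin_subfield[OF ai])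
  have g: "complex_subfield (generate_field \<CC> {\<i>})" using sub by (simp add: complex_subfield_def)
  have "generate_field \<CC> {\<i>} \<subseteq> adjoin \<rat> \<i>"
    using Q.CC.generate_field_min_subfield1[of "{\<i>}" "adjoin \<rat> \<i>"] A.subfield_k Q.adjoin_self by simp
  moreover have "adjoin \<rat> \<i> \<subseteq> generate_field \<CC> {\<i>}"
    using Q.adjoin_least[OF g complex_subfield.Rats_subset[OF g] i] .
  ultimately have "gaussian_rationals = adjoin \<rat> \<i>" by (simp add: gaussian_rationals_def)
  then show "ring.finite_dimension \<CC> \<rat> gaussian_rationals"
    using Q.CC.finite_dimensionI[OF Q.adjoin_dimension[OF ai]] by simp
qed

lemma finite_extension_trans:
  assumes "finite_extension_of k K" "subfield F \<CC>" "ring.finite_dimension \<CC> F k"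
  shows "ring.finite_dimension \<CC> F K"
  using field.is_ring[OF field_CC] ring.telescopic_base_dim(1)[of \<CC> F k K] assms
  unfolding finite_extension_of_def by blast

lemma gaussian_integers_subset:
  assumes "complex_subfield k" "\<i> \<in> k" shows "gaussian_integers \<subseteq> k"
proof -
  interpret complex_subfield k by fact
  show ?thesis using assms(2) by (auto simp: gaussian_integers_def)
qed

lemma above_prime_cong:
  assumes "\<And>z. z \<in> gaussian_integers \<Longrightarrow> v z = w z" shows "above_prime v \<pi> = above_prime w \<pi>"
  unfolding above_prime_def using assms by (metis (mono_tags, lifting) Collect_cong)

lemma above_primeD: "above_prime w \<pi> \<Longrightarrow> w \<pi> < 1"
proof -
  assume a: "above_prime w \<pi>"
  have "1 \<in> gaussian_integers"
    unfolding gaussian_integers_def by (rule CollectI, rule exI[of _ 1], rule exI[of _ 0]) simp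
  then have "\<pi> * 1 \<in> {\<pi> * z | z. z \<in> gaussian_integers}" by blast
  then have "\<pi> * 1 \<in> {z \<in> gaussian_integers. w z < 1}" using a unfolding above_prime_def by blast
  then show ?thesis by simp
qed

lemma gaussian_mult: "y \<in> gaussian_integers \<Longrightarrow> z \<in> gaussian_integers \<Longrightarrow> y * z \<in> gaussian_integers"
proof -
  assume "y \<in> gaussian_integers" "z \<in> gaussian_integers"
  then obtain a b c d where "y = of_int a + of_int b * \<i>" "z = of_int c + of_int d * \<i>"
    by (auto simp: gaussian_integers_def)
  then have "y * z = of_int (a * c - b * d) + of_int (a * d + b * c) * \<i>"
    by (simp add: algebra_simps)
  then show ?thesis unfolding gaussian_integers_def by blast
qed

context complex_valued
begin

lemma w_i: "\<i> \<in> K \<Longrightarrow> w \<i> = 1"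
proof -
  assume i: "\<i> \<in> K"
  have "\<i> ^ 4 = (1::complex)" by (simp add: eval_nat_numeral)
  then have "w \<i> ^ 4 = 1" using w_power[OF i, of 4] by (simp only: w_1)
  then show ?thesis using w_nonneg[OF i] power_eq_iff_eq_base[of 4 "w \<i>" 1] by simp
qed

lemma norm_five: "\<i> \<in> K \<Longrightarrow> w (2 + \<i>) * w (2 - \<i>) = w 5"
proof -
  assume i: "\<i> \<in> K"
  have "(2 + \<i>) * (2 - \<i>) = 5" by (simp add: algebra_simps)
  moreover have "2 + \<i> \<in> K" "2 - \<i> \<in> K" using i k_of_nat[of 2] by auto
  ultimately show ?thesis using w_mult by metis
qed

lemma nonarch_le_1:
  assumes p: "Factorial_Ring.prime p" "\<And>q. w (of_rat q) = padic_abs p q"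
  shows w_of_int: "w (of_int n) \<le> 1" and w_gaussian: "\<i> \<in> K \<Longrightarrow> z \<in> gaussian_integers \<Longrightarrow> w z \<le> 1"
proof -
  show n: "w (of_int n) \<le> 1" for n
    using p(2)[of "of_int n"] padic_abs_int_le_1[OF p(1), of n] by simp
  assume i: "\<i> \<in> K" and "z \<in> gaussian_integers"
  then obtain a b where z: "z = of_int a + of_int b * \<i>" by (auto simp: gaussian_integers_def)
  have "w z \<le> max (w (of_int a)) (w (of_int b * \<i>))"
    unfolding z by (rule ultrametric[OF p]) (use i in auto)
  then show "w z \<le> 1" using n[of a] n[of b] i by (simp add: w_mult w_i)
qed

text \<open>Modulo \<open>2 + s i\<close> the number \<open>a + b i\<close> is congruent to the
  integer \<open>a - 2 s b\<close>. If the number has value below 1, so has this integer, which is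
  then divisible by \<open>5 = (2 + s i)(2 - s i)\<close>.\<close>

lemma above_primeI:
  fixes s :: int
  assumes s: "s = 1 \<or> s = -1" and i: "\<i> \<in> K"
    and w: "\<And>q. w (of_rat q) = padic_abs 5 q" and \<pi>: "w (2 + of_int s * \<i>) < 1"
  shows "above_prime w (2 + of_int s * \<i>)"
proof -
  let ?p = "2 + of_int s * \<i>"
  have p5: "Factorial_Ring.prime (5::nat)" by simp
  have pK: "?p \<in> K" using i k_of_nat[of 2] by auto
  have pg: "?p \<in> gaussian_integers"
    unfolding gaussian_integers_def by (rule CollectI, rule exI[of _ 2], rule exI[of _ s]) simp
  have "\<exists>y\<in>gaussian_integers. z = ?p * y" if z: "z \<in> gaussian_integers" "w z < 1" for z
  proof -
    obtain a b where ab: "z = of_int a + of_int b * \<i>" using z(1) by (auto simp: gaussian_integers_def)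
    define m where "m = a - 2 * s * b"
    have ss: "of_int s * of_int s = (1::complex)" using s by auto
    have "z - of_int (s * b) * ?p = of_int m + (of_int b - of_int s * of_int s * of_int b) * \<i>"
      by (simp add: ab m_def algebra_simps)
    then have eq: "of_int m = z - of_int (s * b) * ?p" by (simp add: ss)
    have zK: "z \<in> K" using ab i by auto
    have "w (of_int (s * b) * ?p) \<le> 1 * w ?p"
      unfolding w_mult[OF k_of_int pK] using w_of_int[OF p5 w, of "s * b"] pK by (intro mult_right_mono) (auto simp del: of_int_mult)
    moreover have "w (of_int m) \<le> max (w z) (w (of_int (s * b) * ?p))"
      unfolding eq by (rule ultrametric_diff[OF p5 w]) (use zK pK in auto)
    ultimately have m1: "w (of_int m) < 1" using z(2) \<pi> by auto
    have "5 dvd m"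
    proof (rule ccontr)
      assume nd: "\<not> 5 dvd m"
      then have "m \<noteq> 0" by auto
      moreover have "multiplicity (int 5) m = 0" using nd by (simp add: not_dvd_imp_multiplicity_0)
      ultimately have "padic_abs 5 (of_int m) = 1" using padic_abs_fraction[OF p5, of m 1] by simp
      then show False using w[of "of_int m"] m1 by simp
    qed
    then obtain t where t: "m = 5 * t" by auto
    have "z = ?p * (of_int (s * b) + of_int t * (2 - of_int s * \<i>))"
    proof -
      have "?p * (2 - of_int s * \<i>) = 4 + of_int s * of_int s" by (simp add: algebra_simps)
      then have p5: "?p * (2 - of_int s * \<i>) = 5" by (simp add: ss)
      have "x * (y + r * u) = y * x + r * (x * u)" for x y r u :: complex by (simp add: algebra_simps)
      from this[of ?p "of_int (s * b)" "of_int t" "2 - of_int s * \<i>"]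
      have "?p * (of_int (s * b) + of_int t * (2 - of_int s * \<i>)) = of_int (s * b) * ?p + of_int m"
        unfolding p5 t by simp
      then show ?thesis unfolding eq by (simp only: add_diff_eq diff_add_cancel add_diff_cancel_left')
    qed
    moreover have "of_int (s * b) + of_int t * (2 - of_int s * \<i>) = of_int (s * b + 2 * t) + of_int (- t * s) * \<i>"
      by (simp add: algebra_simps)
    then have "of_int (s * b) + of_int t * (2 - of_int s * \<i>) \<in> gaussian_integers"
      unfolding gaussian_integers_def by blast
    ultimately show ?thesis by blast
  qed
  moreover have "?p * z \<in> gaussian_integers \<and> w (?p * z) < 1" if z: "z \<in> gaussian_integers" for z
  proof -
    have zK: "z \<in> K" using z i by (auto simp: gaussian_integers_def)
    have "w (?p * z) \<le> w ?p * 1"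
      unfolding w_mult[OF pK zK] using w_gaussian[OF p5 w i z] pK by (intro mult_left_mono) auto
    then show ?thesis using \<pi> gaussian_mult[OF pg z] by simp
  qed
  ultimately show ?thesis unfolding above_prime_def by auto
qed

text \<open>The numbers \<open>2 + i\<close> and \<open>2 - i\<close> have product 5 and sum 4.
  Above 5 the sum is a unit, so exactly one of them has value 1/5 and the other is a unit. At an
  archimedean place both have value at most 3, so neither can be below 1.\<close>

lemma place_types:
  assumes w: "w \<in> places K" and i: "\<i> \<in> K"
  obtains (arch) "archimedean w" "\<not> above_prime w (2 + \<i>)" "\<not> above_prime w (2 - \<i>)" "w 5 = 5"
  | (plus) "\<not> archimedean w" "\<And>q. w (of_rat q) = padic_abs 5 q" "w 5 = 1/5" "w (2 + \<i>) = 1/5"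
      "above_prime w (2 + \<i>)" "\<not> above_prime w (2 - \<i>)"
  | (minus) "\<not> archimedean w" "\<And>q. w (of_rat q) = padic_abs 5 q" "w 5 = 1/5" "w (2 - \<i>) = 1/5"
      "\<not> above_prime w (2 + \<i>)" "above_prime w (2 - \<i>)"
  | (other) p :: nat where "\<not> archimedean w" "Factorial_Ring.prime p" "\<And>q. w (of_rat q) = padic_abs p q"
      "w 5 = 1" "\<not> above_prime w (2 + \<i>)" "\<not> above_prime w (2 - \<i>)"
proof -
  have K2: "2 + \<i> \<in> K" "2 - \<i> \<in> K" "2 \<in> K" using i k_of_nat[of 2] by auto
  have nn: "w (2 + \<i>) \<ge> 0" "w (2 - \<i>) \<ge> 0" using K2 by auto
  note n5 = norm_five[OF i]
  show ?thesis
  proof (cases "archimedean w")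
    case True
    then have w2: "w 2 = 2" and w5: "w 5 = 5"
      unfolding archimedean_def by (metis abs_numeral of_rat_numeral_eq)+
    have le: "w (2 + \<i>) \<le> 3" "w (2 - \<i>) \<le> 3"
      using w_add[of 2 \<i>] w_diff[of 2 \<i>] K2 i w2 w_i by auto
    have "\<not> w (2 + \<i>) < 1"
    proof
      assume "w (2 + \<i>) < 1"
      then have "w (2 + \<i>) * w (2 - \<i>) \<le> 1 * 3" using le nn by (intro mult_mono) auto
      then show False using n5 w5 by simp
    qed
    moreover have "\<not> w (2 - \<i>) < 1"
    proof
      assume "w (2 - \<i>) < 1"
      then have "w (2 + \<i>) * w (2 - \<i>) \<le> 3 * 1" using le nn by (intro mult_mono) auto
      then show False using n5 w5 by simp
    qed
    ultimately show ?thesis using arch True above_primeD w5 by blast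
  next
    case False
    then obtain p :: nat where p: "Factorial_Ring.prime p" "\<And>q. w (of_rat q) = padic_abs p q"
      using w unfolding places_def by blast
    have p5: "Factorial_Ring.prime (5::nat)" by simp
    have w5: "w 5 = (if p = 5 then 1/5 else 1)"
      using p(2)[of 5] padic_abs_prime[OF p(1) p5] by (auto split: if_splits)
    have g: "2 + \<i> \<in> gaussian_integers" "2 - \<i> \<in> gaussian_integers"
      unfolding gaussian_integers_def
      by (rule CollectI, rule exI[of _ 2], rule exI[of _ 1], simp)
        (rule CollectI, rule exI[of _ 2], rule exI[of _ "-1"], simp)
    have le: "w (2 + \<i>) \<le> 1" "w (2 - \<i>) \<le> 1"
      using w_gaussian[OF p i] g by auto
    show ?thesis
    proof (cases "p = 5")
      case neq: False
      have "w (2 + \<i>) = 1" "w (2 - \<i>) = 1"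
        using n5 w5 neq le nn mult_mono[of "w (2 + \<i>)" 1 "w (2 - \<i>)" "w (2 - \<i>)"]
          mult_mono[of "w (2 + \<i>)" "w (2 + \<i>)" "w (2 - \<i>)" 1] by auto
      then show ?thesis using other[OF False p] w5 neq above_primeD by force
    next
      case True
      have q: "w (of_rat q) = padic_abs 5 q" for q using p(2) True by simp
      have "w 4 = 1"
        using q[of 4] padic_abs_fraction[OF p5, of 4 1] by (simp add: not_dvd_imp_multiplicity_0)
      moreover have "w 4 \<le> max (w (2 + \<i>)) (w (2 - \<i>))"
        using ultrametric[OF p K2(1,2)] by simp
      ultimately have disj: "w (2 + \<i>) = 1 \<or> w (2 - \<i>) = 1" using le by auto
      have pr: "w (2 + \<i>) * w (2 - \<i>) = 1/5" using n5 w5 True by simp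
      from disj show ?thesis
      proof
        assume 1: "w (2 + \<i>) = 1"
        then have 2: "w (2 - \<i>) = 1/5" using pr by simp
        have "above_prime w (2 - \<i>)" using above_primeI[of "-1"] i q 2 by simp
        moreover have "\<not> above_prime w (2 + \<i>)" using above_primeD[of w "2 + \<i>"] 1 by auto
        ultimately show ?thesis using minus[OF False q] w5 True 2 by simp
      next
        assume 1: "w (2 - \<i>) = 1"
        then have 2: "w (2 + \<i>) = 1/5" using pr by simp
        have "above_prime w (2 + \<i>)" using above_primeI[of 1] i q 2 by simp
        moreover have "\<not> above_prime w (2 - \<i>)" using above_primeD[of w "2 - \<i>"] 1 by auto
        ultimately show ?thesis using plus[OF False q] w5 True 2 by simp
      qed
    qed
  qed
qed

end

section \<open>Local inequalities\<close>

text \<open>The forms \<open>b\<^sup>5 + 2ia\<^sup>5\<close> and \<open>a\<^sup>5 + 2ib\<^sup>5\<close> are congruent to multiples of \<open>a\<^sup>5 + b\<^sup>5\<close> modulo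
  \<open>2 + i\<close> and of \<open>a\<^sup>5 - b\<^sup>5\<close> modulo \<open>2 - i\<close>; hence they are small at all places above \<open>5\<close>, while at
  the archimedean places they are at most \<open>3\<close> when \<open>|a| = |b| = 1\<close>.\<close>

definition quintic :: "complex \<Rightarrow> complex \<Rightarrow> complex"
  where "quintic a b = b ^ 5 + 2 * \<i> * a ^ 5"

lemma (in complex_subfield) quintic_in: "\<i> \<in> k \<Longrightarrow> a \<in> k \<Longrightarrow> b \<in> k \<Longrightarrow> quintic a b \<in> k"
  using k_of_nat[of 2] by (simp add: quintic_def)

text \<open>The left side is \<open>z^3 (8 - 5z)^2\<close>, with maximum about 9.1 on the interval.
  The value 24 is a convenient one below 25, the factor gained at the places above 5. The cut at
  63/100 lies just beyond the point where \<open>(8 - 5z)^2 = 24\<close>; to the left of it the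
  factor \<open>z^3\<close> suffices.\<close>

lemma archimedean_inequality_aux:
  fixes z :: real
  assumes z: "0 \<le> z" "z \<le> 1"
  shows "z ^ 3 * (64 - 80 * z + 25 * z\<^sup>2) \<le> 24"
proof -
  have nn: "64 - 80 * z + 25 * z\<^sup>2 \<ge> 0"
  proof -
    have "64 - 80 * z + 25 * z\<^sup>2 = (5 * z - 8)\<^sup>2" by (simp add: power2_eq_square algebra_simps)
    then show ?thesis by simp
  qed
  show ?thesis
  proof (cases "z \<ge> 63/100")
    case True
    \<comment> \<open>Replacing \<open>z^2\<close> by its chord over the interval from 63/100 to 1
      makes the claim linear.\<close>
    have "(z - 63/100) * (1 - z) \<ge> 0" using True z by (intro mult_nonneg_nonneg) auto
    moreover have "(z - 63/100) * (1 - z) = 163/100 * z - 63/100 - z\<^sup>2"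
      by (simp add: power2_eq_square field_simps)
    ultimately have "z\<^sup>2 \<le> 163/100 * z - 63/100" by linarith
    then have "64 - 80 * z + 25 * z\<^sup>2 \<le> 24" using True by linarith
    moreover have "z ^ 3 \<le> 1" using z by (intro power_le_one)
    ultimately have "z ^ 3 * (64 - 80 * z + 25 * z\<^sup>2) \<le> 1 * 24"
      using nn z by (intro mult_mono) auto
    then show ?thesis by simp
  next
    case False
    have "z\<^sup>2 \<le> z" using z by (simp add: power2_eq_square mult_left_le)
    then have "64 - 80 * z + 25 * z\<^sup>2 \<le> 64" using z by linarith
    moreover have "z ^ 3 \<le> (63/100) ^ 3" using False z by (intro power_mono) auto
    ultimately have "z ^ 3 * (64 - 80 * z + 25 * z\<^sup>2) \<le> (63/100) ^ 3 * 64"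
      using nn z by (intro mult_mono) auto
    also have "\<dots> \<le> 24" by (simp add: power3_eq_cube)
    finally show ?thesis .
  qed
qed

text \<open>The product of the two factors is \<open>5 (st)^5 + 2 (s^10 + t^10)\<close>, and
  \<open>s^10 + t^10\<close> is a polynomial in \<open>s^2 + t^2 = 2m\<close> and
  \<open>e = (st)^2\<close>. The odd power of \<open>st\<close> is removed by
  \<open>st \<le> m\<close>. By homogeneity only the ratio \<open>z\<close> of \<open>e\<close> to
  \<open>m^2\<close> matters, which lies between 0 and 1.\<close>

lemma archimedean_inequality:
  fixes s t :: real
  assumes st: "s \<ge> 0" "t \<ge> 0"
  shows "2 ^ 11 / 24 * ((s * t) ^ 6 * ((t ^ 5 + 2 * s ^ 5) * (s ^ 5 + 2 * t ^ 5))) \<le> (s\<^sup>2 + t\<^sup>2) ^ 11"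
proof (cases "s\<^sup>2 + t\<^sup>2 = 0")
  case True
  then show ?thesis by (simp add: sum_power2_eq_zero_iff)
next
  case False
  define m where "m = (s\<^sup>2 + t\<^sup>2) / 2"
  define e where "e = (s * t)\<^sup>2"
  have m: "m > 0" using False by (simp add: m_def less_le)
  have stm: "s * t \<le> m"
    using sum_squares_bound[of s t] by (simp add: m_def)
  have em: "e \<le> m\<^sup>2" unfolding e_def using stm st by (intro power_mono) auto
  have "(t ^ 5 + 2 * s ^ 5) * (s ^ 5 + 2 * t ^ 5) = 5 * (s * t * e\<^sup>2) + 2 * (32 * m ^ 5 - 40 * m ^ 3 * e + 10 * m * e\<^sup>2)"
    unfolding m_def e_def by (simp add: field_simps power2_eq_square power3_eq_cube eval_nat_numeral)
  also have "\<dots> \<le> 5 * (m * e\<^sup>2) + 2 * (32 * m ^ 5 - 40 * m ^ 3 * e + 10 * m * e\<^sup>2)"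
    using stm by (intro add_right_mono mult_left_mono mult_right_mono) auto
  finally have D: "(t ^ 5 + 2 * s ^ 5) * (s ^ 5 + 2 * t ^ 5) \<le> m * (64 * m ^ 4 - 80 * m\<^sup>2 * e + 25 * e\<^sup>2)"
    by (simp add: algebra_simps power2_eq_square eval_nat_numeral)
  define z where "z = e / m\<^sup>2"
  have z: "0 \<le> z" "z \<le> 1" "e = z * m\<^sup>2"
    using em m by (auto simp: z_def e_def divide_le_eq)
  have "(s * t) ^ 6 = e ^ 3" by (simp add: e_def power_mult[symmetric])
  then have "(s * t) ^ 6 * ((t ^ 5 + 2 * s ^ 5) * (s ^ 5 + 2 * t ^ 5)) \<le> e ^ 3 * (m * (64 * m ^ 4 - 80 * m\<^sup>2 * e + 25 * e\<^sup>2))"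
    using D by (simp add: e_def mult_left_mono)
  also have "\<dots> = m ^ 11 * (z ^ 3 * (64 - 80 * z + 25 * z\<^sup>2))"
    unfolding z(3) by (simp add: algebra_simps power2_eq_square eval_nat_numeral)
  also have "\<dots> \<le> m ^ 11 * 24"
    using archimedean_inequality_aux[OF z(1,2)] m by (intro mult_left_mono) auto
  finally have "2 ^ 11 / 24 * ((s * t) ^ 6 * ((t ^ 5 + 2 * s ^ 5) * (s ^ 5 + 2 * t ^ 5))) \<le> 2 ^ 11 / 24 * (m ^ 11 * 24)"
    by (intro mult_left_mono) auto
  also have "\<dots> = (s\<^sup>2 + t\<^sup>2) ^ 11"
    by (simp add: m_def power_divide)
  finally show ?thesis .
qed

context complex_valued
begin

lemma quintic_le_3: "w 2 = 2 \<Longrightarrow> \<i> \<in> K \<Longrightarrow> a \<in> K \<Longrightarrow> b \<in> K \<Longrightarrow> w (quintic a b) \<le> w b ^ 5 + 2 * w a ^ 5"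
  using w_add[of "b ^ 5" "2 * \<i> * a ^ 5"] k_of_nat[of 2] by (simp add: quintic_def w_mult w_power w_i)

lemma quintic_le_max:
  assumes p: "Factorial_Ring.prime p" "\<And>q. w (of_rat q) = padic_abs p q"
    and ab: "\<i> \<in> K" "a \<in> K" "b \<in> K" "w a \<le> M" "w b \<le> M"
  shows "w (quintic a b) \<le> M ^ 5"
proof -
  have K2: "2 \<in> K" using k_of_nat[of 2] by simp
  have w2: "w 2 \<le> 1" using w_of_int[OF p, of 2] by simp
  have "w (quintic a b) \<le> max (w (b ^ 5)) (w (2 * \<i> * a ^ 5))"
    unfolding quintic_def by (rule ultrametric[OF p]) (use ab K2 in auto)
  moreover have "w (b ^ 5) \<le> M ^ 5" using ab by (simp add: w_power power_mono)
  moreover have "w (2 * \<i> * a ^ 5) \<le> 1 * M ^ 5"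
    using ab K2 w2 by (simp add: w_mult w_power w_i) (metis mult.left_neutral mult_mono power_mono w_nonneg zero_le_one zero_le_power)
  ultimately show ?thesis by auto
qed

text \<open>Substituting \<open>b = u - a\<close> gives \<open>u^5 - 5 u g\<close>, since the inner
  binomial coefficients of the fifth power are divisible by 5. The second term is small because of
  the factor 5, the first by the assumption on \<open>u\<close>.\<close>

lemma fifth_powers_sum:
  assumes w: "\<And>q. w (of_rat q) = padic_abs 5 q"
    and ab: "a \<in> K" "b \<in> K" "w a \<le> M" "w (a + b) \<le> M" and u: "w (a + b) ^ 5 \<le> M ^ 5 / 5"
  shows "w (a ^ 5 + b ^ 5) \<le> M ^ 5 / 5"
proof -
  have p5: "Factorial_Ring.prime (5::nat)" by simp
  have M: "M \<ge> 0" using ab(3) w_nonneg[OF ab(1)] by linarith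
  define u where "u = a + b"
  have uK: "u \<in> K" using ab by (auto simp: u_def)
  have num: "numeral n \<in> K" for n using k_of_nat[of "numeral n"] by simp
  have w5: "w 5 = 1/5" using w[of 5] padic_abs_prime[OF p5 p5] by simp
  have w2: "w 2 \<le> 1" using w_of_int[OF p5 w, of 2] by simp
  define g where "g = (u ^ 3 * a - 2 * (u\<^sup>2 * a\<^sup>2)) + (2 * (u * a ^ 3) - a ^ 4)"
  have gK: "u ^ 3 * a \<in> K" "2 * (u\<^sup>2 * a\<^sup>2) \<in> K" "2 * (u * a ^ 3) \<in> K" "a ^ 4 \<in> K"
    using uK ab num by auto
  have mono: "w (u ^ i * a ^ j) \<le> M ^ (i + j)" for i j
    unfolding power_add using uK ab M by (simp add: w_mult w_power u_def mult_mono power_mono)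
  have two: "w (2 * y) \<le> B" if "y \<in> K" "w y \<le> B" for y B
  proof -
    have "w (2 * y) \<le> 1 * w y"
      unfolding w_mult[OF num that(1)] using w2 that by (intro mult_right_mono) auto
    then show ?thesis using that by simp
  qed
  have bounds: "w (u ^ 3 * a) \<le> M ^ 4" "w (2 * (u\<^sup>2 * a\<^sup>2)) \<le> M ^ 4" "w (2 * (u * a ^ 3)) \<le> M ^ 4" "w (a ^ 4) \<le> M ^ 4"
    using mono[of 3 1] mono[of 2 2] mono[of 1 3] mono[of 0 4] uK ab by (auto intro!: two)
  have "w g \<le> max (w (u ^ 3 * a - 2 * (u\<^sup>2 * a\<^sup>2))) (w (2 * (u * a ^ 3) - a ^ 4))"
    unfolding g_def by (rule ultrametric[OF p5 w]) (use gK in auto)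
  also have "\<dots> \<le> M ^ 4"
    using ultrametric_diff[OF p5 w gK(1,2)] ultrametric_diff[OF p5 w gK(3,4)] bounds by auto
  finally have g: "w g \<le> M ^ 4" .
  have gK': "g \<in> K" unfolding g_def using gK by auto
  have eq: "a ^ 5 + b ^ 5 = u ^ 5 - 5 * (u * g)"
    unfolding g_def u_def by (simp add: algebra_simps power2_eq_square eval_nat_numeral)
  have "w (5 * (u * g)) = 1/5 * (w u * w g)"
    using num uK gK' by (simp add: w_mult w5)
  also have "\<dots> \<le> 1/5 * (M * M ^ 4)"
    using g ab M uK gK' by (intro mult_left_mono mult_mono) (auto simp: u_def)
  finally have "w (5 * (u * g)) \<le> M ^ 5 / 5" by (simp add: eval_nat_numeral)
  moreover have "w (u ^ 5) \<le> M ^ 5 / 5" using u uK by (simp add: w_power u_def)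
  moreover have "w (u ^ 5 - 5 * (u * g)) \<le> max (w (u ^ 5)) (w (5 * (u * g)))"
    by (rule ultrametric_diff[OF p5 w]) (use uK gK' num in auto)
  ultimately show ?thesis unfolding eq by auto
qed

text \<open>From \<open>2i = i (2 + s i) + s\<close> both forms are, up to the sign
  \<open>s\<close>, equal to \<open>a^5 + s b^5\<close> plus a multiple of \<open>2 + s i\<close>,
  which has value 1/5. The condition \<open>5 \<le> c ^ 5\<close> turns the weight \<open>c\<close>
  on \<open>a + s b\<close> into the assumption of \<open>fifth_powers_sum\<close>.\<close>

lemma quintic_small:
  fixes s :: int
  assumes w: "\<And>q. w (of_rat q) = padic_abs 5 q" and s: "s = 1 \<or> s = -1"
    and \<pi>: "w (2 + of_int s * \<i>) = 1/5" and i: "\<i> \<in> K"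
    and ab: "a \<in> K" "b \<in> K" "w a \<le> M" and c: "c \<ge> 1" "c ^ 5 \<ge> 5" "c * w (a + of_int s * b) \<le> M"
  shows "w b \<le> M" "w (quintic a b) \<le> M ^ 5 / 5" "w (quintic b a) \<le> M ^ 5 / 5"
proof -
  have p5: "Factorial_Ring.prime (5::nat)" by simp
  have num: "numeral n \<in> K" for n using k_of_nat[of "numeral n"] by simp
  define b' where "b' = of_int s * b"
  have b': "b' \<in> K" using ab by (auto simp: b'_def)
  have ss: "of_int s * (of_int s * y) = y" for y :: complex using s by auto
  have b_eq: "b = of_int s * b'" by (simp add: b'_def ss)
  have b5: "b' ^ 5 = of_int s * b ^ 5" using s by (auto simp: b'_def)
  have wb: "w b' = w b" using s ab by (auto simp: b'_def)
  have M: "M \<ge> 0" using ab(3) w_nonneg[OF ab(1)] by linarith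
  have uK: "a + b' \<in> K" using ab b' by auto
  have "1 * w (a + b') \<le> c * w (a + b')" using c uK by (intro mult_right_mono) auto
  then have u: "w (a + b') \<le> M" using c(3) by (simp add: b'_def)
  have "5 * w (a + b') ^ 5 \<le> c ^ 5 * w (a + b') ^ 5" using c uK by (intro mult_right_mono) auto
  also have "\<dots> = (c * w (a + b')) ^ 5" by (simp add: power_mult_distrib)
  also have "\<dots> \<le> M ^ 5" using c uK by (intro power_mono) (auto simp: b'_def)
  finally have u5: "w (a + b') ^ 5 \<le> M ^ 5 / 5" by simp
  have "w ((a + b') - a) \<le> max (w (a + b')) (w a)"
    by (rule ultrametric_diff[OF p5 w uK ab(1)])
  then show wbM: "w b \<le> M" using u ab wb by auto
  note sum5 = fifth_powers_sum[OF w ab(1) b' ab(3) u u5]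
  have \<pi>K: "2 + of_int s * \<i> \<in> K" using i num by auto
  have pi: "w (\<i> * (2 + of_int s * \<i>) * y ^ 5) \<le> M ^ 5 / 5" if "y \<in> K" "w y \<le> M" for y
  proof -
    have "w (\<i> * (2 + of_int s * \<i>) * y ^ 5) = 1/5 * w y ^ 5"
      using w_mult[of "\<i> * (2 + of_int s * \<i>)" "y ^ 5"] w_mult[OF i \<pi>K] w_power[OF that(1), of 5]
        w_i[OF i] \<pi> \<pi>K i that(1) by simp
    then show ?thesis using power_mono[OF that(2), of 5] that(1) by simp
  qed
  have ieq: "2 * \<i> = \<i> * (2 + of_int s * \<i>) + of_int s" by (simp add: algebra_simps)
  have sK: "(of_int s :: complex) \<in> K" by simp
  have "quintic a b = of_int s * (a ^ 5 + b' ^ 5) + \<i> * (2 + of_int s * \<i>) * a ^ 5"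
    unfolding quintic_def b5 using ss[of "b ^ 5"] ieq by (simp add: algebra_simps)
  moreover have "w (of_int s * (a ^ 5 + b' ^ 5) + \<i> * (2 + of_int s * \<i>) * a ^ 5) \<le>
      max (w (of_int s * (a ^ 5 + b' ^ 5))) (w (\<i> * (2 + of_int s * \<i>) * a ^ 5))"
    by (rule ultrametric[OF p5 w]) (use ab b' i num in auto)
  moreover have ws: "w (of_int s * y) = w y" if "y \<in> K" for y using s that by auto
  ultimately show "w (quintic a b) \<le> M ^ 5 / 5"
    using sum5 pi[OF ab(1,3)] ws[of "a ^ 5 + b' ^ 5"] ab b' by auto
  have "quintic b a = (a ^ 5 + b' ^ 5) + \<i> * (2 + of_int s * \<i>) * b ^ 5"
    unfolding quintic_def b5 using ieq by (simp add: algebra_simps)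
  moreover have "w ((a ^ 5 + b' ^ 5) + \<i> * (2 + of_int s * \<i>) * b ^ 5) \<le>
      max (w (a ^ 5 + b' ^ 5)) (w (\<i> * (2 + of_int s * \<i>) * b ^ 5))"
    by (rule ultrametric[OF p5 w]) (use ab b' i num in auto)
  ultimately show "w (quintic b a) \<le> M ^ 5 / 5"
    using sum5 pi[OF ab(2) wbM] by auto
qed

end

section \<open>The norms of the bundle and of its tensor square\<close>

context complex_valued
begin

lemma w_power_int: "x \<in> K \<Longrightarrow> w (x powi n) = w x powi n"
  by (simp add: power_int_def w_power w_inverse)

text \<open>A \<open>q\<close>-th power is determined only up to a root of unity, but raising it to
  the denominator of \<open>q\<close> fixes its absolute value.\<close>

lemma w_rat_power:
  assumes r: "is_rat_power z q \<alpha>" and K: "z \<in> K" "\<alpha> \<in> K" and z: "w z = 1 / 5"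
  shows "w \<alpha> = 5 powr - of_rat q"
proof -
  obtain a b where ab: "quotient_of q = (a, b)" by force
  have b: "b > 0" using quotient_of_denom_pos[OF ab] .
  have q: "of_rat q = real_of_int a / real_of_int b"
    using quotient_of_div[OF ab] by (simp add: of_rat_divide)
  have "\<alpha> ^ nat b = z powi a" using r ab by (simp add: is_rat_power_def)
  then have "w \<alpha> ^ nat b = w z powi a" using w_power[OF K(2)] w_power_int[OF K(1)] by metis
  also have "\<dots> = 5 powr - real_of_int a"
    unfolding z using powr_real_of_int'[of "1/5" a] by (simp add: powr_divide powr_minus_divide)
  also have "\<dots> = (5 powr - of_rat q) ^ nat b"
    using b by (simp add: q powr_powr flip: powr_realpow)
  finally show ?thesis
    using power_eq_iff_eq_base[of "nat b" "w \<alpha>" "5 powr - of_rat q"] b K by simp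
qed

end

text \<open>The bundle norm expressed by a place \<open>w\<close> of \<open>K\<close> itself,
  without passing to \<open>C_v\<close>; \<open>bundle_norm_Eq\<close> makes the link. With a real
  parameter \<open>c\<close> in place of \<open>5^q\<close> the estimates no longer depend on
  \<open>q\<close>.\<close>

definition Eq_norm :: "real \<Rightarrow> (complex \<Rightarrow> real) \<Rightarrow> (2 \<Rightarrow> complex) \<Rightarrow> real"
  where "Eq_norm c w x =
    (if above_prime w (2 + \<i>) then max (w (x 1)) (c * w (x 1 + x 2))
     else if above_prime w (2 - \<i>) then max (w (x 1)) (c * w (x 1 - x 2))
     else if archimedean w then sqrt ((w (x 1))\<^sup>2 + (w (x 2))\<^sup>2)
     else max (w (x 1)) (w (x 2)))"

definition wedge :: "2 \<times> 2 \<Rightarrow> complex"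
  where "wedge = (\<lambda>p. if p = (1, 2) then 1 else if p = (2, 1) then -1 else 0)"

lemma restricted_place:
  assumes kK: "finite_extension_of k K" and i: "\<i> \<in> k" and w: "w \<in> places K"
  defines "v \<equiv> place_below k w"
  shows "complex_subfield k" "complex_completion k v" "v \<in> places k" "\<And>x. x \<in> k \<Longrightarrow> v x = w x"
    "archimedean v \<longleftrightarrow> archimedean w" "above_prime v \<pi> \<longleftrightarrow> above_prime w \<pi>"
proof -
  show k: "complex_subfield k" using kK by (simp add: finite_extension_of_def complex_subfield_def)
  interpret complex_subfield k by (rule k)
  have sub: "k \<subseteq> K" using kK by (simp add: finite_extension_of_def)
  show v: "v \<in> places k" unfolding v_def by (rule place_below_places[OF k sub w])
  show "complex_completion k v"
    using places_complex_valued[OF k v] by (simp add: complex_completion_def)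
  show vw: "v x = w x" if "x \<in> k" for x using that by (simp add: v_def place_below_def)
  show "archimedean v \<longleftrightarrow> archimedean w" by (simp add: archimedean_def vw)
  show "above_prime v \<pi> \<longleftrightarrow> above_prime w \<pi>"
    using gaussian_integers_subset[OF k i] vw by (intro above_prime_cong) blast
qed

lemma bundle_norm_Eq:
  assumes kK: "finite_extension_of k K" and i: "\<i> \<in> k" and w: "w \<in> places K" and x: "\<And>j. x j \<in> K"
  shows "bundle_norm k (Eq_bundle k q) K w x = Eq_norm (5 powr of_rat q) w x"
proof -
  define v where "v = place_below k w"
  define h where "h = ext_emb k K w"
  note rp = restricted_place[OF kK i w, folded v_def]
  interpret complex_completion k v by (rule rp(2))
  interpret K: complex_subfield K using kK by (simp add: finite_extension_of_def complex_subfield_def)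
  have hom: "h \<in> Ring.ring_hom (subring_of K) C"
    unfolding h_def v_def by (rule ext_emb_hom[OF kK w])
  have habs: "Cv_abs k v (h z) = w z" if "z \<in> K" for z
    using ext_emb_abs[OF kK w] that unfolding h_def v_def by blast
  have hC: "h z \<in> carrier C" if "z \<in> K" for z using ring_hom_closed[OF hom] that by simp
  have hadd: "h (y + z) = h y \<oplus>\<^bsub>C\<^esub> h z" if "y \<in> K" "z \<in> K" for y z
    using ring_hom_add[OF hom] that by simp
  have hdiff: "h (y - z) = h y \<ominus>\<^bsub>C\<^esub> h z" if "y \<in> K" "z \<in> K" for y z
  proof -
    have "h y = h (y - z) \<oplus>\<^bsub>C\<^esub> h z" using hadd[of "y - z" z] that by simp
    then show ?thesis
      using hC[of "y - z"] hC[of z] that by (simp add: a_minus_def Cv.a_assoc Cv.r_neg)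
  qed
  show ?thesis
    unfolding bundle_norm_def Eq_bundle_def Eq_norm_def v_def[symmetric] h_def[symmetric] rp(6)
    using x by (simp add: std_2 rp(5) habs flip: hadd hdiff)
qed

lemma bundle_norm_wedge:
  assumes kK: "finite_extension_of k K" and i: "\<i> \<in> k" and w: "w \<in> places K"
    and \<alpha>: "is_rat_power (2 + \<i>) q \<alpha>" "\<alpha> \<in> k" and \<beta>: "is_rat_power (2 - \<i>) q \<beta>" "\<beta> \<in> k"
  shows "bundle_norm k (tensor_bundle k (Eq_bundle k q) (Eq_bundle k q)) K w wedge =
    (if archimedean w then sqrt 2 else if w 5 = 1/5 then 5 powr of_rat q else 1)"
proof -
  define v where "v = place_below k w"
  define h where "h = ext_emb k K w"
  define c where "c = (5::real) powr of_rat q"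
  have c: "c > 0" by (simp add: c_def)
  note rp = restricted_place[OF kK i w, folded v_def]
  interpret complex_completion k v by (rule rp(2))
  interpret K: complex_subfield K using kK by (simp add: finite_extension_of_def complex_subfield_def)
  have hom: "h \<in> Ring.ring_hom (subring_of K) C"
    unfolding h_def v_def by (rule ext_emb_hom[OF kK w])
  have hC: "h z \<in> carrier C" if "z \<in> K" for z using ring_hom_closed[OF hom] that by simp
  have h1: "h 1 = \<one>\<^bsub>C\<^esub>" using ring_hom_one[OF hom] by simp
  have hadd: "h (y + z) = h y \<oplus>\<^bsub>C\<^esub> h z" if "y \<in> K" "z \<in> K" for y z
    using ring_hom_add[OF hom] that by simp
  have h0: "h 0 = \<zero>\<^bsub>C\<^esub>"
    using hadd[of 0 0] hC[of 0] Cv.add.r_cancel_one[of "h 0" "h 0"] by simp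
  have hm1: "h (-1) = \<ominus>\<^bsub>C\<^esub> \<one>\<^bsub>C\<^esub>"
    using hadd[of "-1" 1] hC[of "-1"] h0 h1 Cv.minus_equality[of "h (-1)" "\<one>\<^bsub>C\<^esub>"] by simp
  have hw: "(\<lambda>p. h (wedge p)) =
      (\<lambda>p. if p = (1, 2) then \<one>\<^bsub>C\<^esub> else if p = (2, 1) then \<ominus>\<^bsub>C\<^esub> \<one>\<^bsub>C\<^esub> else \<zero>\<^bsub>C\<^esub>)"
    by (simp add: fun_eq_iff wedge_def h0 h1 hm1)
  have E: "bundle_norm k (tensor_bundle k (Eq_bundle k q) (Eq_bundle k q)) K w wedge =
      (if archimedean v then sqrt 2 else 1) / Cv_abs k v a"
    if "s \<in> carrier C" "a \<in> carrier C" "a \<noteq> \<zero>\<^bsub>C\<^esub>"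
      "\<And>x :: 2 \<Rightarrow> Cv. x \<in> vecs \<Longrightarrow>
        Eq_bundle k q v (\<lambda>i. if i = 1 then x 1 else x 1 \<otimes>\<^bsub>C\<^esub> s \<oplus>\<^bsub>C\<^esub> x 2 \<otimes>\<^bsub>C\<^esub> a) = std x" for s a
  proof -
    have N: "orthonormal_basis k v (Eq_bundle k q v) (tri_basis s a)"
      by (rule tri_basis_onb[OF that(1-3)]) (rule that(4))
    show ?thesis
      unfolding bundle_norm_def v_def[symmetric] h_def[symmetric] hw
      by (rule tensor_norm_wedge[where N = "Eq_bundle k q", OF that(1-3) N])
  qed
  have emb: "Cv_emb k v z \<in> carrier C" "Cv_abs k v (Cv_emb k v z) = v z" if "z \<in> k" for z
    using ring_hom_closed[OF Cv_emb_hom, of z] Cv_abs_emb[of z] that by auto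
  have gens: "2 + \<i> \<in> k" "2 - \<i> \<in> k" using i k_of_nat[of 2] by auto
  have w5: "w 5 = v 5" using rp(4)[of 5] k_of_nat[of 5] by simp
  have unit: "bundle_norm k (tensor_bundle k (Eq_bundle k q) (Eq_bundle k q)) K w wedge =
      (if archimedean v then sqrt 2 else 1)" if "\<not> above_prime v (2 + \<i>)" "\<not> above_prime v (2 - \<i>)"
  proof -
    have "Eq_bundle k q v (\<lambda>i. if i = 1 then x 1 else x 1 \<otimes>\<^bsub>C\<^esub> \<zero>\<^bsub>C\<^esub> \<oplus>\<^bsub>C\<^esub> x 2 \<otimes>\<^bsub>C\<^esub> \<one>\<^bsub>C\<^esub>) = std x"
      if "x \<in> vecs" for x :: "2 \<Rightarrow> Cv"
      using \<open>\<not> above_prime v (2 + \<i>)\<close> \<open>\<not> above_prime v (2 - \<i>)\<close> vecsD[OF that]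
      by (simp add: Eq_bundle_def std_2)
    from E[OF _ _ _ this] show ?thesis by simp
  qed
  have scale: "1 / r = c" if "c * r = 1" for r
    using that by (metis mult_zero_right nonzero_eq_divide_eq zero_neq_one)
  from rp(3) i show ?thesis
  proof (cases rule: place_types)
    case arch
    then show ?thesis using unit rp(5) by simp
  next
    case (other p)
    then show ?thesis using unit rp(5) w5 by simp
  next
    case plus
    have v\<alpha>: "v \<alpha> = 5 powr - of_rat q" by (rule w_rat_power[OF \<alpha>(1) gens(1) \<alpha>(2) plus(4)])
    then have cv: "c * v \<alpha> = 1" by (simp add: c_def flip: powr_add)
    have cm: "c * (y * v \<alpha>) = y" for y
      using cv by (metis mult.left_commute mult.right_neutral)
    let ?a = "Cv_emb k v \<alpha>"
    have a: "?a \<noteq> \<zero>\<^bsub>C\<^esub>" using emb(2)[OF \<alpha>(2)] cv by auto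
    have "Eq_bundle k q v (\<lambda>i. if i = 1 then x 1 else x 1 \<otimes>\<^bsub>C\<^esub> \<ominus>\<^bsub>C\<^esub> \<one>\<^bsub>C\<^esub> \<oplus>\<^bsub>C\<^esub> x 2 \<otimes>\<^bsub>C\<^esub> ?a) = std x"
      if x: "x \<in> vecs" for x :: "2 \<Rightarrow> Cv"
    proof -
      have "x 1 \<oplus>\<^bsub>C\<^esub> (x 1 \<otimes>\<^bsub>C\<^esub> \<ominus>\<^bsub>C\<^esub> \<one>\<^bsub>C\<^esub> \<oplus>\<^bsub>C\<^esub> x 2 \<otimes>\<^bsub>C\<^esub> ?a) = x 2 \<otimes>\<^bsub>C\<^esub> ?a"
        using vecsD[OF x] emb(1)[OF \<alpha>(2)] by (simp add: Cv.r_minus Cv.r_neg flip: Cv.a_assoc)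
      then show ?thesis
        using plus(1,5) vecsD[OF x] emb[OF \<alpha>(2)] cv
        by (simp add: Eq_bundle_def std_2 Cv.v_mult c_def[symmetric] cm)
    qed
    from E[OF _ emb(1)[OF \<alpha>(2)] a this] show ?thesis
      using plus rp(5) w5 emb(2)[OF \<alpha>(2)] scale[OF cv] by (simp add: c_def)
  next
    case minus
    have v\<beta>: "v \<beta> = 5 powr - of_rat q" by (rule w_rat_power[OF \<beta>(1) gens(2) \<beta>(2) minus(4)])
    then have cv: "c * v \<beta> = 1" by (simp add: c_def flip: powr_add)
    have cm: "c * (y * v \<beta>) = y" for y
      using cv by (metis mult.left_commute mult.right_neutral)
    let ?a = "Cv_emb k v \<beta>"
    have a: "?a \<noteq> \<zero>\<^bsub>C\<^esub>" using emb(2)[OF \<beta>(2)] cv by auto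
    have "Eq_bundle k q v (\<lambda>i. if i = 1 then x 1 else x 1 \<otimes>\<^bsub>C\<^esub> \<one>\<^bsub>C\<^esub> \<oplus>\<^bsub>C\<^esub> x 2 \<otimes>\<^bsub>C\<^esub> ?a) = std x"
      if x: "x \<in> vecs" for x :: "2 \<Rightarrow> Cv"
    proof -
      have c2: "x 1 \<in> carrier C" "x 2 \<otimes>\<^bsub>C\<^esub> ?a \<in> carrier C" using vecsD[OF x] emb(1)[OF \<beta>(2)] by auto
      then have "x 1 \<ominus>\<^bsub>C\<^esub> (x 1 \<otimes>\<^bsub>C\<^esub> \<one>\<^bsub>C\<^esub> \<oplus>\<^bsub>C\<^esub> x 2 \<otimes>\<^bsub>C\<^esub> ?a) = \<ominus>\<^bsub>C\<^esub> (x 2 \<otimes>\<^bsub>C\<^esub> ?a)"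
        by (simp add: a_minus_def Cv.minus_add Cv.r_neg flip: Cv.a_assoc)
      then show ?thesis
        using minus(1,5,6) vecsD[OF x] emb[OF \<beta>(2)] cv c2
        by (simp add: Eq_bundle_def std_2 Cv.v_mult c_def[symmetric] cm)
    qed
    from E[OF _ emb(1)[OF \<beta>(2)] a this] show ?thesis
      using minus rp(5) w5 emb(2)[OF \<beta>(2)] scale[OF cv] by (simp add: c_def)
  qed
qed

section \<open>Heights\<close>

text \<open>The field chosen by \<open>SOME\<close> is only known to be a finite extension of
  \<open>k\<close> that contains the coordinates. The estimates that follow are therefore made for
  arbitrary fields of this kind.\<close>

lemma height_field:
  fixes x :: "'i::finite \<Rightarrow> complex"
  assumes k: "complex_subfield k" and x: "\<And>i. algebraic (x i)"
  obtains K where "finite_extension_of k K" "\<And>i. x i \<in> K"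
    "height k N x = place_prod K (\<lambda>w. bundle_norm k N K w x)"
proof -
  interpret complex_subfield k by fact
  have "alg k (x i)" for i
  proof -
    obtain p where p: "\<And>j. Polynomial.coeff p j \<in> \<int>" "p \<noteq> 0" "poly p (x i) = 0"
      using x[of i] unfolding algebraic_def by blast
    have "Polynomial.coeff p j \<in> k" for j
      using p(1)[of j] by (rule Ints_cases) simp
    then have "p \<in> polys_over k" unfolding polys_over_def by blast
    then show ?thesis unfolding alg_iff using p by blast
  qed
  then obtain \<theta> where \<theta>: "alg k \<theta>" "range x \<subseteq> adjoin k \<theta>"
    using primitive_element_finite[of "range x"] by auto
  have "finite_extension_of k (adjoin k \<theta>)"
    unfolding finite_extension_of_def
    using adjoin_subfield[OF \<theta>(1)] subfield_k k_subset_adjoin CC.finite_dimensionI[OF adjoin_dimension[OF \<theta>(1)]]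
    by (simp add: complex_subfield_def)
  then have ex: "\<exists>K. finite_extension_of k K \<and> (\<forall>i. x i \<in> K)" using \<theta>(2) by blast
  define K where "K = (SOME K. finite_extension_of k K \<and> (\<forall>i. x i \<in> K))"
  have K: "finite_extension_of k K" "\<And>i. x i \<in> K" using someI_ex[OF ex] by (auto simp: K_def)
  have "height k N x = place_prod K (\<lambda>w. bundle_norm k N K w x)"
    unfolding height_def K_def[symmetric] height_over_def place_prod_def ..
  with K show ?thesis by (rule that)
qed

lemma place_prod_cong: "(\<And>w. w \<in> places K \<Longrightarrow> G w = H w) \<Longrightarrow> place_prod K G = place_prod K H"
  unfolding place_prod_def by (intro prod.cong) auto

section \<open>Heights over a number field containing the Gaussian numbers\<close>

locale gaussian_number_field =
  fixes K :: "complex set"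
  assumes K: "subfield K \<CC>" "ring.finite_dimension \<CC> \<rat> K" and i_in: "\<i> \<in> K"
begin

sublocale complex_subfield K
  using K(1) by (simp add: complex_subfield_def)

lemma valued: "w \<in> places K \<Longrightarrow> complex_valued K w"
  by (rule places_complex_valued[OF complex_subfield_axioms])

lemma Eq_norm_pos:
  assumes w: "w \<in> places K" and x: "x 1 \<in> K" "x 2 \<in> K" "x 1 \<noteq> 0 \<or> x 2 \<noteq> 0" and c: "c > 0"
  shows "Eq_norm c w x > 0"
proof -
  interpret complex_valued K w by (rule valued[OF w])
  show ?thesis
  proof (cases "x 1 = 0")
    case True
    then have "w (x 2) > 0" using x w_pos by auto
    then show ?thesis using True x c by (simp add: Eq_norm_def less_max_iff_disj)
  next
    case False
    then have "w (x 1) > 0" using x w_pos by auto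
    moreover from this have "(w (x 1))\<^sup>2 + (w (x 2))\<^sup>2 > 0" by (intro add_pos_nonneg) auto
    ultimately show ?thesis by (simp add: Eq_norm_def less_max_iff_disj)
  qed
qed

text \<open>The norm is 1 except at archimedean places, above 5, and where a nonzero coordinate is
  not a unit. Finiteness matters because a product over an infinite set defaults to 1.\<close>

lemma Eq_norm_support:
  assumes x: "x 1 \<in> K" "x 2 \<in> K" "x 1 \<noteq> 0 \<or> x 2 \<noteq> 0"
  shows "finite {w \<in> places K. Eq_norm c w x \<noteq> 1}"
proof (rule finite_subset)
  let ?A = "\<lambda>j. if x j = 0 then {} else {w \<in> places K. w (x j) \<noteq> 1}"
  let ?S = "{w \<in> places K. archimedean w} \<union> {w \<in> places K. w 5 \<noteq> 1} \<union> (?A 1 \<union> ?A 2)"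
  show "finite ?S"
    using finite_place_support[OF K] x finite_place_support(2,3)[OF K, of 1] by auto
  show "{w \<in> places K. Eq_norm c w x \<noteq> 1} \<subseteq> ?S"
  proof (rule subsetI, rule ccontr)
    fix w assume w: "w \<in> {w \<in> places K. Eq_norm c w x \<noteq> 1}" and nS: "w \<notin> ?S"
    then have wp: "w \<in> places K" by simp
    interpret complex_valued K w by (rule valued[OF wp])
    have v: "w (x j) = (if x j = 0 then 0 else 1)" if "j = 1 \<or> j = 2" for j
      using nS wp that by (auto split: if_splits)
    from wp i_in show False
    proof (cases rule: place_types)
      case (other p)
      then have "Eq_norm c w x = max (w (x 1)) (w (x 2))" by (simp add: Eq_norm_def)
      also have "\<dots> = 1" using v[of 1] v[of 2] x(3) by auto
      finally show False using w by simp
    qed (use nS wp in auto)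
  qed
qed

text \<open>Here \<open>z\<close> stands for the value at \<open>x\<close> of a form of degree
  \<open>m\<close>. Its local sizes cancel in the product over all places, so only the constants
  \<open>C0\<close> and \<open>C5\<close> survive. The sign \<open>s\<close> treats the two primes
  above 5 together.\<close>

lemma Eq_norm_lower_bound:
  assumes x: "x 1 \<in> K" "x 2 \<in> K" "x 1 \<noteq> 0 \<or> x 2 \<noteq> 0" and c: "c > 0"
    and z: "z \<in> K" "z \<noteq> 0" and C: "C0 > 0" "C5 > 0"
    and arch: "\<And>w. complex_valued K w \<Longrightarrow> w 2 = 2 \<Longrightarrow> C0 * w z \<le> sqrt ((w (x 1))\<^sup>2 + (w (x 2))\<^sup>2) ^ m"
    and five: "\<And>w s. complex_valued K w \<Longrightarrow> (\<And>r. w (of_rat r) = padic_abs 5 r) \<Longrightarrow> s = 1 \<or> s = -1 \<Longrightarrow>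
      w (2 + of_int s * \<i>) = 1 / 5 \<Longrightarrow> C5 * w z \<le> max (w (x 1)) (c * w (x 1 + of_int s * x 2)) ^ m"
    and other: "\<And>w p. complex_valued K w \<Longrightarrow> Factorial_Ring.prime p \<Longrightarrow> (\<And>r. w (of_rat r) = padic_abs p r) \<Longrightarrow>
      w z \<le> max (w (x 1)) (w (x 2)) ^ m"
  shows "C0 * C5 \<le> place_prod K (\<lambda>w. Eq_norm c w x) ^ m"
proof (rule place_prod_bounds(1)[OF K _ _ z C])
  show "Eq_norm c w x > 0" if "w \<in> places K" for w by (rule Eq_norm_pos[OF that x c])
  show "finite {w \<in> places K. Eq_norm c w x \<noteq> 1}" by (rule Eq_norm_support[OF x])
  fix w assume w: "w \<in> places K"
  note cv = valued[OF w]
  interpret complex_valued K w by (rule cv)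
  show "(if archimedean w then C0 else if w 5 = 1 / 5 then C5 else 1) * w z \<le> Eq_norm c w x ^ m"
  proof (cases rule: place_types[OF w i_in])
    case 1
    then have "w 2 = 2" unfolding archimedean_def by (metis abs_numeral of_rat_numeral_eq)
    then show ?thesis using 1 arch[OF cv] by (simp add: Eq_norm_def)
  next
    case 2
    then show ?thesis using five[OF cv 2(2), of 1] by (simp add: Eq_norm_def)
  next
    case 3
    then show ?thesis using five[OF cv 3(2), of "-1"] by (simp add: Eq_norm_def)
  next
    case (4 p)
    then show ?thesis using other[OF cv 4(2,3)] by (simp add: Eq_norm_def)
  qed
qed

lemma Eq_norm_lower_bound_quintic:
  assumes x: "x 1 \<in> K" "x 2 \<in> K" and jl: "(j, l) = (1, 2) \<or> (j, l) = (2, 1)"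
    and c: "c \<ge> 1" "c ^ 5 \<ge> 5" and nz: "x j \<noteq> 0" and F: "quintic (x j) (x l) = 0"
  shows "sqrt (23 / 10) \<le> place_prod K (\<lambda>w. Eq_norm c w x)"
proof -
  have K: "x j \<in> K" "x l \<in> K" and nz': "x 1 \<noteq> 0 \<or> x 2 \<noteq> 0" using jl x nz by auto
  have "sqrt (23 / 10) * 1 \<le> place_prod K (\<lambda>w. Eq_norm c w x) ^ 1"
  proof (rule Eq_norm_lower_bound[OF x nz' _ K(1) nz])
    fix w assume "complex_valued K w" and w2: "w 2 = 2"
    then interpret complex_valued K w by simp
    have "x l ^ 5 = - (2 * \<i> * x j ^ 5)" using F by (simp add: quintic_def add_eq_0_iff)
    then have "w (x l ^ 5) = 2 * w (x j ^ 5)"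
      using K i_in k_of_nat[of 2] w2 by (simp add: w_mult w_i)
    then have "w (x l) ^ 5 = 2 * w (x j) ^ 5" using K by (simp add: w_power)
    then have eq: "(w (x l) ^ 5)\<^sup>2 = 4 * (w (x j) ^ 5)\<^sup>2" by (simp only: power_mult_distrib) simp
    have swap: "(t\<^sup>2) ^ 5 = (t ^ 5)\<^sup>2" for t :: real by (simp flip: power_mult)
    have "(13 / 10 * (w (x j))\<^sup>2) ^ 5 = (13 / 10) ^ 5 * (w (x j) ^ 5)\<^sup>2"
      by (simp only: power_mult_distrib swap)
    \<comment> \<open>Since \<open>(13/10)^5 < 4\<close>, the relation of the tenth powers gives a
      ratio of squares of at least 13/10, whence \<open>1 + 13/10 = 23/10\<close>.\<close>
    also have "\<dots> \<le> 4 * (w (x j) ^ 5)\<^sup>2" by (intro mult_right_mono) (simp_all add: power_divide)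
    finally have "(13 / 10 * (w (x j))\<^sup>2) ^ 5 \<le> ((w (x l))\<^sup>2) ^ 5"
      by (simp only: eq swap)
    then have "13 / 10 * (w (x j))\<^sup>2 \<le> (w (x l))\<^sup>2"
      by (rule power_le_imp_le_base[of _ 4, simplified]) simp
    then have "23 / 10 * (w (x j))\<^sup>2 \<le> (w (x 1))\<^sup>2 + (w (x 2))\<^sup>2" using jl by auto
    then have "sqrt (23 / 10 * (w (x j))\<^sup>2) \<le> sqrt ((w (x 1))\<^sup>2 + (w (x 2))\<^sup>2)"
      by (rule real_sqrt_le_mono)
    moreover have "sqrt (23 / 10 * (w (x j))\<^sup>2) = sqrt (23 / 10) * w (x j)"
      using w_nonneg[OF K(1)] by (simp only: real_sqrt_mult real_sqrt_abs abs_of_nonneg)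
    ultimately show "sqrt (23 / 10) * w (x j) \<le> sqrt ((w (x 1))\<^sup>2 + (w (x 2))\<^sup>2) ^ 1"
      by (simp only: power_one_right)
  next
    fix w and s :: int assume "complex_valued K w" and w: "\<And>r. w (of_rat r) = padic_abs 5 r"
      and s: "s = 1 \<or> s = -1" and p: "w (2 + of_int s * \<i>) = 1 / 5"
    then interpret complex_valued K w by simp
    show "1 * w (x j) \<le> max (w (x 1)) (c * w (x 1 + of_int s * x 2)) ^ 1"
      using jl quintic_small(1)[OF w s p i_in x _ c, where M = "max (w (x 1)) (c * w (x 1 + of_int s * x 2))"]
      by auto
  qed (use jl c in auto)
  then show ?thesis by simp
qed

lemma Eq_norm_lower_bound_generic:
  assumes x: "x 1 \<in> K" "x 2 \<in> K" "x 1 \<noteq> 0" "x 2 \<noteq> 0"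
    and c: "c \<ge> 1" "c ^ 5 \<ge> 5" and F: "quintic (x 1) (x 2) \<noteq> 0" "quintic (x 2) (x 1) \<noteq> 0"
  shows "2 ^ 11 * 25 / 24 \<le> place_prod K (\<lambda>w. Eq_norm c w x) ^ 22"
proof -
  let ?A = "quintic (x 1) (x 2)" and ?B = "quintic (x 2) (x 1)"
  let ?z = "(x 1 * x 2) ^ 6 * (?A * ?B)"
  note FK = quintic_in[OF i_in]
  have wz: "w ?z = (w (x 1) * w (x 2)) ^ 6 * (w ?A * w ?B)" if "complex_valued K w" for w
  proof -
    interpret complex_valued K w by fact
    have "(x 1 * x 2) ^ 6 \<in> K" "?A * ?B \<in> K" using x FK by auto
    then show ?thesis using x FK by (simp add: w_mult w_power)
  qed
  have "2 ^ 11 / 24 * 25 \<le> place_prod K (\<lambda>w. Eq_norm c w x) ^ 22"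
  proof (rule Eq_norm_lower_bound[OF x(1,2) disjI1[OF x(3)], of c ?z])
    fix w assume cv: "complex_valued K w" and w2: "w 2 = 2"
    then interpret complex_valued K w by simp
    let ?s = "w (x 1)" and ?t = "w (x 2)"
    have "w ?A * w ?B \<le> (?t ^ 5 + 2 * ?s ^ 5) * (?s ^ 5 + 2 * ?t ^ 5)"
      using quintic_le_3[OF w2 i_in] x FK by (intro mult_mono) auto
    then have "2 ^ 11 / 24 * w ?z \<le> 2 ^ 11 / 24 * ((?s * ?t) ^ 6 * ((?t ^ 5 + 2 * ?s ^ 5) * (?s ^ 5 + 2 * ?t ^ 5)))"
      unfolding wz[OF cv] using x by (intro mult_left_mono) auto
    also have "\<dots> \<le> (?s\<^sup>2 + ?t\<^sup>2) ^ 11"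
      by (rule archimedean_inequality) (use x in auto)
    also have "\<dots> = (sqrt (?s\<^sup>2 + ?t\<^sup>2))\<^sup>2 ^ 11" by simp
    also have "\<dots> = sqrt (?s\<^sup>2 + ?t\<^sup>2) ^ 22" by (subst power_mult[symmetric]) simp
    finally show "2 ^ 11 / 24 * w ?z \<le> sqrt (?s\<^sup>2 + ?t\<^sup>2) ^ 22" .
  next
    fix w and s :: int assume cv: "complex_valued K w" and w: "\<And>r. w (of_rat r) = padic_abs 5 r"
      and s: "s = 1 \<or> s = -1" and p: "w (2 + of_int s * \<i>) = 1 / 5"
    then interpret complex_valued K w by simp
    define M where "M = max (w (x 1)) (c * w (x 1 + of_int s * x 2))"
    have M: "w (x 1) \<le> M" "c * w (x 1 + of_int s * x 2) \<le> M" by (simp_all add: M_def)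
    note small = quintic_small[OF w s p i_in x(1,2) M(1) c M(2)]
    have M0: "M \<ge> 0" using M(1) w_nonneg[OF x(1)] by linarith
    have "w ?z \<le> (M * M) ^ 6 * (M ^ 5 / 5 * (M ^ 5 / 5))"
      unfolding wz[OF cv] using x FK M M0 small by (intro mult_mono power_mono) auto
    also have "\<dots> = M ^ 22 / 25" by (simp add: eval_nat_numeral)
    finally show "25 * w ?z \<le> max (w (x 1)) (c * w (x 1 + of_int s * x 2)) ^ 22"
      by (simp add: M_def)
  next
    fix w and p :: nat assume cv: "complex_valued K w"
      and p: "Factorial_Ring.prime p" "\<And>r. w (of_rat r) = padic_abs p r"
    then interpret complex_valued K w by simp
    define M where "M = max (w (x 1)) (w (x 2))"
    have M: "w (x 1) \<le> M" "w (x 2) \<le> M" by (simp_all add: M_def)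
    have M0: "M \<ge> 0" using M(1) w_nonneg[OF x(1)] by linarith
    have "w ?z \<le> (M * M) ^ 6 * (M ^ 5 * M ^ 5)"
      unfolding wz[OF cv] using x FK M M0 quintic_le_max[OF p i_in, where M = M] by (intro mult_mono power_mono) auto
    also have "\<dots> = M ^ 22" by (simp add: eval_nat_numeral)
    finally show "w ?z \<le> max (w (x 1)) (w (x 2)) ^ 22" by (simp add: M_def)
  qed (use x F FK c in auto)
  then show ?thesis by simp
qed

lemma Eq_norm_height_ge:
  assumes x: "x 1 \<in> K" "x 2 \<in> K" "x 1 \<noteq> 0 \<or> x 2 \<noteq> 0" and c: "sqrt 2 < c" "c < sqrt 2 + 1 / 1000"
  shows "c \<le> place_prod K (\<lambda>w. Eq_norm c w x)" (is "c \<le> ?P")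
proof -
  have s2: "1 \<le> sqrt 2" by simp
  have c0: "c > 0" "c \<ge> 1" using c s2 by linarith+
  \<comment> \<open>This is where the lower bound on \<open>5^q\<close> enters the estimates above
    5: \<open>5 < 4 sqrt 2 = (sqrt 2)^5\<close>.\<close>
  have c5: "c ^ 5 \<ge> 5"
  proof -
    have "5 / 4 \<le> sqrt 2" by (rule real_le_rsqrt) (simp add: power_divide)
    then have "5 \<le> 4 * sqrt 2" by simp
    also have "\<dots> = sqrt 2 ^ 5" by (simp add: eval_nat_numeral)
    also have "\<dots> \<le> c ^ 5" using c by (intro power_mono) auto
    finally show ?thesis .
  qed
  consider "x 1 = 0" "x 2 \<noteq> 0" | "x 1 \<noteq> 0" "x 2 = 0"
    | j l where "(j, l) = (1, 2) \<or> (j, l) = (2, 1)" "x j \<noteq> 0" "quintic (x j) (x l) = 0"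
    | "x 1 \<noteq> 0" "x 2 \<noteq> 0" "quintic (x 1) (x 2) \<noteq> 0" "quintic (x 2) (x 1) \<noteq> 0"
    using x(3) by blast
  then show ?thesis
  proof cases
    case 1
    have "1 * c \<le> ?P ^ 1"
    proof (rule Eq_norm_lower_bound[OF x c0(1) x(2) 1(2)])
      fix w and s :: int assume "complex_valued K w" and s: "s = 1 \<or> s = -1"
      then interpret complex_valued K w by simp
      show "c * w (x 2) \<le> max (w (x 1)) (c * w (x 1 + of_int s * x 2)) ^ 1"
        using s 1 x by auto
    next
      fix w assume "complex_valued K w"
      then interpret complex_valued K w by simp
      show "1 * w (x 2) \<le> sqrt ((w (x 1))\<^sup>2 + (w (x 2))\<^sup>2) ^ 1" using 1 x by simp
    qed (use c0 in auto)
    then show ?thesis by simp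
  next
    case 2
    have "1 * c \<le> ?P ^ 1"
    proof (rule Eq_norm_lower_bound[OF x c0(1) x(1) 2(1)])
      fix w assume "complex_valued K w"
      then interpret complex_valued K w by simp
      show "1 * w (x 1) \<le> sqrt ((w (x 1))\<^sup>2 + (w (x 2))\<^sup>2) ^ 1" using 2 x by simp
    qed (use c0 2 in auto)
    then show ?thesis by simp
  next
    case 3
    \<comment> \<open>The comparison is \<open>c < 1.416 < 1.5 \<le> sqrt 2.3\<close>.\<close>
    have "sqrt 2 \<le> 1415 / 1000" by (rule real_le_lsqrt) (simp_all add: power_divide)
    moreover have "15 / 10 \<le> sqrt (23 / 10)" by (rule real_le_rsqrt) (simp add: power_divide)
    ultimately show ?thesis
      using Eq_norm_lower_bound_quintic[OF x(1,2) 3(1) c0(2) c5 3(2,3)] c by linarith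
  next
    case 4
    \<comment> \<open>This case limits the size of \<eta>: the 22nd power of 1001/1000 is about
      1.022, while 25/24 is about 1.042.\<close>
    have "c \<le> sqrt 2 * (1001 / 1000)" using c s2 by linarith
    then have "c ^ 22 \<le> (sqrt 2 * (1001 / 1000)) ^ 22" using c0 by (intro power_mono) auto
    also have "\<dots> = ((sqrt 2)\<^sup>2) ^ 11 * (1001 / 1000) ^ 22"
      by (simp only: power_mult_distrib power_mult[symmetric]) simp
    also have "\<dots> \<le> 2 ^ 11 * (25 / 24)"
      by (intro mult_mono) (simp_all add: power_divide)
    also have "\<dots> \<le> ?P ^ 22"
      using Eq_norm_lower_bound_generic[OF x(1,2) 4(1,2) c0(2) c5 4(3,4)] by simp
    finally have "c ^ Suc 21 \<le> ?P ^ Suc 21" by simp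
    then show ?thesis by (rule power_le_imp_le_base) (rule place_prod_nonneg)
  qed
qed

text \<open>For the first basis vector the local norms coincide with the yardstick for
  \<open>z = 1\<close>, \<open>C0 = 1\<close> and \<open>C5 = c\<close>, so the upper and the lower
  product bound both apply.\<close>

lemma Eq_norm_height_basis:
  assumes c: "c \<ge> 1"
  shows "place_prod K (\<lambda>w. Eq_norm c w (\<lambda>j. if j = 1 then 1 else 0)) = c"
proof -
  let ?x = "\<lambda>j::2. if j = 1 then 1 else (0::complex)"
  have x: "?x 1 \<in> K" "?x 2 \<in> K" "?x 1 \<noteq> 0 \<or> ?x 2 \<noteq> 0" by auto
  have pos: "Eq_norm c w ?x > 0" if "w \<in> places K" for w
    by (rule Eq_norm_pos[OF that x]) (use c in simp)
  note fin = Eq_norm_support[OF x, of c]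
  have "(if archimedean w then 1 else if w 5 = 1 / 5 then c else 1) * w 1 = Eq_norm c w ?x ^ 1"
    if w: "w \<in> places K" for w
  proof -
    interpret complex_valued K w by (rule valued[OF w])
    show ?thesis
      by (cases rule: place_types[OF w i_in]) (use c in \<open>auto simp: Eq_norm_def max_def\<close>)
  qed
  note eq = this
  have "1 * c \<le> place_prod K (\<lambda>w. Eq_norm c w ?x) ^ 1"
    by (rule place_prod_bounds(1)[OF K pos fin, of 1]) (use c eq in auto)
  moreover have "place_prod K (\<lambda>w. Eq_norm c w ?x) ^ 1 \<le> 1 * c"
    by (rule place_prod_bounds(2)[OF K pos fin, of 1]) (use c eq in auto)
  ultimately show ?thesis by simp
qed

lemma wedge_height_le:
  assumes c: "c > 0"
  shows "place_prod K (\<lambda>w. if archimedean w then sqrt 2 else if w 5 = 1 / 5 then c else 1) \<le> sqrt 2 * c"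
proof -
  let ?G = "\<lambda>w. if archimedean w then sqrt 2 else if w 5 = 1 / 5 then c else 1"
  have fin: "finite {w \<in> places K. ?G w \<noteq> 1}"
  proof (rule finite_subset)
    show "finite ({w \<in> places K. archimedean w} \<union> {w \<in> places K. w 5 \<noteq> 1})"
      using finite_place_support(2,3)[OF K, of 1] by auto
  qed (auto split: if_splits)
  have pos: "?G w > 0" for w using c by simp
  have "w 1 = 1" if "w \<in> places K" for w
  proof -
    interpret complex_valued K w by (rule valued[OF that])
    show ?thesis by simp
  qed
  then have le: "?G w ^ 1 \<le> (if archimedean w then sqrt 2 else if w 5 = 1 / 5 then c else 1) * w 1"
    if "w \<in> places K" for w using that by (metis mult.right_neutral order_refl power_one_right)
  have "place_prod K ?G ^ 1 \<le> sqrt 2 * c"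
    by (rule place_prod_bounds(2)[OF K pos fin _ _ _ _ le]) (use c in auto)
  then show ?thesis by simp
qed

end

lemma gaussian_tower:
  assumes k: "finite_extension_of gaussian_rationals k" and K: "finite_extension_of k K"
  shows "gaussian_number_field K"
proof -
  have i: "\<i> \<in> K" using gaussian_rationals_props(2) k K by (auto simp: finite_extension_of_def)
  have sub: "subfield K \<CC>" using K by (simp add: finite_extension_of_def)
  interpret Q: complex_subfield \<rat> by (rule complex_subfield_Rats)
  have "ring.finite_dimension \<CC> \<rat> k"
    by (rule finite_extension_trans[OF k Q.subfield_k gaussian_rationals_props(3)])
  then have "ring.finite_dimension \<CC> \<rat> K"
    by (rule finite_extension_trans[OF K Q.subfield_k])
  then show ?thesis using i sub by (intro gaussian_number_field.intro)
qed

theorem theorem4p2: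
  shows "\<exists>\<eta>::real. \<eta> > 0 \<and>
    (\<forall>(q::rat) (\<alpha>::complex) (\<beta>::complex) (k::complex set).
      sqrt 2 < (5::real) powr of_rat q \<and> (5::real) powr of_rat q < sqrt 2 + \<eta> \<and>
      is_rat_power (2 + \<i>) q \<alpha> \<and> is_rat_power (2 - \<i>) q \<beta> \<and>
      finite_extension_of gaussian_rationals k \<and> \<alpha> \<in> k \<and> \<beta> \<in> k \<longrightarrow>
        Lambda k (Eq_bundle k q) = 5 powr of_rat q \<and>
        Lambda k (tensor_bundle k (Eq_bundle k q) (Eq_bundle k q))
          < (Lambda k (Eq_bundle k q))\<^sup>2)"
proof (rule exI[of _ "1 / 1000"], rule conjI, simp, intro allI impI, goal_cases)
  case (1 q \<alpha> \<beta> k)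
  define c where "c = (5::real) powr of_rat q"
  have c: "sqrt 2 < c" "c < sqrt 2 + 1 / 1000" and k: "finite_extension_of gaussian_rationals k"
    using 1 by (auto simp: c_def)
  have "1 < sqrt 2" by simp
  then have c1: "c \<ge> 1" "c > 0" using c by linarith+
  have ck: "complex_subfield k" using k by (simp add: finite_extension_of_def complex_subfield_def)
  have i: "\<i> \<in> k" using gaussian_rationals_props(2) k by (auto simp: finite_extension_of_def)
  let ?E = "Eq_bundle k q"
  have height_E: "\<exists>K. gaussian_number_field K \<and> (\<forall>j. x j \<in> K) \<and> height k ?E x = place_prod K (\<lambda>w. Eq_norm c w x)"
    if x: "\<And>j. algebraic (x j)" for x :: "2 \<Rightarrow> complex"
  proof -
    obtain K where K: "finite_extension_of k K" "\<And>j. x j \<in> K"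
      "height k ?E x = place_prod K (\<lambda>w. bundle_norm k ?E K w x)"
      by (rule height_field[where x = x and N = "?E", OF ck x]) blast
    have "height k ?E x = place_prod K (\<lambda>w. Eq_norm c w x)"
      unfolding K(3) c_def by (rule place_prod_cong) (rule bundle_norm_Eq[OF K(1) i _ K(2)])
    then show ?thesis using gaussian_tower[OF k K(1)] K(2) by blast
  qed
  have Lambda_E: "Lambda k ?E = c"
    unfolding Lambda_def
  proof (rule cInf_eq_minimum)
    let ?e = "\<lambda>j::2. if j = 1 then 1 else (0::complex)"
    have e: "algebraic (?e j)" for j by simp
    obtain K where "gaussian_number_field K" "height k ?E ?e = place_prod K (\<lambda>w. Eq_norm c w ?e)"
      using height_E[of ?e] e by blast
    then have "height k ?E ?e = c" using gaussian_number_field.Eq_norm_height_basis c1 by metis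
    moreover have "\<exists>j. ?e j \<noteq> 0" by (rule exI[of _ 1]) simp
    ultimately show "c \<in> {height k ?E x | x. (\<forall>i. algebraic (x i)) \<and> (\<exists>i. x i \<noteq> 0)}"
      using e by blast
    fix y assume "y \<in> {height k ?E x | x. (\<forall>i. algebraic (x i)) \<and> (\<exists>i. x i \<noteq> 0)}"
    then obtain x where x: "y = height k ?E x" "\<And>i. algebraic (x i)" "\<exists>i. x i \<noteq> 0" by blast
    then obtain K where K: "gaussian_number_field K" "\<And>j. x j \<in> K" "y = place_prod K (\<lambda>w. Eq_norm c w x)"
      using height_E[of x] by metis
    have "x 1 \<noteq> 0 \<or> x 2 \<noteq> 0" using x(3) exhaust_2 by metis
    then show "c \<le> y"
      unfolding K(3) by (rule gaussian_number_field.Eq_norm_height_ge[OF K(1) K(2) K(2) _ c])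
  qed
  let ?T = "tensor_bundle k ?E ?E"
  have "Lambda k ?T \<le> height k ?T wedge"
    unfolding Lambda_def
  proof (rule cInf_lower)
    have "algebraic (wedge p)" for p using algebraic_of_int[of "-1"] by (simp add: wedge_def)
    moreover have "wedge (1, 2) \<noteq> 0" by (simp add: wedge_def)
    ultimately show "height k ?T wedge \<in> {height k ?T x | x. (\<forall>i. algebraic (x i)) \<and> (\<exists>i. x i \<noteq> 0)}"
      by blast
    \<comment> \<open>An infimum of reals is below its members only if the set is bounded below; 0
      is a bound because heights are products of powers.\<close>
    show "bdd_below {height k ?T x | x. (\<forall>i. algebraic (x i)) \<and> (\<exists>i. x i \<noteq> 0)}"
    proof (rule bdd_belowI[of _ 0])
      fix y assume "y \<in> {height k ?T x | x. (\<forall>i. algebraic (x i)) \<and> (\<exists>i. x i \<noteq> 0)}"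
      then obtain x where x: "y = height k ?T x" "\<And>i. algebraic (x i)" by blast
      obtain K where "y = place_prod K (\<lambda>w. bundle_norm k ?T K w x)"
        unfolding x(1) by (rule height_field[where x = x and N = "?T", OF ck x(2)]) blast
      then show "0 \<le> y" by (simp add: place_prod_nonneg)
    qed
  qed
  also have "\<dots> \<le> sqrt 2 * c"
  proof -
    have "algebraic (wedge p)" for p using algebraic_of_int[of "-1"] by (simp add: wedge_def)
    then obtain K where K: "finite_extension_of k K"
      "height k ?T wedge = place_prod K (\<lambda>w. bundle_norm k ?T K w wedge)"
      by (rule height_field[where x = wedge and N = "?T", OF ck]) blast
    have "height k ?T wedge = place_prod K (\<lambda>w. if archimedean w then sqrt 2 else if w 5 = 1 / 5 then c else 1)"
      unfolding K(2) c_def using 1 by (intro place_prod_cong bundle_norm_wedge[OF K(1) i]) auto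
    then show ?thesis
      using gaussian_number_field.wedge_height_le[OF gaussian_tower[OF k K(1)] c1(2)] by simp
  qed
  also have "\<dots> < c\<^sup>2" using c c1 by (simp add: power2_eq_square)
  finally show ?case using Lambda_E by (simp add: c_def)
qed

end
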